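(* Let $\alpha\in(\tfrac12,1)$ and $\beta\in(0,1)$, let $T>0$, and let $A,B\in\mathbb{R}^{n\times n}$ be non-permutable, i.e. $AB\neq BA$. Let $b,\sigma:[0,T]\times\mathbb{R}^n\to\mathbb{R}^n$ be measurable and bounded functions such that: (1) there exist $L_b,L_\sigma>0$ with $\|b(t,x)-b(t,y)\|\le L_b\|x-y\|$ and $\|\sigma(t,x)-\sigma(t,y)\|\le L_\sigma\|x-y\|$ for all $x,y\in\mathbb{R}^n$, $t\in[0,T]$; (2) $\int_0^T\|b(r,0)\|^2\,\mathrm{d}r<\infty$ and $\operatorname{ess\,sup}_{r\in[0,T]}\|\sigma(r,0)\|<\infty$. Then: (i) for any $\eta\in\Xi_0$, the Cauchy problem $$\left({}^{C}D^{\alpha}_{0^+}X\right)(t)-A\left({}^{C}D^{\beta}_{0^+}X\right)(t)-BX(t)=b(t,X(t))+\sigma(t,X(t))\frac{\mathrm{d}W(t)}{\mathrm{d}t},\qquad X(0)=\eta,$$ has a unique global solution (in the sense given in the context) on the whole interval $[0,T]$, denoted by $\varphi(\cdot,\eta)$; (ii) on any bounded time interval $[0,T]$ with $T>0$, the solution $\varphi(\cdot,\eta)$ depends continuously on $\eta$, i.e. $$\lim_{\eta\to\gamma}\ \sup_{t\in[0,T]}\|\varphi(t,\eta)-\varphi(t,\gamma)\|_{\mathrm{ms}}^2=0,$$ where $\eta,\gamma\in\Xi_0$ and $\eta\to\gamma$ with respect to $\|\cdot\|_{\mathrm{ms}}$.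
   Context: $W=(W_t)_{t\ge0}$ is a standard scalar Brownian motion on a complete probability space $(\Omega,\mathscr{F},\mathbb{F},\mathbb{P})$ with filtration $\mathbb{F}=\{\mathscr{F}_t\}_{t\in[0,T]}$. $\mathbb{R}^n$ carries the Euclidean norm $\|\cdot\|$. For each $t\in[0,T]$, $\Xi_t:=\mathbb{L}^2(\Omega,\mathscr{F}_t,\mathbb{P})$ is the space of $\mathscr{F}_t$-measurable mean-square integrable $f:\Omega\to\mathbb{R}^n$, with $\|f\|_{\mathrm{ms}}^2:=\mathbf{E}(\|f\|^2)$. $H^2([0,T],\mathbb{R}^n)$ is the space of all measurable $\mathbb{F}$-adapted $\mathbb{R}^n$-valued processes $\xi$ on $[0,T]$ with $\|\xi\|_{H^2}^2:=\sup_{t\in[0,T]}\mathbf{E}\|\xi(t)\|^2<\infty$. ${}^{C}D^{\alpha}_{0^+}$ denotes the Caputo fractional derivative of order $\alpha$. A solution (mild solution) on $[0,T]$ of the Cauchy problem with initial value $\eta\in\Xi_0$ is a process $X\in H^2([0,T],\mathbb{R}^n)$ adapted to $\mathbb{F}$, with $\int_0^T\|X(t)\|^2\,\mathrm{d}t<\infty$ almost surely and with almost surely continuous paths, satisfying on $[0,T]$ $$X(t)=\eta-\frac{At^{\alpha-\beta}}{\Gamma(\alpha-\beta+1)}\eta+\frac{A}{\Gamma(\alpha-\beta)}\int_0^t(t-r)^{\alpha-\beta-1}X(r)\,\mathrm{d}r+\frac{B}{\Gamma(\alpha)}\int_0^t(t-r)^{\alpha-1}X(r)\,\mathrm{d}r$$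 $$\qquad+\frac{1}{\Gamma(\alpha)}\int_0^t(t-r)^{\alpha-1}b(r,X(r))\,\mathrm{d}r+\frac{1}{\Gamma(\alpha)}\int_0^t(t-r)^{\alpha-1}\sigma(r,X(r))\,\mathrm{d}W(r),$$ the last integral being an Itô integral. Uniqueness means uniqueness in $H^2([0,T],\mathbb{R}^n)$.
   Formalization: The formal statement additionally assumes β < α; for β ≥ α the integral equation defining a solution is undefined, since (t−r)^{α−β−1} is not integrable at r = t and t^{α−β} or 1/Γ(α−β) has no meaning. *)

theory Defs
  imports "HOL-Probability.Probability"
begin

section \<open>Brownian motion and filtered probability spaces\<close>

locale brownian_motion = prob_space M for M :: "'w measure" +
  fixes W :: "real \<Rightarrow> 'w \<Rightarrow> real"
  assumes measurable_W: "\<And>t. 0 \<le> t \<Longrightarrow> W t \<in> borel_measurable M"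
    and W_0: "AE \<omega> in M. W 0 \<omega> = 0"
    and normal_increments:
      "\<And>s t. 0 \<le> s \<Longrightarrow> s < t \<Longrightarrow>
        distributed M lborel (\<lambda>\<omega>. W t \<omega> - W s \<omega>) (normal_density 0 (sqrt (t - s)))"
    and indep_increments:
      "\<And>(k::nat) \<tau>. 0 \<le> \<tau> 0 \<Longrightarrow> (\<And>i. i < k \<Longrightarrow> \<tau> i < \<tau> (Suc i)) \<Longrightarrow>
        indep_vars (\<lambda>_. borel) (\<lambda>i \<omega>. W (\<tau> (Suc i)) \<omega> - W (\<tau> i) \<omega>) {..<k}"
    and continuous_W: "AE \<omega> in M. continuous_on {0..} (\<lambda>t. W t \<omega>)"

text \<open>
  The filtration is only constrained on \<open>{0..T}\<close>; of \<open>F t\<close> only the space and the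
  \<open>\<sigma>\<close>-algebra matter. The last two assumptions say that \<open>W\<close> is a Brownian motion relative
  to the filtration. Completeness is that of the probability space; \<open>F 0\<close> is not required
  to contain the null sets.
\<close>

locale brownian_basis = brownian_motion M W + complete_measure M
  for M :: "'w measure" and W :: "real \<Rightarrow> 'w \<Rightarrow> real" +
  fixes F :: "real \<Rightarrow> 'w measure" and T :: real
  assumes subalgebra_F: "\<And>t. t \<in> {0..T} \<Longrightarrow> subalgebra M (F t)"
    and F_mono: "\<And>s t. 0 \<le> s \<Longrightarrow> s \<le> t \<Longrightarrow> t \<le> T \<Longrightarrow> sets (F s) \<subseteq> sets (F t)"
    and adapted_W: "\<And>t. t \<in> {0..T} \<Longrightarrow> W t \<in> borel_measurable (F t)"
    and indep_F: "\<And>s t. 0 \<le> s \<Longrightarrow> s < t \<Longrightarrow> t \<le> T \<Longrightarrow>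
      indep_set (sets (F s)) (sets (vimage_algebra (space M) (\<lambda>\<omega>. W t \<omega> - W s \<omega>) borel))"


section \<open>Mean-square spaces\<close>

text \<open>\<open>ms_norm\<close> and \<open>H2_norm\<close> are only meaningful on square-integrable functions and on
  \<open>H2\<close>, respectively.\<close>

definition ms_norm :: "'w measure \<Rightarrow> ('w \<Rightarrow> real ^ 'n) \<Rightarrow> real" where
  "ms_norm M f = sqrt (\<integral>\<omega>. (norm (f \<omega>))\<^sup>2 \<partial>M)"

definition Xi :: "'w measure \<Rightarrow> (real \<Rightarrow> 'w measure) \<Rightarrow> real \<Rightarrow> ('w \<Rightarrow> real ^ 'n) set" where
  "Xi M F t = {f \<in> borel_measurable (F t). integrable M (\<lambda>\<omega>. (norm (f \<omega>))\<^sup>2)}"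

definition H2 :: "'w measure \<Rightarrow> (real \<Rightarrow> 'w measure) \<Rightarrow> real \<Rightarrow> (real \<Rightarrow> 'w \<Rightarrow> real ^ 'n) set" where
  "H2 M F T = {X.
     (\<lambda>(t, \<omega>). X t \<omega>) \<in> borel_measurable (restrict_space borel {0..T} \<Otimes>\<^sub>M M) \<and>
     (\<forall>t\<in>{0..T}. X t \<in> Xi M F t) \<and>
     bdd_above ((\<lambda>t. (ms_norm M (X t))\<^sup>2) ` {0..T})}"

definition H2_norm :: "'w measure \<Rightarrow> real \<Rightarrow> (real \<Rightarrow> 'w \<Rightarrow> real ^ 'n) \<Rightarrow> real" where
  "H2_norm M T X = sqrt (SUP t\<in>{0..T}. (ms_norm M (X t))\<^sup>2)"


section \<open>The Ito integral\<close>

text \<open>\<open>S\<close> is the integral over \<open>{0..t}\<close> of the simple process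
  \<open>\<phi> = (\<Sum>i<k. indicator {\<tau> i<..\<tau> (Suc i)} \<cdot> \<xi> i)\<close>, with \<open>\<xi> i\<close> bounded and
  \<open>F (\<tau> i)\<close>-measurable.\<close>

definition simple_ito ::
  "'w measure \<Rightarrow> (real \<Rightarrow> 'w measure) \<Rightarrow> (real \<Rightarrow> 'w \<Rightarrow> real) \<Rightarrow> real \<Rightarrow>
   (real \<Rightarrow> 'w \<Rightarrow> real ^ 'n) \<Rightarrow> ('w \<Rightarrow> real ^ 'n) \<Rightarrow> bool" where
  "simple_ito M F W t \<phi> S \<longleftrightarrow>
     (\<exists>(k::nat) (\<tau> :: nat \<Rightarrow> real) (\<xi> :: nat \<Rightarrow> 'w \<Rightarrow> real ^ 'n).
        0 \<le> \<tau> 0 \<and> (\<forall>i<k. \<tau> i \<le> \<tau> (Suc i)) \<and> \<tau> k \<le> t \<and>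
        (\<forall>i<k. \<xi> i \<in> borel_measurable (F (\<tau> i)) \<and> bounded (\<xi> i ` space M)) \<and>
        \<phi> = (\<lambda>r \<omega>. \<Sum>i<k. indicator {\<tau> i<..\<tau> (Suc i)} r *\<^sub>R \<xi> i \<omega>) \<and>
        S = (\<lambda>\<omega>. \<Sum>i<k. (W (\<tau> (Suc i)) \<omega> - W (\<tau> i) \<omega>) *\<^sub>R \<xi> i \<omega>))"

text \<open>\<open>I\<close> is (a version of) the Ito integral over \<open>{0..t}\<close> of the measurable, adapted,
  square-integrable process \<open>f\<close>: the mean-square limit of the integrals of simple processes
  approximating \<open>f\<close> in \<open>L\<^sup>2\<close> over \<open>{0..t} \<times> \<Omega>\<close>. It is determined up to a null set.\<close>

definition has_ito_integral ::
  "'w measure \<Rightarrow> (real \<Rightarrow> 'w measure) \<Rightarrow> (real \<Rightarrow> 'w \<Rightarrow> real) \<Rightarrow> real \<Rightarrow>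
   (real \<Rightarrow> 'w \<Rightarrow> real ^ 'n) \<Rightarrow> ('w \<Rightarrow> real ^ 'n) \<Rightarrow> bool" where
  "has_ito_integral M F W t f I \<longleftrightarrow>
     (\<lambda>(r, \<omega>). f r \<omega>) \<in> borel_measurable (restrict_space borel {0..t} \<Otimes>\<^sub>M M) \<and>
     (\<forall>r\<in>{0..t}. f r \<in> borel_measurable (F r)) \<and>
     (\<integral>\<^sup>+\<omega>. (\<integral>\<^sup>+r\<in>{0..t}. ennreal ((norm (f r \<omega>))\<^sup>2) \<partial>lborel) \<partial>M) < \<infinity> \<and>
     I \<in> Xi M F t \<and>
     (\<exists>\<phi> S. (\<forall>m::nat. simple_ito M F W t (\<phi> m) (S m)) \<and>
        (\<lambda>m. \<integral>\<^sup>+\<omega>. (\<integral>\<^sup>+r\<in>{0..t}. ennreal ((norm (f r \<omega> - \<phi> m r \<omega>))\<^sup>2) \<partial>lborel) \<partial>M) \<longlonglongrightarrow> 0 \<and>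
        (\<lambda>m. \<integral>\<^sup>+\<omega>. ennreal ((norm (I \<omega> - S m \<omega>))\<^sup>2) \<partial>M) \<longlonglongrightarrow> 0)"


section \<open>Mild solutions\<close>

text \<open>The formal fractional equation
  \<open>D\<^sup>\<alpha> X - A D\<^sup>\<beta> X - B X = b(t, X) + \<sigma>(t, X) dW/dt\<close>, \<open>X 0 = \<eta>\<close>, has a meaning
  only through the following integral equation, which is required almost surely for each
  time \<open>t\<close>. It is meant for \<open>\<beta> < \<alpha>\<close>: otherwise the kernel \<open>(t - r) powr (\<alpha> - \<beta> - 1)\<close> is not
  integrable on \<open>{0..t}\<close>.\<close>

definition mild_equation ::
  "'w measure \<Rightarrow> (real \<Rightarrow> 'w measure) \<Rightarrow> (real \<Rightarrow> 'w \<Rightarrow> real) \<Rightarrow> real \<Rightarrow> real \<Rightarrow> real \<Rightarrow>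
   real ^ 'n ^ 'n \<Rightarrow> real ^ 'n ^ 'n \<Rightarrow>
   (real \<Rightarrow> real ^ 'n \<Rightarrow> real ^ 'n) \<Rightarrow> (real \<Rightarrow> real ^ 'n \<Rightarrow> real ^ 'n) \<Rightarrow>
   ('w \<Rightarrow> real ^ 'n) \<Rightarrow> (real \<Rightarrow> 'w \<Rightarrow> real ^ 'n) \<Rightarrow> bool" where
  "mild_equation M F W T \<alpha> \<beta> A B b \<sigma> \<eta> X \<longleftrightarrow>
     (\<forall>t\<in>{0..T}. \<exists>I.
        has_ito_integral M F W t (\<lambda>r \<omega>. (t - r) powr (\<alpha> - 1) *\<^sub>R \<sigma> r (X r \<omega>)) I \<and>
        (AE \<omega> in M. X t \<omega> =
           \<eta> \<omega>
           - (t powr (\<alpha> - \<beta>) / Gamma (\<alpha> - \<beta> + 1)) *\<^sub>R (A *v \<eta> \<omega>)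
           + (1 / Gamma (\<alpha> - \<beta>)) *\<^sub>R
               (A *v (LINT r:{0..t}|lborel. (t - r) powr (\<alpha> - \<beta> - 1) *\<^sub>R X r \<omega>))
           + (1 / Gamma \<alpha>) *\<^sub>R
               (B *v (LINT r:{0..t}|lborel. (t - r) powr (\<alpha> - 1) *\<^sub>R X r \<omega>))
           + (1 / Gamma \<alpha>) *\<^sub>R
               (LINT r:{0..t}|lborel. (t - r) powr (\<alpha> - 1) *\<^sub>R b r (X r \<omega>))
           + (1 / Gamma \<alpha>) *\<^sub>R I \<omega>))"

definition mild_solution ::
  "'w measure \<Rightarrow> (real \<Rightarrow> 'w measure) \<Rightarrow> (real \<Rightarrow> 'w \<Rightarrow> real) \<Rightarrow> real \<Rightarrow> real \<Rightarrow> real \<Rightarrow>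
   real ^ 'n ^ 'n \<Rightarrow> real ^ 'n ^ 'n \<Rightarrow>
   (real \<Rightarrow> real ^ 'n \<Rightarrow> real ^ 'n) \<Rightarrow> (real \<Rightarrow> real ^ 'n \<Rightarrow> real ^ 'n) \<Rightarrow>
   ('w \<Rightarrow> real ^ 'n) \<Rightarrow> (real \<Rightarrow> 'w \<Rightarrow> real ^ 'n) \<Rightarrow> bool" where
  "mild_solution M F W T \<alpha> \<beta> A B b \<sigma> \<eta> X \<longleftrightarrow>
     X \<in> H2 M F T \<and>
     (AE \<omega> in M. set_integrable lborel {0..T} (\<lambda>t. (norm (X t \<omega>))\<^sup>2)) \<and>
     (AE \<omega> in M. continuous_on {0..T} (\<lambda>t. X t \<omega>)) \<and>
     mild_equation M F W T \<alpha> \<beta> A B b \<sigma> \<eta> X"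

end

theory Submission
  imports Defs
begin

text \<open>
  The mild equation says that \<open>X\<close> is a fixed point of the map \<open>\<Phi>\<close> that inserts a process into the right
  side. For two inputs with the same initial value the difference of the outputs consists of
  convolutions of the difference of the inputs with \<open>(t - r) powr (\<alpha> - \<beta> - 1)\<close> and \<open>(t - r) powr (\<alpha> - 1)\<close>,
  a drift term, and an Ito integral whose second moment is, by the isometry, a convolution
  with \<open>(t - r) powr (2 \<alpha> - 2)\<close>. Because \<open>\<beta> < \<alpha>\<close> and \<open>\<alpha> > 1 / 2\<close> all three kernels are integrable, and after
  multiplication by \<open>exp (- l (t - r))\<close> with large \<open>l\<close> they have small mass. Hence \<open>\<Phi>\<close> contracts the squared norm
  \<open>SUP t. exp (- l t) E \<bar>X t\<bar>\<^sup>2\<close>. This is \<open>mild_map_contraction\<close>. It gives uniqueness and Lipschitz dependence on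
  the initial value (\<open>mild_solutions_close\<close>), and convergence of the Picard iterates.

  The substance lies in showing that \<open>\<Phi>\<close> has outputs that are jointly measurable, adapted and continuous.
  Ito integrals are limits of integrals of simple processes, so the integrand has to be approximated:
  its averages over the preceding cells of a grid converge to it (\<open>lag_average_tendsto\<close>) and are adapted
  up to null sets (\<open>adapted_time_integral\<close>), which yields \<open>has_ito_integral_exists\<close>. Since the integrand is
  dominated by a deterministic function, the integral is sub-Gaussian (\<open>simple_exponential_bound\<close>). For
  the stochastic convolution, increments from \<open>s\<close> to \<open>t\<close> have variance parameter of order
  \<open>(t - s) powr (2 \<alpha> - 1)\<close>; chaining over dyadic points then gives a continuous version
  (\<open>continuous_version\<close>), however small the exponent. As the \<open>\<sigma>\<close>-algebras need not contain the null sets,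
  adapted versions of continuous processes are built as limits along dyadic times from the left
  (\<open>adapted_measurable_version\<close>).

  The Picard iterates have continuous paths but converge only in mean square at each time, so continuity
  of the limit has to be recovered. Its paths solve, at almost every time, a linear Volterra equation
  whose inhomogeneity is continuous, because drift and noise coefficients are bounded. That equation
  has a continuous solution, and its solutions are unique up to null sets of times; convolutions do not
  see such sets, so the output of the limit has continuous paths (\<open>fixed_point_path_continuous\<close>) and is the solution sought.
\<close>

section \<open>Mean-square size\<close>

text \<open>The squared norm of \<open>L\<^sup>2\<close> as an extended nonnegative number: Fatou, Fubini and limits apply to it
  before integrability is known.\<close>

definition sqn :: "'a measure \<Rightarrow> ('a \<Rightarrow> 'b::real_normed_vector) \<Rightarrow> ennreal" where
  "sqn N f = (\<integral>\<^sup>+x. ennreal ((norm (f x))\<^sup>2) \<partial>N)"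

lemma norm_add_sq: "(norm (x + y))\<^sup>2 \<le> 2 * (norm x)\<^sup>2 + 2 * (norm (y::'b::real_normed_vector))\<^sup>2"
proof -
  have "(norm (x + y))\<^sup>2 \<le> (norm x + norm y)\<^sup>2"
    by (simp add: norm_triangle_ineq power_mono)
  also have "\<dots> \<le> 2 * (norm x)\<^sup>2 + 2 * (norm y)\<^sup>2"
    using sum_squares_bound[of "norm x" "norm y"] by (simp add: power2_sum)
  finally show ?thesis .
qed

lemma sqn_cong_AE:
  assumes "AE x in N. f x = g x"
  shows "sqn N f = sqn N g"
  unfolding sqn_def using assms by (intro nn_integral_cong_AE) auto

lemma sqn_zero [simp]: "sqn N (\<lambda>_. 0) = 0"
  by (simp add: sqn_def)

lemma sqn_add:
  fixes f g :: "'a \<Rightarrow> 'b::{real_normed_vector,second_countable_topology}"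
  assumes [measurable]: "f \<in> borel_measurable N" "g \<in> borel_measurable N"
  shows "sqn N (\<lambda>x. f x + g x) \<le> 2 * sqn N f + 2 * sqn N g"
proof -
  have "sqn N (\<lambda>x. f x + g x)
      \<le> (\<integral>\<^sup>+x. 2 * ennreal ((norm (f x))\<^sup>2) + 2 * ennreal ((norm (g x))\<^sup>2) \<partial>N)"
    unfolding sqn_def
  proof (intro nn_integral_mono)
    fix x
    have "ennreal ((norm (f x + g x))\<^sup>2) \<le> ennreal (2 * (norm (f x))\<^sup>2 + 2 * (norm (g x))\<^sup>2)"
      by (intro ennreal_leI norm_add_sq)
    also have "\<dots> = 2 * ennreal ((norm (f x))\<^sup>2) + 2 * ennreal ((norm (g x))\<^sup>2)"
      by (simp add: ennreal_plus ennreal_mult'')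
    finally show "ennreal ((norm (f x + g x))\<^sup>2)
      \<le> 2 * ennreal ((norm (f x))\<^sup>2) + 2 * ennreal ((norm (g x))\<^sup>2)" .
  qed
  also have "\<dots> = 2 * sqn N f + 2 * sqn N g"
    unfolding sqn_def by (subst nn_integral_add) (auto simp: nn_integral_cmult)
  finally show ?thesis .
qed

lemma sqn_minus_commute: "sqn N (\<lambda>x. f x - g x) = sqn N (\<lambda>x. g x - f x)"
  unfolding sqn_def by (simp add: norm_minus_commute)

lemma sqn_uminus [simp]: "sqn N (\<lambda>x. - f x) = sqn N f"
  unfolding sqn_def by simp

lemma sqn_diff:
  fixes f g :: "'a \<Rightarrow> 'b::{real_normed_vector,second_countable_topology}"
  assumes "f \<in> borel_measurable N" "g \<in> borel_measurable N"
  shows "sqn N (\<lambda>x. f x - g x) \<le> 2 * sqn N f + 2 * sqn N g"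
  using sqn_add[of f N "\<lambda>x. - g x"] assms by simp

lemma sqn_triangle:
  fixes f g :: "'a \<Rightarrow> 'b::{real_normed_vector,second_countable_topology}"
  assumes [measurable]: "f \<in> borel_measurable N" "g \<in> borel_measurable N" "h \<in> borel_measurable N"
  shows "sqn N (\<lambda>x. f x - h x) \<le> 2 * sqn N (\<lambda>x. f x - g x) + 2 * sqn N (\<lambda>x. g x - h x)"
  using sqn_add[of "\<lambda>x. f x - g x" N "\<lambda>x. g x - h x"] by simp

lemma sqn_scaleR: "sqn N (\<lambda>x. c *\<^sub>R f x) = ennreal (c\<^sup>2) * sqn N f"
  if "f \<in> borel_measurable N" for f :: "'a \<Rightarrow> 'b::{real_normed_vector,second_countable_topology}"
  using that unfolding sqn_def
  by (subst nn_integral_cmult[symmetric]) (auto simp: power_mult_distrib ennreal_mult)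

lemma sqn_mono: "(\<And>x. x \<in> space N \<Longrightarrow> norm (f x) \<le> norm (g x)) \<Longrightarrow> sqn N f \<le> sqn N g"
  unfolding sqn_def by (intro nn_integral_mono) (auto intro!: ennreal_leI power_mono)

lemma sqn_eq_0_iff:
  fixes f :: "'a \<Rightarrow> 'b::{real_normed_vector,second_countable_topology}"
  assumes [measurable]: "f \<in> borel_measurable N"
  shows "sqn N f = 0 \<longleftrightarrow> (AE x in N. f x = 0)"
  unfolding sqn_def by (subst nn_integral_0_iff_AE) auto

lemma sqn_finite_iff:
  fixes f :: "'a \<Rightarrow> 'b::{real_normed_vector,second_countable_topology}"
  assumes [measurable]: "f \<in> borel_measurable N"
  shows "sqn N f < \<infinity> \<longleftrightarrow> integrable N (\<lambda>x. (norm (f x))\<^sup>2)"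
  unfolding sqn_def integrable_iff_bounded by auto

lemma ms_norm_sq_eq_sqn:
  assumes "integrable M (\<lambda>\<omega>. (norm (f \<omega>))\<^sup>2)"
  shows "ennreal ((ms_norm M f)\<^sup>2) = sqn M f"
  unfolding ms_norm_def sqn_def using assms
  by (simp add: nn_integral_eq_integral)

text \<open>The Cauchy-Schwarz inequality with the weight split as \<open>sqrt k \<cdot> sqrt k\<close>. When \<open>k u\<close> is not
  integrable the left side is \<open>0\<close> by convention.\<close>

lemma norm_integral_weight_sq_le:
  fixes u :: "'a \<Rightarrow> 'b::{banach,second_countable_topology}"
  assumes [measurable]: "k \<in> borel_measurable N" "u \<in> borel_measurable N"
    and k: "\<And>x. 0 \<le> k x"
  shows "ennreal ((norm (\<integral>x. k x *\<^sub>R u x \<partial>N))\<^sup>2)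
    \<le> (\<integral>\<^sup>+x. ennreal (k x) \<partial>N) * (\<integral>\<^sup>+x. ennreal (k x) * ennreal ((norm (u x))\<^sup>2) \<partial>N)"
proof (cases "integrable N (\<lambda>x. k x *\<^sub>R u x)")
  case True
  have "ennreal (norm (\<integral>x. k x *\<^sub>R u x \<partial>N)) \<le> (\<integral>\<^sup>+x. ennreal (norm (k x *\<^sub>R u x)) \<partial>N)"
    by (intro integral_norm_bound_ennreal True)
  also have "\<dots> = (\<integral>\<^sup>+x. ennreal (sqrt (k x)) * ennreal (sqrt (k x) * norm (u x)) \<partial>N)"
    using k by (intro nn_integral_cong) (simp add: ennreal_mult[symmetric] mult.assoc[symmetric])
  finally have "(ennreal (norm (\<integral>x. k x *\<^sub>R u x \<partial>N)))\<^sup>2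
     \<le> (\<integral>\<^sup>+x. ennreal (sqrt (k x)) * ennreal (sqrt (k x) * norm (u x)) \<partial>N)\<^sup>2"
    by (rule power_mono) simp
  also have "\<dots> \<le> (\<integral>\<^sup>+x. (ennreal (sqrt (k x)))\<^sup>2 \<partial>N) * (\<integral>\<^sup>+x. (ennreal (sqrt (k x) * norm (u x)))\<^sup>2 \<partial>N)"
    by (rule Cauchy_Schwarz_nn_integral) auto
  also have "\<dots> = (\<integral>\<^sup>+x. ennreal (k x) \<partial>N) * (\<integral>\<^sup>+x. ennreal (k x) * ennreal ((norm (u x))\<^sup>2) \<partial>N)"
    using k by (simp add: ennreal_power power_mult_distrib ennreal_mult)
  finally show ?thesis by (simp add: ennreal_power)
next
  case False
  then show ?thesis by (simp add: not_integrable_integral_eq)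
qed

text \<open>Passes between joint measurability over a time interval, which the definitions of \<open>H2\<close> and of the
  Ito integral ask for, and measurability of the extension by zero, to which Fubini applies.\<close>

lemma measurable_pair_restrict_iff:
  fixes f :: "real \<Rightarrow> 'w \<Rightarrow> 'b::{real_normed_vector,second_countable_topology}"
  assumes S: "S \<in> sets borel"
  shows "(\<lambda>(r, \<omega>). f r \<omega>) \<in> borel_measurable (restrict_space borel S \<Otimes>\<^sub>M N) \<longleftrightarrow>
    (\<lambda>(r, \<omega>). indicator S r *\<^sub>R f r \<omega>) \<in> borel_measurable (borel \<Otimes>\<^sub>M N)"
proof
  assume f: "(\<lambda>(r, \<omega>). f r \<omega>) \<in> borel_measurable (restrict_space borel S \<Otimes>\<^sub>M N)"
  have "(\<lambda>x. x) \<in> restrict_space (borel \<Otimes>\<^sub>M N) {x. fst x \<in> S} \<rightarrow>\<^sub>M restrict_space borel S \<Otimes>\<^sub>M N"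
  proof (subst measurable_pair_iff, intro conjI)
    show "fst \<circ> (\<lambda>x. x) \<in> restrict_space (borel \<Otimes>\<^sub>M N) {x. fst x \<in> S} \<rightarrow>\<^sub>M restrict_space borel S"
      by (intro measurable_restrict_space2 measurable_restrict_space1) (auto simp: space_restrict_space comp_def)
    show "snd \<circ> (\<lambda>x. x) \<in> restrict_space (borel \<Otimes>\<^sub>M N) {x. fst x \<in> S} \<rightarrow>\<^sub>M N"
      by (intro measurable_restrict_space1) (auto simp: comp_def)
  qed
  from measurable_compose[OF this f]
  have f': "(\<lambda>(r, \<omega>). f r \<omega>) \<in> borel_measurable (restrict_space (borel \<Otimes>\<^sub>M N) {x. fst x \<in> S})"
    by simp
  have "(\<lambda>x. if fst x \<in> S then (\<lambda>(r, \<omega>). f r \<omega>) x else 0) \<in> borel_measurable (borel \<Otimes>\<^sub>M N)"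
    by (subst measurable_If_restrict_space_iff) (use f' S in auto)
  also have "(\<lambda>x. if fst x \<in> S then (\<lambda>(r, \<omega>). f r \<omega>) x else 0) = (\<lambda>(r, \<omega>). indicator S r *\<^sub>R f r \<omega>)"
    by (auto simp: fun_eq_iff)
  finally show "(\<lambda>(r, \<omega>). indicator S r *\<^sub>R f r \<omega>) \<in> borel_measurable (borel \<Otimes>\<^sub>M N)" .
next
  assume f: "(\<lambda>(r, \<omega>). indicator S r *\<^sub>R f r \<omega>) \<in> borel_measurable (borel \<Otimes>\<^sub>M N)"
  have "(\<lambda>x. x) \<in> restrict_space borel S \<Otimes>\<^sub>M N \<rightarrow>\<^sub>M borel \<Otimes>\<^sub>M N"
  proof (subst measurable_pair_iff, intro conjI)
    have "(\<lambda>x. x) \<in> restrict_space borel S \<rightarrow>\<^sub>M borel"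
      by (intro measurable_restrict_space1) auto
    from measurable_compose[OF measurable_fst this]
    show "fst \<circ> (\<lambda>x. x) \<in> restrict_space borel S \<Otimes>\<^sub>M N \<rightarrow>\<^sub>M borel"
      by (simp add: comp_def)
    show "snd \<circ> (\<lambda>x. x) \<in> restrict_space borel S \<Otimes>\<^sub>M N \<rightarrow>\<^sub>M N"
      by (simp add: comp_def)
  qed
  from measurable_compose[OF this f]
  have "(\<lambda>(r, \<omega>). indicator S r *\<^sub>R f r \<omega>) \<in> borel_measurable (restrict_space borel S \<Otimes>\<^sub>M N)"
    by simp
  then show "(\<lambda>(r, \<omega>). f r \<omega>) \<in> borel_measurable (restrict_space borel S \<Otimes>\<^sub>M N)"
    by (rule measurable_cong[THEN iffD1, rotated])
       (auto simp: space_pair_measure space_restrict_space)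
qed

text \<open>With \<open>p = sqrt q\<close> the inequality \<open>x \<le> (p\<^sup>k + x\<^sup>2 / p\<^sup>k) / 2\<close> turns the geometric bound on second
  moments into one on first moments, so the increments are almost surely absolutely summable.\<close>

lemma (in prob_space) AE_convergent_if_fast_Cauchy:
  fixes U :: "nat \<Rightarrow> 'a \<Rightarrow> 'b::{banach,second_countable_topology}"
  assumes [measurable]: "\<And>k. U k \<in> borel_measurable M"
    and fast: "\<And>k. sqn M (\<lambda>\<omega>. U (Suc k) \<omega> - U k \<omega>) \<le> ennreal (c * q ^ k)"
    and q: "0 < q" "q < 1" and c: "0 \<le> c"
  shows "AE \<omega> in M. convergent (\<lambda>k. U k \<omega>)"
proof -
  define p where "p = sqrt q"
  have p: "0 < p" "p < 1" "p\<^sup>2 = q" using q by (auto simp: p_def)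
  have norm_le: "norm x \<le> (p ^ k + (norm x)\<^sup>2 / p ^ k) / 2" for x :: 'b and k
  proof -
    have "0 \<le> (norm x - p ^ k)\<^sup>2" by simp
    then have "2 * norm x * p ^ k \<le> (norm x)\<^sup>2 + (p ^ k)\<^sup>2"
      by (simp add: power2_diff)
    then show ?thesis using p by (simp add: field_simps power2_eq_square)
  qed
  have step: "(\<integral>\<^sup>+\<omega>. ennreal (norm (U (Suc k) \<omega> - U k \<omega>)) \<partial>M) \<le> ennreal ((1 + c) / 2 * p ^ k)" for k
  proof -
    have "(\<integral>\<^sup>+\<omega>. ennreal (norm (U (Suc k) \<omega> - U k \<omega>)) \<partial>M)
      \<le> (\<integral>\<^sup>+\<omega>. ennreal (p ^ k / 2) + ennreal (1 / (2 * p ^ k)) * ennreal ((norm (U (Suc k) \<omega> - U k \<omega>))\<^sup>2) \<partial>M)"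
    proof (intro nn_integral_mono)
      fix \<omega>
      have "ennreal (norm (U (Suc k) \<omega> - U k \<omega>))
          \<le> ennreal (p ^ k / 2 + 1 / (2 * p ^ k) * (norm (U (Suc k) \<omega> - U k \<omega>))\<^sup>2)"
        using norm_le[of "U (Suc k) \<omega> - U k \<omega>" k] by (intro ennreal_leI) (simp add: field_simps)
      also have "\<dots> = ennreal (p ^ k / 2) + ennreal (1 / (2 * p ^ k)) * ennreal ((norm (U (Suc k) \<omega> - U k \<omega>))\<^sup>2)"
        using p by (subst ennreal_plus) (auto simp: ennreal_mult[symmetric])
      finally show "ennreal (norm (U (Suc k) \<omega> - U k \<omega>)) \<le> \<dots>" .
    qed
    also have "\<dots> = ennreal (p ^ k / 2) + ennreal (1 / (2 * p ^ k)) * sqn M (\<lambda>\<omega>. U (Suc k) \<omega> - U k \<omega>)"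
      unfolding sqn_def by (subst nn_integral_add) (auto simp: nn_integral_cmult emeasure_space_1)
    also have "\<dots> \<le> ennreal (p ^ k / 2) + ennreal (1 / (2 * p ^ k)) * ennreal (c * q ^ k)"
      by (intro add_mono mult_left_mono fast) auto
    also have "\<dots> = ennreal (p ^ k / 2 + 1 / (2 * p ^ k) * (c * q ^ k))"
      using p c q by (simp add: ennreal_plus ennreal_mult[symmetric])
    also have "p ^ k / 2 + 1 / (2 * p ^ k) * (c * q ^ k) = (1 + c) / 2 * p ^ k"
    proof -
      have "q ^ k = p ^ k * p ^ k" unfolding p(3)[symmetric] by (simp add: power2_eq_square power_mult_distrib)
      then show ?thesis using p by (simp add: field_simps)
    qed
    finally show ?thesis .
  qed
  have "(\<integral>\<^sup>+\<omega>. (\<Sum>k. ennreal (norm (U (Suc k) \<omega> - U k \<omega>))) \<partial>M)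
      = (\<Sum>k. \<integral>\<^sup>+\<omega>. ennreal (norm (U (Suc k) \<omega> - U k \<omega>)) \<partial>M)"
    by (rule nn_integral_suminf) auto
  also have "\<dots> \<le> (\<Sum>k. ennreal ((1 + c) / 2 * p ^ k))"
    by (intro suminf_le step) auto
  also have "\<dots> = ennreal (\<Sum>k. (1 + c) / 2 * p ^ k)"
    using p c by (intro suminf_ennreal2 summable_mult summable_geometric) auto
  also have "\<dots> < \<infinity>" by simp
  finally have "(\<integral>\<^sup>+\<omega>. (\<Sum>k. ennreal (norm (U (Suc k) \<omega> - U k \<omega>))) \<partial>M) \<noteq> \<infinity>" by simp
  then have "AE \<omega> in M. (\<Sum>k. ennreal (norm (U (Suc k) \<omega> - U k \<omega>))) \<noteq> \<infinity>"
    by (intro nn_integral_PInf_AE) auto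
  then show ?thesis
  proof eventually_elim
    case (elim \<omega>)
    then have "summable (\<lambda>k. norm (U (Suc k) \<omega> - U k \<omega>))"
      by (intro summable_suminf_not_top) auto
    then have "summable (\<lambda>k. U (Suc k) \<omega> - U k \<omega>)"
      by (rule summable_norm_cancel)
    then have "convergent (\<lambda>n. \<Sum>k<n. U (Suc k) \<omega> - U k \<omega>)"
      by (simp add: summable_iff_convergent)
    then have "convergent (\<lambda>n. U n \<omega> - U 0 \<omega>)"
      unfolding sum_lessThan_telescope[of "\<lambda>k. U k \<omega>"] .
    then have "convergent (\<lambda>n. (U n \<omega> - U 0 \<omega>) + U 0 \<omega>)"
      by (intro convergent_add convergent_const)
    then show ?case by simp
  qed
qed

text \<open>Fatou's lemma, in the form that transfers mean-square bounds to almost sure limits.\<close>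

lemma sqn_le_liminf:
  fixes U :: "nat \<Rightarrow> 'a \<Rightarrow> 'b::{banach,second_countable_topology}"
  assumes [measurable]: "\<And>k. U k \<in> borel_measurable N"
    and lim: "AE x in N. (\<lambda>k. U k x) \<longlonglongrightarrow> V x"
  shows "sqn N V \<le> liminf (\<lambda>k. sqn N (U k))"
proof -
  have "sqn N V = (\<integral>\<^sup>+x. liminf (\<lambda>k. ennreal ((norm (U k x))\<^sup>2)) \<partial>N)"
    unfolding sqn_def
  proof (rule nn_integral_cong_AE, use lim in eventually_elim)
    case (elim x)
    then have "(\<lambda>k. ennreal ((norm (U k x))\<^sup>2)) \<longlonglongrightarrow> ennreal ((norm (V x))\<^sup>2)"
      by (intro tendsto_ennrealI tendsto_power tendsto_norm)
    then show ?case by (intro lim_imp_Liminf[symmetric]) auto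
  qed
  also have "\<dots> \<le> liminf (\<lambda>k. sqn N (U k))"
    unfolding sqn_def by (rule nn_integral_liminf) auto
  finally show ?thesis .
qed

lemma borel_measurable_vec_iff:
  fixes f :: "'a \<Rightarrow> real ^ 'n"
  shows "f \<in> borel_measurable N \<longleftrightarrow> (\<forall>j. (\<lambda>x. f x $ j) \<in> borel_measurable N)"
  by (subst borel_measurable_euclidean_space) (auto simp: Basis_vec_def inner_axis)

context brownian_basis
begin

section \<open>Brownian increments and elementary integrals\<close>

lemma space_F: "t \<in> {0..T} \<Longrightarrow> space (F t) = space M"
  using subalgebra_F[of t] by (simp add: subalgebra_def)

lemma borel_measurable_F_M: "f \<in> borel_measurable (F t) \<Longrightarrow> t \<in> {0..T} \<Longrightarrow> f \<in> borel_measurable M"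
  using measurable_from_subalg[OF subalgebra_F] by blast

lemma borel_measurable_F_mono:
  assumes "f \<in> borel_measurable (F s)" "0 \<le> s" "s \<le> t" "t \<le> T"
  shows "f \<in> borel_measurable (F t)"
proof -
  have "subalgebra (F t) (F s)"
    using assms F_mono[of s t] space_F[of s] space_F[of t] by (auto simp: subalgebra_def)
  then show ?thesis using assms(1) by (rule measurable_from_subalg)
qed

lemma borel_measurable_W_F: "0 \<le> s \<Longrightarrow> s \<le> t \<Longrightarrow> t \<le> T \<Longrightarrow> W s \<in> borel_measurable (F t)"
  using borel_measurable_F_mono[OF adapted_W[of s]] by auto

lemma indep_var_increment:
  assumes U: "U \<in> borel_measurable (F s)" and st: "0 \<le> s" "s < t" "t \<le> T"
  shows "indep_var borel U borel (\<lambda>\<omega>. W t \<omega> - W s \<omega>)"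
proof -
  have UM: "U \<in> borel_measurable M"
    using borel_measurable_F_M[OF U] st by auto
  have W: "(\<lambda>\<omega>. W t \<omega> - W s \<omega>) \<in> borel_measurable M"
    using measurable_W[of t] measurable_W[of s] st by auto
  have sF: "space (F s) = space M" using space_F st by auto
  have "{U -` A \<inter> space M |A. A \<in> sets borel} \<subseteq> sets (F s)"
    using measurable_sets[OF U] unfolding sF by auto
  then have sub: "sigma_sets (space M) {U -` A \<inter> space M |A. A \<in> sets borel} \<subseteq> sets (F s)"
    using sets.sigma_sets_subset[of _ "F s"] unfolding sF by auto
  have "indep_set (sets (F s)) (sets (vimage_algebra (space M) (\<lambda>\<omega>. W t \<omega> - W s \<omega>) borel))"
    by (rule indep_F[OF st])
  then have "indep_set (sigma_sets (space M) {U -` A \<inter> space M |A. A \<in> sets borel})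
     (sigma_sets (space M) {(\<lambda>\<omega>. W t \<omega> - W s \<omega>) -` A \<inter> space M |A. A \<in> sets borel})"
    unfolding sets_vimage_algebra indep_set_def
    by (rule indep_sets_mono_sets) (use sub in \<open>auto split: bool.splits\<close>)
  then show ?thesis
    unfolding indep_var_eq using UM W by auto
qed

text \<open>The exponential moment comes from completing the square in the Gaussian density.\<close>

lemma increment_integrals:
  assumes st: "0 \<le> s" "s \<le> t"
  shows "integrable M (\<lambda>\<omega>. W t \<omega> - W s \<omega>)" "(\<integral>\<omega>. W t \<omega> - W s \<omega> \<partial>M) = 0"
    "integrable M (\<lambda>\<omega>. (W t \<omega> - W s \<omega>)\<^sup>2)" "(\<integral>\<omega>. (W t \<omega> - W s \<omega>)\<^sup>2 \<partial>M) = t - s"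
    "integrable M (\<lambda>\<omega>. exp (l * (W t \<omega> - W s \<omega>)))"
    "(\<integral>\<omega>. exp (l * (W t \<omega> - W s \<omega>)) \<partial>M) = exp (l\<^sup>2 * (t - s) / 2)"
proof -
  have "integrable M (\<lambda>\<omega>. W t \<omega> - W s \<omega>) \<and> (\<integral>\<omega>. W t \<omega> - W s \<omega> \<partial>M) = 0 \<and>
    integrable M (\<lambda>\<omega>. (W t \<omega> - W s \<omega>)\<^sup>2) \<and> (\<integral>\<omega>. (W t \<omega> - W s \<omega>)\<^sup>2 \<partial>M) = t - s \<and>
    integrable M (\<lambda>\<omega>. exp (l * (W t \<omega> - W s \<omega>))) \<and>
    (\<integral>\<omega>. exp (l * (W t \<omega> - W s \<omega>)) \<partial>M) = exp (l\<^sup>2 * (t - s) / 2)"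
  proof (cases "s = t")
    case True
    then show ?thesis by (simp add: prob_space)
  next
    case False
    define \<tau> where "\<tau> = sqrt (t - s)"
    have \<tau>: "0 < \<tau>" "\<tau>\<^sup>2 = t - s" using False st by (auto simp: \<tau>_def)
    have D: "distributed M lborel (\<lambda>\<omega>. W t \<omega> - W s \<omega>) (normal_density 0 \<tau>)"
      using normal_increments[of s t] False st by (simp add: \<tau>_def)
    note I = distributed_integrable[OF D] and E = distributed_integral[OF D]
    have "has_bochner_integral lborel (\<lambda>x. normal_density 0 \<tau> x * (x - 0)^(2 * 1))
        (fact (2 * 1) / ((2 / \<tau>\<^sup>2)^1 * fact 1))"
      by (rule normal_moment_even[OF \<tau>(1)])
    then have m2: "has_bochner_integral lborel (\<lambda>x. normal_density 0 \<tau> x * x\<^sup>2) (t - s)"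
      using \<tau> by (simp add: fact_numeral numeral_2_eq_2)
    have m1: "has_bochner_integral lborel (\<lambda>x. normal_density 0 \<tau> x * x) 0"
      by (rule normal_moment_nz_1[OF \<tau>(1)])
    have shift: "normal_density 0 \<tau> x * exp (l * x) = exp (l\<^sup>2 * (t - s) / 2) * normal_density (l * \<tau>\<^sup>2) \<tau> x" for x
    proof -
      have "- ((x - 0)\<^sup>2 / (2 * \<tau>\<^sup>2)) + l * x = l\<^sup>2 * \<tau>\<^sup>2 / 2 + - ((x - l * \<tau>\<^sup>2)\<^sup>2 / (2 * \<tau>\<^sup>2))"
        using \<tau>(1) by (simp add: field_simps power2_eq_square)
      then have "exp (- (x - 0)\<^sup>2 / (2 * \<tau>\<^sup>2)) * exp (l * x) = exp (l\<^sup>2 * (t - s) / 2) * exp (- (x - l * \<tau>\<^sup>2)\<^sup>2 / (2 * \<tau>\<^sup>2))"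
        unfolding \<tau>(2)[symmetric] by (simp add: exp_add[symmetric])
      then show ?thesis unfolding normal_density_def by simp
    qed
    have "has_bochner_integral lborel (\<lambda>x. exp (l\<^sup>2 * (t - s) / 2) * normal_density (l * \<tau>\<^sup>2) \<tau> x) (exp (l\<^sup>2 * (t - s) / 2) * 1)"
      by (intro has_bochner_integral_mult_right)
         (auto simp: has_bochner_integral_iff integral_normal_density[OF \<tau>(1)] integrable_normal_density[OF \<tau>(1)])
    then have me: "has_bochner_integral lborel (\<lambda>x. normal_density 0 \<tau> x * exp (l * x)) (exp (l\<^sup>2 * (t - s) / 2))"
      unfolding shift by simp
    show ?thesis
      using I[of "\<lambda>x. x"] E[of "\<lambda>x. x"] I[of "\<lambda>x. x\<^sup>2"] E[of "\<lambda>x. x\<^sup>2"]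
        I[of "\<lambda>x. exp (l * x)"] E[of "\<lambda>x. exp (l * x)"] m1 m2 me
      by (auto simp: has_bochner_integral_iff)
  qed
  then show "integrable M (\<lambda>\<omega>. W t \<omega> - W s \<omega>)" "(\<integral>\<omega>. W t \<omega> - W s \<omega> \<partial>M) = 0"
    "integrable M (\<lambda>\<omega>. (W t \<omega> - W s \<omega>)\<^sup>2)" "(\<integral>\<omega>. (W t \<omega> - W s \<omega>)\<^sup>2 \<partial>M) = t - s"
    "integrable M (\<lambda>\<omega>. exp (l * (W t \<omega> - W s \<omega>)))"
    "(\<integral>\<omega>. exp (l * (W t \<omega> - W s \<omega>)) \<partial>M) = exp (l\<^sup>2 * (t - s) / 2)" by auto
qed

lemma increment_mult:
  fixes h :: "real \<Rightarrow> real"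
  assumes U: "U \<in> borel_measurable (F s)" "integrable M U" and st: "0 \<le> s" "s < t" "t \<le> T"
    and h: "h \<in> borel_measurable borel" "integrable M (\<lambda>\<omega>. h (W t \<omega> - W s \<omega>))"
  shows "integrable M (\<lambda>\<omega>. U \<omega> * h (W t \<omega> - W s \<omega>))"
    "(\<integral>\<omega>. U \<omega> * h (W t \<omega> - W s \<omega>) \<partial>M) = (\<integral>\<omega>. U \<omega> \<partial>M) * (\<integral>\<omega>. h (W t \<omega> - W s \<omega>) \<partial>M)"
proof -
  have "indep_var borel ((\<lambda>x. x) \<circ> U) borel (h \<circ> (\<lambda>\<omega>. W t \<omega> - W s \<omega>))"
    by (rule indep_var_compose[OF indep_var_increment[OF U(1) st]]) (use h in auto)
  then have iv: "indep_var borel U borel (\<lambda>\<omega>. h (W t \<omega> - W s \<omega>))"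
    by (simp add: comp_def)
  show "integrable M (\<lambda>\<omega>. U \<omega> * h (W t \<omega> - W s \<omega>))"
    by (rule indep_var_integrable[OF iv U(2) h(2)])
  show "(\<integral>\<omega>. U \<omega> * h (W t \<omega> - W s \<omega>) \<partial>M) = (\<integral>\<omega>. U \<omega> \<partial>M) * (\<integral>\<omega>. h (W t \<omega> - W s \<omega>) \<partial>M)"
    by (rule indep_var_lebesgue_integral[OF iv U(2) h(2)])
qed

lemma increment_centered:
  assumes U: "U \<in> borel_measurable (F s)" "integrable M U" and st: "0 \<le> s" "s \<le> t" "t \<le> T"
  shows "has_bochner_integral M (\<lambda>\<omega>. U \<omega> * (W t \<omega> - W s \<omega>)) 0"
proof (cases "s = t")
  case False
  then show ?thesis
    using increment_mult[of U s t "\<lambda>x. x"] increment_integrals[of s t] assms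
    by (auto simp: has_bochner_integral_iff)
qed (simp add: has_bochner_integral_zero)

lemma increment_square:
  assumes U: "U \<in> borel_measurable (F s)" "integrable M U" and st: "0 \<le> s" "s \<le> t" "t \<le> T"
  shows "has_bochner_integral M (\<lambda>\<omega>. U \<omega> * (W t \<omega> - W s \<omega>)\<^sup>2) ((\<integral>\<omega>. U \<omega> \<partial>M) * (t - s))"
proof (cases "s = t")
  case False
  then show ?thesis
    using increment_mult[of U s t "\<lambda>x. x\<^sup>2"] increment_integrals[of s t] assms
    by (auto simp: has_bochner_integral_iff)
qed (simp add: has_bochner_integral_zero)

lemma integrable_bounded_mult:
  fixes U f :: "'w \<Rightarrow> real"
  assumes [measurable]: "U \<in> borel_measurable M" and C: "\<And>\<omega>. \<omega> \<in> space M \<Longrightarrow> \<bar>U \<omega>\<bar> \<le> C" and f: "integrable M f"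
  shows "integrable M (\<lambda>\<omega>. U \<omega> * f \<omega>)"
proof (rule Bochner_Integration.integrable_bound[of M "\<lambda>\<omega>. C * f \<omega>"])
  show "integrable M (\<lambda>\<omega>. C * f \<omega>)" using f by simp
  show "(\<lambda>\<omega>. U \<omega> * f \<omega>) \<in> borel_measurable M" using f by measurable
  show "AE \<omega> in M. norm (U \<omega> * f \<omega>) \<le> norm (C * f \<omega>)"
  proof (rule AE_I2)
    fix \<omega> assume "\<omega> \<in> space M"
    from C[OF this] have "\<bar>U \<omega>\<bar> \<le> \<bar>C\<bar>" by linarith
    then show "norm (U \<omega> * f \<omega>) \<le> norm (C * f \<omega>)"
      by (simp add: abs_mult mult_right_mono)
  qed
qed

text \<open>Cut both intervals at \<open>c\<close> and at \<open>min b d\<close>. Products of increments over disjoint pieces have mean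
  zero, since the later increment is independent of everything before it; only the square of the
  increment over the common piece, if there is one, remains.\<close>

text \<open>The intervals may lie in any position: elementary processes over different grids have to be compared.\<close>

lemma increment_cross_ordered:
  assumes U: "U \<in> borel_measurable (F c)" and C: "\<And>\<omega>. \<omega> \<in> space M \<Longrightarrow> \<bar>U \<omega>\<bar> \<le> C"
    and o: "0 \<le> a" "a \<le> b" "b \<le> T" "a \<le> c" "c \<le> d" "d \<le> T"
  shows "has_bochner_integral M (\<lambda>\<omega>. U \<omega> * ((W b \<omega> - W a \<omega>) * (W d \<omega> - W c \<omega>)))
    ((\<integral>\<omega>. U \<omega> \<partial>M) * max 0 (min b d - c))"
proof -
  have UM: "U \<in> borel_measurable M" using borel_measurable_F_M[OF U] o by auto
  have F: "(\<lambda>\<omega>. U \<omega> * (W u \<omega> - W v \<omega>)) \<in> borel_measurable (F x)"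
    if "c \<le> x" "x \<le> T" "0 \<le> u" "u \<le> x" "0 \<le> v" "v \<le> x" for u v x
    using borel_measurable_F_mono[OF U, of x] borel_measurable_W_F[of u x] borel_measurable_W_F[of v x] that o
    by auto
  have I: "integrable M (\<lambda>\<omega>. U \<omega> * (W u \<omega> - W v \<omega>))" if "0 \<le> v" "v \<le> u" for u v
    using increment_integrals(1)[OF that] by (intro integrable_bounded_mult[OF UM C])
  have IU: "integrable M U"
    using integrable_bounded_mult[OF UM C, of "\<lambda>_. 1"] by simp
  note has_bochner_integral_add[simp]
  show ?thesis
  proof (cases "b \<le> c")
    case True
    have "has_bochner_integral M (\<lambda>\<omega>. (U \<omega> * (W b \<omega> - W a \<omega>)) * (W d \<omega> - W c \<omega>)) 0"
      by (rule increment_centered) (use F I o True in auto)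
    moreover have "max 0 (min b d - c) = 0" using True by auto
    ultimately show ?thesis by (simp add: mult.assoc)
  next
    case False
    have 1: "has_bochner_integral M (\<lambda>\<omega>. (U \<omega> * (W c \<omega> - W a \<omega>)) * (W d \<omega> - W c \<omega>)) 0"
      by (rule increment_centered) (use F I o False in auto)
    show ?thesis
    proof (cases "b \<le> d")
      case True
      have 2: "has_bochner_integral M (\<lambda>\<omega>. U \<omega> * (W b \<omega> - W c \<omega>)\<^sup>2) ((\<integral>\<omega>. U \<omega> \<partial>M) * (b - c))"
        by (rule increment_square) (use U IU o False True in auto)
      have 3: "has_bochner_integral M (\<lambda>\<omega>. (U \<omega> * (W b \<omega> - W c \<omega>)) * (W d \<omega> - W b \<omega>)) 0"
        by (rule increment_centered) (use F I o True False in auto)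
      have eq: "(U \<omega> * (W c \<omega> - W a \<omega>)) * (W d \<omega> - W c \<omega>) + (U \<omega> * (W b \<omega> - W c \<omega>)\<^sup>2 + (U \<omega> * (W b \<omega> - W c \<omega>)) * (W d \<omega> - W b \<omega>))
         = U \<omega> * ((W b \<omega> - W a \<omega>) * (W d \<omega> - W c \<omega>))" for \<omega>
        by algebra
      show ?thesis
        using has_bochner_integral_add[OF 1 has_bochner_integral_add[OF 2 3]] True False unfolding eq by simp
    next
      case d: False
      have 2: "has_bochner_integral M (\<lambda>\<omega>. U \<omega> * (W d \<omega> - W c \<omega>)\<^sup>2) ((\<integral>\<omega>. U \<omega> \<partial>M) * (d - c))"
        by (rule increment_square) (use U IU o False in auto)
      have 3: "has_bochner_integral M (\<lambda>\<omega>. (U \<omega> * (W d \<omega> - W c \<omega>)) * (W b \<omega> - W d \<omega>)) 0"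
        by (rule increment_centered) (use F I o d False in auto)
      have eq: "(U \<omega> * (W c \<omega> - W a \<omega>)) * (W d \<omega> - W c \<omega>) + (U \<omega> * (W d \<omega> - W c \<omega>)\<^sup>2 + (U \<omega> * (W d \<omega> - W c \<omega>)) * (W b \<omega> - W d \<omega>))
         = U \<omega> * ((W b \<omega> - W a \<omega>) * (W d \<omega> - W c \<omega>))" for \<omega>
        by algebra
      show ?thesis
        using has_bochner_integral_add[OF 1 has_bochner_integral_add[OF 2 3]] d False o unfolding eq by simp
    qed
  qed
qed

lemma increment_cross:
  fixes \<xi> \<zeta> :: "'w \<Rightarrow> 'b::euclidean_space"
  assumes \<xi>: "\<xi> \<in> borel_measurable (F a)" "bounded (\<xi> ` space M)"
    and \<zeta>: "\<zeta> \<in> borel_measurable (F c)" "bounded (\<zeta> ` space M)"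
    and o: "0 \<le> a" "a \<le> b" "b \<le> T" "0 \<le> c" "c \<le> d" "d \<le> T"
  shows "has_bochner_integral M
    (\<lambda>\<omega>. ((W b \<omega> - W a \<omega>) *\<^sub>R \<xi> \<omega>) \<bullet> ((W d \<omega> - W c \<omega>) *\<^sub>R \<zeta> \<omega>))
    (max 0 (min b d - max a c) * (\<integral>\<omega>. \<xi> \<omega> \<bullet> \<zeta> \<omega> \<partial>M))"
proof -
  from \<xi>(2) obtain C1 where C1: "\<And>\<omega>. \<omega> \<in> space M \<Longrightarrow> norm (\<xi> \<omega>) \<le> C1"
    by (auto simp: bounded_iff)
  from \<zeta>(2) obtain C2 where C2: "\<And>\<omega>. \<omega> \<in> space M \<Longrightarrow> norm (\<zeta> \<omega>) \<le> C2"
    by (auto simp: bounded_iff)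
  have C: "\<bar>\<xi> \<omega> \<bullet> \<zeta> \<omega>\<bar> \<le> C1 * C2" if "\<omega> \<in> space M" for \<omega>
  proof -
    have "\<bar>\<xi> \<omega> \<bullet> \<zeta> \<omega>\<bar> \<le> norm (\<xi> \<omega>) * norm (\<zeta> \<omega>)" by (rule Cauchy_Schwarz_ineq2)
    also have "\<dots> \<le> C1 * C2"
      using C1[OF that] C2[OF that] order_trans[OF norm_ge_zero C1[OF that]] by (intro mult_mono) auto
    finally show ?thesis .
  qed
  show ?thesis
  proof (cases "a \<le> c")
    case True
    have [measurable]: "\<xi> \<in> borel_measurable (F c)"
      using borel_measurable_F_mono[OF \<xi>(1)] True o by auto
    note \<zeta>(1)[measurable]
    have "has_bochner_integral M (\<lambda>\<omega>. (\<xi> \<omega> \<bullet> \<zeta> \<omega>) * ((W b \<omega> - W a \<omega>) * (W d \<omega> - W c \<omega>)))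
       ((\<integral>\<omega>. \<xi> \<omega> \<bullet> \<zeta> \<omega> \<partial>M) * max 0 (min b d - c))"
      by (rule increment_cross_ordered[OF _ C]) (use o True in auto)
    moreover have "max a c = c" using True by simp
    ultimately show ?thesis by (simp add: mult_ac)
  next
    case False
    have [measurable]: "\<zeta> \<in> borel_measurable (F a)"
      using borel_measurable_F_mono[OF \<zeta>(1)] False o by auto
    note \<xi>(1)[measurable]
    have "has_bochner_integral M (\<lambda>\<omega>. (\<xi> \<omega> \<bullet> \<zeta> \<omega>) * ((W d \<omega> - W c \<omega>) * (W b \<omega> - W a \<omega>)))
       ((\<integral>\<omega>. \<xi> \<omega> \<bullet> \<zeta> \<omega> \<partial>M) * max 0 (min d b - a))"
      by (rule increment_cross_ordered[OF _ C]) (use o False in auto)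
    moreover have "max a c = a" using False by simp
    ultimately show ?thesis by (simp add: mult_ac min.commute)
  qed
qed

text \<open>Elementary processes with their stochastic integrals. Intervals are added one at a time and in any
  order, so that the class is closed under sums without common refinements of partitions.\<close>

inductive elementary :: "(real \<Rightarrow> 'w \<Rightarrow> 'b::euclidean_space) \<Rightarrow> ('w \<Rightarrow> 'b) \<Rightarrow> bool" where
  zero: "elementary (\<lambda>_ _. 0) (\<lambda>_. 0)"
| step: "elementary \<phi> S \<Longrightarrow> 0 \<le> a \<Longrightarrow> a \<le> b \<Longrightarrow> b \<le> T \<Longrightarrow>
    \<xi> \<in> borel_measurable (F a) \<Longrightarrow> bounded (\<xi> ` space M) \<Longrightarrow>
    elementary (\<lambda>r \<omega>. \<phi> r \<omega> + indicator {a<..b} r *\<^sub>R \<xi> \<omega>)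
      (\<lambda>\<omega>. S \<omega> + (W b \<omega> - W a \<omega>) *\<^sub>R \<xi> \<omega>)"

lemma elementary_add:
  fixes \<phi> :: "real \<Rightarrow> 'w \<Rightarrow> 'b::euclidean_space"
  assumes "elementary \<phi> S" "elementary \<psi> R"
  shows "elementary (\<lambda>r \<omega>. \<phi> r \<omega> + \<psi> r \<omega>) (\<lambda>\<omega>. S \<omega> + R \<omega>)"
  using assms(2)
proof induction
  case zero
  then show ?case using assms(1) by simp
next
  case (step \<psi> R a b \<xi>)
  from elementary.step[OF step.IH step.hyps(2-6)]
  show ?case by (simp add: add.assoc)
qed

lemma elementary_uminus:
  fixes \<phi> :: "real \<Rightarrow> 'w \<Rightarrow> 'b::euclidean_space"
  assumes "elementary \<phi> S"
  shows "elementary (\<lambda>r \<omega>. - \<phi> r \<omega>) (\<lambda>\<omega>. - S \<omega>)"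
  using assms
proof induction
  case zero
  then show ?case using elementary.zero by simp
next
  case (step \<phi> S a b \<xi>)
  have "(\<lambda>\<omega>. - \<xi> \<omega>) \<in> borel_measurable (F a)" "bounded ((\<lambda>\<omega>. - \<xi> \<omega>) ` space M)"
    using step.hyps(5,6) by (auto simp: bounded_iff)
  from elementary.step[OF step.IH step.hyps(2-4) this]
  show ?case by simp
qed

lemma elementary_diff:
  fixes \<phi> :: "real \<Rightarrow> 'w \<Rightarrow> 'b::euclidean_space"
  assumes "elementary \<phi> S" "elementary \<psi> R"
  shows "elementary (\<lambda>r \<omega>. \<phi> r \<omega> - \<psi> r \<omega>) (\<lambda>\<omega>. S \<omega> - R \<omega>)"
  using elementary_add[OF assms(1) elementary_uminus[OF assms(2)]] by simp

lemma elementary_generator: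
  fixes \<xi> :: "'w \<Rightarrow> 'b::euclidean_space"
  assumes "0 \<le> a" "a \<le> b" "b \<le> T" "\<xi> \<in> borel_measurable (F a)" "bounded (\<xi> ` space M)"
  shows "elementary (\<lambda>r \<omega>. indicator {a<..b} r *\<^sub>R \<xi> \<omega>) (\<lambda>\<omega>. (W b \<omega> - W a \<omega>) *\<^sub>R \<xi> \<omega>)"
  using elementary.step[OF elementary.zero assms] by simp

text \<open>The second part allows time integrals over \<open>{0..t}\<close> to be replaced by integrals over the line.\<close>

lemma simple_ito_elementary:
  fixes \<phi> :: "real \<Rightarrow> 'w \<Rightarrow> real ^ 'n"
  assumes "simple_ito M F W t \<phi> S" and t: "t \<in> {0..T}"
  shows "elementary \<phi> S" "\<And>r \<omega>. r \<notin> {0..t} \<Longrightarrow> \<phi> r \<omega> = 0"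
proof -
  from assms obtain k :: nat and \<tau> :: "nat \<Rightarrow> real" and \<xi> :: "nat \<Rightarrow> 'w \<Rightarrow> real ^ 'n"
    where o: "0 \<le> \<tau> 0" "\<And>i. i < k \<Longrightarrow> \<tau> i \<le> \<tau> (Suc i)" "\<tau> k \<le> t"
      and \<xi>: "\<And>i. i < k \<Longrightarrow> \<xi> i \<in> borel_measurable (F (\<tau> i)) \<and> bounded (\<xi> i ` space M)"
      and \<phi>: "\<phi> = (\<lambda>r \<omega>. \<Sum>i<k. indicator {\<tau> i<..\<tau> (Suc i)} r *\<^sub>R \<xi> i \<omega>)"
      and S: "S = (\<lambda>\<omega>. \<Sum>i<k. (W (\<tau> (Suc i)) \<omega> - W (\<tau> i) \<omega>) *\<^sub>R \<xi> i \<omega>)"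
    unfolding simple_ito_def by blast
  have mono: "\<tau> i \<le> \<tau> j" if "i \<le> j" "j \<le> k" for i j
    using that by (induction j rule: dec_induct) (use o(2) in \<open>auto intro: order_trans\<close>)
  have lo: "0 \<le> \<tau> i" "\<tau> i \<le> t" if "i \<le> k" for i
    using mono[of 0 i] mono[of i k] o that by auto
  have "j \<le> k \<Longrightarrow> elementary (\<lambda>r \<omega>. \<Sum>i<j. indicator {\<tau> i<..\<tau> (Suc i)} r *\<^sub>R \<xi> i \<omega>)
     (\<lambda>\<omega>. \<Sum>i<j. (W (\<tau> (Suc i)) \<omega> - W (\<tau> i) \<omega>) *\<^sub>R \<xi> i \<omega>)" for j
  proof (induction j)
    case 0
    then show ?case using elementary.zero by simp
  next
    case (Suc j)
    then have "elementary (\<lambda>r \<omega>. (\<Sum>i<j. indicator {\<tau> i<..\<tau> (Suc i)} r *\<^sub>R \<xi> i \<omega>) + indicator {\<tau> j<..\<tau> (Suc j)} r *\<^sub>R \<xi> j \<omega>)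
      (\<lambda>\<omega>. (\<Sum>i<j. (W (\<tau> (Suc i)) \<omega> - W (\<tau> i) \<omega>) *\<^sub>R \<xi> i \<omega>) + (W (\<tau> (Suc j)) \<omega> - W (\<tau> j) \<omega>) *\<^sub>R \<xi> j \<omega>)"
      using lo[of j] lo[of "Suc j"] o(2)[of j] \<xi>[of j] t by (intro elementary.step) auto
    then show ?case by simp
  qed
  then show "elementary \<phi> S" unfolding \<phi> S by blast
  show "\<phi> r \<omega> = 0" if "r \<notin> {0..t}" for r \<omega>
    unfolding \<phi>
  proof (intro sum.neutral ballI)
    fix i assume "i \<in> {..<k}"
    then show "indicator {\<tau> i<..\<tau> (Suc i)} r *\<^sub>R \<xi> i \<omega> = 0"
      using lo[of i] lo[of "Suc i"] that by (auto simp: indicator_def)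
  qed
qed

lemma elementary_regular:
  fixes \<phi> :: "real \<Rightarrow> 'w \<Rightarrow> 'b::euclidean_space"
  assumes "elementary \<phi> S"
  shows "S \<in> borel_measurable M" "integrable M (\<lambda>\<omega>. (norm (S \<omega>))\<^sup>2)"
    "case_prod \<phi> \<in> borel_measurable (lborel \<Otimes>\<^sub>M M)"
    "\<exists>C\<ge>0. \<forall>r. \<forall>\<omega>\<in>space M. norm (\<phi> r \<omega>) \<le> C * indicator {0..T} r"
proof -
  have "S \<in> borel_measurable M \<and> integrable M (\<lambda>\<omega>. (norm (S \<omega>))\<^sup>2) \<and>
    case_prod \<phi> \<in> borel_measurable (lborel \<Otimes>\<^sub>M M) \<and>
    (\<exists>C\<ge>0. \<forall>r. \<forall>\<omega>\<in>space M. norm (\<phi> r \<omega>) \<le> C * indicator {0..T} r)"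
    using assms
  proof induction
    case zero
    then show ?case by auto
  next
    case (step \<phi> S a b \<xi>)
    from step.IH have [measurable]: "S \<in> borel_measurable M" "case_prod \<phi> \<in> borel_measurable (lborel \<Otimes>\<^sub>M M)"
      and iS: "integrable M (\<lambda>\<omega>. (norm (S \<omega>))\<^sup>2)" by auto
    from step.IH obtain C where C: "0 \<le> C" "\<And>r \<omega>. \<omega> \<in> space M \<Longrightarrow> norm (\<phi> r \<omega>) \<le> C * indicator {0..T} r" by auto
    from step.hyps(6) obtain D where D: "\<And>\<omega>. \<omega> \<in> space M \<Longrightarrow> norm (\<xi> \<omega>) \<le> D"
      by (auto simp: bounded_iff)
    have D0: "0 \<le> D" using D not_empty norm_ge_zero order_trans by blast
    have [measurable]: "\<xi> \<in> borel_measurable M"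
      using borel_measurable_F_M[OF step.hyps(5)] step.hyps by auto
    have [measurable]: "W a \<in> borel_measurable M" "W b \<in> borel_measurable M"
      using step.hyps measurable_W by auto
    have "integrable M (\<lambda>\<omega>. (norm (\<xi> \<omega>))\<^sup>2 * (W b \<omega> - W a \<omega>)\<^sup>2)"
      by (rule integrable_bounded_mult[where C = "D\<^sup>2"])
         (use D increment_integrals(3) step.hyps in \<open>auto intro: power_mono\<close>)
    then have "integrable M (\<lambda>\<omega>. (norm ((W b \<omega> - W a \<omega>) *\<^sub>R \<xi> \<omega>))\<^sup>2)"
      by (simp add: power_mult_distrib mult.commute)
    then have "integrable M (\<lambda>\<omega>. 2 * (norm (S \<omega>))\<^sup>2 + 2 * (norm ((W b \<omega> - W a \<omega>) *\<^sub>R \<xi> \<omega>))\<^sup>2)"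
      using iS by auto
    then have 1: "integrable M (\<lambda>\<omega>. (norm (S \<omega> + (W b \<omega> - W a \<omega>) *\<^sub>R \<xi> \<omega>))\<^sup>2)"
      by (rule Bochner_Integration.integrable_bound) (auto simp del: norm_scaleR intro!: AE_I2 order_trans[OF norm_add_sq])
    have 2: "norm (\<phi> r \<omega> + indicator {a<..b} r *\<^sub>R \<xi> \<omega>) \<le> (C + D) * indicator {0..T} r" if "\<omega> \<in> space M" for r \<omega>
    proof -
      have "norm (\<phi> r \<omega> + indicator {a<..b} r *\<^sub>R \<xi> \<omega>) \<le> norm (\<phi> r \<omega>) + indicator {a<..b} r * norm (\<xi> \<omega>)"
        by (rule order_trans[OF norm_triangle_ineq]) simp
      also have "\<dots> \<le> C * indicator {0..T} r + indicator {0..T} r * D"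
        using C(2)[OF that, of r] D[OF that] D0 step.hyps by (intro add_mono mult_mono) (auto simp: indicator_def)
      finally show ?thesis by (simp add: algebra_simps)
    qed
    have "case_prod (\<lambda>r \<omega>. \<phi> r \<omega> + indicator {a<..b} r *\<^sub>R \<xi> \<omega>) \<in> borel_measurable (lborel \<Otimes>\<^sub>M M)"
      by measurable
    moreover have "0 \<le> C + D" using C(1) D0 by simp
    ultimately show ?case using 1 2 by auto
  qed
  then show "S \<in> borel_measurable M" "integrable M (\<lambda>\<omega>. (norm (S \<omega>))\<^sup>2)"
    "case_prod \<phi> \<in> borel_measurable (lborel \<Otimes>\<^sub>M M)"
    "\<exists>C\<ge>0. \<forall>r. \<forall>\<omega>\<in>space M. norm (\<phi> r \<omega>) \<le> C * indicator {0..T} r" by auto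
qed

sublocale lborel_M: pair_sigma_finite lborel M
  by unfold_locales

lemma elementary_integrable_inner:
  fixes \<phi> \<psi> :: "real \<Rightarrow> 'w \<Rightarrow> 'b::euclidean_space"
  assumes \<phi>: "elementary \<phi> S" and \<psi>: "elementary \<psi> R"
  shows "integrable M (\<lambda>\<omega>. S \<omega> \<bullet> R \<omega>)"
    "integrable (lborel \<Otimes>\<^sub>M M) (\<lambda>(r, \<omega>). \<phi> r \<omega> \<bullet> \<psi> r \<omega>)"
proof -
  note [measurable] = elementary_regular(1,3)[OF \<phi>] elementary_regular(1,3)[OF \<psi>]
  have le: "\<bar>x \<bullet> y\<bar> \<le> (norm x)\<^sup>2 + (norm y)\<^sup>2" for x y :: 'b
  proof -
    have "\<bar>x \<bullet> y\<bar> \<le> norm x * norm y" by (rule Cauchy_Schwarz_ineq2)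
    also have "\<dots> \<le> (norm x)\<^sup>2 + (norm y)\<^sup>2"
      using sum_squares_bound[of "norm x" "norm y"] norm_ge_zero[of x] norm_ge_zero[of y]
        mult_nonneg_nonneg[OF norm_ge_zero[of x] norm_ge_zero[of y]] by linarith
    finally show ?thesis .
  qed
  have "integrable M (\<lambda>\<omega>. (norm (S \<omega>))\<^sup>2 + (norm (R \<omega>))\<^sup>2)"
    using elementary_regular(2)[OF \<phi>] elementary_regular(2)[OF \<psi>] by simp
  then show "integrable M (\<lambda>\<omega>. S \<omega> \<bullet> R \<omega>)"
    by (rule Bochner_Integration.integrable_bound) (auto simp: le)
  obtain C where C: "0 \<le> C" "\<And>r \<omega>. \<omega> \<in> space M \<Longrightarrow> norm (\<phi> r \<omega>) \<le> C * indicator {0..T} r"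
    using elementary_regular(4)[OF \<phi>] by auto
  obtain D where D: "0 \<le> D" "\<And>r \<omega>. \<omega> \<in> space M \<Longrightarrow> norm (\<psi> r \<omega>) \<le> D * indicator {0..T} r"
    using elementary_regular(4)[OF \<psi>] by auto
  have fin: "emeasure (lborel \<Otimes>\<^sub>M M) ({0..T} \<times> space M) < \<infinity>"
    by (subst emeasure_pair_measure_Times) (auto simp: emeasure_space_1 emeasure_lborel_Icc_eq)
  have "integrable (lborel \<Otimes>\<^sub>M M) (\<lambda>x. (C * D) * indicator ({0..T} \<times> space M) x)"
    by (intro integrable_mult_right integrable_real_indicator fin) auto
  then show "integrable (lborel \<Otimes>\<^sub>M M) (\<lambda>(r, \<omega>). \<phi> r \<omega> \<bullet> \<psi> r \<omega>)"
  proof (rule Bochner_Integration.integrable_bound)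
    show "AE x in lborel \<Otimes>\<^sub>M M. norm (case x of (r, \<omega>) \<Rightarrow> \<phi> r \<omega> \<bullet> \<psi> r \<omega>)
        \<le> norm (C * D * indicator ({0..T} \<times> space M) x)"
    proof (rule AE_I2)
      fix x :: "real \<times> 'w" assume "x \<in> space (lborel \<Otimes>\<^sub>M M)"
      then obtain r \<omega> where x: "x = (r, \<omega>)" "\<omega> \<in> space M" by (auto simp: space_pair_measure)
      have "\<bar>\<phi> r \<omega> \<bullet> \<psi> r \<omega>\<bar> \<le> norm (\<phi> r \<omega>) * norm (\<psi> r \<omega>)" by (rule Cauchy_Schwarz_ineq2)
      also have "\<dots> \<le> (C * indicator {0..T} r) * (D * indicator {0..T} r)"
        using C D x by (intro mult_mono) auto
      also have "\<dots> = C * D * indicator {0..T} r" by (auto simp: indicator_def)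
      finally show "norm (case x of (r, \<omega>) \<Rightarrow> \<phi> r \<omega> \<bullet> \<psi> r \<omega>)
        \<le> norm (C * D * indicator ({0..T} \<times> space M) x)"
        using x C D by (simp add: indicator_def)
    qed
  qed auto
qed

text \<open>Both sides are the length of the overlap of the intervals times the mean of \<open>\<xi> \<bullet> \<zeta>\<close>.\<close>

lemma generator_cross:
  fixes \<xi> \<zeta> :: "'w \<Rightarrow> 'b::euclidean_space"
  assumes \<xi>: "\<xi> \<in> borel_measurable (F a)" "bounded (\<xi> ` space M)"
    and \<zeta>: "\<zeta> \<in> borel_measurable (F c)" "bounded (\<zeta> ` space M)"
    and o: "0 \<le> a" "a \<le> b" "b \<le> T" "0 \<le> c" "c \<le> d" "d \<le> T"
  shows "(\<integral>\<omega>. ((W b \<omega> - W a \<omega>) *\<^sub>R \<xi> \<omega>) \<bullet> ((W d \<omega> - W c \<omega>) *\<^sub>R \<zeta> \<omega>) \<partial>M) =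
    (\<integral>(r, \<omega>). (indicator {a<..b} r *\<^sub>R \<xi> \<omega>) \<bullet> (indicator {c<..d} r *\<^sub>R \<zeta> \<omega>) \<partial>(lborel \<Otimes>\<^sub>M M))"
proof -
  have "(\<integral>(r, \<omega>). (indicator {a<..b} r *\<^sub>R \<xi> \<omega>) \<bullet> (indicator {c<..d} r *\<^sub>R \<zeta> \<omega>) \<partial>(lborel \<Otimes>\<^sub>M M)) =
    (\<integral>r. (\<integral>\<omega>. (indicator {a<..b} r *\<^sub>R \<xi> \<omega>) \<bullet> (indicator {c<..d} r *\<^sub>R \<zeta> \<omega>) \<partial>M) \<partial>lborel)"
    by (rule lborel_M.integral_fst[symmetric, OF elementary_integrable_inner(2)])
       (use assms in \<open>auto intro!: elementary_generator\<close>)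
  also have "\<dots> = (\<integral>r. (\<integral>\<omega>. \<xi> \<omega> \<bullet> \<zeta> \<omega> \<partial>M) * indicator {max a c<..min b d} r \<partial>lborel)"
    by (intro Bochner_Integration.integral_cong refl) (auto simp: indicator_def)
  also have "\<dots> = (\<integral>\<omega>. \<xi> \<omega> \<bullet> \<zeta> \<omega> \<partial>M) * measure lborel {max a c<..min b d}"
    by simp
  also have "measure lborel {max a c<..min b d} = max 0 (min b d - max a c)"
    by (cases "max a c \<le> min b d") auto
  finally show ?thesis
    using increment_cross[OF assms] by (auto simp: has_bochner_integral_iff mult_ac)
qed

text \<open>Both sides are bilinear, so two inductions reduce the claim to a pair of generators.\<close>

lemma elementary_cross:
  fixes \<phi> \<psi> :: "real \<Rightarrow> 'w \<Rightarrow> 'b::euclidean_space"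
  assumes \<phi>: "elementary \<phi> S" and \<psi>: "elementary \<psi> R"
  shows "(\<integral>\<omega>. S \<omega> \<bullet> R \<omega> \<partial>M) = (\<integral>(r, \<omega>). \<phi> r \<omega> \<bullet> \<psi> r \<omega> \<partial>(lborel \<Otimes>\<^sub>M M))"
proof -
  have lin: "(\<integral>\<omega>. (S \<omega> + S' \<omega>) \<bullet> R \<omega> \<partial>M) = (\<integral>(r, \<omega>). (\<phi> r \<omega> + \<phi>' r \<omega>) \<bullet> \<psi> r \<omega> \<partial>(lborel \<Otimes>\<^sub>M M))"
    if "elementary \<phi> S" "elementary \<phi>' S'" "elementary \<psi> R"
      "(\<integral>\<omega>. S \<omega> \<bullet> R \<omega> \<partial>M) = (\<integral>(r, \<omega>). \<phi> r \<omega> \<bullet> \<psi> r \<omega> \<partial>(lborel \<Otimes>\<^sub>M M))"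
      "(\<integral>\<omega>. S' \<omega> \<bullet> R \<omega> \<partial>M) = (\<integral>(r, \<omega>). \<phi>' r \<omega> \<bullet> \<psi> r \<omega> \<partial>(lborel \<Otimes>\<^sub>M M))"
    for \<phi> \<phi>' \<psi> :: "real \<Rightarrow> 'w \<Rightarrow> 'b" and S S' R
    using that(4,5) elementary_integrable_inner[OF that(1,3)] elementary_integrable_inner[OF that(2,3)]
    by (simp add: inner_add_left split_beta')
  have gen: "(\<integral>\<omega>. ((W b \<omega> - W a \<omega>) *\<^sub>R \<xi> \<omega>) \<bullet> R \<omega> \<partial>M) =
      (\<integral>(r, \<omega>). (indicator {a<..b} r *\<^sub>R \<xi> \<omega>) \<bullet> \<psi> r \<omega> \<partial>(lborel \<Otimes>\<^sub>M M))"
    if g: "0 \<le> a" "a \<le> b" "b \<le> T" "\<xi> \<in> borel_measurable (F a)" "bounded (\<xi> ` space M)" for a b \<xi>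
    using \<psi>
  proof induction
    case zero
    then show ?case by simp
  next
    case (step \<psi> R c d \<zeta>)
    have "(\<integral>\<omega>. (R \<omega> + (W d \<omega> - W c \<omega>) *\<^sub>R \<zeta> \<omega>) \<bullet> ((W b \<omega> - W a \<omega>) *\<^sub>R \<xi> \<omega>) \<partial>M) =
      (\<integral>(r, \<omega>). (\<psi> r \<omega> + indicator {c<..d} r *\<^sub>R \<zeta> \<omega>) \<bullet> (indicator {a<..b} r *\<^sub>R \<xi> \<omega>) \<partial>(lborel \<Otimes>\<^sub>M M))"
    proof (rule lin)
      show "elementary \<psi> R" by fact
      show "elementary (\<lambda>r \<omega>. indicator {c<..d} r *\<^sub>R \<zeta> \<omega>) (\<lambda>\<omega>. (W d \<omega> - W c \<omega>) *\<^sub>R \<zeta> \<omega>)"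
        by (rule elementary_generator; fact)
      show "elementary (\<lambda>r \<omega>. indicator {a<..b} r *\<^sub>R \<xi> \<omega>) (\<lambda>\<omega>. (W b \<omega> - W a \<omega>) *\<^sub>R \<xi> \<omega>)"
        by (rule elementary_generator; fact)
      show "(\<integral>\<omega>. R \<omega> \<bullet> ((W b \<omega> - W a \<omega>) *\<^sub>R \<xi> \<omega>) \<partial>M) =
        (\<integral>(r, \<omega>). \<psi> r \<omega> \<bullet> (indicator {a<..b} r *\<^sub>R \<xi> \<omega>) \<partial>(lborel \<Otimes>\<^sub>M M))"
        using step.IH by (simp add: inner_commute)
    qed (rule generator_cross; fact)
    then show ?case by (simp add: inner_commute)
  qed
  show ?thesis
    using \<phi>
  proof induction
    case zero
    then show ?case by simp
  next
    case (step \<phi> S a b \<xi>)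
    show ?case
      by (rule lin[OF step.hyps(1) elementary_generator[OF step.hyps(2-6)] \<psi> step.IH gen[OF step.hyps(2-6)]])
  qed
qed

text \<open>The Ito isometry is the diagonal case of \<open>elementary_cross\<close>.\<close>

theorem elementary_isometry:
  fixes \<phi> :: "real \<Rightarrow> 'w \<Rightarrow> 'b::euclidean_space"
  assumes "elementary \<phi> S"
  shows "sqn M S = sqn (lborel \<Otimes>\<^sub>M M) (case_prod \<phi>)"
proof -
  have "sqn M S = ennreal (\<integral>\<omega>. S \<omega> \<bullet> S \<omega> \<partial>M)"
    unfolding sqn_def power2_norm_eq_inner
    by (rule nn_integral_eq_integral[OF elementary_integrable_inner(1)[OF assms assms]]) auto
  also have "\<dots> = ennreal (\<integral>x. case_prod \<phi> x \<bullet> case_prod \<phi> x \<partial>(lborel \<Otimes>\<^sub>M M))"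
    unfolding elementary_cross[OF assms assms] by (simp add: split_beta')
  also have "\<dots> = sqn (lborel \<Otimes>\<^sub>M M) (case_prod \<phi>)"
    unfolding sqn_def power2_norm_eq_inner
    using elementary_integrable_inner(2)[OF assms assms]
    by (intro nn_integral_eq_integral[symmetric]) (auto simp: split_beta')
  finally show ?thesis .
qed

end

text \<open>The exponential function lies below its chord between \<open>- c x\<close> and \<open>c x\<close>. The bound is affine in \<open>y\<close>,
  which may therefore be random when the mean is taken.\<close>

lemma exp_le_chord:
  fixes y c x :: real
  assumes "\<bar>y\<bar> \<le> 1"
  shows "exp (y * c * x) \<le> (1 + y) / 2 * exp (c * x) + (1 - y) / 2 * exp (- c * x)"
proof -
  have "exp ((1 - (1 + y) / 2) *\<^sub>R (- c * x) + ((1 + y) / 2) *\<^sub>R (c * x))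
      \<le> (1 - (1 + y) / 2) * exp (- c * x) + (1 + y) / 2 * exp (c * x)"
    by (rule convex_onD[OF exp_convex]) (use assms in auto)
  moreover have "(1 - (1 + y) / 2) *\<^sub>R (- c * x) + ((1 + y) / 2) *\<^sub>R (c * x) = y * c * x"
    by (simp add: field_simps)
  moreover have "1 - (1 + y) / 2 = (1 - y) / 2" by (simp add: field_simps)
  ultimately show ?thesis by simp
qed

context brownian_basis
begin

section \<open>Limits of elementary integrals\<close>

text \<open>Integrals over all of \<open>{0..T}\<close> of integrands extended by zero. This is a linear relation between
  integrand and value, without the adaptedness that \<open>has_ito_integral\<close> adds; it carries the bounds
  and the uniqueness.\<close>

definition ito :: "(real \<Rightarrow> 'w \<Rightarrow> 'b::euclidean_space) \<Rightarrow> ('w \<Rightarrow> 'b) \<Rightarrow> bool" where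
  "ito f I \<longleftrightarrow>
     case_prod f \<in> borel_measurable (lborel \<Otimes>\<^sub>M M) \<and> I \<in> borel_measurable M \<and>
     (\<exists>\<phi> S. (\<forall>m::nat. elementary (\<phi> m) (S m)) \<and>
        (\<lambda>m. sqn (lborel \<Otimes>\<^sub>M M) (\<lambda>(r, \<omega>). f r \<omega> - \<phi> m r \<omega>)) \<longlonglongrightarrow> 0 \<and>
        (\<lambda>m. sqn M (\<lambda>\<omega>. I \<omega> - S m \<omega>)) \<longlonglongrightarrow> 0)"

lemma ito_measurable: "ito f I \<Longrightarrow> case_prod f \<in> borel_measurable (lborel \<Otimes>\<^sub>M M)"
    "ito f I \<Longrightarrow> I \<in> borel_measurable M"
  by (auto simp: ito_def)

lemma ito_diff:
  fixes f g :: "real \<Rightarrow> 'w \<Rightarrow> 'b::euclidean_space"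
  assumes f: "ito f I" and g: "ito g J"
  shows "ito (\<lambda>r \<omega>. f r \<omega> - g r \<omega>) (\<lambda>\<omega>. I \<omega> - J \<omega>)"
proof -
  note [measurable] = ito_measurable[OF f] ito_measurable[OF g]
  from f obtain \<phi> S where \<phi>: "\<And>m::nat. elementary (\<phi> m) (S m)"
    "(\<lambda>m. sqn (lborel \<Otimes>\<^sub>M M) (\<lambda>(r, \<omega>). f r \<omega> - \<phi> m r \<omega>)) \<longlonglongrightarrow> 0"
    "(\<lambda>m. sqn M (\<lambda>\<omega>. I \<omega> - S m \<omega>)) \<longlonglongrightarrow> 0" unfolding ito_def by blast
  from g obtain \<psi> R where \<psi>: "\<And>m::nat. elementary (\<psi> m) (R m)"
    "(\<lambda>m. sqn (lborel \<Otimes>\<^sub>M M) (\<lambda>(r, \<omega>). g r \<omega> - \<psi> m r \<omega>)) \<longlonglongrightarrow> 0"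
    "(\<lambda>m. sqn M (\<lambda>\<omega>. J \<omega> - R m \<omega>)) \<longlonglongrightarrow> 0" unfolding ito_def by blast
  note [measurable] = elementary_regular(1,3)[OF \<phi>(1)] elementary_regular(1,3)[OF \<psi>(1)]
  have lim: "(\<lambda>m. 2 * x m + 2 * y m) \<longlonglongrightarrow> 0" if "x \<longlonglongrightarrow> 0" "y \<longlonglongrightarrow> 0" for x y :: "nat \<Rightarrow> ennreal"
    using tendsto_add[OF ennreal_tendsto_cmult[OF _ that(1), of 2] ennreal_tendsto_cmult[OF _ that(2), of 2]] by simp
  have le1: "sqn (lborel \<Otimes>\<^sub>M M) (\<lambda>(r, \<omega>). (f r \<omega> - g r \<omega>) - (\<phi> m r \<omega> - \<psi> m r \<omega>))
     \<le> 2 * sqn (lborel \<Otimes>\<^sub>M M) (\<lambda>(r, \<omega>). f r \<omega> - \<phi> m r \<omega>) + 2 * sqn (lborel \<Otimes>\<^sub>M M) (\<lambda>(r, \<omega>). g r \<omega> - \<psi> m r \<omega>)" for m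
    using sqn_diff[of "\<lambda>(r, \<omega>). f r \<omega> - \<phi> m r \<omega>" "lborel \<Otimes>\<^sub>M M" "\<lambda>(r, \<omega>). g r \<omega> - \<psi> m r \<omega>"]
    by (simp add: split_beta' algebra_simps)
  have le2: "sqn M (\<lambda>\<omega>. (I \<omega> - J \<omega>) - (S m \<omega> - R m \<omega>)) \<le> 2 * sqn M (\<lambda>\<omega>. I \<omega> - S m \<omega>) + 2 * sqn M (\<lambda>\<omega>. J \<omega> - R m \<omega>)" for m
    using sqn_diff[of "\<lambda>\<omega>. I \<omega> - S m \<omega>" M "\<lambda>\<omega>. J \<omega> - R m \<omega>"] by (simp add: algebra_simps)
  have "(\<lambda>m. sqn (lborel \<Otimes>\<^sub>M M) (\<lambda>(r, \<omega>). (f r \<omega> - g r \<omega>) - (\<phi> m r \<omega> - \<psi> m r \<omega>))) \<longlonglongrightarrow> 0"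
    by (rule tendsto_sandwich[OF _ _ tendsto_const lim[OF \<phi>(2) \<psi>(2)]]) (use le1 in auto)
  moreover have "(\<lambda>m. sqn M (\<lambda>\<omega>. (I \<omega> - J \<omega>) - (S m \<omega> - R m \<omega>))) \<longlonglongrightarrow> 0"
    by (rule tendsto_sandwich[OF _ _ tendsto_const lim[OF \<phi>(3) \<psi>(3)]]) (use le2 in auto)
  ultimately show ?thesis
    unfolding ito_def using elementary_diff[OF \<phi>(1) \<psi>(1)]
    by (intro conjI exI[of _ "\<lambda>m r \<omega>. \<phi> m r \<omega> - \<psi> m r \<omega>"] exI[of _ "\<lambda>m \<omega>. S m \<omega> - R m \<omega>"]) auto
qed

text \<open>The factor 4 comes from applying \<open>\<bar>x + y\<bar>\<^sup>2 \<le> 2 \<bar>x\<bar>\<^sup>2 + 2 \<bar>y\<bar>\<^sup>2\<close> twice to the isometry of the approximating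
  processes; this stays within extended nonnegative reals, and any constant serves the contraction
  argument.\<close>

lemma ito_bound:
  fixes f :: "real \<Rightarrow> 'w \<Rightarrow> 'b::euclidean_space"
  assumes f: "ito f I"
  shows "sqn M I \<le> 4 * sqn (lborel \<Otimes>\<^sub>M M) (case_prod f)"
proof -
  note [measurable] = ito_measurable[OF f]
  from f obtain \<phi> S where \<phi>: "\<And>m::nat. elementary (\<phi> m) (S m)"
    "(\<lambda>m. sqn (lborel \<Otimes>\<^sub>M M) (\<lambda>(r, \<omega>). f r \<omega> - \<phi> m r \<omega>)) \<longlonglongrightarrow> 0"
    "(\<lambda>m. sqn M (\<lambda>\<omega>. I \<omega> - S m \<omega>)) \<longlonglongrightarrow> 0" unfolding ito_def by blast
  note [measurable] = elementary_regular(1,3)[OF \<phi>(1)]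
  have "sqn M I \<le> 2 * (2 * sqn (lborel \<Otimes>\<^sub>M M) (case_prod f) +
      2 * sqn (lborel \<Otimes>\<^sub>M M) (\<lambda>(r, \<omega>). f r \<omega> - \<phi> m r \<omega>)) + 2 * sqn M (\<lambda>\<omega>. I \<omega> - S m \<omega>)" for m
  proof -
    have 1: "sqn M I \<le> 2 * sqn M (S m) + 2 * sqn M (\<lambda>\<omega>. I \<omega> - S m \<omega>)"
      using sqn_add[of "S m" M "\<lambda>\<omega>. I \<omega> - S m \<omega>"] by simp
    have 2: "sqn M (S m) \<le> 2 * sqn (lborel \<Otimes>\<^sub>M M) (case_prod f) + 2 * sqn (lborel \<Otimes>\<^sub>M M) (\<lambda>(r, \<omega>). f r \<omega> - \<phi> m r \<omega>)"
      unfolding elementary_isometry[OF \<phi>(1)]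
      using sqn_diff[of "case_prod f" "lborel \<Otimes>\<^sub>M M" "\<lambda>(r, \<omega>). f r \<omega> - \<phi> m r \<omega>"]
      by (simp add: split_beta')
    show ?thesis
      by (rule order_trans[OF 1]) (intro add_right_mono mult_left_mono 2, simp)
  qed
  moreover have "(\<lambda>m. 2 * (2 * sqn (lborel \<Otimes>\<^sub>M M) (case_prod f) +
      2 * sqn (lborel \<Otimes>\<^sub>M M) (\<lambda>(r, \<omega>). f r \<omega> - \<phi> m r \<omega>)) + 2 * sqn M (\<lambda>\<omega>. I \<omega> - S m \<omega>))
    \<longlonglongrightarrow> 2 * (2 * sqn (lborel \<Otimes>\<^sub>M M) (case_prod f) + 2 * 0) + 2 * 0"
    by (intro tendsto_add ennreal_tendsto_cmult tendsto_const \<phi>) auto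
  ultimately have "sqn M I \<le> 2 * (2 * sqn (lborel \<Otimes>\<^sub>M M) (case_prod f) + 2 * 0) + 2 * 0"
    by (intro LIMSEQ_le_const) auto
  then show ?thesis by (simp add: mult.assoc[symmetric])
qed

lemma ito_unique:
  fixes f :: "real \<Rightarrow> 'w \<Rightarrow> 'b::euclidean_space"
  assumes "ito f I" "ito g J" "AE x in lborel \<Otimes>\<^sub>M M. case_prod f x = case_prod g x"
  shows "AE \<omega> in M. I \<omega> = J \<omega>"
proof -
  note [measurable] = ito_measurable[OF assms(1)] ito_measurable[OF assms(2)]
  have "sqn M (\<lambda>\<omega>. I \<omega> - J \<omega>) \<le> 4 * sqn (lborel \<Otimes>\<^sub>M M) (case_prod (\<lambda>r \<omega>. f r \<omega> - g r \<omega>))"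
    by (rule ito_bound[OF ito_diff[OF assms(1,2)]])
  also have "sqn (lborel \<Otimes>\<^sub>M M) (case_prod (\<lambda>r \<omega>. f r \<omega> - g r \<omega>)) = 0"
    using assms(3) by (subst sqn_eq_0_iff) (auto simp: split_beta')
  finally have "sqn M (\<lambda>\<omega>. I \<omega> - J \<omega>) = 0" by simp
  moreover have "(\<lambda>\<omega>. I \<omega> - J \<omega>) \<in> borel_measurable M" by measurable
  ultimately have "AE \<omega> in M. I \<omega> - J \<omega> = 0" by (simp only: sqn_eq_0_iff)
  then show ?thesis by eventually_elim simp
qed

lemma measurable_lborel_pair: "measurable (lborel \<Otimes>\<^sub>M M) N = measurable (borel \<Otimes>\<^sub>M M) N"
  by (rule measurable_cong_sets[OF sets_pair_measure_cong[OF sets_lborel refl] refl])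

lemma nn_integral_pair_indicator:
  fixes g :: "real \<Rightarrow> 'w \<Rightarrow> 'b::euclidean_space"
  assumes "(\<lambda>(r, \<omega>). indicator S r *\<^sub>R g r \<omega>) \<in> borel_measurable (lborel \<Otimes>\<^sub>M M)"
  shows "sqn (lborel \<Otimes>\<^sub>M M) (\<lambda>(r, \<omega>). indicator S r *\<^sub>R g r \<omega>) =
    (\<integral>\<^sup>+\<omega>. (\<integral>\<^sup>+r\<in>S. ennreal ((norm (g r \<omega>))\<^sup>2) \<partial>lborel) \<partial>M)"
proof -
  have m: "(\<lambda>(r, \<omega>). ennreal ((norm (indicator S r *\<^sub>R g r \<omega>))\<^sup>2)) \<in> borel_measurable (lborel \<Otimes>\<^sub>M M)"
    using measurable_compose[OF borel_measurable_power[OF measurable_compose[OF assms borel_measurable_norm], of 2] measurable_ennreal]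
    by (simp add: split_beta')
  have "sqn (lborel \<Otimes>\<^sub>M M) (\<lambda>(r, \<omega>). indicator S r *\<^sub>R g r \<omega>) =
    (\<integral>\<^sup>+(r, \<omega>). ennreal ((norm (indicator S r *\<^sub>R g r \<omega>))\<^sup>2) \<partial>(lborel \<Otimes>\<^sub>M M))"
    unfolding sqn_def by (simp add: split_beta')
  also have "\<dots> = (\<integral>\<^sup>+\<omega>. (\<integral>\<^sup>+r. ennreal ((norm (indicator S r *\<^sub>R g r \<omega>))\<^sup>2) \<partial>lborel) \<partial>M)"
    by (subst lborel_M.nn_integral_snd[OF m, symmetric]) (simp only: prod.case)
  also have "\<dots> = (\<integral>\<^sup>+\<omega>. (\<integral>\<^sup>+r\<in>S. ennreal ((norm (g r \<omega>))\<^sup>2) \<partial>lborel) \<partial>M)"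
    by (intro nn_integral_cong) (auto simp: indicator_def)
  finally show ?thesis .
qed

text \<open>Simple processes over \<open>{0..t}\<close> vanish elsewhere, so they approximate the extension of \<open>f\<close> by zero
  equally well.\<close>

lemma has_ito_integral_imp_ito:
  fixes f :: "real \<Rightarrow> 'w \<Rightarrow> real ^ 'n"
  assumes f: "has_ito_integral M F W t f I" and t: "t \<in> {0..T}"
  shows "ito (\<lambda>r \<omega>. indicator {0..t} r *\<^sub>R f r \<omega>) I"
proof -
  note f' = f[unfolded has_ito_integral_def]
  from f'[THEN conjunct2, THEN conjunct2, THEN conjunct2, THEN conjunct2]
  obtain \<phi> S where 1: "\<And>m::nat. simple_ito M F W t (\<phi> m) (S m)"
    and 2: "(\<lambda>m. \<integral>\<^sup>+\<omega>. (\<integral>\<^sup>+r\<in>{0..t}. ennreal ((norm (f r \<omega> - \<phi> m r \<omega>))\<^sup>2) \<partial>lborel) \<partial>M) \<longlonglongrightarrow> 0"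
    and 3: "(\<lambda>m. \<integral>\<^sup>+\<omega>. ennreal ((norm (I \<omega> - S m \<omega>))\<^sup>2) \<partial>M) \<longlonglongrightarrow> 0"
    by (elim exE conjE) (rule that; simp)
  have m: "(\<lambda>(r, \<omega>). indicator {0..t} r *\<^sub>R f r \<omega>) \<in> borel_measurable (lborel \<Otimes>\<^sub>M M)"
    unfolding measurable_lborel_pair
    by (rule measurable_pair_restrict_iff[THEN iffD1, OF _ f'[THEN conjunct1]]) simp
  have IM: "I \<in> borel_measurable M"
    using f'[THEN conjunct2, THEN conjunct2, THEN conjunct2, THEN conjunct1]
    by (intro borel_measurable_F_M[OF _ t]) (simp add: Xi_def)
  note el = simple_ito_elementary[OF 1 t]
  note [measurable] = elementary_regular(1,3)[OF el(1)]
  have eq: "(\<lambda>(r, \<omega>). indicator {0..t} r *\<^sub>R f r \<omega> - \<phi> m r \<omega>) = (\<lambda>(r, \<omega>). indicator {0..t} r *\<^sub>R (f r \<omega> - \<phi> m r \<omega>))" for m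
  proof (intro ext, clarify)
    fix r \<omega>
    show "indicator {0..t} r *\<^sub>R f r \<omega> - \<phi> m r \<omega> = indicator {0..t} r *\<^sub>R (f r \<omega> - \<phi> m r \<omega>)"
      using el(2)[of r m \<omega>] by (cases "r \<in> {0..t}") auto
  qed
  have "(\<lambda>(r, \<omega>). indicator {0..t} r *\<^sub>R f r \<omega> - \<phi> m r \<omega>) \<in> borel_measurable (lborel \<Otimes>\<^sub>M M)" for m
    using borel_measurable_diff[OF m elementary_regular(3)[OF el(1)]] by (simp add: split_beta')
  then have "sqn (lborel \<Otimes>\<^sub>M M) (\<lambda>(r, \<omega>). indicator {0..t} r *\<^sub>R f r \<omega> - \<phi> m r \<omega>) =
    (\<integral>\<^sup>+\<omega>. (\<integral>\<^sup>+r\<in>{0..t}. ennreal ((norm (f r \<omega> - \<phi> m r \<omega>))\<^sup>2) \<partial>lborel) \<partial>M)" for m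
    unfolding eq by (rule nn_integral_pair_indicator)
  then show ?thesis
    unfolding ito_def using m IM el(1) 2 3
    by (intro conjI exI[of _ \<phi>] exI[of _ S]) (simp_all add: sqn_def)
qed

section \<open>Exponential moments\<close>

text \<open>Deterministic bounds on the coefficients make the integral sub-Gaussian. In the step from \<open>j\<close> to
  \<open>j + 1\<close> the last increment \<open>D\<close> is Gaussian and independent of the past. By \<open>exp_le_chord\<close> with
  \<open>y = \<xi> j / c j\<close>, the factor \<open>exp (D \<cdot> \<xi> j)\<close> is at most a combination of \<open>exp (c j \<cdot> D)\<close> and
  \<open>exp (- c j \<cdot> D)\<close> with coefficients depending only on the past. These two variables have the same
  mean, so the terms containing \<open>y\<close> cancel.\<close>

lemma simple_exponential_bound:
  fixes \<tau> c :: "nat \<Rightarrow> real" and \<xi> :: "nat \<Rightarrow> 'w \<Rightarrow> real"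
  assumes \<tau>: "0 \<le> \<tau> 0" "\<And>i. i < k \<Longrightarrow> \<tau> i \<le> \<tau> (Suc i)" "\<tau> k \<le> T"
    and \<xi>: "\<And>i. i < k \<Longrightarrow> \<xi> i \<in> borel_measurable (F (\<tau> i))"
    and c: "\<And>i \<omega>. i < k \<Longrightarrow> \<omega> \<in> space M \<Longrightarrow> \<bar>\<xi> i \<omega>\<bar> \<le> c i"
  shows "(\<integral>\<^sup>+\<omega>. ennreal (exp (\<Sum>i<k. (W (\<tau> (Suc i)) \<omega> - W (\<tau> i) \<omega>) * \<xi> i \<omega>)) \<partial>M)
    \<le> ennreal (exp ((\<Sum>i<k. (c i)\<^sup>2 * (\<tau> (Suc i) - \<tau> i)) / 2))"
proof -
  have mono: "\<tau> i \<le> \<tau> j" if "i \<le> j" "j \<le> k" for i j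
    using that by (induction j rule: dec_induct) (use \<tau>(2) in \<open>auto intro: order_trans\<close>)
  have lo: "0 \<le> \<tau> i" "\<tau> i \<le> T" if "i \<le> k" for i
    using mono[of 0 i] mono[of i k] \<tau> that by auto
  have "j \<le> k \<Longrightarrow>
    (\<lambda>\<omega>. exp (\<Sum>i<j. (W (\<tau> (Suc i)) \<omega> - W (\<tau> i) \<omega>) * \<xi> i \<omega>)) \<in> borel_measurable (F (\<tau> j)) \<and>
    integrable M (\<lambda>\<omega>. exp (\<Sum>i<j. (W (\<tau> (Suc i)) \<omega> - W (\<tau> i) \<omega>) * \<xi> i \<omega>)) \<and>
    (\<integral>\<omega>. exp (\<Sum>i<j. (W (\<tau> (Suc i)) \<omega> - W (\<tau> i) \<omega>) * \<xi> i \<omega>) \<partial>M)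
      \<le> exp ((\<Sum>i<j. (c i)\<^sup>2 * (\<tau> (Suc i) - \<tau> i)) / 2)" for j
  proof (induction j)
    case 0
    then show ?case by (simp add: prob_space)
  next
    case (Suc j)
    define U where "U = (\<lambda>\<omega>. exp (\<Sum>i<j. (W (\<tau> (Suc i)) \<omega> - W (\<tau> i) \<omega>) * \<xi> i \<omega>))"
    define V where "V = (\<lambda>\<omega>. U \<omega> * (\<xi> j \<omega> / c j))"
    define D where "D = (\<lambda>\<omega>. W (\<tau> (Suc j)) \<omega> - W (\<tau> j) \<omega>)"
    define v where "v = (c j)\<^sup>2 * (\<tau> (Suc j) - \<tau> j) / 2"
    from Suc have IH: "U \<in> borel_measurable (F (\<tau> j))" "integrable M U"
      "(\<integral>\<omega>. U \<omega> \<partial>M) \<le> exp ((\<Sum>i<j. (c i)\<^sup>2 * (\<tau> (Suc i) - \<tau> i)) / 2)" by (auto simp: U_def)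
    have j: "j < k" using Suc by simp
    have j_lo: "0 \<le> \<tau> j" "\<tau> j \<le> \<tau> (Suc j)" "\<tau> (Suc j) \<le> T"
      using lo[of j] lo[of "Suc j"] \<tau>(2)[of j] Suc by auto
    note [measurable] = IH(1) \<xi>[OF j]
    have UM: "U \<in> borel_measurable M" "\<xi> j \<in> borel_measurable M"
      using borel_measurable_F_M[OF IH(1)] borel_measurable_F_M[OF \<xi>[OF j]] j_lo by auto
    \<comment> \<open>If \<open>c j = 0\<close> then \<open>\<xi> j = 0\<close>, so that the division by zero does no harm.\<close>
    have y: "\<bar>\<xi> j \<omega> / c j\<bar> \<le> 1" "\<xi> j \<omega> / c j * c j = \<xi> j \<omega>" if "\<omega> \<in> space M" for \<omega>
      using c[OF j that] by (auto simp: abs_div_pos divide_le_eq_1)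
    have VF: "V \<in> borel_measurable (F (\<tau> j))" unfolding V_def by measurable
    have VI: "integrable M V"
      using integrable_bounded_mult[of "\<lambda>\<omega>. \<xi> j \<omega> / c j" 1 U] UM y(1) IH(2)
      unfolding V_def by (simp add: mult.commute)
    have Ie: "integrable M (\<lambda>\<omega>. exp (l * D \<omega>))" "(\<integral>\<omega>. exp (l * D \<omega>) \<partial>M) = exp (l\<^sup>2 * (\<tau> (Suc j) - \<tau> j) / 2)" for l
      unfolding D_def by (rule increment_integrals; fact)+
    have prod: "has_bochner_integral M (\<lambda>\<omega>. X \<omega> * exp (l * D \<omega>)) ((\<integral>\<omega>. X \<omega> \<partial>M) * exp (l\<^sup>2 * (\<tau> (Suc j) - \<tau> j) / 2))"
      if X: "X \<in> borel_measurable (F (\<tau> j))" "integrable M X" for X l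
    proof (cases "\<tau> j = \<tau> (Suc j)")
      case True
      then show ?thesis using X by (simp add: D_def has_bochner_integral_iff)
    next
      case False
      then show ?thesis
        using increment_mult[OF X, of "\<tau> (Suc j)" "\<lambda>x. exp (l * x)"] Ie[of l] j_lo
        by (auto simp: has_bochner_integral_iff D_def)
    qed
    have p: "has_bochner_integral M (\<lambda>\<omega>. X \<omega> * exp (c j * D \<omega>)) ((\<integral>\<omega>. X \<omega> \<partial>M) * exp v)"
      "has_bochner_integral M (\<lambda>\<omega>. X \<omega> * exp (- c j * D \<omega>)) ((\<integral>\<omega>. X \<omega> \<partial>M) * exp v)"
      if X: "X \<in> borel_measurable (F (\<tau> j))" "integrable M X" for X
      using prod[OF X, of "c j"] prod[OF X, of "- c j"] by (auto simp: v_def)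
    \<comment> \<open>The chord bound times \<open>U\<close>. The part containing \<open>V\<close> has mean zero.\<close>
    define R where "R = (\<lambda>\<omega>. (U \<omega> * exp (c j * D \<omega>) + U \<omega> * exp (- c j * D \<omega>)) / 2
        + (V \<omega> * exp (c j * D \<omega>) - V \<omega> * exp (- c j * D \<omega>)) / 2)"
    have R: "has_bochner_integral M R ((\<integral>\<omega>. U \<omega> \<partial>M) * exp v)"
    proof -
      have "has_bochner_integral M R ((((\<integral>\<omega>. U \<omega> \<partial>M) * exp v) + ((\<integral>\<omega>. U \<omega> \<partial>M) * exp v)) / 2
         + (((\<integral>\<omega>. V \<omega> \<partial>M) * exp v) - ((\<integral>\<omega>. V \<omega> \<partial>M) * exp v)) / 2)"
        unfolding R_def
        by (intro has_bochner_integral_add has_bochner_integral_diff has_bochner_integral_divide p IH VF VI)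
      then show ?thesis by (simp add: mult.commute)
    qed
    have chord_eq: "u * ((1 + y) / 2 * a + (1 - y) / 2 * b) = (u * a + u * b) / 2 + (u * y * a - u * y * b) / 2"
      for u y a b :: real by (simp add: field_simps)
    have le: "U \<omega> * exp (D \<omega> * \<xi> j \<omega>) \<le> R \<omega>" if "\<omega> \<in> space M" for \<omega>
    proof -
      have "exp (D \<omega> * \<xi> j \<omega>) = exp ((\<xi> j \<omega> / c j) * c j * D \<omega>)"
        unfolding y(2)[OF that] by (simp add: mult.commute)
      also have "\<dots> \<le> (1 + \<xi> j \<omega> / c j) / 2 * exp (c j * D \<omega>) + (1 - \<xi> j \<omega> / c j) / 2 * exp (- c j * D \<omega>)"
        by (rule exp_le_chord[OF y(1)[OF that]])
      finally have "U \<omega> * exp (D \<omega> * \<xi> j \<omega>) \<le> U \<omega> * \<dots>"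
        by (rule mult_left_mono) (simp add: U_def)
      also have "\<dots> = R \<omega>" unfolding R_def V_def by (rule chord_eq)
      finally show ?thesis .
    qed
    have eq: "exp (\<Sum>i<Suc j. (W (\<tau> (Suc i)) \<omega> - W (\<tau> i) \<omega>) * \<xi> i \<omega>) = U \<omega> * exp (D \<omega> * \<xi> j \<omega>)" for \<omega>
      by (simp add: U_def D_def exp_add)
    have [measurable]: "U \<in> borel_measurable (F (\<tau> (Suc j)))" "\<xi> j \<in> borel_measurable (F (\<tau> (Suc j)))"
       "D \<in> borel_measurable (F (\<tau> (Suc j)))"
      using borel_measurable_F_mono[OF IH(1), of "\<tau> (Suc j)"] borel_measurable_F_mono[OF \<xi>[OF j], of "\<tau> (Suc j)"] j_lo
        borel_measurable_W_F[of "\<tau> j" "\<tau> (Suc j)"] borel_measurable_W_F[of "\<tau> (Suc j)" "\<tau> (Suc j)"]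
      unfolding D_def by auto
    have m: "(\<lambda>\<omega>. U \<omega> * exp (D \<omega> * \<xi> j \<omega>)) \<in> borel_measurable (F (\<tau> (Suc j)))" by measurable
    from borel_measurable_F_M[OF m]
    have mM: "(\<lambda>\<omega>. U \<omega> * exp (D \<omega> * \<xi> j \<omega>)) \<in> borel_measurable M"
      using j_lo by simp
    have i: "integrable M (\<lambda>\<omega>. U \<omega> * exp (D \<omega> * \<xi> j \<omega>))"
    proof (rule Bochner_Integration.integrable_bound[OF _ mM])
      show "integrable M R" using R by (simp add: has_bochner_integral_iff)
      show "AE \<omega> in M. norm (U \<omega> * exp (D \<omega> * \<xi> j \<omega>)) \<le> norm (R \<omega>)"
      proof (rule AE_I2)
        fix \<omega> assume "\<omega> \<in> space M"
        from le[OF this] show "norm (U \<omega> * exp (D \<omega> * \<xi> j \<omega>)) \<le> norm (R \<omega>)"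
          by (simp add: U_def)
      qed
    qed
    have "(\<integral>\<omega>. U \<omega> * exp (D \<omega> * \<xi> j \<omega>) \<partial>M) \<le> (\<integral>\<omega>. R \<omega> \<partial>M)"
      using R le i by (intro integral_mono) (auto simp: has_bochner_integral_iff)
    also have "\<dots> = (\<integral>\<omega>. U \<omega> \<partial>M) * exp v" using R by (simp add: has_bochner_integral_iff)
    also have "\<dots> \<le> exp ((\<Sum>i<j. (c i)\<^sup>2 * (\<tau> (Suc i) - \<tau> i)) / 2) * exp v"
      by (intro mult_right_mono IH) auto
    also have "\<dots> = exp ((\<Sum>i<Suc j. (c i)\<^sup>2 * (\<tau> (Suc i) - \<tau> i)) / 2)"
      by (simp add: exp_add[symmetric] v_def add_divide_distrib)
    finally show ?case unfolding eq using m i by simp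
  qed
  from this[of k] show ?thesis
    by (subst nn_integral_eq_integral) (auto intro: ennreal_leI)
qed

section \<open>Adapted versions of time integrals\<close>

text \<open>Each \<open>f r\<close> is \<open>F t\<close>-measurable, but joint measurability is known only with respect to \<open>M\<close>, so the time
  integral \<open>Y\<close> agrees with an \<open>F t\<close>-measurable variable only almost surely. The candidate is the
  conditional expectation \<open>Z\<close> of \<open>Y\<close>. To see \<open>Y = Z\<close>, test against an event \<open>A\<close> with conditional
  probability \<open>V\<close>: by Fubini
  \<open>E (Y 1\<^sub>A) = \<integral> E (f r 1\<^sub>A) dr = \<integral> E (f r V) dr = E (Y V) = E (Z V) = E (Z 1\<^sub>A)\<close>.\<close>

lemma adapted_time_integral_real:
  fixes f :: "real \<Rightarrow> 'w \<Rightarrow> real"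
  assumes t: "t \<in> {0..T}" and I: "integrable (lborel \<Otimes>\<^sub>M M) (case_prod f)"
    and ad: "\<And>r. f r \<in> borel_measurable (F t)"
  shows "\<exists>Z\<in>borel_measurable (F t). AE \<omega> in M. Z \<omega> = (\<integral>r. f r \<omega> \<partial>lborel)"
proof -
  have sub: "subalgebra M (F t)" using subalgebra_F[OF t] .
  have "finite_measure_subalgebra M (F t)"
    using sub finite_measure_axioms
    by (simp add: finite_measure_subalgebra_def finite_measure_subalgebra_axioms_def)
  then interpret sigma_finite_subalgebra M "F t"
    by (rule finite_measure_subalgebra_is_sigma_finite)
  define Y where "Y = (\<lambda>\<omega>. \<integral>r. f r \<omega> \<partial>lborel)"
  define Z where "Z = real_cond_exp M (F t) Y"
  have fm [measurable]: "case_prod f \<in> borel_measurable (lborel \<Otimes>\<^sub>M M)" using I by auto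
  have IY: "integrable M Y" unfolding Y_def using lborel_M.integrable_snd[OF I] .
  then have [measurable]: "Y \<in> borel_measurable M" by auto
  have ZF [measurable]: "Z \<in> borel_measurable (F t)" by (simp add: Z_def)
  have IZ: "integrable M Z" unfolding Z_def by (rule real_cond_exp_int(1)[OF IY])
  then have ZM [measurable]: "Z \<in> borel_measurable M" by auto
  have "AE \<omega> in M. Y \<omega> - Z \<omega> = 0"
  proof (rule density_zero)
    show "integrable M (\<lambda>\<omega>. Y \<omega> - Z \<omega>)" using IY IZ by simp
    fix A assume A [measurable]: "A \<in> sets M"
    define U where "U = real_cond_exp M (F t) (indicator A :: 'w \<Rightarrow> real)"
    \<comment> \<open>Clipping makes the conditional probability bounded everywhere, so that \<open>f r \<cdot> V\<close> is integrable.\<close>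
    define V where "V = (\<lambda>\<omega>. max 0 (min 1 (U \<omega>)))"
    have UF [measurable]: "U \<in> borel_measurable (F t)" by (simp add: U_def)
    have VF [measurable]: "V \<in> borel_measurable (F t)" unfolding V_def by measurable
    have [measurable]: "V \<in> borel_measurable M" "U \<in> borel_measurable M"
      using borel_measurable_F_M[OF VF t] borel_measurable_F_M[OF UF t] by auto
    have IA: "integrable M (indicator A :: 'w \<Rightarrow> real)" by (simp add: less_top[symmetric])
    have "AE \<omega> in M. 0 \<le> U \<omega>" unfolding U_def by (rule real_cond_exp_pos) auto
    moreover have "AE \<omega> in M. U \<omega> \<le> 1" unfolding U_def
      by (rule real_cond_exp_le_c[OF IA]) (auto simp: indicator_def)
    ultimately have VU: "AE \<omega> in M. V \<omega> = U \<omega>" by eventually_elim (simp add: V_def)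
    have IfA: "integrable (lborel \<Otimes>\<^sub>M M) (\<lambda>(r, \<omega>). f r \<omega> * indicator A \<omega>)"
    proof (rule Bochner_Integration.integrable_bound[OF I])
      show "AE x in lborel \<Otimes>\<^sub>M M. norm (case x of (r, \<omega>) \<Rightarrow> f r \<omega> * indicator A \<omega>) \<le> norm (case_prod f x)"
        by (intro AE_I2) (simp add: split_beta indicator_def)
    qed measurable
    have IfV: "integrable (lborel \<Otimes>\<^sub>M M) (\<lambda>(r, \<omega>). f r \<omega> * V \<omega>)"
    proof (rule Bochner_Integration.integrable_bound[OF I])
      have "\<bar>f r \<omega> * V \<omega>\<bar> \<le> \<bar>f r \<omega>\<bar>" for r \<omega>
        unfolding abs_mult by (rule mult_left_le) (auto simp: V_def)
      then show "AE x in lborel \<Otimes>\<^sub>M M. norm (case x of (r, \<omega>) \<Rightarrow> f r \<omega> * V \<omega>) \<le> norm (case_prod f x)"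
        by auto
    qed measurable
    have "(\<integral>\<omega>. Y \<omega> * indicator A \<omega> \<partial>M) = (\<integral>\<omega>. (\<integral>r. f r \<omega> * indicator A \<omega> \<partial>lborel) \<partial>M)"
      unfolding Y_def by simp
    also have "\<dots> = (\<integral>r. (\<integral>\<omega>. f r \<omega> * indicator A \<omega> \<partial>M) \<partial>lborel)"
      by (rule lborel_M.Fubini_integral[OF IfA])
    also have "\<dots> = (\<integral>r. (\<integral>\<omega>. f r \<omega> * V \<omega> \<partial>M) \<partial>lborel)"
    proof (rule integral_cong_AE)
      show "(\<lambda>r. \<integral>\<omega>. f r \<omega> * indicator A \<omega> \<partial>M) \<in> borel_measurable lborel" by measurable
      show "(\<lambda>r. \<integral>\<omega>. f r \<omega> * V \<omega> \<partial>M) \<in> borel_measurable lborel" by measurable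
      show "AE r in lborel. (\<integral>\<omega>. f r \<omega> * indicator A \<omega> \<partial>M) = (\<integral>\<omega>. f r \<omega> * V \<omega> \<partial>M)"
        using lborel_M.AE_integrable_fst[OF IfA]
      proof eventually_elim
        case (elim r)
        have fr [measurable]: "f r \<in> borel_measurable M" using borel_measurable_F_M[OF ad t] .
        have "(\<integral>\<omega>. f r \<omega> * U \<omega> \<partial>M) = (\<integral>\<omega>. f r \<omega> * indicator A \<omega> \<partial>M)"
          unfolding U_def by (rule real_cond_exp_intg(2)) (simp_all add: elim ad)
        moreover have "(\<integral>\<omega>. f r \<omega> * U \<omega> \<partial>M) = (\<integral>\<omega>. f r \<omega> * V \<omega> \<partial>M)"
          by (rule integral_cong_AE) (use VU in auto)
        ultimately show ?case by simp
      qed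
    qed
    also have "\<dots> = (\<integral>\<omega>. (\<integral>r. f r \<omega> * V \<omega> \<partial>lborel) \<partial>M)"
      by (rule lborel_M.Fubini_integral[OF IfV, symmetric])
    also have "\<dots> = (\<integral>\<omega>. V \<omega> * Y \<omega> \<partial>M)" by (simp add: Y_def mult.commute)
    also have "\<dots> = (\<integral>\<omega>. V \<omega> * Z \<omega> \<partial>M)"
      unfolding Z_def
    proof (rule real_cond_exp_intg(2)[symmetric])
      show "integrable M (\<lambda>\<omega>. V \<omega> * Y \<omega>)"
        by (rule integrable_bounded_mult[where C = 1, OF _ _ IY]) (simp_all add: V_def)
    qed measurable
    also have "\<dots> = (\<integral>\<omega>. Z \<omega> * U \<omega> \<partial>M)"
      by (rule integral_cong_AE) (use VU in auto)
    also have "\<dots> = (\<integral>\<omega>. Z \<omega> * indicator A \<omega> \<partial>M)"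
      unfolding U_def by (rule real_cond_exp_intg(2)) (simp_all add: integrable_real_mult_indicator IZ)
    finally have eq: "(\<integral>\<omega>. Y \<omega> * indicator A \<omega> \<partial>M) = (\<integral>\<omega>. Z \<omega> * indicator A \<omega> \<partial>M)" .
    have "(\<integral>\<omega>. indicator A \<omega> *\<^sub>R (Y \<omega> - Z \<omega>) \<partial>M) = (\<integral>\<omega>. Y \<omega> * indicator A \<omega> - Z \<omega> * indicator A \<omega> \<partial>M)"
      by (simp add: algebra_simps)
    also have "\<dots> = 0"
      by (subst Bochner_Integration.integral_diff) (simp_all add: integrable_real_mult_indicator IY IZ eq)
    finally show "set_lebesgue_integral M A (\<lambda>\<omega>. Y \<omega> - Z \<omega>) = 0"
      by (simp add: set_lebesgue_integral_def)
  qed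
  then have "AE \<omega> in M. Z \<omega> = (\<integral>r. f r \<omega> \<partial>lborel)"
    by eventually_elim (simp add: Y_def)
  then show ?thesis using ZF by blast
qed

lemma adapted_time_integral:
  fixes f :: "real \<Rightarrow> 'w \<Rightarrow> real ^ 'n"
  assumes t: "t \<in> {0..T}" and I: "integrable (lborel \<Otimes>\<^sub>M M) (case_prod f)"
    and ad: "\<And>r. f r \<in> borel_measurable (F t)"
  shows "\<exists>Z\<in>borel_measurable (F t). AE \<omega> in M. Z \<omega> = (\<integral>r. f r \<omega> \<partial>lborel)"
proof -
  have "\<exists>Z\<in>borel_measurable (F t). AE \<omega> in M. Z \<omega> = (\<integral>r. f r \<omega> $ j \<partial>lborel)" for j
  proof (rule adapted_time_integral_real[OF t])
    have "integrable (lborel \<Otimes>\<^sub>M M) (\<lambda>x. case_prod f x \<bullet> axis j 1)"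
      using I by (rule integrable_inner_left)
    then show "integrable (lborel \<Otimes>\<^sub>M M) (\<lambda>(r, \<omega>). f r \<omega> $ j)"
      by (simp add: inner_axis split_beta')
    show "(\<lambda>\<omega>. f r \<omega> $ j) \<in> borel_measurable (F t)" for r
      using ad[of r] by (simp add: borel_measurable_vec_iff)
  qed
  then have "\<forall>j. \<exists>Z. Z \<in> borel_measurable (F t) \<and> (AE \<omega> in M. Z \<omega> = (\<integral>r. f r \<omega> $ j \<partial>lborel))"
    by blast
  from choice[OF this] obtain Z where Z: "\<And>j. Z j \<in> borel_measurable (F t)"
    "\<And>j. AE \<omega> in M. Z j \<omega> = (\<integral>r. f r \<omega> $ j \<partial>lborel)" by blast
  have "AE \<omega> in M. integrable lborel (\<lambda>r. f r \<omega>)"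
    by (rule lborel_M.AE_integrable_snd[OF I])
  moreover have "AE \<omega> in M. \<forall>j. Z j \<omega> = (\<integral>r. f r \<omega> $ j \<partial>lborel)"
    unfolding AE_all_countable by (intro allI Z(2))
  ultimately have "AE \<omega> in M. (\<chi> j. Z j \<omega>) = (\<integral>r. f r \<omega> \<partial>lborel)"
  proof eventually_elim
    case (elim \<omega>)
    have "(\<integral>r. f r \<omega> \<partial>lborel) $ j = (\<integral>r. f r \<omega> $ j \<partial>lborel)" for j
      using integral_inner_left[of "axis j 1" lborel "\<lambda>r. f r \<omega>"] elim(1) by (simp add: inner_axis)
    then show ?case by (simp add: vec_eq_iff elim(2))
  qed
  moreover have "(\<lambda>\<omega>. \<chi> j. Z j \<omega>) \<in> borel_measurable (F t)"
    using Z(1) by (simp add: borel_measurable_vec_iff)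
  ultimately show ?thesis by (intro bexI[of _ "\<lambda>\<omega>. \<chi> j. Z j \<omega>"])
qed

end

section \<open>Averages over the preceding cell\<close>

text \<open>The mean of \<open>f\<close> over the cell of the grid \<open>h \<int>\<close> preceding the cell that contains \<open>r\<close>. It is constant on
  cells and looks only into the past, so it turns adapted processes into elementary ones.\<close>

definition lag_average :: "real \<Rightarrow> (real \<Rightarrow> 'b::{banach,second_countable_topology}) \<Rightarrow> real \<Rightarrow> 'b" where
  "lag_average h f r = (\<integral>s. (indicator {s. \<lceil>s / h\<rceil> = \<lceil>r / h\<rceil> - 1} s / h) *\<^sub>R f s \<partial>lborel)"

lemma cell_eq: "0 < h \<Longrightarrow> {s::real. \<lceil>s / h\<rceil> = k} = {(of_int k - 1) * h <.. of_int k * h}"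
  by (auto simp: ceiling_eq_iff field_simps)

lemma borel_measurable_lag_average:
  fixes f :: "real \<Rightarrow> 'b::{banach,second_countable_topology}"
  shows "lag_average h f \<in> borel_measurable borel"
proof -
  have "(\<lambda>r::real. \<lceil>r / h\<rceil>) \<in> borel \<rightarrow>\<^sub>M count_space UNIV" by measurable
  from measurable_compose[OF this, of "\<lambda>k. (\<integral>s. (indicator {s. \<lceil>s / h\<rceil> = k - 1} s / h) *\<^sub>R f s \<partial>lborel)" borel]
  show ?thesis unfolding lag_average_def[abs_def] by simp
qed

lemma nn_integral_cell: "0 < h \<Longrightarrow> (\<integral>\<^sup>+s. ennreal (indicator {s::real. \<lceil>s / h\<rceil> = k} s / h) \<partial>lborel) = 1"
proof -
  assume h: "0 < h"
  have "(\<integral>\<^sup>+s. ennreal (indicator {s::real. \<lceil>s / h\<rceil> = k} s / h) \<partial>lborel)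
     = (\<integral>\<^sup>+s. ennreal (1 / h) * indicator {(of_int k - 1) * h <.. of_int k * h} s \<partial>lborel)"
    unfolding cell_eq[OF h] by (intro nn_integral_cong) (auto simp: indicator_def)
  also have "\<dots> = ennreal (1 / h) * ennreal h"
    using h by (subst nn_integral_cmult_indicator) (auto simp: algebra_simps)
  also have "\<dots> = 1" using h by (simp add: ennreal_mult[symmetric])
  finally show ?thesis .
qed

lemma cell_measurable [measurable]: "0 < h \<Longrightarrow> {s::real. \<lceil>s / h\<rceil> = k} \<in> sets borel"
  by (simp add: cell_eq)

text \<open>Jensen's inequality within a cell; every cell serves as predecessor of exactly one cell.\<close>

lemma sqn_lag_average_le:
  fixes f :: "real \<Rightarrow> 'b::{banach,second_countable_topology}"
  assumes [measurable]: "f \<in> borel_measurable borel" and h: "0 < h"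
  shows "sqn lborel (lag_average h f) \<le> sqn lborel f"
proof -
  note [measurable] = cell_measurable[OF h]
  have le: "ennreal ((norm (lag_average h f r))\<^sup>2)
      \<le> (\<integral>\<^sup>+s. ennreal (indicator {s. \<lceil>s / h\<rceil> = \<lceil>r / h\<rceil> - 1} s / h) * ennreal ((norm (f s))\<^sup>2) \<partial>lborel)" for r
  proof -
    have "ennreal ((norm (lag_average h f r))\<^sup>2)
      \<le> (\<integral>\<^sup>+s. ennreal (indicator {s. \<lceil>s / h\<rceil> = \<lceil>r / h\<rceil> - 1} s / h) \<partial>lborel) *
        (\<integral>\<^sup>+s. ennreal (indicator {s. \<lceil>s / h\<rceil> = \<lceil>r / h\<rceil> - 1} s / h) * ennreal ((norm (f s))\<^sup>2) \<partial>lborel)"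
      unfolding lag_average_def
      by (rule norm_integral_weight_sq_le) (use h in auto)
    then show ?thesis unfolding nn_integral_cell[OF h] by simp
  qed
  have "sqn lborel (lag_average h f) \<le>
      (\<integral>\<^sup>+r. (\<integral>\<^sup>+s. ennreal (indicator {s. \<lceil>s / h\<rceil> = \<lceil>r / h\<rceil> - 1} s / h) * ennreal ((norm (f s))\<^sup>2) \<partial>lborel) \<partial>lborel)"
    unfolding sqn_def by (intro nn_integral_mono le)
  also have "\<dots> = (\<integral>\<^sup>+r. (\<integral>\<^sup>+s. ennreal (indicator {x. \<lceil>fst x / h\<rceil> = \<lceil>snd x / h\<rceil> - 1} (s, r) / h) * ennreal ((norm (f s))\<^sup>2) \<partial>lborel) \<partial>lborel)"
    by (intro nn_integral_cong) (simp add: indicator_def)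
  also have "\<dots> = (\<integral>\<^sup>+s. (\<integral>\<^sup>+r. ennreal (indicator {x. \<lceil>fst x / h\<rceil> = \<lceil>snd x / h\<rceil> - 1} (s, r) / h) * ennreal ((norm (f s))\<^sup>2) \<partial>lborel) \<partial>lborel)"
    by (rule lborel_pair.Fubini') measurable
  also have "\<dots> = (\<integral>\<^sup>+s. (\<integral>\<^sup>+r. ennreal (indicator {r. \<lceil>r / h\<rceil> = \<lceil>s / h\<rceil> + 1} r / h) * ennreal ((norm (f s))\<^sup>2) \<partial>lborel) \<partial>lborel)"
    by (intro nn_integral_cong arg_cong2[where f = "(*)"] refl arg_cong[where f = ennreal]) (auto simp: indicator_def)
  also have "\<dots> = (\<integral>\<^sup>+s. ennreal ((norm (f s))\<^sup>2) \<partial>lborel)"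
    by (intro nn_integral_cong) (simp add: nn_integral_multc nn_integral_cell[OF h])
  finally show ?thesis by (simp add: sqn_def)
qed

lemma integrable_on_interval_if_square:
  fixes f :: "real \<Rightarrow> 'b::{banach,second_countable_topology}"
  assumes [measurable]: "f \<in> borel_measurable borel" and fin: "sqn lborel f < \<infinity>"
  shows "integrable lborel (\<lambda>s. indicator {a<..b} s *\<^sub>R f s)"
proof (rule Bochner_Integration.integrable_bound)
  have "integrable lborel (\<lambda>s. (norm (f s))\<^sup>2)" using fin sqn_finite_iff[of f lborel] by simp
  moreover have "integrable lborel (indicator {a<..b} :: real \<Rightarrow> real)"
    by (cases "a \<le> b") (auto simp: integrable_indicator_iff)
  ultimately show "integrable lborel (\<lambda>s. indicator {a<..b} s + (norm (f s))\<^sup>2 :: real)" by simp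
  have "x \<le> 1 + x\<^sup>2" for x :: real
    using zero_le_power2[of "x - 1"] by (simp add: power2_diff) (smt (verit) zero_le_power2)
  then show "AE s in lborel. norm (indicator {a<..b} s *\<^sub>R f s) \<le> norm (indicator {a<..b} s + (norm (f s))\<^sup>2 :: real)"
    by (intro AE_I2) (auto simp: indicator_def abs_of_nonneg)
qed measurable

lemma integrable_lag_average:
  fixes f :: "real \<Rightarrow> 'b::{banach,second_countable_topology}"
  assumes "f \<in> borel_measurable borel" "sqn lborel f < \<infinity>" "0 < h"
  shows "integrable lborel (\<lambda>s. (indicator {s. \<lceil>s / h\<rceil> = k} s / h) *\<^sub>R f s)"
proof -
  have "integrable lborel (\<lambda>s. (1 / h) *\<^sub>R (indicator {(of_int k - 1) * h <.. of_int k * h} s *\<^sub>R f s))"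
    by (intro integrable_scaleR_right integrable_on_interval_if_square assms)
  then show ?thesis unfolding cell_eq[OF assms(3)] by simp
qed

lemma lag_average_diff:
  fixes f g :: "real \<Rightarrow> 'b::{banach,second_countable_topology}"
  assumes "f \<in> borel_measurable borel" "sqn lborel f < \<infinity>" "g \<in> borel_measurable borel" "sqn lborel g < \<infinity>" "0 < h"
  shows "lag_average h (\<lambda>s. f s - g s) r = lag_average h f r - lag_average h g r"
  unfolding lag_average_def scaleR_diff_right
  by (intro Bochner_Integration.integral_diff integrable_lag_average assms)

lemma lag_average_uminus: "lag_average h (\<lambda>s. - f s) r = - lag_average h f r"
  unfolding lag_average_def by simp

text \<open>The class of functions that lagged averages recover in mean square. It is shown to contain intervals,
  then bounded Borel sets, simple functions of bounded support, and finally every square-integrable function.\<close>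

definition lag_recovered :: "(nat \<Rightarrow> real) \<Rightarrow> (real \<Rightarrow> 'b::{banach,second_countable_topology}) \<Rightarrow> bool" where
  "lag_recovered h f \<longleftrightarrow> f \<in> borel_measurable borel \<and> sqn lborel f < \<infinity> \<and>
     (\<lambda>m. sqn lborel (\<lambda>r. lag_average (h m) f r - f r)) \<longlonglongrightarrow> 0"

lemma ennreal_tendsto_0_lin:
  assumes "x \<longlonglongrightarrow> 0" "y \<longlonglongrightarrow> 0"
  shows "(\<lambda>m. 2 * x m + 2 * y m :: ennreal) \<longlonglongrightarrow> 0"
  using tendsto_add[OF ennreal_tendsto_cmult[OF _ assms(1), of 2] ennreal_tendsto_cmult[OF _ assms(2), of 2]] by simp

lemma ennreal_tendsto_0_le:
  fixes x y :: "nat \<Rightarrow> ennreal"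
  assumes "y \<longlonglongrightarrow> 0" "\<And>m. x m \<le> y m"
  shows "x \<longlonglongrightarrow> 0"
  by (rule tendsto_sandwich[OF _ _ tendsto_const assms(1)]) (use assms(2) in auto)

lemma lag_recovered_diff:
  fixes f g :: "real \<Rightarrow> 'b::{banach,second_countable_topology}"
  assumes f: "lag_recovered h f" and g: "lag_recovered h g" and h: "\<And>m. 0 < h m"
  shows "lag_recovered h (\<lambda>r. f r - g r)"
proof -
  from f g have [measurable]: "f \<in> borel_measurable borel" "g \<in> borel_measurable borel"
    and fin: "sqn lborel f < \<infinity>" "sqn lborel g < \<infinity>" by (auto simp: lag_recovered_def)
  note [measurable] = borel_measurable_lag_average
  have "sqn lborel (\<lambda>r. f r - g r) \<le> 2 * sqn lborel f + 2 * sqn lborel g"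
    by (rule sqn_diff) auto
  also have "\<dots> < \<infinity>" using fin by (auto simp: ennreal_mult_less_top)
  finally have "sqn lborel (\<lambda>r. f r - g r) < \<infinity>" .
  moreover have "(\<lambda>m. sqn lborel (\<lambda>r. lag_average (h m) (\<lambda>r. f r - g r) r - (f r - g r))) \<longlonglongrightarrow> 0"
  proof (rule ennreal_tendsto_0_le)
    show "(\<lambda>m. 2 * sqn lborel (\<lambda>r. lag_average (h m) f r - f r) + 2 * sqn lborel (\<lambda>r. lag_average (h m) g r - g r)) \<longlonglongrightarrow> 0"
      using f g by (intro ennreal_tendsto_0_lin) (auto simp: lag_recovered_def)
    fix m
    have "lag_average (h m) (\<lambda>r. f r - g r) r - (f r - g r) = (lag_average (h m) f r - f r) - (lag_average (h m) g r - g r)" for r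
      by (subst lag_average_diff) (use fin h in \<open>auto simp: algebra_simps\<close>)
    then show "sqn lborel (\<lambda>r. lag_average (h m) (\<lambda>r. f r - g r) r - (f r - g r))
       \<le> 2 * sqn lborel (\<lambda>r. lag_average (h m) f r - f r) + 2 * sqn lborel (\<lambda>r. lag_average (h m) g r - g r)"
      using sqn_diff[of "\<lambda>r. lag_average (h m) f r - f r" lborel "\<lambda>r. lag_average (h m) g r - g r"]
      by (simp only: borel_measurable_diff borel_measurable_lag_average) simp
  qed
  ultimately show ?thesis unfolding lag_recovered_def by simp
qed

lemma lag_recovered_uminus: "lag_recovered h f \<Longrightarrow> lag_recovered h (\<lambda>r. - f r)"
proof -
  assume f: "lag_recovered h f"
  have "sqn lborel (\<lambda>r. lag_average (h m) (\<lambda>r. - f r) r - - f r) = sqn lborel (\<lambda>r. lag_average (h m) f r - f r)" for m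
    unfolding lag_average_uminus by (subst sqn_minus_commute) simp
  then show ?thesis using f by (simp add: lag_recovered_def)
qed

lemma lag_recovered_add:
  assumes "lag_recovered h f" "lag_recovered h g" "\<And>m. 0 < h m"
  shows "lag_recovered h (\<lambda>r. f r + g r)"
  using lag_recovered_diff[OF assms(1) lag_recovered_uminus[OF assms(2)] assms(3)] by simp

lemma lag_recovered_zero: "lag_recovered h (\<lambda>_. 0)"
  by (simp add: lag_recovered_def lag_average_def sqn_def)

lemma lag_recovered_sum:
  assumes "finite I" "\<And>i. i \<in> I \<Longrightarrow> lag_recovered h (f i)" "\<And>m. 0 < h m"
  shows "lag_recovered h (\<lambda>r. \<Sum>i\<in>I. f i r)"
  using assms(1,2)
  by (induction I rule: finite_induct) (auto intro!: lag_recovered_add lag_recovered_zero assms(3))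

text \<open>Averaging is a contraction, so the error of approximating \<open>f\<close> by \<open>u n\<close> does not depend on the mesh.\<close>

lemma lag_recovered_limit:
  fixes f :: "real \<Rightarrow> 'b::{banach,second_countable_topology}"
  assumes u: "\<And>n::nat. lag_recovered h (u n)" and h: "\<And>m. 0 < h m"
    and f [measurable]: "f \<in> borel_measurable borel" and fin: "sqn lborel f < \<infinity>"
    and lim: "(\<lambda>n. sqn lborel (\<lambda>r. u n r - f r)) \<longlonglongrightarrow> 0"
  shows "lag_recovered h f"
proof -
  have um [measurable]: "\<And>n. u n \<in> borel_measurable borel" and ufin: "\<And>n. sqn lborel (u n) < \<infinity>"
    using u by (auto simp: lag_recovered_def)
  note [measurable] = borel_measurable_lag_average
  have le: "sqn lborel (\<lambda>r. lag_average (h m) f r - f r)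
    \<le> 6 * sqn lborel (\<lambda>r. u n r - f r) + 4 * sqn lborel (\<lambda>r. lag_average (h m) (u n) r - u n r)" for n m
  proof -
    have "sqn lborel (\<lambda>r. lag_average (h m) f r - f r)
      \<le> 2 * sqn lborel (\<lambda>r. lag_average (h m) f r - lag_average (h m) (u n) r) + 2 * sqn lborel (\<lambda>r. lag_average (h m) (u n) r - f r)"
      by (rule sqn_triangle) auto
    also have "(\<lambda>r. lag_average (h m) f r - lag_average (h m) (u n) r) = lag_average (h m) (\<lambda>r. f r - u n r)"
      by (rule ext, rule lag_average_diff[symmetric]) (use fin ufin h in auto)
    finally have 1: "sqn lborel (\<lambda>r. lag_average (h m) f r - f r)
      \<le> 2 * sqn lborel (lag_average (h m) (\<lambda>r. f r - u n r)) + 2 * sqn lborel (\<lambda>r. lag_average (h m) (u n) r - f r)" .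
    have 2: "sqn lborel (lag_average (h m) (\<lambda>r. f r - u n r)) \<le> sqn lborel (\<lambda>r. u n r - f r)"
      using sqn_lag_average_le[of "\<lambda>r. f r - u n r" "h m"] h by (simp add: sqn_minus_commute)
    have 3: "sqn lborel (\<lambda>r. lag_average (h m) (u n) r - f r)
       \<le> 2 * sqn lborel (\<lambda>r. lag_average (h m) (u n) r - u n r) + 2 * sqn lborel (\<lambda>r. u n r - f r)"
      by (rule sqn_triangle) auto
    have "sqn lborel (\<lambda>r. lag_average (h m) f r - f r) \<le> 2 * sqn lborel (\<lambda>r. u n r - f r)
       + 2 * (2 * sqn lborel (\<lambda>r. lag_average (h m) (u n) r - u n r) + 2 * sqn lborel (\<lambda>r. u n r - f r))"
      by (rule order_trans[OF 1]) (intro add_mono mult_left_mono 2 3; simp)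
    also have "\<dots> = (2 + 2 * 2) * sqn lborel (\<lambda>r. u n r - f r) + (2 * 2) * sqn lborel (\<lambda>r. lag_average (h m) (u n) r - u n r)"
      unfolding distrib_left distrib_right mult.assoc by (simp only: ac_simps)
    finally show ?thesis by simp
  qed
  have "limsup (\<lambda>m. sqn lborel (\<lambda>r. lag_average (h m) f r - f r)) \<le> 6 * sqn lborel (\<lambda>r. u n r - f r)" for n
  proof -
    have "(\<lambda>m. 6 * sqn lborel (\<lambda>r. u n r - f r) + 4 * sqn lborel (\<lambda>r. lag_average (h m) (u n) r - u n r))
       \<longlonglongrightarrow> 6 * sqn lborel (\<lambda>r. u n r - f r) + 4 * 0"
      using u[of n] by (intro tendsto_add tendsto_const ennreal_tendsto_cmult) (auto simp: lag_recovered_def)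
    then have "limsup (\<lambda>m. 6 * sqn lborel (\<lambda>r. u n r - f r) + 4 * sqn lborel (\<lambda>r. lag_average (h m) (u n) r - u n r))
       = 6 * sqn lborel (\<lambda>r. u n r - f r) + 4 * 0"
      by (intro lim_imp_Limsup) auto
    moreover have "limsup (\<lambda>m. sqn lborel (\<lambda>r. lag_average (h m) f r - f r)) \<le>
       limsup (\<lambda>m. 6 * sqn lborel (\<lambda>r. u n r - f r) + 4 * sqn lborel (\<lambda>r. lag_average (h m) (u n) r - u n r))"
      by (intro Limsup_mono always_eventually allI le)
    ultimately show ?thesis by simp
  qed
  moreover have "(\<lambda>n. 6 * sqn lborel (\<lambda>r. u n r - f r)) \<longlonglongrightarrow> 6 * 0"
    by (intro ennreal_tendsto_cmult lim) auto
  ultimately have "limsup (\<lambda>m. sqn lborel (\<lambda>r. lag_average (h m) f r - f r)) \<le> 6 * 0"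
    by (intro LIMSEQ_le_const) auto
  then have "(\<lambda>m. sqn lborel (\<lambda>r. lag_average (h m) f r - f r)) \<longlonglongrightarrow> 0"
    by (intro tendsto_0_if_Limsup_eq_0_ennreal) simp
  then show ?thesis using fin by (simp add: lag_recovered_def)
qed

text \<open>The factor 2 is the one with which simple functions approximate a measurable function.\<close>

lemma lag_recovered_dominated_limit:
  fixes f :: "real \<Rightarrow> 'b::{banach,second_countable_topology}"
  assumes u: "\<And>n::nat. lag_recovered h (u n)" and h: "\<And>m. 0 < h m"
    and f [measurable]: "f \<in> borel_measurable borel" and fin: "sqn lborel f < \<infinity>"
    and lim: "\<And>r. (\<lambda>n. u n r) \<longlonglongrightarrow> f r" and dom: "\<And>n r. norm (u n r) \<le> 2 * norm (f r)"
  shows "lag_recovered h f"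
proof (rule lag_recovered_limit[OF u h f fin])
  have [measurable]: "\<And>n. u n \<in> borel_measurable borel" using u by (auto simp: lag_recovered_def)
  have "(\<lambda>n. \<integral>\<^sup>+r. ennreal ((norm (u n r - f r))\<^sup>2) \<partial>lborel) \<longlonglongrightarrow> (\<integral>\<^sup>+(r::real). 0 \<partial>lborel)"
  proof (rule nn_integral_dominated_convergence[where w = "\<lambda>r. 9 * ennreal ((norm (f r))\<^sup>2)"])
    show "AE r in lborel. ennreal ((norm (u n r - f r))\<^sup>2) \<le> 9 * ennreal ((norm (f r))\<^sup>2)" for n
    proof (rule AE_I2)
      fix r
      have "norm (u n r - f r) \<le> norm (u n r) + norm (f r)" by (rule norm_triangle_ineq4)
      also have "\<dots> \<le> 3 * norm (f r)" using dom[of n r] by simp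
      finally have "(norm (u n r - f r))\<^sup>2 \<le> (3 * norm (f r))\<^sup>2" by (rule power_mono) simp
      then have "ennreal ((norm (u n r - f r))\<^sup>2) \<le> ennreal (9 * (norm (f r))\<^sup>2)"
        by (intro ennreal_leI) (simp add: power_mult_distrib)
      also have "\<dots> = 9 * ennreal ((norm (f r))\<^sup>2)" by (simp add: ennreal_mult)
      finally show "ennreal ((norm (u n r - f r))\<^sup>2) \<le> 9 * ennreal ((norm (f r))\<^sup>2)" .
    qed
    show "(\<integral>\<^sup>+r. 9 * ennreal ((norm (f r))\<^sup>2) \<partial>lborel) < \<infinity>"
      using fin by (simp add: nn_integral_cmult sqn_def ennreal_mult_less_top)
    show "AE r in lborel. (\<lambda>n. ennreal ((norm (u n r - f r))\<^sup>2)) \<longlonglongrightarrow> 0"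
    proof (rule AE_I2)
      fix r
      have "(\<lambda>n. ennreal ((norm (u n r - f r))\<^sup>2)) \<longlonglongrightarrow> ennreal ((norm (f r - f r))\<^sup>2)"
        by (intro tendsto_ennrealI tendsto_power tendsto_norm tendsto_diff lim tendsto_const)
      then show "(\<lambda>n. ennreal ((norm (u n r - f r))\<^sup>2)) \<longlonglongrightarrow> 0" by simp
    qed
  qed auto
  then show "(\<lambda>n. sqn lborel (\<lambda>r. u n r - f r)) \<longlonglongrightarrow> 0" by (simp add: sqn_def)
qed

lemma sqn_indicator_scale:
  assumes [measurable]: "A \<in> sets lborel"
  shows "sqn lborel (\<lambda>r. indicator A r *\<^sub>R c) = ennreal ((norm c)\<^sup>2) * emeasure lborel A"
proof -
  have "sqn lborel (\<lambda>r. indicator A r *\<^sub>R c) = (\<integral>\<^sup>+r. ennreal ((norm c)\<^sup>2) * indicator A r \<partial>lborel)"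
    unfolding sqn_def by (intro nn_integral_cong) (auto simp: indicator_def)
  then show ?thesis using assms by (subst (asm) nn_integral_cmult_indicator) simp_all
qed

lemma lag_recovered_interval:
  fixes c :: "'b::{banach,second_countable_topology}"
  assumes h: "\<And>m. 0 < h m" and lim: "h \<longlonglongrightarrow> 0"
  shows "lag_recovered h (\<lambda>r. indicator {a<..b} r *\<^sub>R c)"
proof -
  let ?f = "\<lambda>r. indicator {a<..b} r *\<^sub>R c"
  have fin: "sqn lborel ?f < \<infinity>"
    by (cases "a \<le> b") (auto simp: sqn_indicator_scale ennreal_mult_less_top)
  \<comment> \<open>Away from the two end points the function is constant on \<open>{r - 2 * h..r}\<close>.\<close>
  have eq: "lag_average k ?f r = ?f r" if k: "0 < k" and r: "r \<notin> {a..a + 2 * k} \<union> {b..b + 2 * k}" for k r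
  proof -
    have s: "?f s = ?f r" if "\<lceil>s / k\<rceil> = \<lceil>r / k\<rceil> - 1" for s
    proof -
      have "s \<in> {(of_int (\<lceil>r / k\<rceil> - 1) - 1) * k <.. of_int (\<lceil>r / k\<rceil> - 1) * k}"
        using that cell_eq[OF k, of "\<lceil>r / k\<rceil> - 1"] by auto
      moreover have "r \<le> of_int \<lceil>r / k\<rceil> * k" "of_int \<lceil>r / k\<rceil> * k < r + k"
        using ceiling_divide_upper[OF k, of r] ceiling_divide_lower[OF k, of r] by (auto simp: algebra_simps)
      ultimately have "s < r" "r - 2 * k < s" by (auto simp: algebra_simps)
      then show ?thesis using r by (auto simp: indicator_def)
    qed
    have "lag_average k ?f r = (\<integral>s. (indicator {s. \<lceil>s / k\<rceil> = \<lceil>r / k\<rceil> - 1} s / k) *\<^sub>R ?f r \<partial>lborel)"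
      unfolding lag_average_def
    proof (rule Bochner_Integration.integral_cong[OF refl])
      fix s
      show "(indicator {s. \<lceil>s / k\<rceil> = \<lceil>r / k\<rceil> - 1} s / k) *\<^sub>R ?f s = (indicator {s. \<lceil>s / k\<rceil> = \<lceil>r / k\<rceil> - 1} s / k) *\<^sub>R ?f r"
        by (cases "\<lceil>s / k\<rceil> = \<lceil>r / k\<rceil> - 1") (simp_all add: s)
    qed
    also have "\<dots> = (\<integral>s. indicator {s. \<lceil>s / k\<rceil> = \<lceil>r / k\<rceil> - 1} s / k \<partial>lborel) *\<^sub>R ?f r"
    proof (rule integral_scaleR_left)
      have "integrable lborel (\<lambda>s. (1 / k) * indicator {(of_int (\<lceil>r / k\<rceil> - 1) - 1) * k <.. of_int (\<lceil>r / k\<rceil> - 1) * k} s :: real)"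
        using k by (intro integrable_mult_right integrable_real_indicator) auto
      then show "integrable lborel (\<lambda>s. indicator {s. \<lceil>s / k\<rceil> = \<lceil>r / k\<rceil> - 1} s / k :: real)"
        unfolding cell_eq[OF k] by simp
    qed
    also have "(\<integral>s. indicator {s. \<lceil>s / k\<rceil> = \<lceil>r / k\<rceil> - 1} s / k \<partial>lborel) = (1::real)"
      using k nn_integral_cell[OF k, of "\<lceil>r / k\<rceil> - 1"] by (intro integral_eq_nn_integral[THEN trans]) auto
    finally show ?thesis by simp
  qed
  have le: "sqn lborel (\<lambda>r. lag_average k ?f r - ?f r) \<le> ennreal (16 * k * (norm c)\<^sup>2)" if k: "0 < k" for k
  proof -
    have 1: "norm (lag_average k ?f r) \<le> norm c" for r
    proof -
      have "ennreal (norm (lag_average k ?f r)) \<le> (\<integral>\<^sup>+s. norm ((indicator {s. \<lceil>s / k\<rceil> = \<lceil>r / k\<rceil> - 1} s / k) *\<^sub>R ?f s) \<partial>lborel)"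
        unfolding lag_average_def by (intro integral_norm_bound_ennreal integrable_lag_average fin k) auto
      also have "\<dots> \<le> (\<integral>\<^sup>+s. ennreal (indicator {s. \<lceil>s / k\<rceil> = \<lceil>r / k\<rceil> - 1} s / k) * ennreal (norm c) \<partial>lborel)"
        using k by (intro nn_integral_mono) (auto simp: indicator_def ennreal_mult[symmetric])
      also have "\<dots> = ennreal (norm c)"
        using k by (subst nn_integral_multc) (auto simp: nn_integral_cell)
      finally show ?thesis by simp
    qed
    have 2: "norm (lag_average k ?f r - ?f r) \<le> 2 * norm c" for r
    proof -
      have "norm (lag_average k ?f r - ?f r) \<le> norm (lag_average k ?f r) + norm (?f r)" by (rule norm_triangle_ineq4)
      also have "\<dots> \<le> norm c + norm c" using 1[of r] by (intro add_mono) (auto simp: indicator_def)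
      finally show ?thesis by simp
    qed
    have "norm (lag_average k ?f r - ?f r) \<le> norm (indicator ({a..a + 2 * k} \<union> {b..b + 2 * k}) r *\<^sub>R (2 *\<^sub>R c))" for r
      using eq[OF k, of r] 2[of r] by (cases "r \<in> {a..a + 2 * k} \<union> {b..b + 2 * k}") simp_all
    then have "sqn lborel (\<lambda>r. lag_average k ?f r - ?f r) \<le> sqn lborel (\<lambda>r. indicator ({a..a + 2 * k} \<union> {b..b + 2 * k}) r *\<^sub>R (2 *\<^sub>R c))"
      by (rule sqn_mono)
    also have "\<dots> = ennreal ((norm (2 *\<^sub>R c))\<^sup>2) * emeasure lborel ({a..a + 2 * k} \<union> {b..b + 2 * k})"
      by (rule sqn_indicator_scale) auto
    also have "\<dots> \<le> ennreal ((norm (2 *\<^sub>R c))\<^sup>2) * (emeasure lborel {a..a + 2 * k} + emeasure lborel {b..b + 2 * k})"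
      by (intro mult_left_mono emeasure_subadditive) auto
    also have "\<dots> = ennreal (16 * k * (norm c)\<^sup>2)"
      using k by (simp add: power_mult_distrib ennreal_mult[symmetric] ennreal_plus[symmetric] del: ennreal_plus)
    finally show ?thesis .
  qed
  have "(\<lambda>m. ennreal (16 * h m * (norm c)\<^sup>2)) \<longlonglongrightarrow> ennreal (16 * 0 * (norm c)\<^sup>2)"
    by (intro tendsto_ennrealI tendsto_mult tendsto_const lim)
  then have "(\<lambda>m. ennreal (16 * h m * (norm c)\<^sup>2)) \<longlonglongrightarrow> 0" by simp
  from ennreal_tendsto_0_le[OF this le[OF h]]
  show ?thesis using fin by (simp add: lag_recovered_def)
qed

text \<open>The sets with this property form a Dynkin system that contains the half-open intervals. The window
  \<open>{u<..v}\<close> keeps all indicators square-integrable.\<close>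

lemma lag_recovered_bounded_set:
  fixes c :: "'b::{banach,second_countable_topology}"
  assumes h: "\<And>m. 0 < h m" and lim: "h \<longlonglongrightarrow> 0" and A: "A \<in> sets borel"
  shows "lag_recovered h (\<lambda>r. indicator (A \<inter> {u<..v}) r *\<^sub>R c)"
proof -
  have A': "A \<in> sigma_sets UNIV (range (\<lambda>(i, j). {i<..j::real}))"
    using A unfolding borel_sigma_sets_Ioc by simp
  have fin: "sqn lborel (\<lambda>r. indicator (B \<inter> {u<..v}) r *\<^sub>R c) < \<infinity>" if "B \<in> sets borel" for B
  proof -
    have "emeasure lborel (B \<inter> {u<..v}) \<le> emeasure lborel {u<..v}" by (intro emeasure_mono) auto
    also have "\<dots> < \<infinity>" by (cases "u \<le> v") auto
    finally show ?thesis using that by (subst sqn_indicator_scale) (auto simp: ennreal_mult_less_top)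
  qed
  have sb: "sigma_sets UNIV (range (\<lambda>(i, j). {i<..j::real})) = sets borel"
    unfolding borel_sigma_sets_Ioc by simp
  have stable: "Int_stable (range (\<lambda>(i, j). {i<..j::real}))"
    by (auto simp: Int_stable_def Int_greaterThanAtMost)
  have closed: "range (\<lambda>(i, j). {i<..j::real}) \<subseteq> Pow UNIV" by simp
  let ?P = "\<lambda>B. lag_recovered h (\<lambda>r. indicator (B \<inter> {u<..v}) r *\<^sub>R c)"
  show ?thesis
  proof (rule sigma_sets_induct_disjoint[OF stable closed A', where P = ?P])
    fix B assume "B \<in> range (\<lambda>(i, j). {i<..j::real})"
    then obtain i j where "B = {i<..j}" by auto
    then have "B \<inter> {u<..v} = {max i u<..min j v}" by auto
    then show "?P B" using lag_recovered_interval[OF h lim] by simp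
  next
    show "?P {}" using lag_recovered_zero by simp
  next
    fix B assume compl: "?P B"
    have "(\<lambda>r. indicator ((UNIV - B) \<inter> {u<..v}) r *\<^sub>R c) = (\<lambda>r. indicator {u<..v} r *\<^sub>R c - indicator (B \<inter> {u<..v}) r *\<^sub>R c)"
      by (auto simp: indicator_def fun_eq_iff)
    then show "?P (UNIV - B)" using lag_recovered_diff[OF lag_recovered_interval[OF h lim] compl h] by simp
  next
    fix B :: "nat \<Rightarrow> real set"
    assume union: "disjoint_family B" "range B \<subseteq> sigma_sets UNIV (range (\<lambda>(i, j). {i<..j::real}))" "\<And>i. ?P (B i)"
    have Bs [measurable]: "B i \<in> sets borel" for i using union(2) unfolding sb by auto
    have eq: "(\<Sum>i<n. indicator (B i \<inter> {u<..v}) r *\<^sub>R c) = indicator ((\<Union>i<n. B i) \<inter> {u<..v}) r *\<^sub>R c" for n r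
    proof -
      have "(\<Sum>i<n. indicator (B i \<inter> {u<..v}) r) = (indicator (\<Union>i<n. B i \<inter> {u<..v}) r :: real)"
        by (rule indicator_UN_disjoint[symmetric])
           (use union(1) in \<open>auto simp: disjoint_family_on_def\<close>)
      also have "(\<Union>i<n. B i \<inter> {u<..v}) = (\<Union>i<n. B i) \<inter> {u<..v}" by auto
      finally show ?thesis by (simp add: scaleR_sum_left[symmetric])
    qed
    show "?P (\<Union>i. B i)"
    proof (rule lag_recovered_dominated_limit[where u = "\<lambda>n r. \<Sum>i<n. indicator (B i \<inter> {u<..v}) r *\<^sub>R c"])
      show "lag_recovered h (\<lambda>r. \<Sum>i<n. indicator (B i \<inter> {u<..v}) r *\<^sub>R c)" for n
        by (rule lag_recovered_sum) (use union(3) h in auto)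
      show "0 < h m" for m by (rule h)
      show "(\<lambda>r. indicator (\<Union> (range B) \<inter> {u<..v}) r *\<^sub>R c) \<in> borel_measurable borel" by measurable
      show "sqn lborel (\<lambda>r. indicator (\<Union> (range B) \<inter> {u<..v}) r *\<^sub>R c) < \<infinity>" by (rule fin) measurable
      show "(\<lambda>n. \<Sum>i<n. indicator (B i \<inter> {u<..v}) r *\<^sub>R c) \<longlonglongrightarrow> indicator (\<Union> (range B) \<inter> {u<..v}) r *\<^sub>R c" for r
      proof (cases "r \<in> \<Union> (range B) \<inter> {u<..v}")
        case True
        then obtain i where i: "r \<in> B i" "r \<in> {u<..v}" by auto
        have "eventually (\<lambda>n. indicator ((\<Union>i<n. B i) \<inter> {u<..v}) r *\<^sub>R c = c) sequentially"
          using eventually_gt_at_top[of i]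
        proof eventually_elim
          case (elim n)
          then have "r \<in> (\<Union>i<n. B i) \<inter> {u<..v}" using i by auto
          then show ?case by simp
        qed
        then show ?thesis unfolding eq using True by (intro tendsto_eventually) auto
      next
        case False
        then have z: "indicator ((\<Union>i<n. B i) \<inter> {u<..v}) r *\<^sub>R c = 0" for n by (auto simp: indicator_def)
        show ?thesis unfolding eq z using False by (auto simp: indicator_def)
      qed
      show "norm (\<Sum>i<n. indicator (B i \<inter> {u<..v}) r *\<^sub>R c) \<le> 2 * norm (indicator (\<Union> (range B) \<inter> {u<..v}) r *\<^sub>R c)" for n r
        unfolding eq by (auto simp: indicator_def)
    qed
  qed
qed

text \<open>A mean-square version of the Lebesgue differentiation theorem along a sequence of grids.\<close>

theorem lag_average_tendsto:
  fixes f :: "real \<Rightarrow> 'b::euclidean_space"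
  assumes f [measurable]: "f \<in> borel_measurable borel" and fin: "sqn lborel f < \<infinity>"
    and h: "\<And>m. 0 < h m" and lim: "h \<longlonglongrightarrow> 0"
  shows "(\<lambda>m. sqn lborel (\<lambda>r. lag_average (h m) f r - f r)) \<longlonglongrightarrow> 0"
proof -
  have "\<exists>s. (\<forall>i. simple_function borel (s i)) \<and> (\<forall>x\<in>space borel. (\<lambda>i. s i x) \<longlonglongrightarrow> f x) \<and>
      (\<forall>i. \<forall>x\<in>space borel. dist (s i x) 0 \<le> 2 * dist (f x) 0)"
    by (rule borel_measurable_implies_sequence_metric[OF f, of 0]) 
  then obtain s where s: "\<And>i. simple_function borel (s i)" "\<And>x. (\<lambda>i. s i x) \<longlonglongrightarrow> f x"
     "\<And>i x. norm (s i x) \<le> 2 * norm (f x)" by auto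
  have "lag_recovered h f"
  proof (rule lag_recovered_dominated_limit[where u = "\<lambda>n r. indicator {- real n<..real n} r *\<^sub>R s n r", OF _ h f fin])
    show "lag_recovered h (\<lambda>r. indicator {- real n<..real n} r *\<^sub>R s n r)" for n
    proof -
      have "indicator {- real n<..real n} r *\<^sub>R s n r = (\<Sum>y\<in>range (s n). indicator (s n -` {y} \<inter> {- real n<..real n}) r *\<^sub>R y)" for r
      proof -
        have "(\<Sum>y\<in>range (s n). indicator (s n -` {y} \<inter> {- real n<..real n}) r *\<^sub>R y)
            = (\<Sum>y\<in>range (s n). if y = s n r then indicator {- real n<..real n} r *\<^sub>R y else 0)"
          by (intro sum.cong refl) (auto simp: indicator_def)
        also have "\<dots> = indicator {- real n<..real n} r *\<^sub>R s n r"
          using simple_functionD(1)[OF s(1)[of n]] by (subst sum.delta) auto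
        finally show ?thesis by simp
      qed
      then have eq: "(\<lambda>r. indicator {- real n<..real n} r *\<^sub>R s n r) =
        (\<lambda>r. \<Sum>y\<in>range (s n). indicator (s n -` {y} \<inter> {- real n<..real n}) r *\<^sub>R y)" by (rule ext)
      show ?thesis
        unfolding eq
      proof (rule lag_recovered_sum[OF _ _ h])
        show "finite (range (s n))" using simple_functionD(1)[OF s(1)[of n]] by simp
        show "lag_recovered h (\<lambda>r. indicator (s n -` {y} \<inter> {- real n<..real n}) r *\<^sub>R y)" for y
          using simple_functionD(2)[OF s(1)[of n], of "{y}"] by (intro lag_recovered_bounded_set h lim) simp
      qed
    qed
    show "(\<lambda>n. indicator {- real n<..real n} r *\<^sub>R s n r) \<longlonglongrightarrow> f r" for r
    proof (rule Lim_transform_eventually[OF s(2)])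
      obtain N where N: "\<bar>r\<bar> < real N" using reals_Archimedean2 by blast
      show "eventually (\<lambda>n. s n r = indicator {- real n<..real n} r *\<^sub>R s n r) sequentially"
        using eventually_ge_at_top[of N]
      proof eventually_elim
        case (elim n)
        then have "r \<in> {- real n<..real n}" using N by auto
        then show ?case by simp
      qed
    qed
    show "norm (indicator {- real n<..real n} r *\<^sub>R s n r) \<le> 2 * norm (f r)" for n r
      using s(3)[of n r] by (auto simp: indicator_def)
  qed
  then show ?thesis by (simp add: lag_recovered_def)
qed

context brownian_basis
begin

section \<open>Existence of the Ito integral of a dominated process\<close>

text \<open>The limit is the pointwise limit along an almost surely convergent subsequence, which makes it
  measurable for \<open>F t\<close>. The subsequence is part of the result because exponential moments pass to the
  limit along it.\<close>

lemma mean_square_limit: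
  fixes S :: "nat \<Rightarrow> 'w \<Rightarrow> 'b::{banach,second_countable_topology}"
  assumes t: "t \<in> {0..T}" and S: "\<And>m. S m \<in> borel_measurable (F t)"
    and cauchy: "\<And>m n. sqn M (\<lambda>\<omega>. S m \<omega> - S n \<omega>) \<le> 2 * a m + 2 * a n" and a: "a \<longlonglongrightarrow> 0"
  obtains I r where "I \<in> borel_measurable (F t)" "(\<lambda>m. sqn M (\<lambda>\<omega>. I \<omega> - S m \<omega>)) \<longlonglongrightarrow> 0"
    "strict_mono (r :: nat \<Rightarrow> nat)" "AE \<omega> in M. (\<lambda>k. S (r k) \<omega>) \<longlonglongrightarrow> I \<omega>"
proof -
  have [measurable]: "S m \<in> borel_measurable M" for m using borel_measurable_F_M[OF S t] .
  have "\<exists>m>N. a m \<le> ennreal ((1/2) ^ k)" for k N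
  proof -
    have "eventually (\<lambda>m. a m < ennreal ((1/2) ^ k)) sequentially"
      using a by (rule order_tendstoD) simp
    then have "eventually (\<lambda>m. a m < ennreal ((1/2) ^ k) \<and> N < m) sequentially"
      using eventually_gt_at_top[of N] by (rule eventually_conj)
    then obtain m where "a m < ennreal ((1/2) ^ k) \<and> N < m"
      using eventually_happens'[OF sequentially_bot] by blast
    then show ?thesis by (intro exI[of _ m]) (simp add: less_imp_le)
  qed
  then have ex: "\<exists>m. N < m \<and> a m \<le> ennreal ((1/2) ^ k)" for k N .
  define g where "g = (\<lambda>k N. SOME m. N < m \<and> a m \<le> ennreal ((1/2) ^ k))"
  have g: "N < g k N" "a (g k N) \<le> ennreal ((1/2) ^ k)" for k N
    using someI_ex[OF ex[of N k]] unfolding g_def by simp_all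
  define r where "r = rec_nat (g 0 0) (\<lambda>k rk. g (Suc k) rk)"
  have r_Suc: "r (Suc k) = g (Suc k) (r k)" for k by (simp add: r_def)
  have r: "strict_mono r" by (rule strict_monoI_Suc) (simp add: r_Suc g)
  have ar: "a (r k) \<le> ennreal ((1/2) ^ k)" for k
  proof (cases k)
    case 0
    then show ?thesis using g(2)[of 0 0] by (simp add: r_def)
  next
    case (Suc n)
    show ?thesis unfolding Suc r_Suc by (rule g(2))
  qed
  have conv: "AE \<omega> in M. convergent (\<lambda>k. S (r k) \<omega>)"
  proof (rule AE_convergent_if_fast_Cauchy[where c = 3 and q = "1/2"])
    fix k
    have "sqn M (\<lambda>\<omega>. S (r (Suc k)) \<omega> - S (r k) \<omega>) \<le> 2 * a (r (Suc k)) + 2 * a (r k)" by (rule cauchy)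
    also have "\<dots> \<le> 2 * ennreal ((1/2) ^ Suc k) + 2 * ennreal ((1/2) ^ k)"
      by (intro add_mono mult_left_mono ar) auto
    also have "\<dots> = ennreal (2 * (1/2) ^ Suc k + 2 * (1/2) ^ k)"
    proof -
      have "2 * ennreal x + 2 * ennreal y = ennreal (2 * x + 2 * y)" if "0 \<le> x" "0 \<le> y" for x y
        using that by (simp add: ennreal_plus ennreal_mult)
      then show ?thesis by this simp_all
    qed
    also have "2 * (1/2) ^ Suc k + 2 * (1/2) ^ k = (3 * (1/2) ^ k :: real)" by simp
    finally show "sqn M (\<lambda>\<omega>. S (r (Suc k)) \<omega> - S (r k) \<omega>) \<le> ennreal (3 * (1/2) ^ k)" .
  qed auto
  define I where "I = (\<lambda>\<omega>. lim (\<lambda>k. S (r k) \<omega>))"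
  have I [measurable]: "I \<in> borel_measurable (F t)"
    unfolding I_def by (rule borel_measurable_lim_metric) (rule S)
  have [measurable]: "I \<in> borel_measurable M" using borel_measurable_F_M[OF I t] .
  have lim: "AE \<omega> in M. (\<lambda>k. S (r k) \<omega>) \<longlonglongrightarrow> I \<omega>"
    using conv unfolding I_def by eventually_elim (rule convergent_LIMSEQ_iff[THEN iffD1])
  have "sqn M (\<lambda>\<omega>. I \<omega> - S m \<omega>) \<le> 2 * a m" for m
  proof -
    have "sqn M (\<lambda>\<omega>. I \<omega> - S m \<omega>) \<le> liminf (\<lambda>k. sqn M (\<lambda>\<omega>. S (r k) \<omega> - S m \<omega>))"
    proof (rule sqn_le_liminf)
      show "AE \<omega> in M. (\<lambda>k. S (r k) \<omega> - S m \<omega>) \<longlonglongrightarrow> I \<omega> - S m \<omega>"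
        using lim by eventually_elim (intro tendsto_diff tendsto_const)
    qed measurable
    also have "\<dots> \<le> liminf (\<lambda>k. 2 * a (r k) + 2 * a m)"
      by (intro Liminf_mono always_eventually allI cauchy)
    also have "\<dots> = 2 * 0 + 2 * a m"
      by (intro lim_imp_Liminf tendsto_add tendsto_const ennreal_tendsto_cmult)
         (use LIMSEQ_subseq_LIMSEQ[OF a r] in \<open>auto simp: comp_def\<close>)
    finally show ?thesis by simp
  qed
  moreover have "(\<lambda>m. 2 * a m) \<longlonglongrightarrow> 0"
    using ennreal_tendsto_cmult[OF _ a, of 2] by simp
  ultimately have "(\<lambda>m. sqn M (\<lambda>\<omega>. I \<omega> - S m \<omega>)) \<longlonglongrightarrow> 0"
    using ennreal_tendsto_0_le[where y = "\<lambda>m. 2 * a m"] by simp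
  from that[OF I this r lim] show ?thesis .
qed

text \<open>On a uniform grid of \<open>{0..t}\<close> the integrand is replaced by its averages over the preceding cells. An
  average is measurable for the start of its cell only up to a null set, so \<open>adapted_time_integral\<close>
  supplies a version \<open>Z\<close>, whose components are clipped at the average \<open>B\<close> of the dominating function. By
  \<open>lag_average_tendsto\<close> and dominated convergence these simple processes converge to the integrand, and
  by the isometry their integrals converge. The clipping also yields the exponential moments: by
  Cauchy-Schwarz the sum of \<open>B\<^sup>2\<close> times the mesh is at most \<open>v\<close>, so \<open>simple_exponential_bound\<close> holds uniformly
  in the grid and survives the limit.\<close>

theorem has_ito_integral_exists:
  fixes f :: "real \<Rightarrow> 'w \<Rightarrow> real ^ 'n"
  assumes t: "t \<in> {0..T}"
    and f: "(\<lambda>(r, \<omega>). f r \<omega>) \<in> borel_measurable (restrict_space borel {0..t} \<Otimes>\<^sub>M M)"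
    and ad: "\<And>r. r \<in> {0..t} \<Longrightarrow> f r \<in> borel_measurable (F r)"
    and g: "g \<in> borel_measurable borel"
    and dom: "\<And>r \<omega>. r \<in> {0..t} \<Longrightarrow> \<omega> \<in> space M \<Longrightarrow> norm (f r \<omega>) \<le> g r"
    and v: "(\<integral>\<^sup>+r\<in>{0..t}. ennreal ((g r)\<^sup>2) \<partial>lborel) \<le> ennreal v" and v0: "0 \<le> v"
  shows "\<exists>I. has_ito_integral M F W t f I \<and>
    (\<forall>j l. (\<integral>\<^sup>+\<omega>. ennreal (exp (l * I \<omega> $ j)) \<partial>M) \<le> ennreal (exp (l\<^sup>2 * v / 2)))"
proof -
  define f0 where "f0 = (\<lambda>r \<omega>. indicator {0..t} r *\<^sub>R f r \<omega>)"
  define g0 where "g0 = (\<lambda>r. indicator {0..t} r * g r)"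
  have g0m [measurable]: "g0 \<in> borel_measurable borel" using g unfolding g0_def by measurable
  have f0m: "(\<lambda>(r, \<omega>). f0 r \<omega>) \<in> borel_measurable (borel \<Otimes>\<^sub>M M)"
    unfolding f0_def by (rule measurable_pair_restrict_iff[THEN iffD1, OF _ f]) simp
  then have f0m' [measurable]: "case_prod f0 \<in> borel_measurable (lborel \<Otimes>\<^sub>M M)"
    unfolding measurable_lborel_pair .
  have f0_le: "norm (f0 r \<omega>) \<le> g0 r" if "\<omega> \<in> space M" for r \<omega>
    using dom[of r \<omega>] that by (simp add: f0_def g0_def indicator_def)
  have g0_nonneg: "0 \<le> g0 r" for r
  proof -
    obtain \<omega> where "\<omega> \<in> space M" using not_empty by auto
    from order_trans[OF norm_ge_zero f0_le[OF this]] show ?thesis .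
  qed
  have g0_v: "sqn lborel g0 \<le> ennreal v"
  proof -
    have "sqn lborel g0 = (\<integral>\<^sup>+r\<in>{0..t}. ennreal ((g r)\<^sup>2) \<partial>lborel)"
      unfolding sqn_def g0_def by (intro nn_integral_cong) (auto simp: indicator_def)
    then show ?thesis using v by simp
  qed
  then have g0_fin: "sqn lborel g0 < \<infinity>" by (rule le_less_trans) simp
  have f0_sect [measurable]: "(\<lambda>r. f0 r \<omega>) \<in> borel_measurable borel" if "\<omega> \<in> space M" for \<omega>
    using measurable_compose[OF measurable_Pair2'[OF that] f0m'] by simp
  have f0_sqn: "sqn lborel (\<lambda>r. f0 r \<omega>) \<le> ennreal v" if "\<omega> \<in> space M" for \<omega>
    using f0_le[OF that] g0_nonneg
    by (intro order_trans[OF _ g0_v] sqn_mono) (simp add: abs_of_nonneg)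
  have f0_fin: "sqn (lborel \<Otimes>\<^sub>M M) (case_prod f0) \<le> ennreal v"
  proof -
    have "sqn (lborel \<Otimes>\<^sub>M M) (case_prod f0) = (\<integral>\<^sup>+\<omega>. sqn lborel (\<lambda>r. f0 r \<omega>) \<partial>M)"
      unfolding sqn_def by (subst lborel_M.nn_integral_snd[symmetric]) auto
    also have "\<dots> \<le> (\<integral>\<^sup>+\<omega>. ennreal v \<partial>M)" by (intro nn_integral_mono f0_sqn)
    finally show ?thesis by (simp add: emeasure_space_1)
  qed
  show ?thesis
  proof (cases "t = 0")
    case True
    have null: "(\<integral>\<^sup>+r\<in>{0..t}. k r \<partial>lborel) = 0" for k :: "real \<Rightarrow> ennreal"
    proof -
      have "(\<integral>\<^sup>+r\<in>{0..t}. k r \<partial>lborel) = (\<integral>\<^sup>+(r::real). 0 \<partial>lborel)"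
      proof (rule nn_integral_cong_AE, use AE_lborel_singleton[of 0] in eventually_elim)
        case (elim r)
        then show ?case using True by (simp add: indicator_def)
      qed
      then show ?thesis by simp
    qed
    have simple: "simple_ito M F W t (\<lambda>_ _. 0 :: real ^ 'n) (\<lambda>_. 0)"
      unfolding simple_ito_def
      by (rule exI[of _ 0], rule exI[of _ "\<lambda>_. 0"], rule exI[of _ "\<lambda>_ _. 0"]) (simp add: True)
    have "has_ito_integral M F W t f (\<lambda>_. 0)"
      unfolding has_ito_integral_def
      by (intro conjI ballI exI[of _ "\<lambda>_ _ _. 0"] exI[of _ "\<lambda>_ _. 0"] allI simple f ad)
         (simp_all add: null Xi_def)
    then show ?thesis
      using v0 by (intro exI[of _ "\<lambda>_. 0"]) (simp add: emeasure_space_1)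
  next
    case False
    then have t0: "0 < t" using t by simp
    define h where "h = (\<lambda>m. t / real (Suc m))"
    have h: "0 < h m" for m using t0 by (simp add: h_def)
    have h_lim: "h \<longlonglongrightarrow> 0"
      unfolding h_def using tendsto_mult[OF tendsto_const[of t] LIMSEQ_inverse_real_of_nat] by (simp add: divide_inverse)
    define \<tau> where "\<tau> = (\<lambda>m i. real i * h m)"
    have \<tau>: "0 \<le> \<tau> m i" "\<tau> m i \<le> \<tau> m (Suc i)" "\<tau> m (Suc m) = t" for m i
      using h[of m] t0 by (auto simp: \<tau>_def h_def field_simps)
    have \<tau>_t: "\<tau> m i \<le> t" if "i \<le> Suc m" for m i
    proof -
      have "\<tau> m i \<le> \<tau> m (Suc m)" unfolding \<tau>_def using that h[of m] by (intro mult_right_mono) auto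
      then show ?thesis by (simp add: \<tau>(3))
    qed
    \<comment> \<open>The density of averaging over cell \<open>i\<close>. Cell \<open>0\<close> lies to the left of \<open>0\<close>, where \<open>f0\<close> vanishes up to one point.\<close>
    define c :: "nat \<Rightarrow> nat \<Rightarrow> real \<Rightarrow> real" where "c = (\<lambda>m i s. indicator {s. \<lceil>s / h m\<rceil> = int i} s / h m)"
    have cm [measurable]: "c m i \<in> borel_measurable borel" for m i
      using cell_measurable[OF h[of m], of "int i"] unfolding c_def by measurable
    have c_nonneg: "0 \<le> c m i s" for m i s using h[of m] by (simp add: c_def)
    have c_int: "(\<integral>\<^sup>+s. ennreal (c m i s) \<partial>lborel) = 1" for m i
      unfolding c_def by (rule nn_integral_cell[OF h])
    define B where "B = (\<lambda>m i. \<integral>s. c m i s *\<^sub>R g0 s \<partial>lborel)"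
    have gi: "integrable lborel (\<lambda>s. c m i s *\<^sub>R g0 s)" for m i
      unfolding c_def by (rule integrable_lag_average[OF _ g0_fin h]) simp
    have B0: "0 \<le> B m i" for m i
      unfolding B_def using c_nonneg g0_nonneg by (intro Bochner_Integration.integral_nonneg) auto
    have fi: "integrable lborel (\<lambda>s. c m i s *\<^sub>R f0 s \<omega>)" if "\<omega> \<in> space M" for m i \<omega>
    proof (rule Bochner_Integration.integrable_bound[OF gi])
      show "(\<lambda>s. c m i s *\<^sub>R f0 s \<omega>) \<in> borel_measurable lborel" using f0_sect[OF that] by simp
      show "AE s in lborel. norm (c m i s *\<^sub>R f0 s \<omega>) \<le> norm (c m i s *\<^sub>R g0 s)"
        using f0_le[OF that] c_nonneg g0_nonneg by (intro AE_I2) (simp add: mult_left_mono)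
    qed
    have fB: "norm (\<integral>s. c m i s *\<^sub>R f0 s \<omega> \<partial>lborel) \<le> B m i" if "\<omega> \<in> space M" for m i \<omega>
    proof -
      have "norm (\<integral>s. c m i s *\<^sub>R f0 s \<omega> \<partial>lborel) \<le> (\<integral>s. norm (c m i s *\<^sub>R f0 s \<omega>) \<partial>lborel)"
        by (rule integral_norm_bound)
      also have "\<dots> \<le> B m i"
        unfolding B_def using f0_le[OF that] c_nonneg g0_nonneg
        by (intro integral_mono integrable_norm fi that gi) (simp add: mult_left_mono)
      finally show ?thesis .
    qed
    have cell_bound: "s \<le> \<tau> m i" if "\<lceil>s / h m\<rceil> = int i" for s m i
      using that cell_eq[OF h[of m], of "int i"] by (auto simp: \<tau>_def)
    have version: "\<exists>Z\<in>borel_measurable (F (\<tau> m i)). AE \<omega> in M. Z \<omega> = (\<integral>s. c m i s *\<^sub>R f0 s \<omega> \<partial>lborel)"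
      if i: "i \<le> m" for m i
    proof (rule adapted_time_integral)
      show "\<tau> m i \<in> {0..T}" using \<tau>(1)[of m i] \<tau>_t[of i m] i t by auto
      show "integrable (lborel \<Otimes>\<^sub>M M) (\<lambda>(s, \<omega>). c m i s *\<^sub>R f0 s \<omega>)"
      proof (rule integrableI_bounded)
        have "(\<integral>\<^sup>+x. ennreal (norm (case x of (s, \<omega>) \<Rightarrow> c m i s *\<^sub>R f0 s \<omega>)) \<partial>(lborel \<Otimes>\<^sub>M M)) =
          (\<integral>\<^sup>+\<omega>. (\<integral>\<^sup>+s. ennreal (norm (c m i s *\<^sub>R f0 s \<omega>)) \<partial>lborel) \<partial>M)"
          by (subst lborel_M.nn_integral_snd[symmetric]) auto
        also have "\<dots> \<le> (\<integral>\<^sup>+\<omega>. (\<integral>\<^sup>+s. ennreal (norm (c m i s *\<^sub>R g0 s)) \<partial>lborel) \<partial>M)"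
          using f0_le c_nonneg g0_nonneg
          by (intro nn_integral_mono ennreal_leI) (simp add: mult_left_mono)
        also have "\<dots> = (\<integral>\<^sup>+s. ennreal (norm (c m i s *\<^sub>R g0 s)) \<partial>lborel)"
          by (simp add: emeasure_space_1)
        also have "\<dots> < \<infinity>" using gi[of m i] unfolding integrable_iff_bounded by simp
        finally show "(\<integral>\<^sup>+x. ennreal (norm (case x of (s, \<omega>) \<Rightarrow> c m i s *\<^sub>R f0 s \<omega>)) \<partial>(lborel \<Otimes>\<^sub>M M)) < \<infinity>" .
      qed measurable
      show "(\<lambda>\<omega>. c m i s *\<^sub>R f0 s \<omega>) \<in> borel_measurable (F (\<tau> m i))" for s
      proof (cases "s \<in> {0..t} \<and> \<lceil>s / h m\<rceil> = int i")
        case True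
        then have "f s \<in> borel_measurable (F s)" using ad by blast
        then have "f s \<in> borel_measurable (F (\<tau> m i))"
          by (rule borel_measurable_F_mono) (use True cell_bound[of s m i] \<tau>_t[of i m] i t in auto)
        then show ?thesis unfolding f0_def by (intro borel_measurable_scaleR borel_measurable_const)
      next
        case False
        then have z: "(\<lambda>\<omega>. c m i s *\<^sub>R f0 s \<omega>) = (\<lambda>_. 0)"
          by (intro ext) (auto simp: c_def f0_def indicator_def)
        show ?thesis unfolding z by simp
      qed
    qed
    then have ex: "\<exists>Z. Z \<in> borel_measurable (F (\<tau> m i)) \<and> (AE \<omega> in M. Z \<omega> = (\<integral>s. c m i s *\<^sub>R f0 s \<omega> \<partial>lborel))"
      if "i \<le> m" for m i using that by (simp only: Bex_def)
    define Z where "Z = (\<lambda>m i. SOME Z. Z \<in> borel_measurable (F (\<tau> m i)) \<and> (AE \<omega> in M. Z \<omega> = (\<integral>s. c m i s *\<^sub>R f0 s \<omega> \<partial>lborel)))"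
    have Z: "Z m i \<in> borel_measurable (F (\<tau> m i))" "AE \<omega> in M. Z m i \<omega> = (\<integral>s. c m i s *\<^sub>R f0 s \<omega> \<partial>lborel)"
      if "i \<le> m" for m i
      using someI_ex[OF ex[OF that]] unfolding Z_def by simp_all
    \<comment> \<open>By \<open>fB\<close> the clipping changes nothing almost surely, but it bounds the coefficients everywhere.\<close>
    define \<xi> :: "nat \<Rightarrow> nat \<Rightarrow> 'w \<Rightarrow> real ^ 'n" where "\<xi> = (\<lambda>m i \<omega>. \<chi> j. max (- B m i) (min (B m i) (Z m i \<omega> $ j)))"
    have \<xi>_bound: "\<bar>\<xi> m i \<omega> $ j\<bar> \<le> B m i" for m i \<omega> j
      using B0[of m i] by (simp add: \<xi>_def)
    have \<xi>_F: "\<xi> m i \<in> borel_measurable (F (\<tau> m i))" if "i \<le> m" for m i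
    proof -
      have "(\<lambda>\<omega>. Z m i \<omega> $ j) \<in> borel_measurable (F (\<tau> m i))" for j
        using Z(1)[OF that] by (simp add: borel_measurable_vec_iff)
      then show ?thesis
        by (simp add: borel_measurable_vec_iff \<xi>_def)
    qed
    have \<xi>_bdd: "bounded (\<xi> m i ` space M)" for m i
    proof -
      have "norm (\<xi> m i \<omega>) \<le> (\<Sum>j\<in>(UNIV :: 'n set). B m i)" for \<omega>
      proof -
        have "norm (\<xi> m i \<omega>) \<le> (\<Sum>j\<in>(UNIV :: 'n set). \<bar>\<xi> m i \<omega> $ j\<bar>)" by (rule norm_le_l1_cart)
        also have "\<dots> \<le> (\<Sum>j\<in>(UNIV :: 'n set). B m i)" by (intro sum_mono \<xi>_bound)
        finally show ?thesis .
      qed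
      then show ?thesis by (auto simp: bounded_iff)
    qed
    have \<xi>_AE: "AE \<omega> in M. \<xi> m i \<omega> = (\<integral>s. c m i s *\<^sub>R f0 s \<omega> \<partial>lborel)" if "i \<le> m" for m i
      using Z(2)[OF that] AE_space
    proof eventually_elim
      case (elim \<omega>)
      show ?case
        unfolding vec_eq_iff
      proof
        fix j
        have "\<bar>(\<integral>s. c m i s *\<^sub>R f0 s \<omega> \<partial>lborel) $ j\<bar> \<le> B m i"
          by (rule order_trans[OF component_le_norm_cart fB[OF elim(2)]])
        then show "\<xi> m i \<omega> $ j = (\<integral>s. c m i s *\<^sub>R f0 s \<omega> \<partial>lborel) $ j"
          unfolding \<xi>_def elim(1) by (simp add: abs_le_iff)
      qed
    qed
    define \<phi> where "\<phi> = (\<lambda>m r \<omega>. \<Sum>i<Suc m. indicator {\<tau> m i<..\<tau> m (Suc i)} r *\<^sub>R \<xi> m i \<omega>)"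
    define S where "S = (\<lambda>m \<omega>. \<Sum>i<Suc m. (W (\<tau> m (Suc i)) \<omega> - W (\<tau> m i) \<omega>) *\<^sub>R \<xi> m i \<omega>)"
    have simple: "simple_ito M F W t (\<phi> m) (S m)" for m
      unfolding simple_ito_def
      by (rule exI[of _ "Suc m"], rule exI[of _ "\<tau> m"], rule exI[of _ "\<xi> m"])
         (intro conjI allI impI \<tau>(1,2) \<xi>_F \<xi>_bdd; simp add: \<tau>(3) \<phi>_def S_def)
    have el: "elementary (\<phi> m) (S m)" for m by (rule simple_ito_elementary(1)[OF simple t])
    note [measurable] = elementary_regular(1,3)[OF el]
    have \<phi>_val: "\<phi> m r \<omega> = \<xi> m i \<omega>" if i: "i \<le> m" and r: "\<lceil>r / h m\<rceil> = int i + 1" for m r \<omega> i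
    proof -
      have "indicator {\<tau> m k<..\<tau> m (Suc k)} r = (if k = i then 1 else 0 :: real)" for k
      proof -
        have "{\<tau> m k<..\<tau> m (Suc k)} = {s. \<lceil>s / h m\<rceil> = int k + 1}"
          using cell_eq[OF h[of m], of "int k + 1"] by (simp add: \<tau>_def add.commute)
        then show ?thesis using r by (auto simp: indicator_def)
      qed
      then have "\<phi> m r \<omega> = (\<Sum>k<Suc m. if k = i then \<xi> m k \<omega> else 0)"
        unfolding \<phi>_def by (intro sum.cong) auto
      then show ?thesis using i by simp
    qed
    define a where "a = (\<lambda>m. sqn (lborel \<Otimes>\<^sub>M M) (\<lambda>(r, \<omega>). f0 r \<omega> - \<phi> m r \<omega>))"
    have sect_le: "AE \<omega> in M. sqn lborel (\<lambda>r. f0 r \<omega> - \<phi> m r \<omega>) \<le> sqn lborel (\<lambda>r. lag_average (h m) (\<lambda>r. f0 r \<omega>) r - f0 r \<omega>)" for m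
    proof -
      have "AE \<omega> in M. \<forall>i\<in>{..m}. \<xi> m i \<omega> = (\<integral>s. c m i s *\<^sub>R f0 s \<omega> \<partial>lborel)"
        using \<xi>_AE by (intro AE_finite_allI) auto
      then show ?thesis
      proof eventually_elim
        case (elim \<omega>)
        have "ennreal ((norm (f0 r \<omega> - \<phi> m r \<omega>))\<^sup>2) \<le> ennreal ((norm (lag_average (h m) (\<lambda>r. f0 r \<omega>) r - f0 r \<omega>))\<^sup>2)"
          if r0: "r \<noteq> 0" for r
        proof (cases "r \<in> {0<..t}")
          case True
          define i where "i = nat (\<lceil>r / h m\<rceil> - 1)"
          have "0 < r / h m" using True h[of m] by simp
          then have i1: "\<lceil>r / h m\<rceil> = int i + 1" unfolding i_def by linarith
          have "r / h m \<le> real (Suc m)"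
          proof -
            have "r * real (Suc m) \<le> t * real (Suc m)" using True by (intro mult_right_mono) auto
            then show ?thesis using t0 by (simp add: h_def divide_le_eq)
          qed
          then have "\<lceil>r / h m\<rceil> \<le> int (Suc m)" by (simp add: ceiling_le_iff)
          then have im: "i \<le> m" using i1 by simp
          have "\<phi> m r \<omega> = \<xi> m i \<omega>" by (rule \<phi>_val[OF im i1])
          also have "\<dots> = (\<integral>s. c m i s *\<^sub>R f0 s \<omega> \<partial>lborel)" using elim im by simp
          also have "\<dots> = lag_average (h m) (\<lambda>r. f0 r \<omega>) r" by (simp add: lag_average_def c_def i1)
          finally show ?thesis by (simp add: norm_minus_commute)
        next
          case False
          then have "r \<notin> {0..t}" using r0 by auto
          then have "f0 r \<omega> = 0" "\<phi> m r \<omega> = 0" using simple_ito_elementary(2)[OF simple t, of r m] by (auto simp: f0_def)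
          then show ?thesis by simp
        qed
        then show ?case
          unfolding sqn_def by (intro nn_integral_mono_AE eventually_mono[OF AE_lborel_singleton[of 0]]) blast
      qed
    qed
    have a_lim: "a \<longlonglongrightarrow> 0"
    proof -
      define D where "D = (\<lambda>m \<omega>. sqn lborel (\<lambda>r. f0 r \<omega> - \<phi> m r \<omega>))"
      have Dm [measurable]: "D m \<in> borel_measurable M" for m unfolding D_def sqn_def by measurable
      have a_D: "a m = (\<integral>\<^sup>+\<omega>. D m \<omega> \<partial>M)" for m
        unfolding a_def D_def sqn_def by (subst lborel_M.nn_integral_snd[symmetric]) (auto simp: split_beta')
      have "(\<lambda>m. \<integral>\<^sup>+\<omega>. D m \<omega> \<partial>M) \<longlonglongrightarrow> (\<integral>\<^sup>+\<omega>. 0 \<partial>M)"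
      proof (rule nn_integral_dominated_convergence[where u = D and u' = "\<lambda>_. 0" and w = "\<lambda>_. 4 * ennreal v"])
        show "AE \<omega> in M. D m \<omega> \<le> 4 * ennreal v" for m
          using sect_le[of m] AE_space
        proof eventually_elim
          case (elim \<omega>)
          note [measurable] = f0_sect[OF elim(2)] borel_measurable_lag_average
          have "D m \<omega> \<le> sqn lborel (\<lambda>r. lag_average (h m) (\<lambda>r. f0 r \<omega>) r - f0 r \<omega>)" using elim by (simp add: D_def)
          also have "\<dots> \<le> 2 * sqn lborel (lag_average (h m) (\<lambda>r. f0 r \<omega>)) + 2 * sqn lborel (\<lambda>r. f0 r \<omega>)"
            by (rule sqn_diff) auto
          also have "\<dots> \<le> 2 * ennreal v + 2 * ennreal v"
            by (intro add_mono mult_left_mono order_trans[OF sqn_lag_average_le[OF f0_sect[OF elim(2)] h] f0_sqn[OF elim(2)]] f0_sqn[OF elim(2)]) auto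
          also have "\<dots> = (2 + 2) * ennreal v" by (simp only: distrib_right)
          finally show ?case by simp
        qed
        show "(\<integral>\<^sup>+\<omega>. 4 * ennreal v \<partial>M) < \<infinity>" by (simp add: emeasure_space_1 ennreal_mult_less_top)
        show "AE \<omega> in M. (\<lambda>m. D m \<omega>) \<longlonglongrightarrow> 0"
        proof -
          have "AE \<omega> in M. \<forall>m. D m \<omega> \<le> sqn lborel (\<lambda>r. lag_average (h m) (\<lambda>r. f0 r \<omega>) r - f0 r \<omega>)"
            unfolding AE_all_countable D_def by (intro allI sect_le)
          then show ?thesis using AE_space
          proof eventually_elim
            case (elim \<omega>)
            have "sqn lborel (\<lambda>r. f0 r \<omega>) < \<infinity>" using f0_sqn[OF elim(2)] by (rule le_less_trans) simp
            from lag_average_tendsto[OF f0_sect[OF elim(2)] this h h_lim]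
            show ?case by (rule ennreal_tendsto_0_le) (rule elim(1)[rule_format])
          qed
        qed
      qed auto
      moreover have "a = (\<lambda>m. \<integral>\<^sup>+\<omega>. D m \<omega> \<partial>M)" by (rule ext) (rule a_D)
      ultimately show ?thesis by simp
    qed
    have SF: "S m \<in> borel_measurable (F t)" for m
      unfolding S_def
    proof (intro borel_measurable_sum borel_measurable_scaleR borel_measurable_diff)
      fix i assume "i \<in> {..<Suc m}"
      then have i: "i \<le> m" by simp
      have o: "0 \<le> \<tau> m i" "\<tau> m i \<le> t" "0 \<le> \<tau> m (Suc i)" "\<tau> m (Suc i) \<le> t"
        using \<tau>(1) \<tau>_t[of i m] \<tau>_t[of "Suc i" m] i by auto
      show "W (\<tau> m (Suc i)) \<in> borel_measurable (F t)" "W (\<tau> m i) \<in> borel_measurable (F t)"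
        using borel_measurable_W_F o t by auto
      show "\<xi> m i \<in> borel_measurable (F t)"
        using borel_measurable_F_mono[OF \<xi>_F[OF i]] o t by auto
    qed
    have cauchy: "sqn M (\<lambda>\<omega>. S m \<omega> - S k \<omega>) \<le> 2 * a m + 2 * a k" for m k
    proof -
      have "sqn M (\<lambda>\<omega>. S m \<omega> - S k \<omega>) = sqn (lborel \<Otimes>\<^sub>M M) (case_prod (\<lambda>r \<omega>. \<phi> m r \<omega> - \<phi> k r \<omega>))"
        by (rule elementary_isometry[OF elementary_diff[OF el el]])
      also have "\<dots> \<le> 2 * sqn (lborel \<Otimes>\<^sub>M M) (\<lambda>x. case_prod (\<phi> m) x - case_prod f0 x) + 2 * sqn (lborel \<Otimes>\<^sub>M M) (\<lambda>x. case_prod f0 x - case_prod (\<phi> k) x)"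
        using sqn_triangle[of "case_prod (\<phi> m)" "lborel \<Otimes>\<^sub>M M" "case_prod f0" "case_prod (\<phi> k)"]
        by (simp add: split_beta')
      also have "sqn (lborel \<Otimes>\<^sub>M M) (\<lambda>x. case_prod (\<phi> m) x - case_prod f0 x) = a m"
        by (subst sqn_minus_commute) (simp add: a_def split_beta')
      also have "sqn (lborel \<Otimes>\<^sub>M M) (\<lambda>x. case_prod f0 x - case_prod (\<phi> k) x) = a k"
        by (simp add: a_def split_beta')
      finally show ?thesis .
    qed
    from mean_square_limit[OF t SF cauchy a_lim]
    obtain I \<rho> where I: "I \<in> borel_measurable (F t)" "(\<lambda>m. sqn M (\<lambda>\<omega>. I \<omega> - S m \<omega>)) \<longlonglongrightarrow> 0"
      "strict_mono (\<rho> :: nat \<Rightarrow> nat)" "AE \<omega> in M. (\<lambda>k. S (\<rho> k) \<omega>) \<longlonglongrightarrow> I \<omega>" .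
    have IM [measurable]: "I \<in> borel_measurable M" using borel_measurable_F_M[OF I(1) t] .
    have a_eq: "a m = (\<integral>\<^sup>+\<omega>. (\<integral>\<^sup>+r\<in>{0..t}. ennreal ((norm (f r \<omega> - \<phi> m r \<omega>))\<^sup>2) \<partial>lborel) \<partial>M)" for m
    proof -
      have eq: "(\<lambda>(r, \<omega>). f0 r \<omega> - \<phi> m r \<omega>) = (\<lambda>(r, \<omega>). indicator {0..t} r *\<^sub>R (f r \<omega> - \<phi> m r \<omega>))"
      proof (intro ext, clarify)
        fix r \<omega>
        show "f0 r \<omega> - \<phi> m r \<omega> = indicator {0..t} r *\<^sub>R (f r \<omega> - \<phi> m r \<omega>)"
          using simple_ito_elementary(2)[OF simple t, of r m \<omega>] by (cases "r \<in> {0..t}") (auto simp: f0_def)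
      qed
      have "(\<lambda>(r, \<omega>). f0 r \<omega> - \<phi> m r \<omega>) \<in> borel_measurable (lborel \<Otimes>\<^sub>M M)" by measurable
      then show ?thesis unfolding a_def eq by (rule nn_integral_pair_indicator)
    qed
    have I_fin: "sqn M I < \<infinity>"
    proof -
      have "eventually (\<lambda>m. sqn M (\<lambda>\<omega>. I \<omega> - S m \<omega>) < 1) sequentially"
        using I(2) by (rule order_tendstoD) simp
      then obtain m where m: "sqn M (\<lambda>\<omega>. I \<omega> - S m \<omega>) < 1"
        using eventually_happens'[OF sequentially_bot] by blast
      have Sm: "sqn M (S m) < \<infinity>"
        using elementary_regular(2)[OF el[of m]] sqn_finite_iff[of "S m" M] by simp
      have "sqn M I \<le> 2 * sqn M (\<lambda>\<omega>. I \<omega> - S m \<omega>) + 2 * sqn M (S m)"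
        using sqn_add[of "\<lambda>\<omega>. I \<omega> - S m \<omega>" M "S m"] by simp
      also have "\<dots> < \<infinity>"
        using m Sm order_less_trans[OF m ennreal_one_less_top] by (auto simp: ennreal_mult_less_top)
      finally show ?thesis .
    qed
    have "has_ito_integral M F W t f I"
      unfolding has_ito_integral_def
    proof (intro conjI ballI exI[of _ \<phi>] exI[of _ S] allI)
      show "(\<integral>\<^sup>+\<omega>. (\<integral>\<^sup>+r\<in>{0..t}. ennreal ((norm (f r \<omega>))\<^sup>2) \<partial>lborel) \<partial>M) < \<infinity>"
        using nn_integral_pair_indicator[of "{0..t}" f] f0m' f0_fin
        by (simp add: f0_def[abs_def] le_less_trans[OF _ ennreal_less_top])
      show "I \<in> Xi M F t" using I(1) I_fin sqn_finite_iff[of I M] by (simp add: Xi_def)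
      show "(\<lambda>m. \<integral>\<^sup>+\<omega>. ennreal ((norm (I \<omega> - S m \<omega>))\<^sup>2) \<partial>M) \<longlonglongrightarrow> 0" using I(2) by (simp add: sqn_def)
      show "(\<lambda>m. \<integral>\<^sup>+\<omega>. (\<integral>\<^sup>+r\<in>{0..t}. ennreal ((norm (f r \<omega> - \<phi> m r \<omega>))\<^sup>2) \<partial>lborel) \<partial>M) \<longlonglongrightarrow> 0"
        using a_lim unfolding a_eq[symmetric] .
    qed (use f ad simple in auto)
    moreover have "(\<integral>\<^sup>+\<omega>. ennreal (exp (l * I \<omega> $ j)) \<partial>M) \<le> ennreal (exp (l\<^sup>2 * v / 2))" for l j
    proof -
      \<comment> \<open>Cauchy-Schwarz on each cell; the cells are disjoint.\<close>
      have B_sum: "(\<Sum>i<Suc m. (B m i)\<^sup>2 * (\<tau> m (Suc i) - \<tau> m i)) \<le> v" for m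
      proof -
        have "ennreal ((B m i)\<^sup>2 * h m) \<le> (\<integral>\<^sup>+s. indicator {s. \<lceil>s / h m\<rceil> = int i} s * ennreal ((norm (g0 s))\<^sup>2) \<partial>lborel)" for i
        proof -
          have "ennreal ((norm (B m i))\<^sup>2) \<le> (\<integral>\<^sup>+s. ennreal (c m i s) \<partial>lborel) * (\<integral>\<^sup>+s. ennreal (c m i s) * ennreal ((norm (g0 s))\<^sup>2) \<partial>lborel)"
            unfolding B_def by (rule norm_integral_weight_sq_le) (auto simp: c_nonneg)
          then have "ennreal ((B m i)\<^sup>2) \<le> (\<integral>\<^sup>+s. ennreal (c m i s) * ennreal ((norm (g0 s))\<^sup>2) \<partial>lborel)"
            by (simp add: c_int)
          then have "ennreal (h m) * ennreal ((B m i)\<^sup>2) \<le> ennreal (h m) * (\<integral>\<^sup>+s. ennreal (c m i s) * ennreal ((norm (g0 s))\<^sup>2) \<partial>lborel)"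
            by (rule mult_left_mono) simp
          also have "\<dots> = (\<integral>\<^sup>+s. ennreal (h m) * (ennreal (c m i s) * ennreal ((norm (g0 s))\<^sup>2)) \<partial>lborel)"
            by (rule nn_integral_cmult[symmetric]) simp
          also have "\<dots> = (\<integral>\<^sup>+s. indicator {s. \<lceil>s / h m\<rceil> = int i} s * ennreal ((norm (g0 s))\<^sup>2) \<partial>lborel)"
            using h[of m] by (intro nn_integral_cong) (auto simp: c_def indicator_def ennreal_mult[symmetric])
          finally show ?thesis using h[of m] by (simp add: ennreal_mult mult.commute)
        qed
        then have "(\<Sum>i<Suc m. ennreal ((B m i)\<^sup>2 * h m)) \<le> (\<Sum>i<Suc m. \<integral>\<^sup>+s. indicator {s. \<lceil>s / h m\<rceil> = int i} s * ennreal ((norm (g0 s))\<^sup>2) \<partial>lborel)"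
          by (rule sum_mono)
        also have "\<dots> = (\<integral>\<^sup>+s. (\<Sum>i<Suc m. indicator {s. \<lceil>s / h m\<rceil> = int i} s * ennreal ((norm (g0 s))\<^sup>2)) \<partial>lborel)"
          using cell_measurable[OF h[of m]] by (intro nn_integral_sum[symmetric]) measurable
        also have "\<dots> \<le> sqn lborel g0"
          unfolding sqn_def
        proof (intro nn_integral_mono)
          fix s
          have "(\<Sum>i<Suc m. indicator {s. \<lceil>s / h m\<rceil> = int i} s) \<le> (1::ennreal)"
          proof (cases "\<exists>i<Suc m. \<lceil>s / h m\<rceil> = int i")
            case True
            then obtain i where "i < Suc m" "\<lceil>s / h m\<rceil> = int i" by blast
            then have "(\<Sum>k<Suc m. indicator {s. \<lceil>s / h m\<rceil> = int k} s) = (\<Sum>k<Suc m. if k = i then 1 else 0 :: ennreal)"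
              by (intro sum.cong) (auto simp: indicator_def)
            then show ?thesis using \<open>i < Suc m\<close> by simp
          next
            case False
            then have "(\<Sum>k<Suc m. indicator {s. \<lceil>s / h m\<rceil> = int k} s) = (0::ennreal)"
              by (intro sum.neutral) (auto simp: indicator_def)
            then show ?thesis by simp
          qed
          from mult_right_mono[OF this zero_le, of "ennreal ((norm (g0 s))\<^sup>2)"]
          show "(\<Sum>i<Suc m. indicator {s. \<lceil>s / h m\<rceil> = int i} s * ennreal ((norm (g0 s))\<^sup>2)) \<le> ennreal ((norm (g0 s))\<^sup>2)"
            by (simp only: sum_distrib_right mult_1)
        qed
        also have "\<dots> \<le> ennreal v" by (rule g0_v)
        finally have "ennreal (\<Sum>i<Suc m. (B m i)\<^sup>2 * h m) \<le> ennreal v"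
          using h[of m] by (subst sum_ennreal[symmetric]) simp_all
        then have "(\<Sum>i<Suc m. (B m i)\<^sup>2 * h m) \<le> v" by (simp only: ennreal_le_iff[OF v0])
        moreover have "\<tau> m (Suc i) - \<tau> m i = h m" for i by (simp add: \<tau>_def algebra_simps)
        ultimately show ?thesis by simp
      qed
      have exp_S: "(\<integral>\<^sup>+\<omega>. ennreal (exp (l * S m \<omega> $ j)) \<partial>M) \<le> ennreal (exp (l\<^sup>2 * v / 2))" for m
      proof -
        have "l * S m \<omega> $ j = (\<Sum>i<Suc m. (W (\<tau> m (Suc i)) \<omega> - W (\<tau> m i) \<omega>) * (l * \<xi> m i \<omega> $ j))" for \<omega>
          unfolding S_def sum_component sum_distrib_left by (intro sum.cong) (auto simp: algebra_simps)
        then have "(\<integral>\<^sup>+\<omega>. ennreal (exp (l * S m \<omega> $ j)) \<partial>M) =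
          (\<integral>\<^sup>+\<omega>. ennreal (exp (\<Sum>i<Suc m. (W (\<tau> m (Suc i)) \<omega> - W (\<tau> m i) \<omega>) * (l * \<xi> m i \<omega> $ j))) \<partial>M)" by simp
        also have "\<dots> \<le> ennreal (exp ((\<Sum>i<Suc m. (\<bar>l\<bar> * B m i)\<^sup>2 * (\<tau> m (Suc i) - \<tau> m i)) / 2))"
        proof (rule simple_exponential_bound[where \<tau> = "\<tau> m" and c = "\<lambda>i. \<bar>l\<bar> * B m i" and \<xi> = "\<lambda>i \<omega>. l * \<xi> m i \<omega> $ j"])
          show "(\<lambda>\<omega>. l * \<xi> m i \<omega> $ j) \<in> borel_measurable (F (\<tau> m i))" if "i < Suc m" for i
          proof -
            have "(\<lambda>\<omega>. \<xi> m i \<omega> $ j) \<in> borel_measurable (F (\<tau> m i))"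
              using \<xi>_F[of i m] that by (simp add: borel_measurable_vec_iff)
            then show ?thesis by (intro borel_measurable_times borel_measurable_const)
          qed
          show "\<bar>l * \<xi> m i \<omega> $ j\<bar> \<le> \<bar>l\<bar> * B m i" for i \<omega>
            unfolding abs_mult by (intro mult_left_mono \<xi>_bound) simp
        qed (use \<tau> t in auto)
        also have "\<dots> \<le> ennreal (exp (l\<^sup>2 * v / 2))"
        proof -
          have "(\<Sum>i<Suc m. (\<bar>l\<bar> * B m i)\<^sup>2 * (\<tau> m (Suc i) - \<tau> m i)) = l\<^sup>2 * (\<Sum>i<Suc m. (B m i)\<^sup>2 * (\<tau> m (Suc i) - \<tau> m i))"
            unfolding sum_distrib_left by (intro sum.cong) (auto simp: power_mult_distrib)
          also have "\<dots> \<le> l\<^sup>2 * v" by (rule mult_left_mono[OF B_sum]) simp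
          finally show ?thesis by (intro ennreal_leI) (simp del: sum.lessThan_Suc)
        qed
        finally show ?thesis .
      qed
      have [measurable]: "(\<lambda>\<omega>. S k \<omega> $ j) \<in> borel_measurable M" for k
        using elementary_regular(1)[OF el[of k]] by (simp add: borel_measurable_vec_iff)
      have "(\<integral>\<^sup>+\<omega>. ennreal (exp (l * I \<omega> $ j)) \<partial>M) = (\<integral>\<^sup>+\<omega>. liminf (\<lambda>k. ennreal (exp (l * S (\<rho> k) \<omega> $ j))) \<partial>M)"
      proof (rule nn_integral_cong_AE, use I(4) in eventually_elim)
        case (elim \<omega>)
        then have "(\<lambda>k. ennreal (exp (l * S (\<rho> k) \<omega> $ j))) \<longlonglongrightarrow> ennreal (exp (l * I \<omega> $ j))"
          by (intro tendsto_ennrealI tendsto_exp tendsto_mult tendsto_const tendsto_vec_nth)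
        then show ?case by (intro lim_imp_Liminf[symmetric]) auto
      qed
      also have "\<dots> \<le> liminf (\<lambda>k. \<integral>\<^sup>+\<omega>. ennreal (exp (l * S (\<rho> k) \<omega> $ j)) \<partial>M)"
        by (rule nn_integral_liminf) measurable
      also have "\<dots> \<le> liminf (\<lambda>k. ennreal (exp (l\<^sup>2 * v / 2)))"
        by (intro Liminf_mono always_eventually allI exp_S)
      also have "\<dots> = ennreal (exp (l\<^sup>2 * v / 2))" by (simp add: Liminf_const)
      finally show ?thesis .
    qed
    ultimately show ?thesis by blast
  qed
qed

end

section \<open>Weakly singular kernels\<close>

lemma nn_integral_kernel:
  fixes a b \<gamma> :: real
  assumes \<gamma>: "0 < \<gamma>" and ab: "a \<le> b"
  shows "(\<integral>\<^sup>+r\<in>{a..b}. ennreal ((b - r) powr (\<gamma> - 1)) \<partial>lborel) = ennreal ((b - a) powr \<gamma> / \<gamma>)"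
proof -
  have "((\<lambda>x. x powr (\<gamma> - 1)) has_integral ((b - a) powr (\<gamma> - 1 + 1) / (\<gamma> - 1 + 1))) {0..b - a}"
    using \<gamma> ab by (intro has_integral_powr_from_0) auto
  then have "(\<integral>\<^sup>+x. ennreal (indicator {0..b - a} x * x powr (\<gamma> - 1)) \<partial>lborel) = ennreal ((b - a) powr \<gamma> / \<gamma>)"
    by (subst nn_integral_has_integral_lebesgue[where I = "(b - a) powr (\<gamma> - 1 + 1) / (\<gamma> - 1 + 1)"]) auto
  moreover have "(\<integral>\<^sup>+r\<in>{a..b}. ennreal ((b - r) powr (\<gamma> - 1)) \<partial>lborel)
     = (\<integral>\<^sup>+x. ennreal (indicator {0..b - a} x * x powr (\<gamma> - 1)) \<partial>lborel)"
  proof -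
    have "(\<integral>\<^sup>+r\<in>{a..b}. ennreal ((b - r) powr (\<gamma> - 1)) \<partial>lborel)
      = ennreal \<bar>- 1\<bar> * (\<integral>\<^sup>+x. ennreal ((b - (b + (- 1) * x)) powr (\<gamma> - 1)) * indicator {a..b} (b + (- 1) * x) \<partial>lborel)"
      by (rule nn_integral_real_affine[where t = b and c = "- 1"]) auto
    also have "\<dots> = (\<integral>\<^sup>+x. ennreal (indicator {0..b - a} x * x powr (\<gamma> - 1)) \<partial>lborel)"
      by (simp, intro nn_integral_cong) (auto simp: indicator_def)
    finally show ?thesis .
  qed
  ultimately show ?thesis by simp
qed

text \<open>Where \<open>r < s\<close> the kernel for \<open>s\<close> is the larger one. Adding the kernel for \<open>t\<close> to both sides therefore
  leaves explicit integrals only, and \<open>s powr \<gamma> \<le> t powr \<gamma>\<close> allows the added term to be cancelled.\<close>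

lemma kernel_increment:
  fixes s t \<gamma> :: real
  assumes \<gamma>: "0 < \<gamma>" "\<gamma> < 1" and st: "0 \<le> s" "s \<le> t"
  shows "(\<integral>\<^sup>+r\<in>{0..t}. ennreal \<bar>(t - r) powr (\<gamma> - 1) - indicator {0..s} r * (s - r) powr (\<gamma> - 1)\<bar> \<partial>lborel)
    \<le> ennreal (2 * (t - s) powr \<gamma> / \<gamma>)"
proof -
  let ?k = "\<lambda>t r. (t - r) powr (\<gamma> - 1)"
  have "(\<integral>\<^sup>+r\<in>{0..t}. ennreal \<bar>?k t r - indicator {0..s} r * ?k s r\<bar> \<partial>lborel) + (\<integral>\<^sup>+r\<in>{0..t}. ennreal (?k t r) \<partial>lborel)
    = (\<integral>\<^sup>+r. ennreal \<bar>?k t r - indicator {0..s} r * ?k s r\<bar> * indicator {0..t} r + ennreal (?k t r) * indicator {0..t} r \<partial>lborel)"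
    by (rule nn_integral_add[symmetric]) auto
  also have "\<dots> \<le> (\<integral>\<^sup>+r. ennreal (?k s r) * indicator {0..s} r + 2 * (ennreal (?k t r) * indicator {s..t} r) \<partial>lborel)"
  proof (rule nn_integral_mono_AE, use AE_lborel_singleton[of s] in eventually_elim)
    case (elim r)
    show ?case
    proof (cases "r \<in> {0..t}")
      case True
      show ?thesis
      proof (cases "r < s")
        case rs: True
        have "?k t r \<le> ?k s r" using rs st \<gamma> by (intro powr_mono2') auto
        then have "ennreal \<bar>?k t r - ?k s r\<bar> + ennreal (?k t r) = ennreal (?k s r)"
          by (subst ennreal_plus[symmetric]) auto
        then show ?thesis using rs True by (simp add: indicator_def)
      next
        case False
        then have "s < r" using elim by simp
        then show ?thesis using True st by (simp add: indicator_def mult_2)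
      qed
    qed simp
  qed
  also have "\<dots> = (\<integral>\<^sup>+r\<in>{0..s}. ennreal (?k s r) \<partial>lborel) + 2 * (\<integral>\<^sup>+r\<in>{s..t}. ennreal (?k t r) \<partial>lborel)"
    by (subst nn_integral_add) (auto simp: nn_integral_cmult)
  also have "\<dots> = ennreal (s powr \<gamma> / \<gamma>) + 2 * ennreal ((t - s) powr \<gamma> / \<gamma>)"
    using nn_integral_kernel[OF \<gamma>(1), of 0 s] nn_integral_kernel[OF \<gamma>(1), of s t] st by simp
  also have "\<dots> \<le> ennreal (t powr \<gamma> / \<gamma>) + 2 * ennreal ((t - s) powr \<gamma> / \<gamma>)"
    using \<gamma> st by (intro add_right_mono ennreal_leI divide_right_mono powr_mono2) auto
  also have "(\<integral>\<^sup>+r\<in>{0..t}. ennreal (?k t r) \<partial>lborel) = ennreal (t powr \<gamma> / \<gamma>)"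
    using nn_integral_kernel[OF \<gamma>(1), of 0 t] st by simp
  finally have "ennreal (t powr \<gamma> / \<gamma>) + (\<integral>\<^sup>+r\<in>{0..t}. ennreal \<bar>?k t r - indicator {0..s} r * ?k s r\<bar> \<partial>lborel)
    \<le> ennreal (t powr \<gamma> / \<gamma>) + 2 * ennreal ((t - s) powr \<gamma> / \<gamma>)"
    by (simp only: add.commute)
  then have "(\<integral>\<^sup>+r\<in>{0..t}. ennreal \<bar>?k t r - indicator {0..s} r * ?k s r\<bar> \<partial>lborel) \<le> 2 * ennreal ((t - s) powr \<gamma> / \<gamma>)"
    by (subst (asm) ennreal_add_left_cancel_le) auto
  also have "\<dots> = ennreal (2 * (t - s) powr \<gamma> / \<gamma>)"
    using \<gamma> by (simp add: ennreal_mult[symmetric] divide_ennreal_def flip: ennreal_numeral)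
  finally show ?thesis .
qed

lemma integrable_kernel_bounded:
  fixes u :: "real \<Rightarrow> 'b::{banach,second_countable_topology}"
  assumes \<gamma>: "0 < \<gamma>" and t: "0 \<le> t"
    and [measurable]: "(\<lambda>r. indicator {0..t} r *\<^sub>R u r) \<in> borel_measurable borel"
    and C: "\<And>r. r \<in> {0..t} \<Longrightarrow> norm (u r) \<le> C"
  shows "set_integrable lborel {0..t} (\<lambda>r. (t - r) powr (\<gamma> - 1) *\<^sub>R u r)"
  unfolding set_integrable_def
proof (rule integrableI_bounded)
  have "(\<lambda>r. (t - r) powr (\<gamma> - 1) *\<^sub>R (indicator {0..t} r *\<^sub>R u r)) \<in> borel_measurable lborel" by measurable
  then show "(\<lambda>r. indicator {0..t} r *\<^sub>R (t - r) powr (\<gamma> - 1) *\<^sub>R u r) \<in> borel_measurable lborel"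
    by (simp add: mult.commute)
  have C0: "0 \<le> C" using C[of 0] t by (auto intro: order_trans[OF norm_ge_zero])
  have "(\<integral>\<^sup>+r. ennreal (norm (indicator {0..t} r *\<^sub>R (t - r) powr (\<gamma> - 1) *\<^sub>R u r)) \<partial>lborel)
    \<le> (\<integral>\<^sup>+r. ennreal C * (ennreal ((t - r) powr (\<gamma> - 1)) * indicator {0..t} r) \<partial>lborel)"
    using C C0 by (intro nn_integral_mono) (auto simp: indicator_def ennreal_mult[symmetric] mult.commute intro!: ennreal_leI mult_right_mono)
  also have "\<dots> = ennreal C * ennreal (t powr \<gamma> / \<gamma>)"
    using nn_integral_kernel[OF \<gamma>, of 0 t] t by (subst nn_integral_cmult) auto
  also have "\<dots> < \<infinity>" by (simp add: ennreal_mult_less_top)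
  finally show "(\<integral>\<^sup>+r. ennreal (norm (indicator {0..t} r *\<^sub>R (t - r) powr (\<gamma> - 1) *\<^sub>R u r)) \<partial>lborel) < \<infinity>" .
qed

lemma kernel_convolution_increment:
  fixes u :: "real \<Rightarrow> 'b::{banach,second_countable_topology}"
  assumes \<gamma>: "0 < \<gamma>" "\<gamma> < 1" and st: "0 \<le> s" "s \<le> t"
    and u: "(\<lambda>r. indicator {0..t} r *\<^sub>R u r) \<in> borel_measurable borel"
    and C: "\<And>r. r \<in> {0..t} \<Longrightarrow> norm (u r) \<le> C"
  shows "norm ((LINT r:{0..t}|lborel. (t - r) powr (\<gamma> - 1) *\<^sub>R u r) - (LINT r:{0..s}|lborel. (s - r) powr (\<gamma> - 1) *\<^sub>R u r))
    \<le> C * (2 * (t - s) powr \<gamma> / \<gamma>)"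
proof -
  let ?k = "\<lambda>t r. (t - r) powr (\<gamma> - 1)"
  note [measurable] = u
  have C0: "0 \<le> C" using C[of 0] st by (auto intro: order_trans[OF norm_ge_zero])
  have us: "(\<lambda>r. indicator {0..s} r *\<^sub>R u r) \<in> borel_measurable borel"
  proof -
    have "(\<lambda>r. indicator {0..s} r *\<^sub>R (indicator {0..t} r *\<^sub>R u r)) \<in> borel_measurable borel" by measurable
    also have "(\<lambda>r. indicator {0..s} r *\<^sub>R (indicator {0..t} r *\<^sub>R u r)) = (\<lambda>r. indicator {0..s} r *\<^sub>R u r)"
      using st by (auto simp: indicator_def fun_eq_iff)
    finally show ?thesis .
  qed
  have it: "integrable lborel (\<lambda>r. indicator {0..t} r *\<^sub>R ?k t r *\<^sub>R u r)"
    using integrable_kernel_bounded[OF \<gamma>(1) _ u C] st unfolding set_integrable_def by simp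
  have iS: "integrable lborel (\<lambda>r. indicator {0..s} r *\<^sub>R ?k s r *\<^sub>R u r)"
    using integrable_kernel_bounded[OF \<gamma>(1) _ us, of C] C st unfolding set_integrable_def by simp
  have "(LINT r:{0..t}|lborel. ?k t r *\<^sub>R u r) - (LINT r:{0..s}|lborel. ?k s r *\<^sub>R u r)
    = (\<integral>r. indicator {0..t} r *\<^sub>R ?k t r *\<^sub>R u r - indicator {0..s} r *\<^sub>R ?k s r *\<^sub>R u r \<partial>lborel)"
    unfolding set_lebesgue_integral_def by (rule Bochner_Integration.integral_diff[symmetric, OF it iS])
  then have "ennreal (norm ((LINT r:{0..t}|lborel. ?k t r *\<^sub>R u r) - (LINT r:{0..s}|lborel. ?k s r *\<^sub>R u r)))
    \<le> (\<integral>\<^sup>+r. ennreal (norm (indicator {0..t} r *\<^sub>R ?k t r *\<^sub>R u r - indicator {0..s} r *\<^sub>R ?k s r *\<^sub>R u r)) \<partial>lborel)"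
    using integral_norm_bound_ennreal[OF Bochner_Integration.integrable_diff[OF it iS]] by simp
  also have "\<dots> \<le> (\<integral>\<^sup>+r. ennreal C * (ennreal \<bar>?k t r - indicator {0..s} r * ?k s r\<bar> * indicator {0..t} r) \<partial>lborel)"
  proof (intro nn_integral_mono)
    fix r
    show "ennreal (norm (indicator {0..t} r *\<^sub>R ?k t r *\<^sub>R u r - indicator {0..s} r *\<^sub>R ?k s r *\<^sub>R u r))
      \<le> ennreal C * (ennreal \<bar>?k t r - indicator {0..s} r * ?k s r\<bar> * indicator {0..t} r)"
    proof (cases "r \<in> {0..t}")
      case True
      have "indicator {0..t} r *\<^sub>R ?k t r *\<^sub>R u r - indicator {0..s} r *\<^sub>R ?k s r *\<^sub>R u r = (?k t r - indicator {0..s} r * ?k s r) *\<^sub>R u r"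
        using True by (simp add: scaleR_diff_left)
      then have "norm (indicator {0..t} r *\<^sub>R ?k t r *\<^sub>R u r - indicator {0..s} r *\<^sub>R ?k s r *\<^sub>R u r) = \<bar>?k t r - indicator {0..s} r * ?k s r\<bar> * norm (u r)"
        by simp
      also have "\<dots> \<le> \<bar>?k t r - indicator {0..s} r * ?k s r\<bar> * C"
        using C[OF True] by (intro mult_left_mono) auto
      finally show ?thesis using True C0 by (simp add: ennreal_mult[symmetric] mult.commute ennreal_leI del: abs_mult)
    next
      case False
      moreover from this have "r \<notin> {0..s}" using st by auto
      ultimately show ?thesis by simp
    qed
  qed
  also have "\<dots> = ennreal C * (\<integral>\<^sup>+r\<in>{0..t}. ennreal \<bar>?k t r - indicator {0..s} r * ?k s r\<bar> \<partial>lborel)"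
    by (rule nn_integral_cmult) auto
  also have "\<dots> \<le> ennreal C * ennreal (2 * (t - s) powr \<gamma> / \<gamma>)"
    by (intro mult_left_mono kernel_increment \<gamma> st) auto
  also have "\<dots> = ennreal (C * (2 * (t - s) powr \<gamma> / \<gamma>))"
    using C0 \<gamma> by (subst ennreal_mult) auto
  finally show ?thesis using C0 \<gamma> by (subst (asm) ennreal_le_iff) auto
qed

lemma continuous_on_kernel_convolution:
  fixes u :: "real \<Rightarrow> 'b::{banach,second_countable_topology}"
  assumes \<gamma>: "0 < \<gamma>" "\<gamma> < 1"
    and u: "(\<lambda>r. indicator {0..T} r *\<^sub>R u r) \<in> borel_measurable borel"
    and C: "\<And>r. r \<in> {0..T} \<Longrightarrow> norm (u r) \<le> C"
  shows "continuous_on {0..T} (\<lambda>t. LINT r:{0..t}|lborel. (t - r) powr (\<gamma> - 1) *\<^sub>R u r)"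
proof -
  let ?v = "\<lambda>t. LINT r:{0..t}|lborel. (t - r) powr (\<gamma> - 1) *\<^sub>R u r"
  note [measurable] = u
  have ut: "(\<lambda>r. indicator {0..t} r *\<^sub>R u r) \<in> borel_measurable borel" if "t \<le> T" for t
  proof -
    have "(\<lambda>r. indicator {0..t} r *\<^sub>R (indicator {0..T} r *\<^sub>R u r)) \<in> borel_measurable borel" by measurable
    also have "(\<lambda>r. indicator {0..t} r *\<^sub>R (indicator {0..T} r *\<^sub>R u r)) = (\<lambda>r. indicator {0..t} r *\<^sub>R u r)"
      using that by (auto simp: indicator_def fun_eq_iff)
    finally show ?thesis .
  qed
  have inc: "norm (?v t - ?v s) \<le> C * (2 * \<bar>t - s\<bar> powr \<gamma> / \<gamma>)" if "s \<in> {0..T}" "t \<in> {0..T}" for s t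
  proof (cases "s \<le> t")
    case True
    then show ?thesis using kernel_convolution_increment[OF \<gamma> _ True ut C] that by auto
  next
    case False
    then show ?thesis using kernel_convolution_increment[OF \<gamma>, of t s u C] ut C that by (auto simp: norm_minus_commute)
  qed
  show ?thesis
    unfolding continuous_on_def
  proof (intro ballI)
    fix s assume s: "s \<in> {0..T}"
    have "((\<lambda>t. C * (2 * \<bar>t - s\<bar> powr \<gamma> / \<gamma>)) \<longlongrightarrow> C * (2 * \<bar>s - s\<bar> powr \<gamma> / \<gamma>)) (at s within {0..T})"
      using \<gamma> by (intro tendsto_intros tendsto_powr') auto
    then have lim: "((\<lambda>t. C * (2 * \<bar>t - s\<bar> powr \<gamma> / \<gamma>)) \<longlongrightarrow> 0) (at s within {0..T})" by simp
    have "((\<lambda>t. ?v t - ?v s) \<longlongrightarrow> 0) (at s within {0..T})"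
    proof (rule Lim_null_comparison[OF _ lim])
      show "\<forall>\<^sub>F t in at s within {0..T}. norm (?v t - ?v s) \<le> C * (2 * \<bar>t - s\<bar> powr \<gamma> / \<gamma>)"
        unfolding eventually_at_filter using inc[OF s] by (intro always_eventually) auto
    qed
    then show "(?v \<longlongrightarrow> ?v s) (at s within {0..T})" by (simp add: LIM_zero_iff)
  qed
qed

section \<open>Dyadic chaining\<close>

text \<open>The largest multiple of \<open>T / 2 ^ k\<close> that does not exceed \<open>t\<close>.\<close>

definition dyadic_floor :: "real \<Rightarrow> nat \<Rightarrow> real \<Rightarrow> real" where
  "dyadic_floor T k t = T * of_int \<lfloor>2 ^ k * t / T\<rfloor> / 2 ^ k"

lemma dyadic_floor_bounds:
  assumes "0 < T"
  shows "dyadic_floor T k t \<le> t" "t < dyadic_floor T k t + T / 2 ^ k"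
    "t \<in> {0..T} \<Longrightarrow> dyadic_floor T k t \<in> {0..T}"
proof -
  have 1: "T * of_int \<lfloor>2 ^ k * t / T\<rfloor> \<le> 2 ^ k * t" "2 ^ k * t < T * of_int \<lfloor>2 ^ k * t / T\<rfloor> + T"
    using floor_divide_lower[OF assms, of "2 ^ k * t"] floor_divide_upper[OF assms, of "2 ^ k * t"]
    by (auto simp: algebra_simps)
  then show a: "dyadic_floor T k t \<le> t" "t < dyadic_floor T k t + T / 2 ^ k"
    unfolding dyadic_floor_def by (auto simp: field_simps)
  assume "t \<in> {0..T}"
  then have "0 \<le> \<lfloor>2 ^ k * t / T\<rfloor>" using assms by auto
  then have "0 \<le> dyadic_floor T k t" unfolding dyadic_floor_def using assms by auto
  then show "dyadic_floor T k t \<in> {0..T}" using a \<open>t \<in> {0..T}\<close> by auto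
qed

lemma dyadic_floor_nat:
  assumes T: "0 < T" and t: "t \<in> {0..T}"
  obtains i where "i \<le> 2 ^ k" "\<lfloor>2 ^ k * t / T\<rfloor> = int i" "dyadic_floor T k t = T * real i / 2 ^ k"
proof -
  have "0 \<le> 2 ^ k * t / T" "2 ^ k * t / T \<le> 2 ^ k" using T t by (auto simp: divide_le_eq)
  then have "0 \<le> \<lfloor>2 ^ k * t / T\<rfloor>" "\<lfloor>2 ^ k * t / T\<rfloor> \<le> 2 ^ k"
    by (auto simp: floor_le_iff)
  then show ?thesis
    by (intro that[of "nat \<lfloor>2 ^ k * t / T\<rfloor>"]) (auto simp: dyadic_floor_def nat_le_iff)
qed

lemma dyadic_floor_tendsto: "0 < T \<Longrightarrow> (\<lambda>k. dyadic_floor T k t) \<longlonglongrightarrow> t"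
proof (rule real_tendsto_sandwich[where f = "\<lambda>k. t - T / 2 ^ k" and h = "\<lambda>_. t"])
  assume T: "0 < T"
  have "(\<lambda>k. t - T * (1 / 2) ^ k) \<longlonglongrightarrow> t - T * 0"
    by (intro tendsto_intros LIMSEQ_realpow_zero) auto
  then show "(\<lambda>k. t - T / 2 ^ k) \<longlonglongrightarrow> t" by (simp add: power_divide)
qed (auto intro!: always_eventually less_imp_le dyadic_floor_bounds simp: diff_less_eq[symmetric] less_diff_eq algebra_simps dest: dyadic_floor_bounds)

text \<open>The approximations of one point at consecutive levels, and those at level \<open>k\<close> of two points closer than
  \<open>T / 2 ^ k\<close>, are equal or neighbours in a dyadic grid. So \<open>z\<close> converges along the approximations,
  uniformly in the point, and the limit has modulus of continuity \<open>2 R k + \<epsilon> k\<close>, where \<open>R k\<close> is a tail of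
  the series of \<open>\<epsilon>\<close>.\<close>

lemma dyadic_chaining:
  fixes z :: "real \<Rightarrow> 'b::banach"
  assumes T: "0 < T" and \<epsilon>: "summable \<epsilon>" "\<And>k. 0 \<le> \<epsilon> k"
    and step: "\<And>k i. i < 2 ^ k \<Longrightarrow> norm (z (T * real (Suc i) / 2 ^ k) - z (T * real i / 2 ^ k)) \<le> \<epsilon> k"
  shows "continuous_on {0..T} (\<lambda>t. lim (\<lambda>k. z (dyadic_floor T k t)))"
    "t \<in> {0..T} \<Longrightarrow> convergent (\<lambda>k. z (dyadic_floor T k t))"
proof -
  define y where "y = (\<lambda>t. lim (\<lambda>k. z (dyadic_floor T k t)))"
  define R where "R = (\<lambda>k. \<Sum>j. \<epsilon> (j + Suc k))"
  have sum_tail: "summable (\<lambda>j. \<epsilon> (j + k))" for k using \<epsilon>(1) by (rule summable_ignore_initial_segment)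
  have next_le: "norm (z (dyadic_floor T (Suc k) t) - z (dyadic_floor T k t)) \<le> \<epsilon> (Suc k)" if t: "t \<in> {0..T}" for t k
  proof -
    obtain i where i: "i \<le> 2 ^ k" "\<lfloor>2 ^ k * t / T\<rfloor> = int i" "dyadic_floor T k t = T * real i / 2 ^ k"
      by (rule dyadic_floor_nat[OF T t])
    obtain j where j: "j \<le> 2 ^ Suc k" "\<lfloor>2 ^ Suc k * t / T\<rfloor> = int j" "dyadic_floor T (Suc k) t = T * real j / 2 ^ Suc k"
      by (rule dyadic_floor_nat[OF T t])
    have "2 ^ Suc k * t / T = 2 * (2 ^ k * t / T)" by simp
    then have "int j = 2 * int i \<or> int j = 2 * int i + 1"
      unfolding j(2)[symmetric] i(2)[symmetric] by linarith
    then have "j = 2 * i \<or> j = Suc (2 * i)" by linarith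
    moreover have e: "T * real i / 2 ^ k = T * real (2 * i) / 2 ^ Suc k" by simp
    ultimately show ?thesis
      using step[of "2 * i" "Suc k"] j(1) \<epsilon>(2)[of "Suc k"] unfolding i(3) j(3) e by auto
  qed
  have part: "norm (z (dyadic_floor T (k + m) t) - z (dyadic_floor T k t)) \<le> (\<Sum>j<m. \<epsilon> (j + Suc k))" if t: "t \<in> {0..T}" for t k m
  proof (induction m)
    case (Suc m)
    have "norm (z (dyadic_floor T (k + Suc m) t) - z (dyadic_floor T k t))
      \<le> norm (z (dyadic_floor T (Suc (k + m)) t) - z (dyadic_floor T (k + m) t)) + norm (z (dyadic_floor T (k + m) t) - z (dyadic_floor T k t))"
      using norm_triangle_ineq[of "z (dyadic_floor T (Suc (k + m)) t) - z (dyadic_floor T (k + m) t)" "z (dyadic_floor T (k + m) t) - z (dyadic_floor T k t)"] by simp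
    also have "\<dots> \<le> \<epsilon> (Suc (k + m)) + (\<Sum>j<m. \<epsilon> (j + Suc k))" by (intro add_mono next_le t Suc)
    finally show ?case by (simp add: add.commute)
  qed simp
  have conv: "convergent (\<lambda>k. z (dyadic_floor T k t))" if t: "t \<in> {0..T}" for t
  proof -
    have "summable (\<lambda>k. norm (z (dyadic_floor T (Suc k) t) - z (dyadic_floor T k t)))"
      by (rule summable_comparison_test'[of "\<lambda>k. \<epsilon> (Suc k)" 0]) (use sum_tail[of 1] next_le[OF t] in auto)
    then have "summable (\<lambda>k. z (dyadic_floor T (Suc k) t) - z (dyadic_floor T k t))"
      by (rule summable_norm_cancel)
    then have "convergent (\<lambda>n. \<Sum>k<n. z (dyadic_floor T (Suc k) t) - z (dyadic_floor T k t))"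
      by (simp add: summable_iff_convergent)
    then have "convergent (\<lambda>n. z (dyadic_floor T n t) - z (dyadic_floor T 0 t))"
      unfolding sum_lessThan_telescope[of "\<lambda>k. z (dyadic_floor T k t)"] .
    then have "convergent (\<lambda>n. (z (dyadic_floor T n t) - z (dyadic_floor T 0 t)) + z (dyadic_floor T 0 t))"
      by (intro convergent_add convergent_const)
    then show ?thesis by simp
  qed
  then show "t \<in> {0..T} \<Longrightarrow> convergent (\<lambda>k. z (dyadic_floor T k t))" .
  have lim: "(\<lambda>k. z (dyadic_floor T k t)) \<longlonglongrightarrow> y t" if "t \<in> {0..T}" for t
    unfolding y_def using conv[OF that] by (rule convergent_LIMSEQ_iff[THEN iffD1])
  have tail: "norm (y t - z (dyadic_floor T k t)) \<le> R k" if t: "t \<in> {0..T}" for t k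
  proof (rule LIMSEQ_le_const2)
    show "(\<lambda>m. norm (z (dyadic_floor T (m + k) t) - z (dyadic_floor T k t))) \<longlonglongrightarrow> norm (y t - z (dyadic_floor T k t))"
      by (intro tendsto_intros LIMSEQ_ignore_initial_segment lim t)
    have "(\<Sum>j<m. \<epsilon> (j + Suc k)) \<le> R k" for m
      unfolding R_def by (intro sum_le_suminf sum_tail) (auto simp: \<epsilon>)
    then show "\<exists>N. \<forall>m\<ge>N. norm (z (dyadic_floor T (m + k) t) - z (dyadic_floor T k t)) \<le> R k"
      using part[OF t, of k] by (auto simp: add.commute intro: order_trans)
  qed
  have close: "norm (y t - y s) \<le> 2 * R k + \<epsilon> k" if s: "s \<in> {0..T}" and t: "t \<in> {0..T}" and st: "s \<le> t" "t - s < T / 2 ^ k" for s t k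
  proof -
    obtain i where i: "i \<le> 2 ^ k" "\<lfloor>2 ^ k * s / T\<rfloor> = int i" "dyadic_floor T k s = T * real i / 2 ^ k"
      by (rule dyadic_floor_nat[OF T s])
    obtain j where j: "j \<le> 2 ^ k" "\<lfloor>2 ^ k * t / T\<rfloor> = int j" "dyadic_floor T k t = T * real j / 2 ^ k"
      by (rule dyadic_floor_nat[OF T t])
    have "2 ^ k * t / T < 2 ^ k * s / T + 1" "2 ^ k * s / T \<le> 2 ^ k * t / T"
      using st T by (auto simp: field_simps)
    then have "int j = int i \<or> int j = int i + 1"
      unfolding j(2)[symmetric] i(2)[symmetric] by linarith
    then have "j = i \<or> j = Suc i" by linarith
    then have m: "norm (z (dyadic_floor T k t) - z (dyadic_floor T k s)) \<le> \<epsilon> k"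
      using step[of i k] j(1) \<epsilon>(2)[of k] unfolding i(3) j(3) by auto
    have "y t - y s = (y t - z (dyadic_floor T k t)) + (z (dyadic_floor T k t) - z (dyadic_floor T k s)) - (y s - z (dyadic_floor T k s))" by simp
    also have "norm \<dots> \<le> norm (y t - z (dyadic_floor T k t)) + norm (z (dyadic_floor T k t) - z (dyadic_floor T k s)) + norm (y s - z (dyadic_floor T k s))"
      by (rule order_trans[OF norm_triangle_ineq4 add_right_mono[OF norm_triangle_ineq]])
    finally show ?thesis using tail[OF t, of k] tail[OF s, of k] m by linarith
  qed
  have "(\<lambda>k. 2 * R k + \<epsilon> k) \<longlonglongrightarrow> 2 * 0 + 0"
  proof (intro tendsto_intros)
    have "R = (\<lambda>k. (\<Sum>j. \<epsilon> j) - (\<Sum>j<Suc k. \<epsilon> j))"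
    proof
      fix k
      show "R k = (\<Sum>j. \<epsilon> j) - (\<Sum>j<Suc k. \<epsilon> j)"
        unfolding R_def using suminf_minus_initial_segment[OF \<epsilon>(1), of "Suc k"] .
    qed
    moreover have "(\<lambda>k. (\<Sum>j. \<epsilon> j) - (\<Sum>j<Suc k. \<epsilon> j)) \<longlonglongrightarrow> (\<Sum>j. \<epsilon> j) - (\<Sum>j. \<epsilon> j)"
      by (intro tendsto_diff tendsto_const LIMSEQ_Suc summable_LIMSEQ \<epsilon>(1))
    ultimately show "R \<longlonglongrightarrow> 0" by simp
    show "\<epsilon> \<longlonglongrightarrow> 0" by (rule summable_LIMSEQ_zero[OF \<epsilon>(1)])
  qed
  then have small: "(\<lambda>k. 2 * R k + \<epsilon> k) \<longlonglongrightarrow> 0" by simp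
  have "continuous_on {0..T} y"
    unfolding continuous_on_iff
  proof (intro ballI allI impI)
    fix s e :: real assume s: "s \<in> {0..T}" and e: "0 < e"
    from order_tendstoD(2)[OF small e] obtain k where k: "2 * R k + \<epsilon> k < e"
      using eventually_happens'[OF sequentially_bot] by blast
    have "dist (y t) (y s) < e" if t: "t \<in> {0..T}" "dist t s < T / 2 ^ k" for t
    proof (cases "s \<le> t")
      case True
      then show ?thesis using close[OF s t(1) True, of k] t k by (simp add: dist_norm)
    next
      case False
      then have "norm (y s - y t) \<le> 2 * R k + \<epsilon> k"
        using t by (intro close s t(1)) (auto simp: dist_norm)
      then show ?thesis using k by (simp add: dist_norm norm_minus_commute)
    qed
    then show "\<exists>d>0. \<forall>t\<in>{0..T}. dist t s < d \<longrightarrow> dist (y t) (y s) < e"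
      using T by (intro exI[of _ "T / 2 ^ k"]) auto
  qed
  then show "continuous_on {0..T} (\<lambda>t. lim (\<lambda>k. z (dyadic_floor T k t)))" by (simp add: y_def)
qed

lemma le_of_exp_le:
  fixes x l c :: real
  assumes "0 < l" "exp (l * x) \<le> c" "exp (- l * x) \<le> c"
  shows "\<bar>x\<bar> \<le> ln c / l"
proof -
  have c: "0 < c" using assms(2) less_le_trans[OF exp_gt_zero] by blast
  have "l * x \<le> ln c" "- l * x \<le> ln c"
    using assms(2,3) c by (simp_all add: ln_ge_iff)
  then have "l * \<bar>x\<bar> \<le> ln c" by (cases "0 \<le> x") auto
  then show ?thesis using assms(1) by (simp add: field_simps)
qed

section \<open>Continuous versions from exponential moments\<close>

text \<open>Kolmogorov's criterion with exponential moments, which allow every positive exponent \<open>q\<close>. Dyadic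
  increments at level \<open>k\<close> are scaled by \<open>l k\<close> to have bounded exponential moments, and \<open>Tot\<close> adds up the
  exponentials of all of them with weight \<open>4\<close> to the power \<open>- k\<close> against the \<open>2 ^ k\<close> increments of level
  \<open>k\<close>. Its mean is finite. Where \<open>Tot\<close> itself is finite, an increment of level \<open>k\<close> is of order
  \<open>(1 + k) / l k\<close>, a summable sequence, and \<open>dyadic_chaining\<close> applies.\<close>

lemma (in prob_space) continuous_version:
  fixes Z :: "real \<Rightarrow> 'a \<Rightarrow> real ^ 'n"
  assumes T: "0 < T" and q: "0 < q" and K: "0 \<le> K"
    and Z: "\<And>t. t \<in> {0..T} \<Longrightarrow> Z t \<in> borel_measurable M"
    and exp_moment: "\<And>s t l j. 0 \<le> s \<Longrightarrow> s \<le> t \<Longrightarrow> t \<le> T \<Longrightarrow>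
      (\<integral>\<^sup>+\<omega>. ennreal (exp (l * (Z t \<omega> $ j - Z s \<omega> $ j))) \<partial>M) \<le> ennreal (exp (l\<^sup>2 * (K * (t - s) powr q) / 2))"
    and ms: "\<And>s t. 0 \<le> s \<Longrightarrow> s \<le> t \<Longrightarrow> t \<le> T \<Longrightarrow> sqn M (\<lambda>\<omega>. Z t \<omega> - Z s \<omega>) \<le> ennreal (L * (t - s) powr q)"
  shows "\<exists>Y. (AE \<omega> in M. continuous_on {0..T} (\<lambda>t. Y t \<omega>)) \<and> (\<forall>t\<in>{0..T}. AE \<omega> in M. Y t \<omega> = Z t \<omega>)"
proof -
  define d where "d = (\<lambda>k i. T * real i / 2 ^ k)"
  have d: "d k i \<in> {0..T}" if "i \<le> 2 ^ k" for k i
  proof -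
    have "real i \<le> 2 ^ k" using that by (metis of_nat_le_iff of_nat_numeral of_nat_power)
    then have "T * real i \<le> T * 2 ^ k" using T by (intro mult_left_mono) auto
    then show ?thesis unfolding d_def using T by (auto simp: field_simps)
  qed
  \<comment> \<open>The inverse of the standard deviation of a dyadic increment of level \<open>k\<close>, up to a constant.\<close>
  define l where "l = (\<lambda>k. (T / 2 ^ k) powr (- q / 2))"
  have l0: "0 < l k" for k using T by (simp add: l_def)
  have l_sq: "(l k)\<^sup>2 * (T / 2 ^ k) powr q = 1" for k
  proof -
    have "(l k)\<^sup>2 = (T / 2 ^ k) powr (- q)"
      using T by (simp add: l_def power2_eq_square powr_add[symmetric])
    then show ?thesis using T by (simp add: powr_add[symmetric])
  qed
  define E where "E = (\<lambda>k i j \<omega>. ennreal (exp (l k * (Z (d k (Suc i)) \<omega> $ j - Z (d k i) \<omega> $ j)))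
     + ennreal (exp (- l k * (Z (d k (Suc i)) \<omega> $ j - Z (d k i) \<omega> $ j))))"
  have Zj: "(\<lambda>\<omega>. Z t \<omega> $ j) \<in> borel_measurable M" if "t \<in> {0..T}" for t j
    using Z[OF that] by (simp add: borel_measurable_vec_iff)
  have Em: "E k i j \<in> borel_measurable M" if "i < 2 ^ k" for k i j
  proof -
    have [measurable]: "(\<lambda>\<omega>. Z (d k i) \<omega> $ j) \<in> borel_measurable M" "(\<lambda>\<omega>. Z (d k (Suc i)) \<omega> $ j) \<in> borel_measurable M"
      using that by (auto intro!: Zj d)
    show ?thesis unfolding E_def by measurable
  qed
  have E_le: "(\<integral>\<^sup>+\<omega>. E k i j \<omega> \<partial>M) \<le> ennreal (2 * exp (K / 2))" if i: "i < 2 ^ k" for k i j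
  proof -
    have dd: "0 \<le> d k i" "d k i \<le> d k (Suc i)" "d k (Suc i) \<le> T" "d k (Suc i) - d k i = T / 2 ^ k"
      using d[of i k] d[of "Suc i" k] i T by (auto simp: d_def field_simps)
    have "(\<integral>\<^sup>+\<omega>. ennreal (exp (c * (Z (d k (Suc i)) \<omega> $ j - Z (d k i) \<omega> $ j))) \<partial>M) \<le> ennreal (exp (K / 2))"
      if c: "c\<^sup>2 = (l k)\<^sup>2" for c
    proof -
      have "c\<^sup>2 * (K * (d k (Suc i) - d k i) powr q) / 2 = K / 2 * ((l k)\<^sup>2 * (T / 2 ^ k) powr q)"
        unfolding dd(4) c by (simp add: mult_ac)
      also have "\<dots> = K / 2" unfolding l_sq by simp
      finally have e: "c\<^sup>2 * (K * (d k (Suc i) - d k i) powr q) / 2 = K / 2" .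
      show ?thesis using exp_moment[OF dd(1,2,3), of c j] unfolding e .
    qed
    from this[of "l k"] this[of "- l k"]
    have "(\<integral>\<^sup>+\<omega>. E k i j \<omega> \<partial>M) \<le> ennreal (exp (K / 2)) + ennreal (exp (K / 2))"
      unfolding E_def using Zj[OF d, of i k j] Zj[OF d, of "Suc i" k j] i
      by (subst nn_integral_add) (auto intro!: add_mono)
    also have "\<dots> = ennreal (2 * exp (K / 2))" by (subst ennreal_plus[symmetric]) auto
    finally show ?thesis .
  qed
  define Tot where "Tot = (\<lambda>\<omega>. \<Sum>k. ennreal ((1/4) ^ k) * (\<Sum>i<2 ^ k. \<Sum>j\<in>(UNIV :: 'n set). E k i j \<omega>))"
  have Tot_m: "(\<lambda>\<omega>. ennreal ((1/4) ^ k) * (\<Sum>i<2 ^ k. \<Sum>j\<in>(UNIV :: 'n set). E k i j \<omega>)) \<in> borel_measurable M" for k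
    by (intro borel_measurable_times_ennreal borel_measurable_const borel_measurable_sum Em) simp
  have "(\<integral>\<^sup>+\<omega>. Tot \<omega> \<partial>M) = (\<Sum>k. \<integral>\<^sup>+\<omega>. ennreal ((1/4) ^ k) * (\<Sum>i<2 ^ k. \<Sum>j\<in>(UNIV :: 'n set). E k i j \<omega>) \<partial>M)"
    unfolding Tot_def by (rule nn_integral_suminf[OF Tot_m])
  also have "\<dots> \<le> (\<Sum>k. ennreal (2 * exp (K / 2) * real CARD('n) * (1/2) ^ k))"
  proof (intro suminf_le)
    fix k
    have "(\<integral>\<^sup>+\<omega>. ennreal ((1/4) ^ k) * (\<Sum>i<2 ^ k. \<Sum>j\<in>(UNIV :: 'n set). E k i j \<omega>) \<partial>M)
       = ennreal ((1/4) ^ k) * (\<Sum>i<2 ^ k. \<Sum>j\<in>(UNIV :: 'n set). \<integral>\<^sup>+\<omega>. E k i j \<omega> \<partial>M)"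
      using Em by (subst nn_integral_cmult, simp add: borel_measurable_sum, subst nn_integral_sum, simp add: borel_measurable_sum,
        intro arg_cong2[where f = "(*)"] refl sum.cong nn_integral_sum) auto
    also have "\<dots> \<le> ennreal ((1/4) ^ k) * (\<Sum>i<(2::nat) ^ k. \<Sum>j\<in>(UNIV :: 'n set). ennreal (2 * exp (K / 2)))"
      by (intro mult_left_mono sum_mono E_le) auto
    also have "\<dots> = ennreal ((1/4) ^ k) * ennreal (2 ^ k * (real CARD('n) * (2 * exp (K / 2))))"
      by (simp add: ennreal_of_nat_eq_real_of_nat ennreal_mult)
    also have "\<dots> = ennreal ((1/4) ^ k * (2 ^ k * (real CARD('n) * (2 * exp (K / 2)))))"
      by (rule ennreal_mult[symmetric]) auto
    also have "(1/4) ^ k * (2 ^ k * (real CARD('n) * (2 * exp (K / 2)))) = 2 * exp (K / 2) * real CARD('n) * (1/2) ^ k"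
    proof -
      have "(1/4) ^ k * 2 ^ k = ((1/2) ^ k :: real)" by (simp add: power_mult_distrib[symmetric])
      then show ?thesis by (simp add: mult.assoc[symmetric])
    qed
    finally show "(\<integral>\<^sup>+\<omega>. ennreal ((1/4) ^ k) * (\<Sum>i<2 ^ k. \<Sum>j\<in>(UNIV :: 'n set). E k i j \<omega>) \<partial>M)
      \<le> ennreal (2 * exp (K / 2) * real CARD('n) * (1/2) ^ k)" .
  qed auto
  also have "\<dots> = ennreal (\<Sum>k. 2 * exp (K / 2) * real CARD('n) * (1/2) ^ k)"
    by (intro suminf_ennreal2 summable_mult summable_geometric) auto
  also have "\<dots> < \<infinity>" by simp
  finally have "(\<integral>\<^sup>+\<omega>. Tot \<omega> \<partial>M) \<noteq> \<infinity>" by simp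
  then have "AE \<omega> in M. Tot \<omega> \<noteq> \<infinity>"
    by (rule nn_integral_PInf_AE[rotated]) (unfold Tot_def, rule borel_measurable_suminf_order, rule Tot_m)
  then have path: "AE \<omega> in M. continuous_on {0..T} (\<lambda>t. lim (\<lambda>k. Z (dyadic_floor T k t) \<omega>)) \<and>
      (\<forall>t\<in>{0..T}. convergent (\<lambda>k. Z (dyadic_floor T k t) \<omega>))"
  proof eventually_elim
    case (elim \<omega>)
    define C where "C = enn2real (Tot \<omega>) + 1"
    have C: "Tot \<omega> \<le> ennreal C" "1 \<le> C"
      using elim by (auto simp: C_def less_top[symmetric] ennreal_plus)
    have E_bound: "E k i j \<omega> \<le> ennreal (C * 4 ^ k)" if i: "i < 2 ^ k" for k i j
    proof -
      have "ennreal ((1/4) ^ k) * E k i j \<omega> \<le> ennreal ((1/4) ^ k) * (\<Sum>i<2 ^ k. \<Sum>j\<in>(UNIV :: 'n set). E k i j \<omega>)"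
      proof (rule mult_left_mono)
        have "E k i j \<omega> \<le> (\<Sum>j\<in>(UNIV :: 'n set). E k i j \<omega>)" by (rule member_le_sum) auto
        also have "\<dots> \<le> (\<Sum>i<2 ^ k. \<Sum>j\<in>(UNIV :: 'n set). E k i j \<omega>)"
          using i by (intro member_le_sum[of i _ "\<lambda>i. \<Sum>j\<in>(UNIV :: 'n set). E k i j \<omega>"]) auto
        finally show "E k i j \<omega> \<le> (\<Sum>i<2 ^ k. \<Sum>j\<in>(UNIV :: 'n set). E k i j \<omega>)" .
      qed simp
      also have "\<dots> \<le> Tot \<omega>"
        unfolding Tot_def
        using sum_le_suminf[of "\<lambda>k. ennreal ((1/4) ^ k) * (\<Sum>i<2 ^ k. \<Sum>j\<in>(UNIV :: 'n set). E k i j \<omega>)" "{k}"] by simp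
      also have "\<dots> \<le> ennreal C" by (rule C)
      finally have "ennreal (4 ^ k) * (ennreal ((1/4) ^ k) * E k i j \<omega>) \<le> ennreal (4 ^ k) * ennreal C"
        by (rule mult_left_mono) simp
      moreover have "ennreal (4 ^ k) * (ennreal ((1/4) ^ k) * E k i j \<omega>) = E k i j \<omega>"
        unfolding mult.assoc[symmetric] by (subst ennreal_mult[symmetric]) (auto simp: power_mult_distrib[symmetric])
      ultimately show ?thesis using C(2) by (simp add: ennreal_mult mult.commute)
    qed
    define \<epsilon> where "\<epsilon> = (\<lambda>k. real CARD('n) * (ln (C * 4 ^ k) / l k))"
    have step: "norm (Z (T * real (Suc i) / 2 ^ k) \<omega> - Z (T * real i / 2 ^ k) \<omega>) \<le> \<epsilon> k" if i: "i < 2 ^ k" for k i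
    proof -
      have comp: "\<bar>(Z (d k (Suc i)) \<omega> - Z (d k i) \<omega>) $ j\<bar> \<le> ln (C * 4 ^ k) / l k" for j
      proof (rule le_of_exp_le[OF l0])
        have "ennreal (exp (l k * (Z (d k (Suc i)) \<omega> $ j - Z (d k i) \<omega> $ j))) \<le> E k i j \<omega>"
          "ennreal (exp (- l k * (Z (d k (Suc i)) \<omega> $ j - Z (d k i) \<omega> $ j))) \<le> E k i j \<omega>"
          unfolding E_def by simp_all
        from this[THEN order_trans[OF _ E_bound[OF i, of j]]]
        show "exp (l k * (Z (d k (Suc i)) \<omega> - Z (d k i) \<omega>) $ j) \<le> C * 4 ^ k"
          "exp (- l k * (Z (d k (Suc i)) \<omega> - Z (d k i) \<omega>) $ j) \<le> C * 4 ^ k"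
          using C(2) by (simp_all add: vector_minus_component)
      qed
      have "norm (Z (d k (Suc i)) \<omega> - Z (d k i) \<omega>) \<le> (\<Sum>j\<in>(UNIV :: 'n set). \<bar>(Z (d k (Suc i)) \<omega> - Z (d k i) \<omega>) $ j\<bar>)"
        by (rule norm_le_l1_cart)
      also have "\<dots> \<le> (\<Sum>j\<in>(UNIV :: 'n set). ln (C * 4 ^ k) / l k)" by (intro sum_mono comp)
      finally show ?thesis by (simp add: \<epsilon>_def d_def)
    qed
    \<comment> \<open>A geometric sequence with at most linear factors, as the logarithm turns \<open>4 ^ k\<close> into a multiple of \<open>k\<close>.\<close>
    have \<epsilon>_eq: "\<epsilon> k = real CARD('n) * T powr (q / 2) * (ln C * (2 powr (- q / 2)) ^ k + ln 4 * ((2 powr (- q / 2)) ^ k * of_nat k))" for k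
    proof -
      have "1 / l k = (T / 2 ^ k) powr (q / 2)" using T by (simp add: l_def powr_minus field_simps)
      also have "\<dots> = T powr (q / 2) * (2 powr (- q / 2)) ^ k"
        using T by (simp add: powr_divide powr_power[symmetric] powr_minus powr_realpow[symmetric] powr_powr field_simps)
      finally have 1: "1 / l k = T powr (q / 2) * (2 powr (- q / 2)) ^ k" .
      have 2: "ln (C * 4 ^ k) = ln C + real k * ln 4" using C(2) by (simp add: ln_mult ln_realpow)
      have "\<epsilon> k = real CARD('n) * (ln (C * 4 ^ k) * (1 / l k))" by (simp add: \<epsilon>_def)
      then show ?thesis unfolding 1 2 by (simp add: algebra_simps)
    qed
    have r: "norm (2 powr (- q / 2) :: real) < 1" using q powr_less_mono[of "- q / 2" 0 2] by simp
    have "summable (\<lambda>k. real CARD('n) * T powr (q / 2) * (ln C * (2 powr (- q / 2)) ^ k + ln 4 * ((2 powr (- q / 2)) ^ k * of_nat k)))"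
      by (intro summable_mult summable_add summable_geometric[OF r] summable_mult geometric_sums_times_n[OF r, THEN sums_summable])
    then have \<epsilon>: "summable \<epsilon>" unfolding \<epsilon>_eq[abs_def] .
    have \<epsilon>0: "0 \<le> \<epsilon> k" for k
    proof -
      have "1 \<le> C * 4 ^ k" using C(2) one_le_power[of "4::real" k] mult_mono[of 1 C 1 "4 ^ k"] by simp
      then have "0 \<le> ln (C * 4 ^ k)" by (rule ln_ge_zero)
      then show ?thesis using l0[of k] unfolding \<epsilon>_def by simp
    qed
    from dyadic_chaining[of T \<epsilon> "\<lambda>t. Z t \<omega>", OF T \<epsilon> \<epsilon>0 step]
    show ?case by blast
  qed
  define Y where "Y = (\<lambda>t \<omega>. lim (\<lambda>k. Z (dyadic_floor T k t) \<omega>))"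
  have "AE \<omega> in M. continuous_on {0..T} (\<lambda>t. Y t \<omega>)"
    using path unfolding Y_def by eventually_elim blast
  moreover have "AE \<omega> in M. Y t \<omega> = Z t \<omega>" if t: "t \<in> {0..T}" for t
  proof -
    have D: "dyadic_floor T k t \<in> {0..T}" for k by (rule dyadic_floor_bounds(3)[OF T t])
    have Ym [measurable]: "Y t \<in> borel_measurable M"
      unfolding Y_def by (rule borel_measurable_lim_metric) (rule Z[OF D])
    note [measurable] = Z[OF t] Z[OF D]
    have lim: "AE \<omega> in M. (\<lambda>k. Z t \<omega> - Z (dyadic_floor T k t) \<omega>) \<longlonglongrightarrow> Z t \<omega> - Y t \<omega>"
      using path
    proof eventually_elim
      case (elim \<omega>)
      then have "convergent (\<lambda>k. Z (dyadic_floor T k t) \<omega>)" using t by blast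
      then have "(\<lambda>k. Z (dyadic_floor T k t) \<omega>) \<longlonglongrightarrow> Y t \<omega>"
        unfolding Y_def by (rule convergent_LIMSEQ_iff[THEN iffD1])
      then show ?case by (intro tendsto_diff tendsto_const)
    qed
    have "sqn M (\<lambda>\<omega>. Z t \<omega> - Y t \<omega>) \<le> liminf (\<lambda>k. sqn M (\<lambda>\<omega>. Z t \<omega> - Z (dyadic_floor T k t) \<omega>))"
      by (rule sqn_le_liminf[OF _ lim]) measurable
    also have "\<dots> \<le> liminf (\<lambda>k. ennreal (L * (t - dyadic_floor T k t) powr q))"
      using D dyadic_floor_bounds(1)[OF T] t by (intro Liminf_mono always_eventually allI ms) auto
    also have "\<dots> = ennreal (L * (t - t) powr q)"
      using q dyadic_floor_bounds(1)[OF T, of _ t]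
      by (intro lim_imp_Liminf tendsto_ennrealI tendsto_mult tendsto_const tendsto_powr' tendsto_diff dyadic_floor_tendsto T)
         (auto intro!: always_eventually)
    finally have "sqn M (\<lambda>\<omega>. Z t \<omega> - Y t \<omega>) = 0" by simp
    moreover have "(\<lambda>\<omega>. Z t \<omega> - Y t \<omega>) \<in> borel_measurable M" by measurable
    ultimately have "AE \<omega> in M. Z t \<omega> - Y t \<omega> = 0" by (simp only: sqn_eq_0_iff)
    then show ?thesis by eventually_elim simp
  qed
  ultimately show ?thesis by (intro exI[of _ Y] conjI ballI)
qed

context brownian_basis
begin

section \<open>Adapted measurable versions and the stochastic convolution\<close>

text \<open>The limit of \<open>Z\<close> along the dyadic points to the left of \<open>t\<close> is built from countably many random
  variables, hence jointly measurable, and at time \<open>t\<close> only from variables known by then, hence adapted.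
  It is taken of \<open>Z\<close> and not of the continuous process \<open>Y\<close>, because \<open>F t\<close> need not contain the null sets
  on which the two differ.\<close>

lemma adapted_measurable_version:
  fixes Z Y :: "real \<Rightarrow> 'w \<Rightarrow> real ^ 'n"
  assumes T: "0 < T" and Z: "\<And>t. t \<in> {0..T} \<Longrightarrow> Z t \<in> borel_measurable (F t)"
    and Y: "AE \<omega> in M. continuous_on {0..T} (\<lambda>t. Y t \<omega>)"
    and eq: "\<And>t. t \<in> {0..T} \<Longrightarrow> AE \<omega> in M. Y t \<omega> = Z t \<omega>"
  shows "\<exists>X. (\<lambda>(t, \<omega>). X t \<omega>) \<in> borel_measurable (restrict_space borel {0..T} \<Otimes>\<^sub>M M) \<and>
    (\<forall>t\<in>{0..T}. X t \<in> borel_measurable (F t)) \<and>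
    (AE \<omega> in M. \<forall>t\<in>{0..T}. X t \<omega> = Y t \<omega>)"
proof -
  \<comment> \<open>The value \<open>0\<close> off \<open>{0..T}\<close> makes \<open>G k i\<close> measurable for every integer \<open>i\<close>.\<close>
  define G where "G = (\<lambda>(k::nat) (i::int) \<omega>. if T * of_int i / 2 ^ k \<in> {0..T} then Z (T * of_int i / 2 ^ k) \<omega> else 0)"
  define X where "X = (\<lambda>t \<omega>. lim (\<lambda>k. G k \<lfloor>2 ^ k * t / T\<rfloor> \<omega>))"
  have G_eq: "G k \<lfloor>2 ^ k * t / T\<rfloor> = Z (dyadic_floor T k t)" if t: "t \<in> {0..T}" for k t
    using dyadic_floor_bounds(3)[OF T t, of k] by (simp add: G_def dyadic_floor_def)
  have Gm: "G k i \<in> borel_measurable M" for k i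
  proof (cases "T * of_int i / 2 ^ k \<in> {0..T}")
    case True
    then show ?thesis using borel_measurable_F_M[OF Z[OF True] True] by (simp add: G_def)
  next
    case False
    then have "G k i = (\<lambda>_. 0)" unfolding G_def by auto
    then show ?thesis by simp
  qed
  have "(\<lambda>x. G k \<lfloor>2 ^ k * fst x / T\<rfloor> (snd x)) \<in> borel_measurable (borel \<Otimes>\<^sub>M M)" for k
  proof (rule measurable_compose_countable)
    show "(\<lambda>x. G k i (snd x)) \<in> borel_measurable (borel \<Otimes>\<^sub>M M)" for i
      by (rule measurable_compose[OF measurable_snd Gm])
    show "(\<lambda>x. \<lfloor>2 ^ k * fst x / T\<rfloor>) \<in> borel \<Otimes>\<^sub>M M \<rightarrow>\<^sub>M count_space UNIV" by measurable
  qed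
  then have "(\<lambda>x. X (fst x) (snd x)) \<in> borel_measurable (borel \<Otimes>\<^sub>M M)"
    unfolding X_def by (rule borel_measurable_lim_metric)
  then have "(\<lambda>x. indicator {0..T} (fst x) *\<^sub>R X (fst x) (snd x)) \<in> borel_measurable (borel \<Otimes>\<^sub>M M)"
    by (intro borel_measurable_scaleR) measurable
  then have "(\<lambda>(t, \<omega>). indicator {0..T} t *\<^sub>R X t \<omega>) \<in> borel_measurable (borel \<Otimes>\<^sub>M M)"
    by (simp add: split_beta')
  then have m: "(\<lambda>(t, \<omega>). X t \<omega>) \<in> borel_measurable (restrict_space borel {0..T} \<Otimes>\<^sub>M M)"
    by (rule measurable_pair_restrict_iff[THEN iffD2, rotated]) simp
  have a: "X t \<in> borel_measurable (F t)" if t: "t \<in> {0..T}" for t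
    unfolding X_def G_eq[OF t]
  proof (rule borel_measurable_lim_metric)
    fix k
    have D: "dyadic_floor T k t \<in> {0..T}" by (rule dyadic_floor_bounds(3)[OF T t])
    show "Z (dyadic_floor T k t) \<in> borel_measurable (F t)"
      by (rule borel_measurable_F_mono[OF Z[OF D]]) (use D t dyadic_floor_bounds(1)[OF T] in auto)
  qed
  have "AE \<omega> in M. \<forall>k i. T * of_int i / 2 ^ k \<in> {0..T} \<longrightarrow> Y (T * of_int i / 2 ^ k) \<omega> = Z (T * of_int i / 2 ^ k) \<omega>"
    unfolding AE_all_countable
  proof (intro allI)
    fix k :: nat and i :: int
    show "AE \<omega> in M. T * of_int i / 2 ^ k \<in> {0..T} \<longrightarrow> Y (T * of_int i / 2 ^ k) \<omega> = Z (T * of_int i / 2 ^ k) \<omega>"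
    proof (cases "T * of_int i / 2 ^ k \<in> {0..T}")
      case True
      from eq[OF True] show ?thesis by eventually_elim (rule impI)
    next
      case False
      then show ?thesis by (intro AE_I2) (rule impI, rule notE)
    qed
  qed
  with Y have "AE \<omega> in M. \<forall>t\<in>{0..T}. X t \<omega> = Y t \<omega>"
  proof eventually_elim
    case (elim \<omega>)
    show ?case
    proof
      fix t assume t: "t \<in> {0..T}"
      have D: "dyadic_floor T k t \<in> {0..T}" for k by (rule dyadic_floor_bounds(3)[OF T t])
      have "(\<lambda>k. Y (dyadic_floor T k t) \<omega>) \<longlonglongrightarrow> Y t \<omega>"
        by (rule continuous_on_tendsto_compose[OF elim(1) dyadic_floor_tendsto[OF T] t]) (use D in simp)
      moreover have "Y (dyadic_floor T k t) \<omega> = Z (dyadic_floor T k t) \<omega>" for k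
        using elim(2)[THEN spec, of k, THEN spec, of "\<lfloor>2 ^ k * t / T\<rfloor>"] D[of k] unfolding dyadic_floor_def by (rule mp)
      ultimately have "(\<lambda>k. Z (dyadic_floor T k t) \<omega>) \<longlonglongrightarrow> Y t \<omega>" by simp
      then show "X t \<omega> = Y t \<omega>" unfolding X_def G_eq[OF t] by (rule limI)
    qed
  qed
  then show ?thesis using m a by blast
qed

lemma sqn_pair_le:
  fixes f :: "real \<Rightarrow> 'w \<Rightarrow> 'b::euclidean_space"
  assumes [measurable]: "case_prod f \<in> borel_measurable (lborel \<Otimes>\<^sub>M M)"
    and le: "\<And>r \<omega>. \<omega> \<in> space M \<Longrightarrow> norm (f r \<omega>) \<le> g r"
  shows "sqn (lborel \<Otimes>\<^sub>M M) (case_prod f) \<le> sqn lborel g"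
proof -
  have "sqn (lborel \<Otimes>\<^sub>M M) (case_prod f) = (\<integral>\<^sup>+\<omega>. sqn lborel (\<lambda>r. f r \<omega>) \<partial>M)"
    unfolding sqn_def by (subst lborel_M.nn_integral_snd[symmetric]) auto
  also have "\<dots> \<le> (\<integral>\<^sup>+\<omega>. sqn lborel g \<partial>M)"
    by (intro nn_integral_mono sqn_mono order_trans[OF le]) auto
  finally show ?thesis by (simp add: emeasure_space_1)
qed

text \<open>The increment of the convolution from \<open>s\<close> to \<open>t\<close> is the Ito integral of \<open>k s t \<cdot> f\<close>, where \<open>k s t\<close> is the
  increment of the kernel. Since \<open>(x - y)\<^sup>2 \<le> \<bar>x\<^sup>2 - y\<^sup>2\<bar>\<close> for nonnegative \<open>x\<close> and \<open>y\<close>, the square of \<open>k s t\<close> is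
  controlled by \<open>kernel_increment\<close> with exponent \<open>q = 2 \<alpha> - 1 > 0\<close>. So the increment is sub-Gaussian with
  variance of order \<open>(t - s) powr q\<close>, as \<open>continuous_version\<close> requires.\<close>

lemma stochastic_convolution_continuous:
  fixes f :: "real \<Rightarrow> 'w \<Rightarrow> real ^ 'n"
  assumes T: "0 < T" and \<alpha>: "1 / 2 < \<alpha>" "\<alpha> < 1"
    and f: "(\<lambda>(r, \<omega>). f r \<omega>) \<in> borel_measurable (restrict_space borel {0..T} \<Otimes>\<^sub>M M)"
    and ad: "\<And>r. r \<in> {0..T} \<Longrightarrow> f r \<in> borel_measurable (F r)"
    and C: "\<And>r \<omega>. r \<in> {0..T} \<Longrightarrow> \<omega> \<in> space M \<Longrightarrow> norm (f r \<omega>) \<le> C"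
  shows "\<exists>I Y. (\<forall>t\<in>{0..T}. has_ito_integral M F W t (\<lambda>r \<omega>. (t - r) powr (\<alpha> - 1) *\<^sub>R f r \<omega>) (I t)) \<and>
     (AE \<omega> in M. continuous_on {0..T} (\<lambda>t. Y t \<omega>)) \<and> (\<forall>t\<in>{0..T}. AE \<omega> in M. Y t \<omega> = I t \<omega>)"
proof -
  define q where "q = 2 * \<alpha> - 1"
  have q: "0 < q" "q < 1" using \<alpha> by (auto simp: q_def)
  define k where "k = (\<lambda>s t r. (t - r) powr (\<alpha> - 1) - indicator {0..<s} r * (s - r) powr (\<alpha> - 1) :: real)"
  have C0: "0 \<le> C"
  proof -
    obtain \<omega> where "\<omega> \<in> space M" using not_empty by auto
    from order_trans[OF norm_ge_zero C[OF _ this, of 0]] T show ?thesis by simp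
  qed
  define v where "v = (\<lambda>s t. C\<^sup>2 * (2 * (t - s) powr q / q) :: real)"
  have v0: "0 \<le> v s t" for s t using q by (simp add: v_def)
  have k_sq: "(\<integral>\<^sup>+r\<in>{0..t}. ennreal ((C * \<bar>k s t r\<bar>)\<^sup>2) \<partial>lborel) \<le> ennreal (v s t)" if st: "0 \<le> s" "s \<le> t" for s t
  proof -
    have pw: "(k s t r)\<^sup>2 \<le> \<bar>(t - r) powr (q - 1) - indicator {0..s} r * (s - r) powr (q - 1)\<bar>" if "r \<in> {0..t}" for r
    proof -
      have sq: "(x powr (\<alpha> - 1))\<^sup>2 = x powr (q - 1)" for x :: real
        by (simp add: power2_eq_square powr_add[symmetric] q_def)
      show ?thesis
      proof (cases "r < s")
        case True
        have "(t - r) powr (\<alpha> - 1) \<le> (s - r) powr (\<alpha> - 1)" using True st \<alpha> by (intro powr_mono2') auto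
        moreover have "(a - b)\<^sup>2 \<le> \<bar>a\<^sup>2 - b\<^sup>2\<bar>" if "a \<le> b" "0 \<le> a" for a b :: real
        proof -
          have "(a - b)\<^sup>2 = (b - a) * (b - a)" by (simp add: power2_eq_square algebra_simps)
          also have "\<dots> \<le> (b - a) * (b + a)" using that by (intro mult_left_mono) auto
          also have "\<dots> = b\<^sup>2 - a\<^sup>2" by (simp add: power2_eq_square algebra_simps)
          also have "\<dots> \<le> \<bar>a\<^sup>2 - b\<^sup>2\<bar>" by simp
          finally show ?thesis .
        qed
        ultimately have "((t - r) powr (\<alpha> - 1) - (s - r) powr (\<alpha> - 1))\<^sup>2 \<le> \<bar>(t - r) powr (q - 1) - (s - r) powr (q - 1)\<bar>"
          unfolding sq[symmetric] by simp
        then show ?thesis using True that by (simp add: k_def)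
      next
        case False
        then have z: "indicator {0..s} r * (s - r) powr (q - 1) = 0" by (cases "r = s") auto
        show ?thesis unfolding z using False by (simp add: k_def sq)
      qed
    qed
    have "(\<integral>\<^sup>+r\<in>{0..t}. ennreal ((C * \<bar>k s t r\<bar>)\<^sup>2) \<partial>lborel)
      \<le> (\<integral>\<^sup>+r. ennreal (C\<^sup>2) * (ennreal \<bar>(t - r) powr (q - 1) - indicator {0..s} r * (s - r) powr (q - 1)\<bar> * indicator {0..t} r) \<partial>lborel)"
    proof (intro nn_integral_mono)
      fix r
      show "ennreal ((C * \<bar>k s t r\<bar>)\<^sup>2) * indicator {0..t} r
        \<le> ennreal (C\<^sup>2) * (ennreal \<bar>(t - r) powr (q - 1) - indicator {0..s} r * (s - r) powr (q - 1)\<bar> * indicator {0..t} r)"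
      proof (cases "r \<in> {0..t}")
        case True
        have "(C * \<bar>k s t r\<bar>)\<^sup>2 = C\<^sup>2 * (k s t r)\<^sup>2" by (simp add: power_mult_distrib)
        also have "\<dots> \<le> C\<^sup>2 * \<bar>(t - r) powr (q - 1) - indicator {0..s} r * (s - r) powr (q - 1)\<bar>"
          by (intro mult_left_mono pw True) simp
        finally show ?thesis using True by (simp add: ennreal_mult[symmetric] ennreal_leI)
      qed simp
    qed
    also have "\<dots> = ennreal (C\<^sup>2) * (\<integral>\<^sup>+r\<in>{0..t}. ennreal \<bar>(t - r) powr (q - 1) - indicator {0..s} r * (s - r) powr (q - 1)\<bar> \<partial>lborel)"
      by (rule nn_integral_cmult) auto
    also have "\<dots> \<le> ennreal (C\<^sup>2) * ennreal (2 * (t - s) powr q / q)"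
      by (intro mult_left_mono kernel_increment q st) simp
    also have "\<dots> = ennreal (v s t)" unfolding v_def using q by (subst ennreal_mult) auto
    finally show ?thesis .
  qed
  have fm: "(\<lambda>(r, \<omega>). w r *\<^sub>R f r \<omega>) \<in> borel_measurable (restrict_space borel {0..t} \<Otimes>\<^sub>M M)"
    if "w \<in> borel_measurable borel" "t \<le> T" for w t
  proof (rule measurable_pair_restrict_iff[THEN iffD2])
    have 1: "(\<lambda>(r, \<omega>). indicator {0..T} r *\<^sub>R f r \<omega>) \<in> borel_measurable (borel \<Otimes>\<^sub>M M)"
      by (rule measurable_pair_restrict_iff[THEN iffD1, OF _ f]) simp
    have 2: "(\<lambda>x. (indicator {0..t} (fst x) * w (fst x)) *\<^sub>R (case x of (r, \<omega>) \<Rightarrow> indicator {0..T} r *\<^sub>R f r \<omega>)) \<in> borel_measurable (borel \<Otimes>\<^sub>M M)"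
      using measurable_compose[OF measurable_fst that(1)] by (intro borel_measurable_scaleR borel_measurable_times 1) measurable
    also have "(\<lambda>x. (indicator {0..t} (fst x) * w (fst x)) *\<^sub>R (case x of (r, \<omega>) \<Rightarrow> indicator {0..T} r *\<^sub>R f r \<omega>)) = (\<lambda>(r, \<omega>). indicator {0..t} r *\<^sub>R w r *\<^sub>R f r \<omega>)"
      using that(2) by (auto simp: fun_eq_iff indicator_def)
    finally show "(\<lambda>(r, \<omega>). indicator {0..t} r *\<^sub>R w r *\<^sub>R f r \<omega>) \<in> borel_measurable (borel \<Otimes>\<^sub>M M)" .
  qed simp
  have km [measurable]: "k s t \<in> borel_measurable borel" for s t unfolding k_def by measurable
  have fa: "(\<lambda>\<omega>. c *\<^sub>R f r \<omega>) \<in> borel_measurable (F r)" if "r \<in> {0..T}" for r c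
    using ad[OF that] by (intro borel_measurable_scaleR borel_measurable_const)
  have dom: "norm (k s t r *\<^sub>R f r \<omega>) \<le> C * \<bar>k s t r\<bar>" if "r \<in> {0..T}" "\<omega> \<in> space M" for s t r \<omega>
    using C[OF that] mult_right_mono[of "norm (f r \<omega>)" C "\<bar>k s t r\<bar>"] by (simp add: mult.commute)
  have J: "\<exists>I. has_ito_integral M F W t (\<lambda>r \<omega>. k s t r *\<^sub>R f r \<omega>) I \<and>
    (\<forall>j l. (\<integral>\<^sup>+\<omega>. ennreal (exp (l * I \<omega> $ j)) \<partial>M) \<le> ennreal (exp (l\<^sup>2 * v s t / 2)))" if st: "0 \<le> s" "s \<le> t" "t \<le> T" for s t
    by (rule has_ito_integral_exists[where g = "\<lambda>r. C * \<bar>k s t r\<bar>"])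
       (use st fm[OF km] fa dom k_sq[OF st(1,2)] v0 in auto)
  have ex: "\<exists>I. has_ito_integral M F W t (\<lambda>r \<omega>. (t - r) powr (\<alpha> - 1) *\<^sub>R f r \<omega>) I" if t: "t \<in> {0..T}" for t
  proof -
    have "k 0 t r = (t - r) powr (\<alpha> - 1)" for r by (simp add: k_def)
    then show ?thesis using J[of 0 t] t by auto
  qed
  define I where "I = (\<lambda>t. SOME I. has_ito_integral M F W t (\<lambda>r \<omega>. (t - r) powr (\<alpha> - 1) *\<^sub>R f r \<omega>) I)"
  have I: "has_ito_integral M F W t (\<lambda>r \<omega>. (t - r) powr (\<alpha> - 1) *\<^sub>R f r \<omega>) (I t)" if "t \<in> {0..T}" for t
    unfolding I_def by (rule someI_ex[OF ex[OF that]])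
  have inc: "\<exists>J. (AE \<omega> in M. I t \<omega> - I s \<omega> = J \<omega>) \<and>
    (\<forall>j l. (\<integral>\<^sup>+\<omega>. ennreal (exp (l * J \<omega> $ j)) \<partial>M) \<le> ennreal (exp (l\<^sup>2 * v s t / 2))) \<and> sqn M J \<le> 4 * ennreal (v s t)"
    if st: "0 \<le> s" "s \<le> t" "t \<le> T" for s t
  proof -
    have tT: "t \<in> {0..T}" "s \<in> {0..T}" using st by auto
    obtain J where J: "has_ito_integral M F W t (\<lambda>r \<omega>. k s t r *\<^sub>R f r \<omega>) J"
      "\<And>j l. (\<integral>\<^sup>+\<omega>. ennreal (exp (l * J \<omega> $ j)) \<partial>M) \<le> ennreal (exp (l\<^sup>2 * v s t / 2))" using J[OF st] by blast
    note iJ = has_ito_integral_imp_ito[OF J(1) tT(1)]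
    note iI = ito_diff[OF has_ito_integral_imp_ito[OF I[OF tT(1)] tT(1)] has_ito_integral_imp_ito[OF I[OF tT(2)] tT(2)]]
    have "AE \<omega> in M. I t \<omega> - I s \<omega> = J \<omega>"
    proof (rule ito_unique[OF iI iJ], rule AE_I2, clarify)
      fix r \<omega>
      show "indicator {0..t} r *\<^sub>R (t - r) powr (\<alpha> - 1) *\<^sub>R f r \<omega> - indicator {0..s} r *\<^sub>R (s - r) powr (\<alpha> - 1) *\<^sub>R f r \<omega>
         = indicator {0..t} r *\<^sub>R k s t r *\<^sub>R f r \<omega>"
        using st by (cases "r = s") (auto simp: k_def indicator_def scaleR_diff_left)
    qed
    moreover have "sqn M J \<le> 4 * ennreal (v s t)"
    proof -
      have "sqn M J \<le> 4 * sqn (lborel \<Otimes>\<^sub>M M) (case_prod (\<lambda>r \<omega>. indicator {0..t} r *\<^sub>R k s t r *\<^sub>R f r \<omega>))"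
        by (rule ito_bound[OF iJ])
      also have "\<dots> \<le> 4 * sqn lborel (\<lambda>r. indicator {0..t} r * (C * \<bar>k s t r\<bar>))"
      proof (intro mult_left_mono sqn_pair_le ito_measurable(1)[OF iJ])
        fix r \<omega> assume "\<omega> \<in> space M"
        then show "norm (indicator {0..t} r *\<^sub>R k s t r *\<^sub>R f r \<omega>) \<le> indicator {0..t} r * (C * \<bar>k s t r\<bar>)"
          using dom[of r \<omega> s t] st by (auto simp: indicator_def)
      qed simp
      also have "sqn lborel (\<lambda>r. indicator {0..t} r * (C * \<bar>k s t r\<bar>)) = (\<integral>\<^sup>+r\<in>{0..t}. ennreal ((C * \<bar>k s t r\<bar>)\<^sup>2) \<partial>lborel)"
        unfolding sqn_def by (intro nn_integral_cong) (auto simp: indicator_def)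
      also have "4 * (\<integral>\<^sup>+r\<in>{0..t}. ennreal ((C * \<bar>k s t r\<bar>)\<^sup>2) \<partial>lborel) \<le> 4 * ennreal (v s t)"
        by (intro mult_left_mono k_sq st) simp
      finally show ?thesis .
    qed
    ultimately show ?thesis using J(2) by blast
  qed
  have Im: "I t \<in> borel_measurable M" if "t \<in> {0..T}" for t
    using ito_measurable(2)[OF has_ito_integral_imp_ito[OF I[OF that] that]] .
  have "\<exists>Y. (AE \<omega> in M. continuous_on {0..T} (\<lambda>t. Y t \<omega>)) \<and> (\<forall>t\<in>{0..T}. AE \<omega> in M. Y t \<omega> = I t \<omega>)"
  proof (rule continuous_version[OF T q(1), where K = "C\<^sup>2 * 2 / q" and L = "4 * (C\<^sup>2 * 2 / q)"])
    show "0 \<le> C\<^sup>2 * 2 / q" using q by simp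
    fix s t assume st: "0 \<le> s" "s \<le> t" "t \<le> T"
    have v_eq: "v s t = C\<^sup>2 * 2 / q * (t - s) powr q" by (simp add: v_def)
    from inc[OF st] obtain J where J: "AE \<omega> in M. I t \<omega> - I s \<omega> = J \<omega>"
      "\<And>j l. (\<integral>\<^sup>+\<omega>. ennreal (exp (l * J \<omega> $ j)) \<partial>M) \<le> ennreal (exp (l\<^sup>2 * v s t / 2))" "sqn M J \<le> 4 * ennreal (v s t)" by blast
    show "(\<integral>\<^sup>+\<omega>. ennreal (exp (l * (I t \<omega> $ j - I s \<omega> $ j))) \<partial>M) \<le> ennreal (exp (l\<^sup>2 * (C\<^sup>2 * 2 / q * (t - s) powr q) / 2))" for l j
    proof -
      have "(\<integral>\<^sup>+\<omega>. ennreal (exp (l * (I t \<omega> $ j - I s \<omega> $ j))) \<partial>M) = (\<integral>\<^sup>+\<omega>. ennreal (exp (l * J \<omega> $ j)) \<partial>M)"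
      proof (rule nn_integral_cong_AE, use J(1) in eventually_elim)
        case (elim \<omega>)
        then have "J \<omega> $ j = I t \<omega> $ j - I s \<omega> $ j" by (simp flip: elim)
        then show ?case by simp
      qed
      then show ?thesis using J(2)[of l j] unfolding v_eq by simp
    qed
    have "sqn M (\<lambda>\<omega>. I t \<omega> - I s \<omega>) = sqn M J" by (rule sqn_cong_AE[OF J(1)])
    also have "\<dots> \<le> 4 * ennreal (v s t)" by (rule J(3))
    also have "\<dots> = ennreal (4 * v s t)" using v0[of s t] by (simp add: ennreal_mult)
    also have "4 * v s t = 4 * (C\<^sup>2 * 2 / q) * (t - s) powr q" unfolding v_eq by simp
    finally show "sqn M (\<lambda>\<omega>. I t \<omega> - I s \<omega>) \<le> ennreal (4 * (C\<^sup>2 * 2 / q) * (t - s) powr q)" .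
  qed (rule Im)
  then show ?thesis using I by blast
qed

end

section \<open>Exponentially weighted kernels\<close>

text \<open>The factor that convolution with \<open>u powr (p - 1)\<close> costs in norms weighted by \<open>exp (- l t)\<close>. It tends to
  \<open>0\<close> as \<open>l\<close> grows, which makes all Volterra operators below contractions.\<close>

definition laplace_kernel :: "real \<Rightarrow> real \<Rightarrow> real \<Rightarrow> ennreal" where
  "laplace_kernel T p l = (\<integral>\<^sup>+u\<in>{0..T}. ennreal (u powr (p - 1) * exp (- l * u)) \<partial>lborel)"

lemma laplace_kernel_0:
  assumes p: "0 < p" and T: "0 \<le> T"
  shows "laplace_kernel T p 0 < \<infinity>"
proof -
  have "laplace_kernel T p 0 = (\<integral>\<^sup>+u. ennreal (indicator {0..T} u * u powr (p - 1)) \<partial>lborel)"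
    unfolding laplace_kernel_def by (intro nn_integral_cong) (auto simp: indicator_def)
  also have "\<dots> = ennreal (T powr (p - 1 + 1) / (p - 1 + 1))"
    using p T by (intro nn_integral_has_integral_lebesgue has_integral_powr_from_0) auto
  finally show ?thesis by simp
qed

lemma laplace_kernel_tendsto:
  assumes p: "0 < p" and T: "0 \<le> T"
  shows "(\<lambda>n. laplace_kernel T p (real n)) \<longlonglongrightarrow> 0"
proof -
  have "(\<lambda>n. laplace_kernel T p (real n)) \<longlonglongrightarrow> (\<integral>\<^sup>+(u::real). 0 \<partial>lborel)"
    unfolding laplace_kernel_def
  proof (rule nn_integral_dominated_convergence[where w = "\<lambda>u. ennreal (u powr (p - 1)) * indicator {0..T} u"])
    show "AE u in lborel. ennreal (u powr (p - 1) * exp (- real n * u)) * indicator {0..T} u \<le> ennreal (u powr (p - 1)) * indicator {0..T} u" for n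
      by (intro AE_I2) (auto simp: indicator_def intro!: ennreal_leI mult_left_le)
    show "(\<integral>\<^sup>+u. ennreal (u powr (p - 1)) * indicator {0..T} u \<partial>lborel) < \<infinity>"
      using laplace_kernel_0[OF p T] by (simp add: laplace_kernel_def)
    show "AE u in lborel. (\<lambda>n. ennreal (u powr (p - 1) * exp (- real n * u)) * indicator {0..T} u) \<longlonglongrightarrow> 0"
    proof (use AE_lborel_singleton[of 0] in eventually_elim)
      case (elim u)
      show ?case
      proof (cases "u \<in> {0..T}")
        case True
        then have u: "0 < u" using elim by auto
        have "(\<lambda>n. u powr (p - 1) * exp (- u) ^ n) \<longlonglongrightarrow> u powr (p - 1) * 0"
          using u by (intro tendsto_mult tendsto_const LIMSEQ_realpow_zero) auto
        then have "(\<lambda>n. u powr (p - 1) * exp (- real n * u)) \<longlonglongrightarrow> 0"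
          by (simp add: exp_of_nat_mult[symmetric])
        then have "(\<lambda>n. ennreal (u powr (p - 1) * exp (- real n * u))) \<longlonglongrightarrow> ennreal 0"
          by (rule tendsto_ennrealI)
        then show ?thesis using True by simp
      qed simp
    qed
  qed auto
  then show ?thesis by simp
qed

lemma eventually_laplace_kernel_small:
  assumes "0 < p" "0 \<le> T" "0 < \<theta>"
  shows "eventually (\<lambda>n. laplace_kernel T p (real n) \<le> ennreal \<theta>) sequentially"
proof -
  have "eventually (\<lambda>n. laplace_kernel T p (real n) < ennreal \<theta>) sequentially"
    using laplace_kernel_tendsto[OF assms(1,2)] by (rule order_tendstoD) (use assms(3) in simp)
  then show ?thesis by eventually_elim simp
qed

lemma weighted_kernel_le:
  assumes t: "0 \<le> t" "t \<le> T"
  shows "(\<integral>\<^sup>+r\<in>{0..t}. ennreal ((t - r) powr (p - 1) * exp (l * r)) \<partial>lborel) \<le> ennreal (exp (l * t)) * laplace_kernel T p l"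
proof -
  have "(\<integral>\<^sup>+r\<in>{0..t}. ennreal ((t - r) powr (p - 1) * exp (l * r)) \<partial>lborel)
    = ennreal \<bar>- 1\<bar> * (\<integral>\<^sup>+u. ennreal ((t - (t + (- 1) * u)) powr (p - 1) * exp (l * (t + (- 1) * u))) * indicator {0..t} (t + (- 1) * u) \<partial>lborel)"
    by (rule nn_integral_real_affine[where t = t and c = "- 1"]) auto
  also have "\<dots> \<le> (\<integral>\<^sup>+u. ennreal (exp (l * t)) * (ennreal (u powr (p - 1) * exp (- l * u)) * indicator {0..T} u) \<partial>lborel)"
  proof (simp, intro nn_integral_mono)
    fix u
    have "u powr (p - 1) * exp (l * (t - u)) = exp (l * t) * (u powr (p - 1) * exp (- l * u))"
      by (simp add: right_diff_distrib exp_diff exp_minus field_simps)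
    then show "ennreal (u powr (p - 1) * exp (l * (t - u))) * indicator {0..t} (t - u)
      \<le> ennreal (exp (l * t)) * (ennreal (u powr (p - 1) * exp (- (l * u))) * indicator {0..T} u)"
      using t by (auto simp: indicator_def ennreal_mult[symmetric])
  qed
  also have "\<dots> = ennreal (exp (l * t)) * laplace_kernel T p l"
    unfolding laplace_kernel_def by (rule nn_integral_cmult) auto
  finally show ?thesis .
qed

text \<open>The Riemann-Liouville integral of order \<open>p\<close>, up to the factor \<open>1 / Gamma p\<close>.\<close>

definition kernel_conv :: "real \<Rightarrow> (real \<Rightarrow> 'b::{banach,second_countable_topology}) \<Rightarrow> real \<Rightarrow> 'b" where
  "kernel_conv p u t = (LINT r:{0..t}|lborel. (t - r) powr (p - 1) *\<^sub>R u r)"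

lemma kernel_conv_norm_le:
  "ennreal (norm (kernel_conv p u t)) \<le> (\<integral>\<^sup>+r\<in>{0..t}. ennreal ((t - r) powr (p - 1) * norm (u r)) \<partial>lborel)"
proof (cases "integrable lborel (\<lambda>r. indicator {0..t} r *\<^sub>R (t - r) powr (p - 1) *\<^sub>R u r)")
  case True
  have "ennreal (norm (kernel_conv p u t)) \<le> (\<integral>\<^sup>+r. ennreal (norm (indicator {0..t} r *\<^sub>R (t - r) powr (p - 1) *\<^sub>R u r)) \<partial>lborel)"
    unfolding kernel_conv_def set_lebesgue_integral_def by (rule integral_norm_bound_ennreal[OF True])
  also have "\<dots> = (\<integral>\<^sup>+r\<in>{0..t}. ennreal ((t - r) powr (p - 1) * norm (u r)) \<partial>lborel)"
    by (intro nn_integral_cong) (auto simp: indicator_def)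
  finally show ?thesis .
next
  case False
  then show ?thesis unfolding kernel_conv_def set_lebesgue_integral_def by (simp add: not_integrable_integral_eq)
qed

lemma kernel_conv_cong_AE:
  assumes "AE r in lborel. r \<in> {0..t} \<longrightarrow> u r = v r"
    and "(\<lambda>r. indicator {0..t} r *\<^sub>R u r) \<in> borel_measurable borel" "(\<lambda>r. indicator {0..t} r *\<^sub>R v r) \<in> borel_measurable borel"
  shows "kernel_conv p u t = kernel_conv p v t"
  unfolding kernel_conv_def set_lebesgue_integral_def
proof (rule integral_cong_AE)
  show "AE r in lborel. indicator {0..t} r *\<^sub>R (t - r) powr (p - 1) *\<^sub>R u r = indicator {0..t} r *\<^sub>R (t - r) powr (p - 1) *\<^sub>R v r"
    using assms(1) by eventually_elim (auto simp: indicator_def)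
  have "(\<lambda>r. indicator {0..t} r *\<^sub>R (t - r) powr (p - 1) *\<^sub>R w r) \<in> borel_measurable lborel"
    if [measurable]: "(\<lambda>r. indicator {0..t} r *\<^sub>R w r) \<in> borel_measurable borel" for w :: "real \<Rightarrow> 'a"
  proof -
    have "(\<lambda>r. (t - r) powr (p - 1) *\<^sub>R (indicator {0..t} r *\<^sub>R w r)) \<in> borel_measurable lborel" by measurable
    then show ?thesis by (simp add: mult.commute)
  qed
  from this[OF assms(2)] this[OF assms(3)]
  show "(\<lambda>r. indicator {0..t} r *\<^sub>R (t - r) powr (p - 1) *\<^sub>R u r) \<in> borel_measurable lborel"
    "(\<lambda>r. indicator {0..t} r *\<^sub>R (t - r) powr (p - 1) *\<^sub>R v r) \<in> borel_measurable lborel" .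
qed

lemma kernel_conv_diff:
  assumes "set_integrable lborel {0..t} (\<lambda>r. (t - r) powr (p - 1) *\<^sub>R u r)"
    "set_integrable lborel {0..t} (\<lambda>r. (t - r) powr (p - 1) *\<^sub>R v r)"
  shows "kernel_conv p u t - kernel_conv p v t = kernel_conv p (\<lambda>r. u r - v r) t"
  unfolding kernel_conv_def by (subst set_integral_diff(2)[OF assms, symmetric]) (simp add: scaleR_diff_right)

lemma indicator_scale_subset_measurable:
  fixes u :: "real \<Rightarrow> 'b::{real_normed_vector,second_countable_topology}"
  assumes [measurable]: "(\<lambda>r. indicator {0..T} r *\<^sub>R u r) \<in> borel_measurable borel" and "t \<le> T"
  shows "(\<lambda>r. indicator {0..t} r *\<^sub>R u r) \<in> borel_measurable borel"
proof -
  have "(\<lambda>r. indicator {0..t} r *\<^sub>R (indicator {0..T} r *\<^sub>R u r)) \<in> borel_measurable borel" by measurable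
  also have "(\<lambda>r. indicator {0..t} r *\<^sub>R (indicator {0..T} r *\<^sub>R u r)) = (\<lambda>r. indicator {0..t} r *\<^sub>R u r)"
    using assms(2) by (auto simp: indicator_def fun_eq_iff)
  finally show ?thesis .
qed

section \<open>The linear Volterra equation\<close>

lemma continuous_on_indicator_measurable:
  fixes u :: "real \<Rightarrow> 'b::{real_normed_vector,second_countable_topology}"
  assumes "continuous_on {0..T} u"
  shows "(\<lambda>r. indicator {0..T} r *\<^sub>R u r) \<in> borel_measurable borel"
  using borel_measurable_continuous_on_indicator[OF _ assms] by simp

lemma continuous_on_Icc_bounded:
  fixes u :: "real \<Rightarrow> 'b::real_normed_vector"
  assumes "continuous_on {0..T} u"
  shows "\<exists>C. \<forall>r\<in>{0..T}. norm (u r) \<le> C"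
  using compact_imp_bounded[OF compact_continuous_image[OF assms compact_Icc]] by (auto simp: bounded_iff)

lemma continuous_on_kernel_conv:
  fixes u :: "real \<Rightarrow> 'b::{banach,second_countable_topology}"
  assumes "0 < p" "p < 1" "continuous_on {0..T} u"
  shows "continuous_on {0..T} (kernel_conv p u)"
proof -
  obtain C where "\<And>r. r \<in> {0..T} \<Longrightarrow> norm (u r) \<le> C" using continuous_on_Icc_bounded[OF assms(3)] by blast
  from continuous_on_kernel_convolution[OF assms(1,2) continuous_on_indicator_measurable[OF assms(3)] this]
  show ?thesis unfolding kernel_conv_def[abs_def] .
qed

lemma set_integrable_kernel_continuous:
  fixes u :: "real \<Rightarrow> 'b::{banach,second_countable_topology}"
  assumes "0 < p" "continuous_on {0..T} u" "t \<in> {0..T}"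
  shows "set_integrable lborel {0..t} (\<lambda>r. (t - r) powr (p - 1) *\<^sub>R u r)"
proof -
  obtain C where C: "\<And>r. r \<in> {0..T} \<Longrightarrow> norm (u r) \<le> C" using continuous_on_Icc_bounded[OF assms(2)] by blast
  have "(\<lambda>r. indicator {0..t} r *\<^sub>R u r) \<in> borel_measurable borel"
    using assms(3) by (intro indicator_scale_subset_measurable[OF continuous_on_indicator_measurable[OF assms(2)]]) auto
  then show ?thesis
    by (rule integrable_kernel_bounded[OF assms(1), rotated, where C = C]) (use C assms(3) in auto)
qed

text \<open>Banach's fixed point theorem on bounded continuous functions of the line. The operator \<open>\<Theta>\<close> works with
  \<open>exp (- l t) y t\<close>, extended beyond \<open>{0..T}\<close> by the values at the end points; \<open>up\<close> removes the weight. For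
  large \<open>l\<close> each of the two convolutions contributes a factor of at most \<open>1 / 4\<close>.\<close>

theorem volterra_continuous_solution:
  fixes h :: "real \<Rightarrow> 'b::euclidean_space" and P Q :: "'b \<Rightarrow> 'b"
  assumes T: "0 \<le> T" and p: "0 < p" "p < 1" and q: "0 < q" "q < 1"
    and P: "bounded_linear P" and Q: "bounded_linear Q" and h: "continuous_on {0..T} h"
  shows "\<exists>y. continuous_on {0..T} y \<and> (\<forall>t\<in>{0..T}. y t = h t + P (kernel_conv p y t) + Q (kernel_conv q y t))"
proof -
  obtain Kp where Kp: "0 < Kp" "\<And>x. norm (P x) \<le> norm x * Kp" using bounded_linear.pos_bounded[OF P] by blast
  obtain Kq where Kq: "0 < Kq" "\<And>x. norm (Q x) \<le> norm x * Kq" using bounded_linear.pos_bounded[OF Q] by blast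
  have "eventually (\<lambda>n. laplace_kernel T p (real n) \<le> ennreal (1 / (4 * Kp)) \<and> laplace_kernel T q (real n) \<le> ennreal (1 / (4 * Kq))) sequentially"
    using Kp(1) Kq(1) T p q by (intro eventually_conj eventually_laplace_kernel_small) auto
  then obtain n where n: "laplace_kernel T p (real n) \<le> ennreal (1 / (4 * Kp))" "laplace_kernel T q (real n) \<le> ennreal (1 / (4 * Kq))"
    using eventually_happens'[OF sequentially_bot] by blast
  define l where "l = real n"
  define cl where "cl = (\<lambda>t. max 0 (min T t))"
  have cl: "cl t \<in> {0..T}" for t using T by (auto simp: cl_def)
  have cl_id: "cl t = t" if "t \<in> {0..T}" for t using that by (auto simp: cl_def)
  define up where "up = (\<lambda>(z :: real \<Rightarrow>\<^sub>C 'b) r. exp (l * r) *\<^sub>R apply_bcontfun z r)"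
  have up: "continuous_on {0..T} (up z)" for z
    unfolding up_def by (intro continuous_intros continuous_on_apply_bcontfun) 
  define G where "G = (\<lambda>z t. exp (- l * t) *\<^sub>R (h t + P (kernel_conv p (up z) t) + Q (kernel_conv q (up z) t)))"
  have G: "continuous_on {0..T} (G z)" for z
    unfolding G_def
    by (intro continuous_intros h bounded_linear.continuous_on[OF P] bounded_linear.continuous_on[OF Q] continuous_on_kernel_conv p q up)
  have Gcl: "continuous_on UNIV (\<lambda>t. G z (cl t))" for z
    by (rule continuous_on_compose2[OF G]) (use cl in \<open>auto simp: cl_def intro!: continuous_intros\<close>)
  have G_bcont: "(\<lambda>t. G z (cl t)) \<in> bcontfun" for z
  proof -
    obtain C where "\<And>t. t \<in> {0..T} \<Longrightarrow> norm (G z t) \<le> C" using continuous_on_Icc_bounded[OF G] by blast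
    then show ?thesis using Gcl cl by (intro bcontfun_normI) auto
  qed
  define \<Theta> where "\<Theta> = (\<lambda>z. Bcontfun (\<lambda>t. G z (cl t)))"
  have \<Theta>: "apply_bcontfun (\<Theta> z) t = G z (cl t)" for z t
    unfolding \<Theta>_def by (simp add: Bcontfun_inverse[OF G_bcont])
  have conv: "norm (kernel_conv s (up z) t - kernel_conv s (up w) t) \<le> exp (l * t) * dist z w / (4 * K)"
    if s: "0 < s" "laplace_kernel T s l \<le> ennreal (1 / (4 * K))" "0 < K" and t: "t \<in> {0..T}" for s z w t K
  proof -
    have "kernel_conv s (up z) t - kernel_conv s (up w) t = kernel_conv s (\<lambda>r. up z r - up w r) t"
      by (intro kernel_conv_diff set_integrable_kernel_continuous[OF s(1) up t])
    then have "ennreal (norm (kernel_conv s (up z) t - kernel_conv s (up w) t))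
      \<le> (\<integral>\<^sup>+r\<in>{0..t}. ennreal ((t - r) powr (s - 1) * norm (up z r - up w r)) \<partial>lborel)"
      by (simp only: kernel_conv_norm_le)
    also have "\<dots> \<le> (\<integral>\<^sup>+r. ennreal (dist z w) * (ennreal ((t - r) powr (s - 1) * exp (l * r)) * indicator {0..t} r) \<partial>lborel)"
    proof (intro nn_integral_mono)
      fix r
      have "norm (up z r - up w r) = exp (l * r) * dist (apply_bcontfun z r) (apply_bcontfun w r)"
        unfolding up_def by (simp add: scaleR_diff_right[symmetric] dist_norm)
      also have "\<dots> \<le> exp (l * r) * dist z w" by (intro mult_left_mono dist_bounded) auto
      finally have "(t - r) powr (s - 1) * norm (up z r - up w r) \<le> (t - r) powr (s - 1) * (exp (l * r) * dist z w)"
        by (rule mult_left_mono) simp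
      also have "\<dots> = dist z w * ((t - r) powr (s - 1) * exp (l * r))" by simp
      finally show "ennreal ((t - r) powr (s - 1) * norm (up z r - up w r)) * indicator {0..t} r
        \<le> ennreal (dist z w) * (ennreal ((t - r) powr (s - 1) * exp (l * r)) * indicator {0..t} r)"
        by (auto simp: indicator_def ennreal_mult[symmetric] intro!: ennreal_leI)
    qed
    also have "\<dots> = ennreal (dist z w) * (\<integral>\<^sup>+r\<in>{0..t}. ennreal ((t - r) powr (s - 1) * exp (l * r)) \<partial>lborel)"
      by (rule nn_integral_cmult) auto
    also have "\<dots> \<le> ennreal (dist z w) * (ennreal (exp (l * t)) * ennreal (1 / (4 * K)))"
      using t by (intro mult_left_mono order_trans[OF weighted_kernel_le[of t T]] s) auto
    also have "\<dots> = ennreal (exp (l * t) * dist z w / (4 * K))"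
      using s(3) by (simp add: ennreal_mult[symmetric] mult.commute)
    finally show ?thesis using s(3) by (subst (asm) ennreal_le_iff) auto
  qed
  have "\<exists>!z. \<Theta> z = z"
  proof (rule banach_fix_type)
    show "0 \<le> (1 / 2 :: real)" "1 / 2 < (1 :: real)" by auto
    have "dist (\<Theta> z) (\<Theta> w) \<le> 1 / 2 * dist z w" for z w
    proof (rule dist_bound)
      fix t
      define s where "s = cl t"
      have s: "s \<in> {0..T}" using cl by (simp add: s_def)
      have "G z s - G w s = exp (- l * s) *\<^sub>R (P (kernel_conv p (up z) s - kernel_conv p (up w) s) + Q (kernel_conv q (up z) s - kernel_conv q (up w) s))"
        unfolding G_def scaleR_diff_right[symmetric] by (simp add: linear_diff[OF bounded_linear.linear[OF P]] linear_diff[OF bounded_linear.linear[OF Q]])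
      then have "norm (G z s - G w s) = exp (- l * s) * norm (P (kernel_conv p (up z) s - kernel_conv p (up w) s) + Q (kernel_conv q (up z) s - kernel_conv q (up w) s))"
        by simp
      also have "\<dots> \<le> exp (- l * s) * (exp (l * s) * dist z w / 4 + exp (l * s) * dist z w / 4)"
      proof (intro mult_left_mono order_trans[OF norm_triangle_ineq] add_mono)
        have "norm (P (kernel_conv p (up z) s - kernel_conv p (up w) s)) \<le> (exp (l * s) * dist z w / (4 * Kp)) * Kp"
          using Kp n(1) by (intro order_trans[OF Kp(2)] mult_right_mono conv p s) (auto simp: l_def)
        then show "norm (P (kernel_conv p (up z) s - kernel_conv p (up w) s)) \<le> exp (l * s) * dist z w / 4" using Kp(1) by simp
        have "norm (Q (kernel_conv q (up z) s - kernel_conv q (up w) s)) \<le> (exp (l * s) * dist z w / (4 * Kq)) * Kq"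
          using Kq n(2) by (intro order_trans[OF Kq(2)] mult_right_mono conv q s) (auto simp: l_def)
        then show "norm (Q (kernel_conv q (up z) s - kernel_conv q (up w) s)) \<le> exp (l * s) * dist z w / 4" using Kq(1) by simp
      qed simp
      also have "\<dots> = 1 / 2 * dist z w" by (simp add: exp_minus field_simps)
      finally show "dist (apply_bcontfun (\<Theta> z) t) (apply_bcontfun (\<Theta> w) t) \<le> 1 / 2 * dist z w"
        unfolding \<Theta> dist_norm s_def .
    qed
    then show "\<forall>z w. dist (\<Theta> z) (\<Theta> w) \<le> 1 / 2 * dist z w" by blast
  qed
  then obtain z where z: "\<Theta> z = z" by blast
  have "up z t = h t + P (kernel_conv p (up z) t) + Q (kernel_conv q (up z) t)" if t: "t \<in> {0..T}" for t
  proof -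
    have "apply_bcontfun z t = G z t" using \<Theta>[of z t] cl_id[OF t] unfolding z by simp
    then show ?thesis by (simp add: up_def G_def exp_minus)
  qed
  then show ?thesis using up by blast
qed

text \<open>After exchanging the integrals, \<open>t = r + u\<close> separates the variables.\<close>

lemma kernel_Tonelli:
  fixes w0 :: "real \<Rightarrow> real"
  assumes [measurable]: "w0 \<in> borel_measurable borel" and nonneg: "\<And>r. 0 \<le> w0 r"
  shows "(\<integral>\<^sup>+t. ennreal (exp (- l * t)) * (\<integral>\<^sup>+r. ennreal (if 0 \<le> r \<and> r \<le> t \<and> t \<le> T then (t - r) powr (s - 1) * w0 r else 0) \<partial>lborel) \<partial>lborel)
    \<le> laplace_kernel T s l * (\<integral>\<^sup>+t. ennreal (exp (- l * t) * w0 t) \<partial>lborel)"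
proof -
    have "(\<integral>\<^sup>+t. ennreal (exp (- l * t)) * (\<integral>\<^sup>+r. ennreal (if 0 \<le> r \<and> r \<le> t \<and> t \<le> T then (t - r) powr (s - 1) * w0 r else 0) \<partial>lborel) \<partial>lborel)
      = (\<integral>\<^sup>+t. (\<integral>\<^sup>+r. ennreal (exp (- l * t)) * ennreal (if 0 \<le> r \<and> r \<le> t \<and> t \<le> T then (t - r) powr (s - 1) * w0 r else 0) \<partial>lborel) \<partial>lborel)"
      by (intro nn_integral_cong nn_integral_cmult[symmetric]) measurable
    also have "\<dots> = (\<integral>\<^sup>+r. (\<integral>\<^sup>+t. ennreal (exp (- l * t)) * ennreal (if 0 \<le> r \<and> r \<le> t \<and> t \<le> T then (t - r) powr (s - 1) * w0 r else 0) \<partial>lborel) \<partial>lborel)"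
      by (rule lborel_pair.Fubini') measurable
    also have "\<dots> \<le> (\<integral>\<^sup>+r. laplace_kernel T s l * ennreal (exp (- l * r) * w0 r) \<partial>lborel)"
    proof (intro nn_integral_mono)
      fix r
      have "(\<integral>\<^sup>+t. ennreal (exp (- l * t)) * ennreal (if 0 \<le> r \<and> r \<le> t \<and> t \<le> T then (t - r) powr (s - 1) * w0 r else 0) \<partial>lborel)
        = ennreal \<bar>1\<bar> * (\<integral>\<^sup>+u. ennreal (exp (- l * (r + 1 * u))) * ennreal (if 0 \<le> r \<and> r \<le> r + 1 * u \<and> r + 1 * u \<le> T then ((r + 1 * u) - r) powr (s - 1) * w0 r else 0) \<partial>lborel)"
        by (rule nn_integral_real_affine[where t = r and c = 1]) auto
      also have "\<dots> \<le> (\<integral>\<^sup>+u. (ennreal (u powr (s - 1) * exp (- l * u)) * indicator {0..T} u) * ennreal (exp (- l * r) * w0 r) \<partial>lborel)"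
      proof (unfold abs_one ennreal_1 mult_1, intro nn_integral_mono)
        fix u
        have e: "exp (- l * (r + u)) * (u powr (s - 1) * w0 r) = (u powr (s - 1) * exp (- l * u)) * (exp (- l * r) * w0 r)"
          by (simp add: distrib_left exp_diff exp_minus exp_add field_simps)
        note w0 = nonneg[of r]
        show "ennreal (exp (- l * (r + u))) * ennreal (if 0 \<le> r \<and> r \<le> r + u \<and> r + u \<le> T then (r + u - r) powr (s - 1) * w0 r else 0)
          \<le> ennreal (u powr (s - 1) * exp (- l * u)) * indicator {0..T} u * ennreal (exp (- l * r) * w0 r)"
        proof (cases "0 \<le> r \<and> r \<le> r + u \<and> r + u \<le> T")
          case True
          then have u: "u \<in> {0..T}" by auto
          have "ennreal (exp (- l * (r + u))) * ennreal (u powr (s - 1) * w0 r) = ennreal (exp (- l * (r + u)) * (u powr (s - 1) * w0 r))"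
            by (rule ennreal_mult[symmetric]) (use w0 in auto)
          also have "\<dots> = ennreal (u powr (s - 1) * exp (- l * u)) * ennreal (exp (- l * r) * w0 r)"
            unfolding e by (rule ennreal_mult) (use w0 in auto)
          finally show ?thesis using True u by simp
        next
          case False
          then show ?thesis by (simp only: if_False ennreal_0 mult_zero_right zero_le)
        qed
      qed
      also have "\<dots> = laplace_kernel T s l * ennreal (exp (- l * r) * w0 r)"
        unfolding laplace_kernel_def by (rule nn_integral_multc) auto
      finally show "(\<integral>\<^sup>+t. ennreal (exp (- l * t)) * ennreal (if 0 \<le> r \<and> r \<le> t \<and> t \<le> T then (t - r) powr (s - 1) * w0 r else 0) \<partial>lborel)
        \<le> laplace_kernel T s l * ennreal (exp (- l * r) * w0 r)" .
    qed
    also have "\<dots> = laplace_kernel T s l * (\<integral>\<^sup>+t. ennreal (exp (- l * t) * w0 t) \<partial>lborel)" by (rule nn_integral_cmult) measurable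
    finally show ?thesis .
qed

text \<open>Convolution with an integrable kernel maps integrable functions to integrable ones; this is the case
  \<open>l = 0\<close> of \<open>kernel_Tonelli\<close>.\<close>

lemma AE_kernel_integrable:
  fixes u :: "real \<Rightarrow> 'b::{banach,second_countable_topology}"
  assumes u: "(\<lambda>r. indicator {0..T} r *\<^sub>R u r) \<in> borel_measurable borel" and s: "0 < s" and T: "0 \<le> T"
    and fin: "(\<integral>\<^sup>+r\<in>{0..T}. ennreal (norm (u r)) \<partial>lborel) < \<infinity>"
  shows "AE t in lborel. t \<in> {0..T} \<longrightarrow> set_integrable lborel {0..t} (\<lambda>r. (t - r) powr (s - 1) *\<^sub>R u r)"
proof -
  define w0 where "w0 = (\<lambda>r. norm (indicator {0..T} r *\<^sub>R u r))"
  have w0m [measurable]: "w0 \<in> borel_measurable borel" unfolding w0_def by (rule measurable_compose[OF u borel_measurable_norm])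
  define c where "c = (\<lambda>t. \<integral>\<^sup>+r. ennreal (if 0 \<le> r \<and> r \<le> t \<and> t \<le> T then (t - r) powr (s - 1) * w0 r else 0) \<partial>lborel)"
  have [measurable]: "c \<in> borel_measurable borel" unfolding c_def by measurable
  have "(\<integral>\<^sup>+t. c t \<partial>lborel) \<le> laplace_kernel T s 0 * (\<integral>\<^sup>+t. ennreal (w0 t) \<partial>lborel)"
    using kernel_Tonelli[OF w0m, of 0 T s] by (simp add: c_def w0_def)
  also have "(\<integral>\<^sup>+t. ennreal (w0 t) \<partial>lborel) = (\<integral>\<^sup>+r\<in>{0..T}. ennreal (norm (u r)) \<partial>lborel)"
    unfolding w0_def by (intro nn_integral_cong) (auto simp: indicator_def)
  also have "laplace_kernel T s 0 * \<dots> < \<infinity>"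
    using fin laplace_kernel_0[OF s T] by (simp add: ennreal_mult_less_top)
  finally have "(\<integral>\<^sup>+t. c t \<partial>lborel) \<noteq> \<infinity>" by simp
  then have "AE t in lborel. c t \<noteq> \<infinity>" by (intro nn_integral_PInf_AE) auto
  then show ?thesis
  proof eventually_elim
    case (elim t)
    show ?case
    proof
      assume t: "t \<in> {0..T}"
      show "set_integrable lborel {0..t} (\<lambda>r. (t - r) powr (s - 1) *\<^sub>R u r)"
        unfolding set_integrable_def
      proof (rule integrableI_bounded)
        have "(\<lambda>r. (t - r) powr (s - 1) *\<^sub>R (indicator {0..t} r *\<^sub>R u r)) \<in> borel_measurable lborel"
        proof (rule borel_measurable_scaleR)
          show "(\<lambda>r. indicator {0..t} r *\<^sub>R u r) \<in> borel_measurable lborel"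
            using indicator_scale_subset_measurable[OF u, of t] t by simp
        qed measurable
        then show "(\<lambda>r. indicator {0..t} r *\<^sub>R (t - r) powr (s - 1) *\<^sub>R u r) \<in> borel_measurable lborel"
          by (simp add: mult.commute)
        have "(\<integral>\<^sup>+r. ennreal (norm (indicator {0..t} r *\<^sub>R (t - r) powr (s - 1) *\<^sub>R u r)) \<partial>lborel) = c t"
          unfolding c_def w0_def using t by (intro nn_integral_cong) (auto simp: indicator_def)
        then show "(\<integral>\<^sup>+r. ennreal (norm (indicator {0..t} r *\<^sub>R (t - r) powr (s - 1) *\<^sub>R u r)) \<partial>lborel) < \<infinity>"
          using elim by (simp add: less_top)
      qed
    qed
  qed
qed

text \<open>In the weighted \<open>L\<^sup>1\<close> norm \<open>m\<close> of a solution, \<open>kernel_Tonelli\<close> gives \<open>m \<le> m / 2\<close> for large \<open>l\<close>, and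
  \<open>m\<close> is finite. The norm is an integral and not a supremum because nothing but integrability is known of the solution.\<close>

theorem volterra_unique_AE:
  fixes w :: "real \<Rightarrow> 'b::euclidean_space" and P Q :: "'b \<Rightarrow> 'b"
  assumes T: "0 \<le> T" and p: "0 < p" and q: "0 < q"
    and P: "bounded_linear P" and Q: "bounded_linear Q"
    and w: "(\<lambda>r. indicator {0..T} r *\<^sub>R w r) \<in> borel_measurable borel"
    and fin: "(\<integral>\<^sup>+r\<in>{0..T}. ennreal (norm (w r)) \<partial>lborel) < \<infinity>"
    and eq: "AE t in lborel. t \<in> {0..T} \<longrightarrow> w t = P (kernel_conv p w t) + Q (kernel_conv q w t)"
  shows "AE t in lborel. t \<in> {0..T} \<longrightarrow> w t = 0"
proof -
  obtain Kp where Kp: "0 < Kp" "\<And>x. norm (P x) \<le> norm x * Kp" using bounded_linear.pos_bounded[OF P] by blast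
  obtain Kq where Kq: "0 < Kq" "\<And>x. norm (Q x) \<le> norm x * Kq" using bounded_linear.pos_bounded[OF Q] by blast
  have "eventually (\<lambda>n. laplace_kernel T p (real n) \<le> ennreal (1 / (4 * Kp)) \<and> laplace_kernel T q (real n) \<le> ennreal (1 / (4 * Kq))) sequentially"
    using Kp(1) Kq(1) T p q by (intro eventually_conj eventually_laplace_kernel_small) auto
  then obtain n where n: "laplace_kernel T p (real n) \<le> ennreal (1 / (4 * Kp))" "laplace_kernel T q (real n) \<le> ennreal (1 / (4 * Kq))"
    using eventually_happens'[OF sequentially_bot] by blast
  define l where "l = real n"
  define w0 where "w0 = (\<lambda>r. norm (indicator {0..T} r *\<^sub>R w r))"
  have [measurable]: "w0 \<in> borel_measurable borel" unfolding w0_def by (rule measurable_compose[OF w borel_measurable_norm])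
  define m where "m = (\<integral>\<^sup>+t. ennreal (exp (- l * t) * w0 t) \<partial>lborel)"
  define c where "c = (\<lambda>s t. \<integral>\<^sup>+r. ennreal (if 0 \<le> r \<and> r \<le> t \<and> t \<le> T then (t - r) powr (s - 1) * w0 r else 0) \<partial>lborel)"
  have m_fin: "m < \<infinity>"
  proof -
    have "m \<le> (\<integral>\<^sup>+r\<in>{0..T}. ennreal (norm (w r)) \<partial>lborel)"
      unfolding m_def w0_def by (intro nn_integral_mono) (auto simp: indicator_def l_def intro!: ennreal_leI mult_left_le_one_le)
    then show ?thesis using fin by (rule le_less_trans)
  qed
  have c_le: "(\<integral>\<^sup>+t. ennreal (exp (- l * t)) * c s t \<partial>lborel) \<le> laplace_kernel T s l * m" for s
    unfolding c_def m_def by (rule kernel_Tonelli) (simp_all add: w0_def[symmetric], simp add: w0_def)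
  have [measurable]: "c s \<in> borel_measurable borel" for s unfolding c_def by measurable
  have conv_le: "ennreal (norm (kernel_conv s w t)) \<le> c s t" if t: "t \<in> {0..T}" for s t
  proof -
    have "ennreal (norm (kernel_conv s w t)) \<le> (\<integral>\<^sup>+r\<in>{0..t}. ennreal ((t - r) powr (s - 1) * norm (w r)) \<partial>lborel)"
      by (rule kernel_conv_norm_le)
    also have "\<dots> = c s t"
      unfolding c_def w0_def using t by (intro nn_integral_cong) (auto simp: indicator_def)
    finally show ?thesis .
  qed
  have pw: "AE t in lborel. ennreal (exp (- l * t) * w0 t) \<le> ennreal Kp * (ennreal (exp (- l * t)) * c p t) + ennreal Kq * (ennreal (exp (- l * t)) * c q t)"
    using eq
  proof eventually_elim
    case (elim t)
    show ?case
    proof (cases "t \<in> {0..T}")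
      case True
      have "norm (w t) \<le> Kp * norm (kernel_conv p w t) + Kq * norm (kernel_conv q w t)"
        using elim True Kp(2)[of "kernel_conv p w t"] Kq(2)[of "kernel_conv q w t"]
          norm_triangle_ineq[of "P (kernel_conv p w t)" "Q (kernel_conv q w t)"] by (simp add: mult.commute)
      then have "ennreal (norm (w t)) \<le> ennreal (Kp * norm (kernel_conv p w t) + Kq * norm (kernel_conv q w t))"
        by (rule ennreal_leI)
      also have "\<dots> = ennreal Kp * ennreal (norm (kernel_conv p w t)) + ennreal Kq * ennreal (norm (kernel_conv q w t))"
        using Kp(1) Kq(1) by (simp add: ennreal_plus ennreal_mult)
      also have "\<dots> \<le> ennreal Kp * c p t + ennreal Kq * c q t"
        by (intro add_mono mult_left_mono conv_le True) auto
      finally have "ennreal (exp (- l * t)) * ennreal (norm (w t)) \<le> ennreal (exp (- l * t)) * (ennreal Kp * c p t + ennreal Kq * c q t)"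
        by (rule mult_left_mono) simp
      then show ?thesis using True by (simp add: w0_def ennreal_mult distrib_left mult_ac)
    next
      case False
      then show ?thesis by (simp add: w0_def)
    qed
  qed
  have "m \<le> (\<integral>\<^sup>+t. ennreal Kp * (ennreal (exp (- l * t)) * c p t) + ennreal Kq * (ennreal (exp (- l * t)) * c q t) \<partial>lborel)"
    unfolding m_def by (rule nn_integral_mono_AE[OF pw])
  also have "\<dots> = ennreal Kp * (\<integral>\<^sup>+t. ennreal (exp (- l * t)) * c p t \<partial>lborel) + ennreal Kq * (\<integral>\<^sup>+t. ennreal (exp (- l * t)) * c q t \<partial>lborel)"
    by (subst nn_integral_add) (auto simp: nn_integral_cmult)
  also have "\<dots> \<le> ennreal Kp * (ennreal (1 / (4 * Kp)) * m) + ennreal Kq * (ennreal (1 / (4 * Kq)) * m)"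
    using n by (intro add_mono mult_left_mono order_trans[OF c_le] mult_right_mono) (auto simp: l_def)
  also have "\<dots> = ennreal (1 / 4) * m + ennreal (1 / 4) * m"
    using Kp(1) Kq(1) by (simp add: mult.assoc[symmetric] ennreal_mult[symmetric])
  finally have m_le: "m \<le> ennreal (1 / 4) * m + ennreal (1 / 4) * m" .
  have "m = 0"
  proof -
    obtain x where x: "m = ennreal x" "0 \<le> x" using m_fin by (cases m) auto
    have "ennreal x \<le> ennreal (1 / 4 * x + 1 / 4 * x)"
      using m_le x by (simp add: ennreal_mult[symmetric] ennreal_plus[symmetric] del: ennreal_plus)
    then have "x \<le> 1 / 4 * x + 1 / 4 * x" using x(2) by (subst (asm) ennreal_le_iff) auto
    then show ?thesis using x by simp
  qed
  then have "AE t in lborel. ennreal (exp (- l * t) * w0 t) = 0"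
    unfolding m_def by (subst (asm) nn_integral_0_iff_AE) auto
  then show ?thesis
  proof eventually_elim
    case (elim t)
    show ?case
    proof
      assume t: "t \<in> {0..T}"
      have "exp (- l * t) * norm (w t) \<le> 0" using elim t by (simp add: w0_def ennreal_eq_0_iff)
      then show "w t = 0" by (simp add: mult_le_0_iff)
    qed
  qed
qed

lemma sum5_power2_le:
  fixes x1 x2 x3 x4 x5 :: real
  shows "(x1 + x2 + x3 + x4 + x5)\<^sup>2 \<le> 16 * (x1\<^sup>2 + x2\<^sup>2 + x3\<^sup>2 + x4\<^sup>2 + x5\<^sup>2)"
proof -
  have sq: "(x + y)\<^sup>2 \<le> 2 * x\<^sup>2 + 2 * y\<^sup>2" for x y :: real using norm_add_sq[of x y] by simp
  have "(x1 + x2 + x3)\<^sup>2 \<le> 4 * (x1\<^sup>2 + x2\<^sup>2 + x3\<^sup>2)"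
    using sq[of "x1 + x2" x3] sq[of x1 x2] zero_le_power2[of x3] by argo
  then have "(x1 + x2 + x3 + x4)\<^sup>2 \<le> 8 * (x1\<^sup>2 + x2\<^sup>2 + x3\<^sup>2 + x4\<^sup>2)"
    using sq[of "x1 + x2 + x3" x4] zero_le_power2[of x4] by argo
  then show ?thesis
    using sq[of "x1 + x2 + x3 + x4" x5] zero_le_power2[of x5] by argo
qed

context brownian_basis
begin

section \<open>Convolutions of processes\<close>

text \<open>Joint measurability alone; adaptedness is added where an Ito integral or a version for \<open>F t\<close> needs it.\<close>

definition process :: "(real \<Rightarrow> 'w \<Rightarrow> 'b::euclidean_space) \<Rightarrow> bool" where
  "process X \<longleftrightarrow> (\<lambda>(t, \<omega>). X t \<omega>) \<in> borel_measurable (restrict_space borel {0..T} \<Otimes>\<^sub>M M)"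

lemma process_extend: "process X \<Longrightarrow> (\<lambda>(r, \<omega>). indicator {0..T} r *\<^sub>R X r \<omega>) \<in> borel_measurable (borel \<Otimes>\<^sub>M M)"
  unfolding process_def by (rule measurable_pair_restrict_iff[THEN iffD1, rotated]) simp_all

lemma processI: "(\<lambda>(r, \<omega>). indicator {0..T} r *\<^sub>R X r \<omega>) \<in> borel_measurable (borel \<Otimes>\<^sub>M M) \<Longrightarrow> process X"
  unfolding process_def by (rule measurable_pair_restrict_iff[THEN iffD2, rotated]) simp_all

lemma process_weighted:
  assumes U: "process U" and w: "w \<in> borel_measurable borel" and t: "t \<le> T"
  shows "(\<lambda>(r, \<omega>). indicator {0..t} r *\<^sub>R w r *\<^sub>R U r \<omega>) \<in> borel_measurable (lborel \<Otimes>\<^sub>M M)"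
proof -
  note 1 = process_extend[OF U]
  have "(\<lambda>x. (indicator {0..t} (fst x) * w (fst x)) *\<^sub>R (case x of (r, \<omega>) \<Rightarrow> indicator {0..T} r *\<^sub>R U r \<omega>)) \<in> borel_measurable (borel \<Otimes>\<^sub>M M)"
    using measurable_compose[OF measurable_fst w] by (intro borel_measurable_scaleR borel_measurable_times 1) measurable
  also have "(\<lambda>x. (indicator {0..t} (fst x) * w (fst x)) *\<^sub>R (case x of (r, \<omega>) \<Rightarrow> indicator {0..T} r *\<^sub>R U r \<omega>)) = (\<lambda>(r, \<omega>). indicator {0..t} r *\<^sub>R w r *\<^sub>R U r \<omega>)"
    using t by (auto simp: fun_eq_iff indicator_def)
  finally show ?thesis unfolding measurable_lborel_pair .
qed

lemma process_path: "process U \<Longrightarrow> \<omega> \<in> space M \<Longrightarrow> (\<lambda>r. indicator {0..T} r *\<^sub>R U r \<omega>) \<in> borel_measurable borel"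
  using measurable_compose[OF measurable_Pair2' process_extend] by auto

lemma process_at:
  assumes U: "process U" and t: "t \<in> {0..T}"
  shows "U t \<in> borel_measurable M"
proof -
  have "(\<lambda>\<omega>. indicator {0..T} t *\<^sub>R U t \<omega>) \<in> borel_measurable M"
    using measurable_compose[OF measurable_Pair1' process_extend[OF U], of t] by simp
  then show ?thesis using t by simp
qed

lemma process_diff: "process X \<Longrightarrow> process Y \<Longrightarrow> process (\<lambda>r \<omega>. X r \<omega> - Y r \<omega>)"
  unfolding process_def split_beta' by (rule borel_measurable_diff)

lemma process_conv:
  fixes U :: "real \<Rightarrow> 'w \<Rightarrow> 'b::euclidean_space"
  assumes U: "process U"
  shows "process (\<lambda>t \<omega>. kernel_conv p (\<lambda>r. U r \<omega>) t)"
proof (rule processI)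
  define U0 where "U0 = (\<lambda>r \<omega>. indicator {0..T} r *\<^sub>R U r \<omega>)"
  have [measurable]: "case_prod U0 \<in> borel_measurable (borel \<Otimes>\<^sub>M M)"
    using process_extend[OF U] by (simp add: U0_def split_beta')
  have "(\<lambda>x. \<integral>r. (if 0 \<le> r \<and> r \<le> fst x then (fst x - r) powr (p - 1) else 0) *\<^sub>R U0 r (snd x) \<partial>lborel) \<in> borel_measurable (borel \<Otimes>\<^sub>M M)"
    by measurable
  then have "(\<lambda>x. indicator {0..T} (fst x) *\<^sub>R (\<integral>r. (if 0 \<le> r \<and> r \<le> fst x then (fst x - r) powr (p - 1) else 0) *\<^sub>R U0 r (snd x) \<partial>lborel)) \<in> borel_measurable (borel \<Otimes>\<^sub>M M)"
    by (intro borel_measurable_scaleR) measurable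
  also have "(\<lambda>x. indicator {0..T} (fst x) *\<^sub>R (\<integral>r. (if 0 \<le> r \<and> r \<le> fst x then (fst x - r) powr (p - 1) else 0) *\<^sub>R U0 r (snd x) \<partial>lborel))
     = (\<lambda>(t, \<omega>). indicator {0..T} t *\<^sub>R kernel_conv p (\<lambda>r. U r \<omega>) t)"
  proof (intro ext, clarify)
    fix t \<omega>
    show "indicator {0..T} (fst (t, \<omega>)) *\<^sub>R (\<integral>r. (if 0 \<le> r \<and> r \<le> fst (t, \<omega>) then (fst (t, \<omega>) - r) powr (p - 1) else 0) *\<^sub>R U0 r (snd (t, \<omega>)) \<partial>lborel)
      = indicator {0..T} t *\<^sub>R kernel_conv p (\<lambda>r. U r \<omega>) t"
    proof (cases "t \<in> {0..T}")
      case True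
      then have "(\<integral>r. (if 0 \<le> r \<and> r \<le> t then (t - r) powr (p - 1) else 0) *\<^sub>R U0 r \<omega> \<partial>lborel) = kernel_conv p (\<lambda>r. U r \<omega>) t"
        unfolding kernel_conv_def set_lebesgue_integral_def
        by (intro Bochner_Integration.integral_cong refl) (auto simp: U0_def indicator_def)
      then show ?thesis by (simp only: fst_conv snd_conv)
    qed simp
  qed
  finally show "(\<lambda>(t, \<omega>). indicator {0..T} t *\<^sub>R kernel_conv p (\<lambda>r. U r \<omega>) t) \<in> borel_measurable (borel \<Otimes>\<^sub>M M)" .
qed

text \<open>The convolution of the mean squares, which bounds the mean square of every integral in the mild
  equation.\<close>

definition conv_energy :: "real \<Rightarrow> (real \<Rightarrow> 'w \<Rightarrow> 'b::euclidean_space) \<Rightarrow> real \<Rightarrow> ennreal" where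
  "conv_energy p U t = (\<integral>\<^sup>+r\<in>{0..t}. ennreal ((t - r) powr (p - 1)) * sqn M (U r) \<partial>lborel)"

lemma sqn_weighted_process:
  fixes U :: "real \<Rightarrow> 'w \<Rightarrow> 'b::euclidean_space"
  assumes U: "process U" and w: "w \<in> borel_measurable borel" and t: "t \<le> T"
  shows "sqn (lborel \<Otimes>\<^sub>M M) (\<lambda>(r, \<omega>). indicator {0..t} r *\<^sub>R w r *\<^sub>R U r \<omega>) = (\<integral>\<^sup>+r\<in>{0..t}. ennreal ((w r)\<^sup>2) * sqn M (U r) \<partial>lborel)"
proof -
  note [measurable] = process_weighted[OF U w t]
  have "sqn (lborel \<Otimes>\<^sub>M M) (\<lambda>(r, \<omega>). indicator {0..t} r *\<^sub>R w r *\<^sub>R U r \<omega>)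
    = (\<integral>\<^sup>+r. (\<integral>\<^sup>+\<omega>. ennreal ((norm ((\<lambda>(r, \<omega>). indicator {0..t} r *\<^sub>R w r *\<^sub>R U r \<omega>) (r, \<omega>)))\<^sup>2) \<partial>M) \<partial>lborel)"
    unfolding sqn_def by (rule nn_integral_fst[symmetric]) measurable
  also have "\<dots> = (\<integral>\<^sup>+r\<in>{0..t}. ennreal ((w r)\<^sup>2) * sqn M (U r) \<partial>lborel)"
  proof (intro nn_integral_cong)
    fix r
    show "(\<integral>\<^sup>+\<omega>. ennreal ((norm ((\<lambda>(r, \<omega>). indicator {0..t} r *\<^sub>R w r *\<^sub>R U r \<omega>) (r, \<omega>)))\<^sup>2) \<partial>M) = ennreal ((w r)\<^sup>2) * sqn M (U r) * indicator {0..t} r"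
    proof (cases "r \<in> {0..t}")
      case True
      then have "U r \<in> borel_measurable M" using process_at[OF U, of r] t by auto
      then show ?thesis using True sqn_scaleR[of "U r" M "w r"] by (simp add: sqn_def)
    qed simp
  qed
  finally show ?thesis .
qed

text \<open>\<open>norm_integral_weight_sq_le\<close> with the kernel as weight, whose mass on \<open>{0..t}\<close> is \<open>t powr p / p\<close>.\<close>

lemma sqn_conv_le:
  fixes U :: "real \<Rightarrow> 'w \<Rightarrow> 'b::euclidean_space"
  assumes U: "process U" and p: "0 < p" and t: "t \<in> {0..T}"
  shows "sqn M (\<lambda>\<omega>. kernel_conv p (\<lambda>r. U r \<omega>) t) \<le> ennreal (T powr p / p) * conv_energy p U t"
proof -
  define G where "G = (\<lambda>(r, \<omega>). indicator {0..t} r *\<^sub>R ((t - r) powr ((p - 1) / 2)) *\<^sub>R U r \<omega>)"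
  have [measurable]: "G \<in> borel_measurable (lborel \<Otimes>\<^sub>M M)"
    unfolding G_def using t by (intro process_weighted U) auto
  have "ennreal ((norm (kernel_conv p (\<lambda>r. U r \<omega>) t))\<^sup>2)
    \<le> ennreal (T powr p / p) * (\<integral>\<^sup>+r\<in>{0..t}. ennreal ((t - r) powr (p - 1)) * ennreal ((norm (U r \<omega>))\<^sup>2) \<partial>lborel)" if \<omega>: "\<omega> \<in> space M" for \<omega>
  proof -
    let ?k = "\<lambda>r. indicator {0..t} r * (t - r) powr (p - 1) :: real"
    have "kernel_conv p (\<lambda>r. U r \<omega>) t = (\<integral>r. ?k r *\<^sub>R (indicator {0..T} r *\<^sub>R U r \<omega>) \<partial>lborel)"
      unfolding kernel_conv_def set_lebesgue_integral_def
      using t by (intro Bochner_Integration.integral_cong refl) (auto simp: indicator_def)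
    then have "ennreal ((norm (kernel_conv p (\<lambda>r. U r \<omega>) t))\<^sup>2)
      \<le> (\<integral>\<^sup>+r. ennreal (?k r) \<partial>lborel) * (\<integral>\<^sup>+r. ennreal (?k r) * ennreal ((norm (indicator {0..T} r *\<^sub>R U r \<omega>))\<^sup>2) \<partial>lborel)"
      using process_path[OF U \<omega>] by (simp only:, intro norm_integral_weight_sq_le) (auto simp: indicator_def)
    also have "(\<integral>\<^sup>+r. ennreal (?k r) \<partial>lborel) = (\<integral>\<^sup>+r\<in>{0..t}. ennreal ((t - r) powr (p - 1)) \<partial>lborel)"
      by (intro nn_integral_cong) (auto simp: indicator_def)
    also have "\<dots> = ennreal (t powr p / p)" using nn_integral_kernel[OF p, of 0 t] t by simp
    also have "(\<integral>\<^sup>+r. ennreal (?k r) * ennreal ((norm (indicator {0..T} r *\<^sub>R U r \<omega>))\<^sup>2) \<partial>lborel)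
      = (\<integral>\<^sup>+r\<in>{0..t}. ennreal ((t - r) powr (p - 1)) * ennreal ((norm (U r \<omega>))\<^sup>2) \<partial>lborel)"
      using t by (intro nn_integral_cong) (auto simp: indicator_def)
    also have "ennreal (t powr p / p) * (\<integral>\<^sup>+r\<in>{0..t}. ennreal ((t - r) powr (p - 1)) * ennreal ((norm (U r \<omega>))\<^sup>2) \<partial>lborel)
       \<le> ennreal (T powr p / p) * (\<integral>\<^sup>+r\<in>{0..t}. ennreal ((t - r) powr (p - 1)) * ennreal ((norm (U r \<omega>))\<^sup>2) \<partial>lborel)"
      using t p by (intro mult_right_mono ennreal_leI divide_right_mono powr_mono2) auto
    finally show ?thesis .
  qed
  then have "sqn M (\<lambda>\<omega>. kernel_conv p (\<lambda>r. U r \<omega>) t)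
    \<le> (\<integral>\<^sup>+\<omega>. ennreal (T powr p / p) * (\<integral>\<^sup>+r\<in>{0..t}. ennreal ((t - r) powr (p - 1)) * ennreal ((norm (U r \<omega>))\<^sup>2) \<partial>lborel) \<partial>M)"
    unfolding sqn_def by (rule nn_integral_mono)
  also have "\<dots> = (\<integral>\<^sup>+\<omega>. ennreal (T powr p / p) * (\<integral>\<^sup>+r. ennreal ((norm (G (r, \<omega>)))\<^sup>2) \<partial>lborel) \<partial>M)"
  proof (intro nn_integral_cong arg_cong2[where f = "(*)"] refl)
    fix r \<omega>
    have w2: "((t - r) powr ((p - 1) / 2))\<^sup>2 = (t - r) powr (p - 1)" by (simp add: power2_eq_square powr_add[symmetric])
    show "ennreal ((t - r) powr (p - 1)) * ennreal ((norm (U r \<omega>))\<^sup>2) * indicator {0..t} r = ennreal ((norm (G (r, \<omega>)))\<^sup>2)"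
      by (cases "r \<in> {0..t}") (simp_all add: G_def power_mult_distrib w2 ennreal_mult)
  qed
  also have "\<dots> = ennreal (T powr p / p) * (\<integral>\<^sup>+\<omega>. (\<integral>\<^sup>+r. ennreal ((norm (G (r, \<omega>)))\<^sup>2) \<partial>lborel) \<partial>M)"
    by (rule nn_integral_cmult) measurable
  also have "(\<integral>\<^sup>+\<omega>. (\<integral>\<^sup>+r. ennreal ((norm (G (r, \<omega>)))\<^sup>2) \<partial>lborel) \<partial>M) = sqn (lborel \<Otimes>\<^sub>M M) G"
    unfolding sqn_def by (rule lborel_M.nn_integral_snd) measurable
  also have "\<dots> = sqn (lborel \<Otimes>\<^sub>M M) (\<lambda>(r, \<omega>). indicator {0..t} r *\<^sub>R ((t - r) powr ((p - 1) / 2)) *\<^sub>R U r \<omega>)"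
    by (simp add: G_def)
  also have "\<dots> = (\<integral>\<^sup>+r\<in>{0..t}. ennreal (((t - r) powr ((p - 1) / 2))\<^sup>2) * sqn M (U r) \<partial>lborel)"
    using t by (intro sqn_weighted_process U) auto
  also have "\<dots> = conv_energy p U t"
    unfolding conv_energy_def by (simp add: power2_eq_square powr_add[symmetric])
  finally show ?thesis .
qed

lemma integrable_process_kernel:
  fixes U :: "real \<Rightarrow> 'w \<Rightarrow> 'b::euclidean_space"
  assumes U: "process U" and p: "0 < p" and t: "t \<in> {0..T}"
    and D: "\<And>r. r \<in> {0..T} \<Longrightarrow> sqn M (U r) \<le> ennreal D"
  shows "integrable (lborel \<Otimes>\<^sub>M M) (\<lambda>(r, \<omega>). indicator {0..t} r *\<^sub>R (t - r) powr (p - 1) *\<^sub>R U r \<omega>)"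
proof (rule integrableI_bounded)
  show m: "(\<lambda>(r, \<omega>). indicator {0..t} r *\<^sub>R (t - r) powr (p - 1) *\<^sub>R U r \<omega>) \<in> borel_measurable (lborel \<Otimes>\<^sub>M M)"
    using t by (intro process_weighted U) auto
  have "(\<integral>\<^sup>+x. ennreal (norm ((\<lambda>(r, \<omega>). indicator {0..t} r *\<^sub>R (t - r) powr (p - 1) *\<^sub>R U r \<omega>) x)) \<partial>(lborel \<Otimes>\<^sub>M M))
    = (\<integral>\<^sup>+r. (\<integral>\<^sup>+\<omega>. ennreal (norm ((\<lambda>(r, \<omega>). indicator {0..t} r *\<^sub>R (t - r) powr (p - 1) *\<^sub>R U r \<omega>) (r, \<omega>))) \<partial>M) \<partial>lborel)"
    by (rule nn_integral_fst[symmetric]) (rule measurable_compose[OF measurable_compose[OF m borel_measurable_norm] measurable_ennreal])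
  also have "\<dots> \<le> (\<integral>\<^sup>+r. (1 + ennreal D) * (ennreal ((t - r) powr (p - 1)) * indicator {0..t} r) \<partial>lborel)"
  proof (intro nn_integral_mono)
    fix r
    show "(\<integral>\<^sup>+\<omega>. ennreal (norm ((\<lambda>(r, \<omega>). indicator {0..t} r *\<^sub>R (t - r) powr (p - 1) *\<^sub>R U r \<omega>) (r, \<omega>))) \<partial>M)
      \<le> (1 + ennreal D) * (ennreal ((t - r) powr (p - 1)) * indicator {0..t} r)"
    proof (cases "r \<in> {0..t}")
      case True
      then have r: "r \<in> {0..T}" using t by auto
      note [measurable] = process_at[OF U r]
      have "x \<le> 1 + x\<^sup>2" for x :: real
      proof -
        have "2 * x \<le> 1 + x\<^sup>2" using zero_le_power2[of "x - 1"] by (simp add: power2_diff)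
        then show ?thesis using zero_le_power2[of x] by (cases "0 \<le> x") linarith+
      qed
      then have "(\<integral>\<^sup>+\<omega>. ennreal (norm (U r \<omega>)) \<partial>M) \<le> (\<integral>\<^sup>+\<omega>. ennreal (1 + (norm (U r \<omega>))\<^sup>2) \<partial>M)"
        by (intro nn_integral_mono ennreal_leI)
      also have "\<dots> = (\<integral>\<^sup>+\<omega>. 1 + ennreal ((norm (U r \<omega>))\<^sup>2) \<partial>M)"
        by (intro nn_integral_cong) (simp add: ennreal_plus)
      also have "\<dots> = 1 + sqn M (U r)" unfolding sqn_def by (subst nn_integral_add) (auto simp: emeasure_space_1)
      also have "\<dots> \<le> 1 + ennreal D" by (intro add_left_mono D r)
      finally have 1: "(\<integral>\<^sup>+\<omega>. ennreal (norm (U r \<omega>)) \<partial>M) \<le> 1 + ennreal D" .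
      have "(\<integral>\<^sup>+\<omega>. ennreal (norm ((\<lambda>(r, \<omega>). indicator {0..t} r *\<^sub>R (t - r) powr (p - 1) *\<^sub>R U r \<omega>) (r, \<omega>))) \<partial>M)
        = (\<integral>\<^sup>+\<omega>. ennreal ((t - r) powr (p - 1)) * ennreal (norm (U r \<omega>)) \<partial>M)"
        using True by (intro nn_integral_cong) (simp add: ennreal_mult)
      also have "\<dots> = ennreal ((t - r) powr (p - 1)) * (\<integral>\<^sup>+\<omega>. ennreal (norm (U r \<omega>)) \<partial>M)"
        by (rule nn_integral_cmult) auto
      also have "\<dots> \<le> ennreal ((t - r) powr (p - 1)) * (1 + ennreal D)" by (rule mult_left_mono[OF 1]) simp
      finally show ?thesis using True by (simp add: mult.commute)
    qed simp
  qed
  also have "\<dots> = (1 + ennreal D) * ennreal (t powr p / p)"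
    using nn_integral_kernel[OF p, of 0 t] t by (subst nn_integral_cmult) auto
  also have "\<dots> < \<infinity>" by (auto simp: ennreal_mult_less_top)
  finally show "(\<integral>\<^sup>+x. ennreal (norm ((\<lambda>(r, \<omega>). indicator {0..t} r *\<^sub>R (t - r) powr (p - 1) *\<^sub>R U r \<omega>) x)) \<partial>(lborel \<Otimes>\<^sub>M M)) < \<infinity>" .
qed

lemma AE_set_integrable_kernel:
  fixes U :: "real \<Rightarrow> 'w \<Rightarrow> 'b::euclidean_space"
  assumes "process U" "0 < p" "t \<in> {0..T}" "\<And>r. r \<in> {0..T} \<Longrightarrow> sqn M (U r) \<le> ennreal D"
  shows "AE \<omega> in M. set_integrable lborel {0..t} (\<lambda>r. (t - r) powr (p - 1) *\<^sub>R U r \<omega>)"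
  unfolding set_integrable_def by (rule lborel_M.AE_integrable_snd[OF integrable_process_kernel[OF assms]])

text \<open>\<open>adapted_time_integral\<close> applied to the kernel times \<open>U\<close> on \<open>{0..t}\<close>, whose values are known at time \<open>t\<close>.\<close>

lemma conv_version:
  fixes U :: "real \<Rightarrow> 'w \<Rightarrow> real ^ 'n"
  assumes U: "process U" and p: "0 < p" and t: "t \<in> {0..T}"
    and D: "\<And>r. r \<in> {0..T} \<Longrightarrow> sqn M (U r) \<le> ennreal D"
    and ad: "\<And>r. r \<in> {0..T} \<Longrightarrow> U r \<in> borel_measurable (F r)"
  shows "\<exists>V\<in>borel_measurable (F t). AE \<omega> in M. V \<omega> = kernel_conv p (\<lambda>r. U r \<omega>) t"
  unfolding kernel_conv_def set_lebesgue_integral_def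
proof (rule adapted_time_integral[OF t integrable_process_kernel[OF U p t D]])
  fix r
  show "(\<lambda>\<omega>. indicator {0..t} r *\<^sub>R (t - r) powr (p - 1) *\<^sub>R U r \<omega>) \<in> borel_measurable (F t)"
  proof (cases "r \<in> {0..t}")
    case True
    then have "U r \<in> borel_measurable (F t)"
      using borel_measurable_F_mono[OF ad[of r], of t] t by auto
    then show ?thesis by (intro borel_measurable_scaleR borel_measurable_const)
  next
    case False
    then have "(\<lambda>\<omega>. indicator {0..t} r *\<^sub>R (t - r) powr (p - 1) *\<^sub>R U r \<omega>) = (\<lambda>_. 0)" by (intro ext) simp
    then show ?thesis by simp
  qed
qed

lemma H2D:
  assumes "X \<in> H2 M F T"
  shows "process X" "t \<in> {0..T} \<Longrightarrow> X t \<in> borel_measurable (F t)" "t \<in> {0..T} \<Longrightarrow> X t \<in> borel_measurable M"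
    "\<exists>D\<ge>0. \<forall>t\<in>{0..T}. sqn M (X t) \<le> ennreal D"
proof -
  show p: "process X" using assms by (simp add: H2_def process_def)
  show "t \<in> {0..T} \<Longrightarrow> X t \<in> borel_measurable (F t)" using assms by (simp add: H2_def Xi_def)
  show "t \<in> {0..T} \<Longrightarrow> X t \<in> borel_measurable M" by (rule process_at[OF p])
  have "bdd_above ((\<lambda>t. (ms_norm M (X t))\<^sup>2) ` {0..T})" using assms by (simp add: H2_def)
  then obtain D where "\<forall>y\<in>(\<lambda>t. (ms_norm M (X t))\<^sup>2) ` {0..T}. y \<le> D" unfolding bdd_above_def by blast
  then have D: "(ms_norm M (X t))\<^sup>2 \<le> D" if "t \<in> {0..T}" for t using that by blast
  have "sqn M (X t) \<le> ennreal (max 0 D)" if t: "t \<in> {0..T}" for t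
  proof -
    have i: "integrable M (\<lambda>\<omega>. (norm (X t \<omega>))\<^sup>2)" using assms t by (simp add: H2_def Xi_def)
    show ?thesis unfolding ms_norm_sq_eq_sqn[OF i, symmetric] using D[OF t] by (intro ennreal_leI) simp
  qed
  then show "\<exists>D\<ge>0. \<forall>t\<in>{0..T}. sqn M (X t) \<le> ennreal D" by (intro exI[of _ "max 0 D"]) auto
qed

lemma H2I:
  assumes "process X" "\<And>t. t \<in> {0..T} \<Longrightarrow> X t \<in> borel_measurable (F t)"
    "\<And>t. t \<in> {0..T} \<Longrightarrow> sqn M (X t) \<le> ennreal D"
  shows "X \<in> H2 M F T"
proof -
  have i: "integrable M (\<lambda>\<omega>. (norm (X t \<omega>))\<^sup>2)" if t: "t \<in> {0..T}" for t
  proof -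
    have "sqn M (X t) < \<infinity>" using assms(3)[OF t] by (rule le_less_trans) simp
    then show ?thesis using sqn_finite_iff[OF process_at[OF assms(1) t]] by simp
  qed
  have "(ms_norm M (X t))\<^sup>2 \<le> max 0 D" if t: "t \<in> {0..T}" for t
  proof -
    have "ennreal ((ms_norm M (X t))\<^sup>2) \<le> ennreal (max 0 D)"
      unfolding ms_norm_sq_eq_sqn[OF i[OF t]] using assms(3)[OF t] by (rule order_trans) (intro ennreal_leI, simp)
    then show ?thesis by (subst (asm) ennreal_le_iff) auto
  qed
  then have "bdd_above ((\<lambda>t. (ms_norm M (X t))\<^sup>2) ` {0..T})" by (intro bdd_aboveI2)
  then show ?thesis using assms i by (simp add: H2_def process_def Xi_def)
qed

lemma H2_zero: "(\<lambda>_ _. 0) \<in> H2 M F T"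
  by (rule H2I[where D = 0]) (simp_all add: process_def)

end

section \<open>The mild map\<close>

locale fractional_sde = brownian_basis M W F T
  for M :: "'w measure" and W :: "real \<Rightarrow> 'w \<Rightarrow> real" and F :: "real \<Rightarrow> 'w measure" and T :: real +
  fixes \<alpha> \<beta> L\<^sub>b L\<^sub>\<sigma> :: real and A B :: "real ^ 'n ^ 'n" and b \<sigma> :: "real \<Rightarrow> real ^ 'n \<Rightarrow> real ^ 'n"
  assumes \<alpha>: "1 / 2 < \<alpha>" "\<alpha> < 1" and \<beta>: "0 < \<beta>" "\<beta> < \<alpha>" and T: "0 < T"
    and measurable_b: "(\<lambda>(t, x). b t x) \<in> borel_measurable (restrict_space borel {0..T} \<Otimes>\<^sub>M borel)"
    and measurable_\<sigma>: "(\<lambda>(t, x). \<sigma> t x) \<in> borel_measurable (restrict_space borel {0..T} \<Otimes>\<^sub>M borel)"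
    and bounded_b: "bounded ((\<lambda>(t, x). b t x) ` ({0..T} \<times> UNIV))"
    and bounded_\<sigma>: "bounded ((\<lambda>(t, x). \<sigma> t x) ` ({0..T} \<times> UNIV))"
    and L\<^sub>b: "0 < L\<^sub>b" "\<And>t x y. t \<in> {0..T} \<Longrightarrow> norm (b t x - b t y) \<le> L\<^sub>b * norm (x - y)"
    and L\<^sub>\<sigma>: "0 < L\<^sub>\<sigma>" "\<And>t x y. t \<in> {0..T} \<Longrightarrow> norm (\<sigma> t x - \<sigma> t y) \<le> L\<^sub>\<sigma> * norm (x - y)"
begin

abbreviation "\<gamma> \<equiv> \<alpha> - \<beta>"

lemma exponents: "0 < \<gamma>" "\<gamma> < 1" "0 < \<alpha>" "0 < 2 * \<alpha> - 1" "2 * \<alpha> - 1 < 1"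
  using \<alpha> \<beta> by auto

text \<open>The right side of the mild equation, with the drift values \<open>v\<close> and the Ito integral \<open>I\<close> as separate
  arguments: it is linear in \<open>(\<eta>, X, v, I)\<close>, so that differences of values are again values.\<close>

definition rhs :: "real \<Rightarrow> ('w \<Rightarrow> real ^ 'n) \<Rightarrow> (real \<Rightarrow> 'w \<Rightarrow> real ^ 'n) \<Rightarrow> (real \<Rightarrow> 'w \<Rightarrow> real ^ 'n) \<Rightarrow> ('w \<Rightarrow> real ^ 'n) \<Rightarrow> 'w \<Rightarrow> real ^ 'n" where
  "rhs t \<eta> X v I \<omega> = \<eta> \<omega> - (t powr \<gamma> / Gamma (\<gamma> + 1)) *\<^sub>R (A *v \<eta> \<omega>)
     + (1 / Gamma \<gamma>) *\<^sub>R (A *v kernel_conv \<gamma> (\<lambda>r. X r \<omega>) t)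
     + (1 / Gamma \<alpha>) *\<^sub>R (B *v kernel_conv \<alpha> (\<lambda>r. X r \<omega>) t)
     + (1 / Gamma \<alpha>) *\<^sub>R kernel_conv \<alpha> (\<lambda>r. v r \<omega>) t + (1 / Gamma \<alpha>) *\<^sub>R I \<omega>"

text \<open>\<open>Z\<close> is the right side of the mild equation for the input \<open>X\<close>. This is a relation because Ito integrals
  are determined only up to null sets, separately for each time.\<close>

definition mild_map :: "('w \<Rightarrow> real ^ 'n) \<Rightarrow> (real \<Rightarrow> 'w \<Rightarrow> real ^ 'n) \<Rightarrow> (real \<Rightarrow> 'w \<Rightarrow> real ^ 'n) \<Rightarrow> bool" where
  "mild_map \<eta> X Z \<longleftrightarrow> (\<forall>t\<in>{0..T}. \<exists>I.
     has_ito_integral M F W t (\<lambda>r \<omega>. (t - r) powr (\<alpha> - 1) *\<^sub>R \<sigma> r (X r \<omega>)) I \<and>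
     (AE \<omega> in M. Z t \<omega> = rhs t \<eta> X (\<lambda>r \<omega>. b r (X r \<omega>)) I \<omega>))"

lemma mild_equation_iff: "mild_equation M F W T \<alpha> \<beta> A B b \<sigma> \<eta> X \<longleftrightarrow> mild_map \<eta> X X"
  unfolding mild_equation_def mild_map_def rhs_def kernel_conv_def ..

lemma coefficient_bounds:
  "\<exists>C\<ge>0. \<forall>t\<in>{0..T}. \<forall>x. norm (b t x) \<le> C \<and> norm (\<sigma> t x) \<le> C"
proof -
  obtain C1 where "\<And>t x. t \<in> {0..T} \<Longrightarrow> norm (b t x) \<le> C1" using bounded_b unfolding bounded_iff by fastforce
  moreover obtain C2 where "\<And>t x. t \<in> {0..T} \<Longrightarrow> norm (\<sigma> t x) \<le> C2" using bounded_\<sigma> unfolding bounded_iff by fastforce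
  ultimately show ?thesis by (intro exI[of _ "max 0 (max C1 C2)"]) (auto simp: le_max_iff_disj)
qed

lemma coefficient_process:
  fixes c :: "real \<Rightarrow> real ^ 'n \<Rightarrow> real ^ 'n"
  assumes c: "(\<lambda>(t, x). c t x) \<in> borel_measurable (restrict_space borel {0..T} \<Otimes>\<^sub>M borel)" and X: "process X"
  shows "process (\<lambda>r \<omega>. c r (X r \<omega>))"
proof -
  have "(\<lambda>x. (fst x, (\<lambda>(t, \<omega>). X t \<omega>) x)) \<in> restrict_space borel {0..T} \<Otimes>\<^sub>M M \<rightarrow>\<^sub>M restrict_space borel {0..T} \<Otimes>\<^sub>M borel"
    using X unfolding process_def by (intro measurable_Pair measurable_fst)
  from measurable_compose[OF this c] show ?thesis by (simp add: process_def split_beta')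
qed

lemma coefficient_adapted:
  fixes c :: "real \<Rightarrow> real ^ 'n \<Rightarrow> real ^ 'n"
  assumes c: "(\<lambda>(t, x). c t x) \<in> borel_measurable (restrict_space borel {0..T} \<Otimes>\<^sub>M borel)"
    and X: "X r \<in> borel_measurable (F r)" and r: "r \<in> {0..T}"
  shows "(\<lambda>\<omega>. c r (X r \<omega>)) \<in> borel_measurable (F r)"
proof -
  have "r \<in> space (restrict_space borel {0..T})" using r by (simp add: space_restrict_space)
  from measurable_compose[OF measurable_Pair1'[OF this] c]
  have "c r \<in> borel_measurable borel" by simp
  from measurable_compose[OF X this] show ?thesis .
qed

lemma norm_rhs_le:
  "\<exists>S\<ge>0. \<forall>t\<in>{0..T}. \<forall>\<eta> X v I \<omega>. norm (rhs t \<eta> X v I \<omega>) \<le> S * (norm (\<eta> \<omega>) + norm (kernel_conv \<gamma> (\<lambda>r. X r \<omega>) t)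
     + norm (kernel_conv \<alpha> (\<lambda>r. X r \<omega>) t) + norm (kernel_conv \<alpha> (\<lambda>r. v r \<omega>) t) + norm (I \<omega>))"
proof -
  obtain a where a: "0 < a" "\<And>x. norm (A *v x) \<le> norm x * a"
    using bounded_linear.pos_bounded[OF matrix_vector_mul_bounded_linear[of A]] by blast
  obtain c where c: "0 < c" "\<And>x. norm (B *v x) \<le> norm x * c"
    using bounded_linear.pos_bounded[OF matrix_vector_mul_bounded_linear[of B]] by blast
  have G: "0 < Gamma \<gamma>" "0 < Gamma \<alpha>" "0 < Gamma (\<gamma> + 1)" using exponents by (auto intro!: Gamma_real_pos)
  define S where "S = 1 + T powr \<gamma> / Gamma (\<gamma> + 1) * a + a / Gamma \<gamma> + c / Gamma \<alpha> + 1 / Gamma \<alpha>"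
  have pos: "0 \<le> T powr \<gamma> / Gamma (\<gamma> + 1) * a" "0 \<le> a / Gamma \<gamma>" "0 \<le> c / Gamma \<alpha>" "0 \<le> 1 / Gamma \<alpha>"
    using G a c by auto
  have S: "0 \<le> S" "1 + T powr \<gamma> / Gamma (\<gamma> + 1) * a \<le> S" "a / Gamma \<gamma> \<le> S" "c / Gamma \<alpha> \<le> S" "1 / Gamma \<alpha> \<le> S"
    using pos unfolding S_def by linarith+
  have "norm (rhs t \<eta> X v I \<omega>) \<le> S * (norm (\<eta> \<omega>) + norm (kernel_conv \<gamma> (\<lambda>r. X r \<omega>) t)
     + norm (kernel_conv \<alpha> (\<lambda>r. X r \<omega>) t) + norm (kernel_conv \<alpha> (\<lambda>r. v r \<omega>) t) + norm (I \<omega>))"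
    if t: "t \<in> {0..T}" for t \<eta> X v I \<omega>
  proof -
    let ?x = "kernel_conv \<gamma> (\<lambda>r. X r \<omega>) t" and ?y = "kernel_conv \<alpha> (\<lambda>r. X r \<omega>) t" and ?z = "kernel_conv \<alpha> (\<lambda>r. v r \<omega>) t"
    have tri: "norm (x1 - x2 + x3 + x4 + x5 + x6) \<le> norm x1 + norm x2 + norm x3 + norm x4 + norm x5 + norm x6" for x1 x2 x3 x4 x5 x6 :: "real ^ 'n"
      by (intro order_trans[OF norm_triangle_ineq] add_right_mono norm_triangle_ineq4)
    have 2: "norm ((t powr \<gamma> / Gamma (\<gamma> + 1)) *\<^sub>R (A *v \<eta> \<omega>)) \<le> (T powr \<gamma> / Gamma (\<gamma> + 1) * a) * norm (\<eta> \<omega>)"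
    proof -
      have "norm ((t powr \<gamma> / Gamma (\<gamma> + 1)) *\<^sub>R (A *v \<eta> \<omega>)) = (t powr \<gamma> / Gamma (\<gamma> + 1)) * norm (A *v \<eta> \<omega>)"
        using G by simp
      also have "\<dots> \<le> (T powr \<gamma> / Gamma (\<gamma> + 1)) * (norm (\<eta> \<omega>) * a)"
        using t G exponents by (intro mult_mono a divide_right_mono powr_mono2) auto
      finally show ?thesis by (simp add: mult_ac)
    qed
    have 3: "norm ((1 / Gamma \<gamma>) *\<^sub>R (A *v ?x)) \<le> a / Gamma \<gamma> * norm ?x"
      using a(2)[of ?x] G by (simp add: divide_right_mono mult.commute)
    have 4: "norm ((1 / Gamma \<alpha>) *\<^sub>R (B *v ?y)) \<le> c / Gamma \<alpha> * norm ?y"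
      using c(2)[of ?y] G by (simp add: divide_right_mono mult.commute)
    have 5: "norm ((1 / Gamma \<alpha>) *\<^sub>R ?z) \<le> 1 / Gamma \<alpha> * norm ?z" "norm ((1 / Gamma \<alpha>) *\<^sub>R I \<omega>) \<le> 1 / Gamma \<alpha> * norm (I \<omega>)"
      using G by simp_all
    have "norm (rhs t \<eta> X v I \<omega>) \<le> norm (\<eta> \<omega>) + (T powr \<gamma> / Gamma (\<gamma> + 1) * a) * norm (\<eta> \<omega>) + a / Gamma \<gamma> * norm ?x
       + c / Gamma \<alpha> * norm ?y + 1 / Gamma \<alpha> * norm ?z + 1 / Gamma \<alpha> * norm (I \<omega>)"
      unfolding rhs_def by (rule order_trans[OF tri]) (intro add_mono order_refl 2 3 4 5)
    also have "\<dots> = (1 + T powr \<gamma> / Gamma (\<gamma> + 1) * a) * norm (\<eta> \<omega>) + a / Gamma \<gamma> * norm ?x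
       + c / Gamma \<alpha> * norm ?y + 1 / Gamma \<alpha> * norm ?z + 1 / Gamma \<alpha> * norm (I \<omega>)" by (simp add: distrib_right)
    also have "\<dots> \<le> S * norm (\<eta> \<omega>) + S * norm ?x + S * norm ?y + S * norm ?z + S * norm (I \<omega>)"
      by (intro add_mono mult_right_mono S) auto
    finally show ?thesis by (simp add: distrib_left)
  qed
  then show ?thesis using S(1) by blast
qed

lemma sqn_rhs_le:
  "\<exists>K\<ge>0. \<forall>t\<in>{0..T}. \<forall>\<eta> X v I. \<eta> \<in> borel_measurable M \<longrightarrow> process X \<longrightarrow> process v \<longrightarrow> I \<in> borel_measurable M \<longrightarrow>
     sqn M (rhs t \<eta> X v I) \<le> ennreal K * (sqn M \<eta> + conv_energy \<gamma> X t + conv_energy \<alpha> X t + conv_energy \<alpha> v t + sqn M I)"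
proof -
  obtain S where S: "0 \<le> S" "\<And>t \<eta> X v I \<omega>. t \<in> {0..T} \<Longrightarrow> norm (rhs t \<eta> X v I \<omega>) \<le> S * (norm (\<eta> \<omega>) + norm (kernel_conv \<gamma> (\<lambda>r. X r \<omega>) t)
     + norm (kernel_conv \<alpha> (\<lambda>r. X r \<omega>) t) + norm (kernel_conv \<alpha> (\<lambda>r. v r \<omega>) t) + norm (I \<omega>))"
    using norm_rhs_le by blast
  define c where "c = max 1 (max (T powr \<gamma> / \<gamma>) (T powr \<alpha> / \<alpha>))"
  have c: "1 \<le> c" "T powr \<gamma> / \<gamma> \<le> c" "T powr \<alpha> / \<alpha> \<le> c" by (auto simp: c_def)
  have "sqn M (rhs t \<eta> X v I) \<le> ennreal (16 * S\<^sup>2 * c) * (sqn M \<eta> + conv_energy \<gamma> X t + conv_energy \<alpha> X t + conv_energy \<alpha> v t + sqn M I)"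
    if t: "t \<in> {0..T}" and [measurable]: "\<eta> \<in> borel_measurable M" "I \<in> borel_measurable M" and X: "process X" and v: "process v" for t \<eta> X v I
  proof -
    let ?x = "\<lambda>\<omega>. kernel_conv \<gamma> (\<lambda>r. X r \<omega>) t" and ?y = "\<lambda>\<omega>. kernel_conv \<alpha> (\<lambda>r. X r \<omega>) t" and ?z = "\<lambda>\<omega>. kernel_conv \<alpha> (\<lambda>r. v r \<omega>) t"
    have [measurable]: "?x \<in> borel_measurable M" "?y \<in> borel_measurable M" "?z \<in> borel_measurable M"
      using process_at[OF process_conv[OF X] t] process_at[OF process_conv[OF v] t] by auto
    have pw: "(norm (rhs t \<eta> X v I \<omega>))\<^sup>2 \<le> 16 * S\<^sup>2 * ((norm (\<eta> \<omega>))\<^sup>2 + (norm (?x \<omega>))\<^sup>2 + (norm (?y \<omega>))\<^sup>2 + (norm (?z \<omega>))\<^sup>2 + (norm (I \<omega>))\<^sup>2)" for \<omega>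
    proof -
      have "(norm (rhs t \<eta> X v I \<omega>))\<^sup>2 \<le> (S * (norm (\<eta> \<omega>) + norm (?x \<omega>) + norm (?y \<omega>) + norm (?z \<omega>) + norm (I \<omega>)))\<^sup>2"
        by (intro power_mono S t norm_ge_zero)
      also have "\<dots> = S\<^sup>2 * (norm (\<eta> \<omega>) + norm (?x \<omega>) + norm (?y \<omega>) + norm (?z \<omega>) + norm (I \<omega>))\<^sup>2" by (rule power_mult_distrib)
      also have "\<dots> \<le> S\<^sup>2 * (16 * ((norm (\<eta> \<omega>))\<^sup>2 + (norm (?x \<omega>))\<^sup>2 + (norm (?y \<omega>))\<^sup>2 + (norm (?z \<omega>))\<^sup>2 + (norm (I \<omega>))\<^sup>2))"
        by (intro mult_left_mono sum5_power2_le) simp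
      finally show ?thesis by (simp add: mult_ac)
    qed
    have "sqn M (rhs t \<eta> X v I) \<le> (\<integral>\<^sup>+\<omega>. ennreal (16 * S\<^sup>2) * (ennreal ((norm (\<eta> \<omega>))\<^sup>2) + ennreal ((norm (?x \<omega>))\<^sup>2) + ennreal ((norm (?y \<omega>))\<^sup>2) + ennreal ((norm (?z \<omega>))\<^sup>2) + ennreal ((norm (I \<omega>))\<^sup>2)) \<partial>M)"
      unfolding sqn_def
    proof (intro nn_integral_mono)
      fix \<omega>
      have "ennreal ((norm (rhs t \<eta> X v I \<omega>))\<^sup>2) \<le> ennreal (16 * S\<^sup>2 * ((norm (\<eta> \<omega>))\<^sup>2 + (norm (?x \<omega>))\<^sup>2 + (norm (?y \<omega>))\<^sup>2 + (norm (?z \<omega>))\<^sup>2 + (norm (I \<omega>))\<^sup>2))"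
        by (rule ennreal_leI[OF pw])
      also have "\<dots> = ennreal (16 * S\<^sup>2) * (ennreal ((norm (\<eta> \<omega>))\<^sup>2) + ennreal ((norm (?x \<omega>))\<^sup>2) + ennreal ((norm (?y \<omega>))\<^sup>2) + ennreal ((norm (?z \<omega>))\<^sup>2) + ennreal ((norm (I \<omega>))\<^sup>2))"
        by (subst ennreal_mult) (auto simp: ennreal_plus)
      finally show "ennreal ((norm (rhs t \<eta> X v I \<omega>))\<^sup>2) \<le> \<dots>" .
    qed
    also have "\<dots> = ennreal (16 * S\<^sup>2) * (sqn M \<eta> + sqn M ?x + sqn M ?y + sqn M ?z + sqn M I)"
      unfolding sqn_def by (simp add: nn_integral_cmult nn_integral_add)
    also have "\<dots> \<le> ennreal (16 * S\<^sup>2) * (ennreal c * sqn M \<eta> + ennreal c * conv_energy \<gamma> X t + ennreal c * conv_energy \<alpha> X t + ennreal c * conv_energy \<alpha> v t + ennreal c * sqn M I)"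
    proof (intro mult_left_mono add_mono)
      have e: "x \<le> ennreal c * x" for x :: ennreal
        using mult_right_mono[OF ennreal_leI[OF c(1)] zero_le[of x]] by (simp only: ennreal_1 mult_1)
      show "sqn M \<eta> \<le> ennreal c * sqn M \<eta>" "sqn M I \<le> ennreal c * sqn M I" by (rule e)+
      show "sqn M ?x \<le> ennreal c * conv_energy \<gamma> X t"
        by (rule order_trans[OF sqn_conv_le[OF X exponents(1) t]]) (intro mult_right_mono ennreal_leI c, simp)
      show "sqn M ?y \<le> ennreal c * conv_energy \<alpha> X t"
        by (rule order_trans[OF sqn_conv_le[OF X exponents(3) t]]) (intro mult_right_mono ennreal_leI c, simp)
      show "sqn M ?z \<le> ennreal c * conv_energy \<alpha> v t"
        by (rule order_trans[OF sqn_conv_le[OF v exponents(3) t]]) (intro mult_right_mono ennreal_leI c, simp)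
    qed simp
    also have "\<dots> = ennreal (16 * S\<^sup>2 * c) * (sqn M \<eta> + conv_energy \<gamma> X t + conv_energy \<alpha> X t + conv_energy \<alpha> v t + sqn M I)"
      using c(1) by (simp add: ennreal_mult distrib_left mult.assoc)
    finally show ?thesis .
  qed
  moreover have "0 \<le> 16 * S\<^sup>2 * c" using c(1) by simp
  ultimately show ?thesis by blast
qed

lemma rhs_diff:
  assumes t: "t \<in> {0..T}" and X: "process X" "\<And>r. r \<in> {0..T} \<Longrightarrow> sqn M (X r) \<le> ennreal D1"
    and Y: "process Y" "\<And>r. r \<in> {0..T} \<Longrightarrow> sqn M (Y r) \<le> ennreal D2"
    and v: "process v" "\<And>r. r \<in> {0..T} \<Longrightarrow> sqn M (v r) \<le> ennreal D3"
    and w: "process w" "\<And>r. r \<in> {0..T} \<Longrightarrow> sqn M (w r) \<le> ennreal D4"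
  shows "AE \<omega> in M. rhs t \<eta> X v I \<omega> - rhs t \<zeta> Y w J \<omega>
    = rhs t (\<lambda>\<omega>. \<eta> \<omega> - \<zeta> \<omega>) (\<lambda>r \<omega>. X r \<omega> - Y r \<omega>) (\<lambda>r \<omega>. v r \<omega> - w r \<omega>) (\<lambda>\<omega>. I \<omega> - J \<omega>) \<omega>"
proof -
  have iX: "AE \<omega> in M. set_integrable lborel {0..t} (\<lambda>r. (t - r) powr (p - 1) *\<^sub>R X r \<omega>)" if "0 < p" for p
    by (rule AE_set_integrable_kernel[OF X(1) that t]) (erule X(2))
  have iY: "AE \<omega> in M. set_integrable lborel {0..t} (\<lambda>r. (t - r) powr (p - 1) *\<^sub>R Y r \<omega>)" if "0 < p" for p
    by (rule AE_set_integrable_kernel[OF Y(1) that t]) (erule Y(2))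
  have iv: "AE \<omega> in M. set_integrable lborel {0..t} (\<lambda>r. (t - r) powr (p - 1) *\<^sub>R v r \<omega>)" if "0 < p" for p
    by (rule AE_set_integrable_kernel[OF v(1) that t]) (erule v(2))
  have iw: "AE \<omega> in M. set_integrable lborel {0..t} (\<lambda>r. (t - r) powr (p - 1) *\<^sub>R w r \<omega>)" if "0 < p" for p
    by (rule AE_set_integrable_kernel[OF w(1) that t]) (erule w(2))
  show ?thesis
    using iX[OF exponents(1)] iX[OF exponents(3)] iY[OF exponents(1)] iY[OF exponents(3)] iv[OF exponents(3)] iw[OF exponents(3)]
  proof eventually_elim
  case (elim \<omega>)
  show ?case
    unfolding rhs_def kernel_conv_diff[OF elim(1,3), symmetric] kernel_conv_diff[OF elim(2,4), symmetric] kernel_conv_diff[OF elim(5,6), symmetric]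
    by (simp add: matrix_vector_mult_diff_distrib scaleR_diff_right)
  qed
qed

end

context brownian_basis
begin

section \<open>Contraction in a weighted norm\<close>

lemma sqn_process_measurable:
  assumes U: "process U"
  shows "(\<lambda>r. indicator {0..T} r * sqn M (U r)) \<in> borel_measurable borel"
proof -
  define G where "G = (\<lambda>(r, \<omega>). indicator {0..T} r *\<^sub>R U r \<omega>)"
  have [measurable]: "G \<in> borel_measurable (borel \<Otimes>\<^sub>M M)" unfolding G_def by (rule process_extend[OF U])
  have "(\<lambda>r. \<integral>\<^sup>+\<omega>. ennreal ((norm (G (r, \<omega>)))\<^sup>2) \<partial>M) \<in> borel_measurable borel" by measurable
  also have "(\<lambda>r. \<integral>\<^sup>+\<omega>. ennreal ((norm (G (r, \<omega>)))\<^sup>2) \<partial>M) = (\<lambda>r. indicator {0..T} r * sqn M (U r))"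
    by (auto simp: G_def sqn_def fun_eq_iff indicator_def)
  finally show ?thesis .
qed

lemma conv_energy_mono_scale:
  assumes U: "process U" and t: "t \<in> {0..T}" and le: "\<And>r. r \<in> {0..T} \<Longrightarrow> sqn M (V r) \<le> c * sqn M (U r)"
  shows "conv_energy p V t \<le> c * conv_energy p U t"
proof -
  note [measurable] = sqn_process_measurable[OF U]
  have "conv_energy p V t \<le> (\<integral>\<^sup>+r. c * (ennreal ((t - r) powr (p - 1)) * indicator {0..t} r * (indicator {0..T} r * sqn M (U r))) \<partial>lborel)"
    unfolding conv_energy_def
  proof (intro nn_integral_mono)
    fix r
    show "ennreal ((t - r) powr (p - 1)) * sqn M (V r) * indicator {0..t} r
      \<le> c * (ennreal ((t - r) powr (p - 1)) * indicator {0..t} r * (indicator {0..T} r * sqn M (U r)))"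
    proof (cases "r \<in> {0..t}")
      case True
      then have "r \<in> {0..T}" using t by auto
      then show ?thesis using True mult_left_mono[OF le, of r "ennreal ((t - r) powr (p - 1))"] by (simp add: mult_ac)
    qed simp
  qed
  also have "\<dots> = c * (\<integral>\<^sup>+r. ennreal ((t - r) powr (p - 1)) * indicator {0..t} r * (indicator {0..T} r * sqn M (U r)) \<partial>lborel)"
    by (rule nn_integral_cmult) measurable
  also have "(\<integral>\<^sup>+r. ennreal ((t - r) powr (p - 1)) * indicator {0..t} r * (indicator {0..T} r * sqn M (U r)) \<partial>lborel) = conv_energy p U t"
    unfolding conv_energy_def using t by (intro nn_integral_cong) (auto simp: indicator_def)
  finally show ?thesis .
qed

lemma conv_energy_le_const:
  assumes p: "0 < p" and t: "t \<in> {0..T}" and D: "\<And>r. r \<in> {0..T} \<Longrightarrow> sqn M (U r) \<le> ennreal D"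
  shows "conv_energy p U t \<le> ennreal D * ennreal (T powr p / p)"
proof -
  have "conv_energy p U t \<le> (\<integral>\<^sup>+r. ennreal D * (ennreal ((t - r) powr (p - 1)) * indicator {0..t} r) \<partial>lborel)"
    unfolding conv_energy_def
  proof (intro nn_integral_mono)
    fix r
    show "ennreal ((t - r) powr (p - 1)) * sqn M (U r) * indicator {0..t} r \<le> ennreal D * (ennreal ((t - r) powr (p - 1)) * indicator {0..t} r)"
    proof (cases "r \<in> {0..t}")
      case True
      then have "r \<in> {0..T}" using t by auto
      then show ?thesis using True mult_left_mono[OF D, of r "ennreal ((t - r) powr (p - 1))"] by (simp add: mult_ac)
    qed simp
  qed
  also have "\<dots> = ennreal D * ennreal (t powr p / p)"
    using nn_integral_kernel[OF p, of 0 t] t by (subst nn_integral_cmult) auto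
  also have "\<dots> \<le> ennreal D * ennreal (T powr p / p)"
    using t p by (intro mult_left_mono ennreal_leI divide_right_mono powr_mono2) auto
  finally show ?thesis .
qed

lemma conv_energy_zero:
  assumes "process U" "t \<in> {0..T}" "\<And>r. r \<in> {0..T} \<Longrightarrow> sqn M (U r) = 0"
  shows "conv_energy p U t = 0"
  using conv_energy_mono_scale[OF assms(1,2), of U 0] assms(3) by simp

text \<open>The square of Bielecki's weighted norm on \<open>H2\<close>.\<close>

definition weighted_sup :: "real \<Rightarrow> (real \<Rightarrow> 'w \<Rightarrow> 'b::euclidean_space) \<Rightarrow> ennreal" where
  "weighted_sup l D = (SUP t\<in>{0..T}. ennreal (exp (- l * t)) * sqn M (D t))"

lemma sqn_le_weighted_sup: "t \<in> {0..T} \<Longrightarrow> sqn M (D t) \<le> ennreal (exp (l * t)) * weighted_sup l D"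
proof -
  assume t: "t \<in> {0..T}"
  have "ennreal (exp (- l * t)) * sqn M (D t) \<le> weighted_sup l D"
    unfolding weighted_sup_def by (rule SUP_upper[OF t])
  then have "ennreal (exp (l * t)) * (ennreal (exp (- l * t)) * sqn M (D t)) \<le> ennreal (exp (l * t)) * weighted_sup l D"
    by (rule mult_left_mono) simp
  moreover have "ennreal (exp (l * t)) * ennreal (exp (- l * t)) = 1"
    by (simp add: ennreal_mult[symmetric] exp_minus)
  ultimately show ?thesis by (simp add: mult.assoc[symmetric])
qed

lemma conv_energy_le_weighted_sup:
  assumes t: "t \<in> {0..T}"
  shows "conv_energy p D t \<le> weighted_sup l D * (ennreal (exp (l * t)) * laplace_kernel T p l)"
proof -
  have "conv_energy p D t \<le> (\<integral>\<^sup>+r. weighted_sup l D * (ennreal ((t - r) powr (p - 1) * exp (l * r)) * indicator {0..t} r) \<partial>lborel)"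
    unfolding conv_energy_def
  proof (intro nn_integral_mono)
    fix r
    show "ennreal ((t - r) powr (p - 1)) * sqn M (D r) * indicator {0..t} r \<le> weighted_sup l D * (ennreal ((t - r) powr (p - 1) * exp (l * r)) * indicator {0..t} r)"
    proof (cases "r \<in> {0..t}")
      case True
      then have "r \<in> {0..T}" using t by auto
      then show ?thesis using True mult_left_mono[OF sqn_le_weighted_sup[of r D l], of "ennreal ((t - r) powr (p - 1))"]
        by (simp add: mult_ac ennreal_mult)
    qed simp
  qed
  also have "\<dots> = weighted_sup l D * (\<integral>\<^sup>+r\<in>{0..t}. ennreal ((t - r) powr (p - 1) * exp (l * r)) \<partial>lborel)"
    by (rule nn_integral_cmult) auto
  also have "\<dots> \<le> weighted_sup l D * (ennreal (exp (l * t)) * laplace_kernel T p l)"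
    using t by (intro mult_left_mono weighted_kernel_le) auto
  finally show ?thesis .
qed

lemma weighted_sup_finite:
  assumes X: "X \<in> H2 M F T" and Y: "Y \<in> H2 M F T" and l: "0 \<le> l"
  shows "weighted_sup l (\<lambda>t \<omega>. X t \<omega> - Y t \<omega>) < \<infinity>"
proof -
  obtain D1 where D1: "0 \<le> D1" "\<And>t. t \<in> {0..T} \<Longrightarrow> sqn M (X t) \<le> ennreal D1" using H2D(4)[OF X] by blast
  obtain D2 where D2: "0 \<le> D2" "\<And>t. t \<in> {0..T} \<Longrightarrow> sqn M (Y t) \<le> ennreal D2" using H2D(4)[OF Y] by blast
  have "weighted_sup l (\<lambda>t \<omega>. X t \<omega> - Y t \<omega>) \<le> 2 * ennreal D1 + 2 * ennreal D2"
    unfolding weighted_sup_def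
  proof (rule SUP_least)
    fix t assume t: "t \<in> {0..T}"
    have "ennreal (exp (- l * t)) * sqn M (\<lambda>\<omega>. X t \<omega> - Y t \<omega>) \<le> 1 * sqn M (\<lambda>\<omega>. X t \<omega> - Y t \<omega>)"
      using l t by (intro mult_right_mono) auto
    also have "\<dots> \<le> 2 * sqn M (X t) + 2 * sqn M (Y t)"
      using sqn_diff[OF H2D(3)[OF X t] H2D(3)[OF Y t]] by simp
    also have "\<dots> \<le> 2 * ennreal D1 + 2 * ennreal D2" by (intro add_mono mult_left_mono D1 D2 t) auto
    finally show "ennreal (exp (- l * t)) * sqn M (\<lambda>\<omega>. X t \<omega> - Y t \<omega>) \<le> 2 * ennreal D1 + 2 * ennreal D2" .
  qed
  also have "\<dots> < \<infinity>" by (auto simp: ennreal_mult_less_top)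
  finally show ?thesis .
qed

end

context fractional_sde
begin

text \<open>Squaring turns the kernel of exponent \<open>\<alpha>\<close> into the one of exponent \<open>2 \<alpha> - 1\<close>, which is integrable since
  \<open>\<alpha> > 1 / 2\<close>.\<close>

lemma ito_term_diff_le:
  assumes X: "X \<in> H2 M F T" and Y: "Y \<in> H2 M F T" and t: "t \<in> {0..T}"
    and I: "has_ito_integral M F W t (\<lambda>r \<omega>. (t - r) powr (\<alpha> - 1) *\<^sub>R \<sigma> r (X r \<omega>)) I"
    and J: "has_ito_integral M F W t (\<lambda>r \<omega>. (t - r) powr (\<alpha> - 1) *\<^sub>R \<sigma> r (Y r \<omega>)) J"
  shows "sqn M (\<lambda>\<omega>. I \<omega> - J \<omega>) \<le> ennreal (4 * L\<^sub>\<sigma>\<^sup>2) * conv_energy (2 * \<alpha> - 1) (\<lambda>r \<omega>. X r \<omega> - Y r \<omega>) t"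
proof -
  let ?S = "\<lambda>r \<omega>. \<sigma> r (X r \<omega>) - \<sigma> r (Y r \<omega>)"
  have S: "process ?S" by (rule process_diff[OF coefficient_process[OF measurable_\<sigma> H2D(1)[OF X]] coefficient_process[OF measurable_\<sigma> H2D(1)[OF Y]]])
  have XY: "process (\<lambda>r \<omega>. X r \<omega> - Y r \<omega>)" by (intro process_diff H2D(1)[OF X] H2D(1)[OF Y])
  have "sqn M (\<lambda>\<omega>. I \<omega> - J \<omega>) \<le> 4 * sqn (lborel \<Otimes>\<^sub>M M) (case_prod (\<lambda>r \<omega>. indicator {0..t} r *\<^sub>R (t - r) powr (\<alpha> - 1) *\<^sub>R \<sigma> r (X r \<omega>) - indicator {0..t} r *\<^sub>R (t - r) powr (\<alpha> - 1) *\<^sub>R \<sigma> r (Y r \<omega>)))"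
    by (rule ito_bound[OF ito_diff[OF has_ito_integral_imp_ito[OF I t] has_ito_integral_imp_ito[OF J t]]])
  also have "case_prod (\<lambda>r \<omega>. indicator {0..t} r *\<^sub>R (t - r) powr (\<alpha> - 1) *\<^sub>R \<sigma> r (X r \<omega>) - indicator {0..t} r *\<^sub>R (t - r) powr (\<alpha> - 1) *\<^sub>R \<sigma> r (Y r \<omega>))
     = (\<lambda>(r, \<omega>). indicator {0..t} r *\<^sub>R (t - r) powr (\<alpha> - 1) *\<^sub>R ?S r \<omega>)" by (simp add: scaleR_diff_right)
  also have "sqn (lborel \<Otimes>\<^sub>M M) \<dots> = (\<integral>\<^sup>+r\<in>{0..t}. ennreal (((t - r) powr (\<alpha> - 1))\<^sup>2) * sqn M (?S r) \<partial>lborel)"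
    using t by (intro sqn_weighted_process S) auto
  also have "\<dots> = conv_energy (2 * \<alpha> - 1) ?S t"
    unfolding conv_energy_def by (simp add: power2_eq_square powr_add[symmetric])
  also have "4 * \<dots> \<le> 4 * (ennreal (L\<^sub>\<sigma>\<^sup>2) * conv_energy (2 * \<alpha> - 1) (\<lambda>r \<omega>. X r \<omega> - Y r \<omega>) t)"
  proof (intro mult_left_mono conv_energy_mono_scale XY t)
    fix r assume r: "r \<in> {0..T}"
    have "sqn M (?S r) \<le> sqn M (\<lambda>\<omega>. L\<^sub>\<sigma> *\<^sub>R (X r \<omega> - Y r \<omega>))"
      using L\<^sub>\<sigma> r by (intro sqn_mono) simp
    also have "\<dots> = ennreal (L\<^sub>\<sigma>\<^sup>2) * sqn M (\<lambda>\<omega>. X r \<omega> - Y r \<omega>)"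
      by (rule sqn_scaleR[OF process_at[OF XY r]])
    finally show "sqn M (?S r) \<le> ennreal (L\<^sub>\<sigma>\<^sup>2) * sqn M (\<lambda>\<omega>. X r \<omega> - Y r \<omega>)" .
  qed simp
  finally show ?thesis by (simp add: ennreal_mult mult.assoc)
qed

lemma bounded_coefficient_process:
  assumes X: "process X"
  shows "\<exists>D. \<forall>r\<in>{0..T}. sqn M (\<lambda>\<omega>. b r (X r \<omega>)) \<le> ennreal D \<and> sqn M (\<lambda>\<omega>. \<sigma> r (X r \<omega>)) \<le> ennreal D"
proof -
  obtain C where C: "0 \<le> C" "\<And>t x. t \<in> {0..T} \<Longrightarrow> norm (b t x) \<le> C \<and> norm (\<sigma> t x) \<le> C" using coefficient_bounds by blast
  have *: "sqn M f \<le> ennreal (C\<^sup>2)" if "\<And>\<omega>. norm (f \<omega>) \<le> C" for f :: "'w \<Rightarrow> real ^ 'n"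
  proof -
    have "sqn M f \<le> (\<integral>\<^sup>+\<omega>. ennreal (C\<^sup>2) \<partial>M)"
      unfolding sqn_def using that by (intro nn_integral_mono ennreal_leI power_mono) auto
    then show ?thesis by (simp add: emeasure_space_1)
  qed
  show ?thesis using C(2) by (intro exI[of _ "C\<^sup>2"] ballI conjI *) simp_all
qed

text \<open>By linearity of \<open>rhs\<close> and the Lipschitz conditions, every term of the difference of two outputs is
  controlled by a convolution of the mean squares of the difference of the inputs.\<close>

theorem mild_map_stable:
  "\<exists>K\<ge>0. \<forall>X\<in>H2 M F T. \<forall>Y\<in>H2 M F T. \<forall>\<eta> \<zeta> Z Z'. \<eta> \<in> borel_measurable M \<longrightarrow> \<zeta> \<in> borel_measurable M \<longrightarrow>
     mild_map \<eta> X Z \<longrightarrow> mild_map \<zeta> Y Z' \<longrightarrow> (\<forall>t\<in>{0..T}. sqn M (\<lambda>\<omega>. Z t \<omega> - Z' t \<omega>) \<le> ennreal K * (sqn M (\<lambda>\<omega>. \<eta> \<omega> - \<zeta> \<omega>) +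
       conv_energy \<gamma> (\<lambda>r \<omega>. X r \<omega> - Y r \<omega>) t + conv_energy \<alpha> (\<lambda>r \<omega>. X r \<omega> - Y r \<omega>) t + conv_energy (2 * \<alpha> - 1) (\<lambda>r \<omega>. X r \<omega> - Y r \<omega>) t))"
proof -
  obtain K where K: "0 \<le> K" "\<And>t \<eta> X v I. t \<in> {0..T} \<Longrightarrow> \<eta> \<in> borel_measurable M \<Longrightarrow> process X \<Longrightarrow> process v \<Longrightarrow> I \<in> borel_measurable M \<Longrightarrow>
     sqn M (rhs t \<eta> X v I) \<le> ennreal K * (sqn M \<eta> + conv_energy \<gamma> X t + conv_energy \<alpha> X t + conv_energy \<alpha> v t + sqn M I)"
    using sqn_rhs_le by blast
  define c where "c = 1 + L\<^sub>b\<^sup>2 + 4 * L\<^sub>\<sigma>\<^sup>2"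
  have c: "1 \<le> c" "1 + L\<^sub>b\<^sup>2 \<le> c" "4 * L\<^sub>\<sigma>\<^sup>2 \<le> c" by (auto simp: c_def)
  have "sqn M (\<lambda>\<omega>. Z t \<omega> - Z' t \<omega>) \<le> ennreal (K * c) * (sqn M (\<lambda>\<omega>. \<eta> \<omega> - \<zeta> \<omega>) +
       conv_energy \<gamma> (\<lambda>r \<omega>. X r \<omega> - Y r \<omega>) t + conv_energy \<alpha> (\<lambda>r \<omega>. X r \<omega> - Y r \<omega>) t + conv_energy (2 * \<alpha> - 1) (\<lambda>r \<omega>. X r \<omega> - Y r \<omega>) t)"
    if X: "X \<in> H2 M F T" and Y: "Y \<in> H2 M F T" and [measurable]: "\<eta> \<in> borel_measurable M" "\<zeta> \<in> borel_measurable M"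
      and ZX: "mild_map \<eta> X Z" and ZY: "mild_map \<zeta> Y Z'" and t: "t \<in> {0..T}" for X Y \<eta> \<zeta> Z Z' t
  proof -
    let ?D = "\<lambda>r \<omega>. X r \<omega> - Y r \<omega>" and ?v = "\<lambda>r \<omega>. b r (X r \<omega>) - b r (Y r \<omega>)"
    obtain I where I: "has_ito_integral M F W t (\<lambda>r \<omega>. (t - r) powr (\<alpha> - 1) *\<^sub>R \<sigma> r (X r \<omega>)) I"
      "AE \<omega> in M. Z t \<omega> = rhs t \<eta> X (\<lambda>r \<omega>. b r (X r \<omega>)) I \<omega>" using ZX t unfolding mild_map_def by blast
    obtain J where J: "has_ito_integral M F W t (\<lambda>r \<omega>. (t - r) powr (\<alpha> - 1) *\<^sub>R \<sigma> r (Y r \<omega>)) J"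
      "AE \<omega> in M. Z' t \<omega> = rhs t \<zeta> Y (\<lambda>r \<omega>. b r (Y r \<omega>)) J \<omega>" using ZY t unfolding mild_map_def by blast
    note [measurable] = ito_measurable(2)[OF has_ito_integral_imp_ito[OF I(1) t]] ito_measurable(2)[OF has_ito_integral_imp_ito[OF J(1) t]]
    note pX = H2D(1)[OF X] and pY = H2D(1)[OF Y]
    note pbX = coefficient_process[OF measurable_b pX] and pbY = coefficient_process[OF measurable_b pY]
    obtain D1 where D1: "\<forall>t\<in>{0..T}. sqn M (X t) \<le> ennreal D1" using H2D(4)[OF X] by blast
    obtain D2 where D2: "\<forall>t\<in>{0..T}. sqn M (Y t) \<le> ennreal D2" using H2D(4)[OF Y] by blast
    obtain D3 where D3: "\<forall>r\<in>{0..T}. sqn M (\<lambda>\<omega>. b r (X r \<omega>)) \<le> ennreal D3 \<and> sqn M (\<lambda>\<omega>. \<sigma> r (X r \<omega>)) \<le> ennreal D3" using bounded_coefficient_process[OF pX] by blast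
    obtain D4 where D4: "\<forall>r\<in>{0..T}. sqn M (\<lambda>\<omega>. b r (Y r \<omega>)) \<le> ennreal D4 \<and> sqn M (\<lambda>\<omega>. \<sigma> r (Y r \<omega>)) \<le> ennreal D4" using bounded_coefficient_process[OF pY] by blast
    have "AE \<omega> in M. rhs t \<eta> X (\<lambda>r \<omega>. b r (X r \<omega>)) I \<omega> - rhs t \<zeta> Y (\<lambda>r \<omega>. b r (Y r \<omega>)) J \<omega> = rhs t (\<lambda>\<omega>. \<eta> \<omega> - \<zeta> \<omega>) ?D ?v (\<lambda>\<omega>. I \<omega> - J \<omega>) \<omega>"
      by (rule rhs_diff[OF t pX _ pY _ pbX _ pbY, of D1 D2 D3 D4]) (use D1 D2 D3 D4 in auto)
    with I(2) J(2) have "AE \<omega> in M. Z t \<omega> - Z' t \<omega> = rhs t (\<lambda>\<omega>. \<eta> \<omega> - \<zeta> \<omega>) ?D ?v (\<lambda>\<omega>. I \<omega> - J \<omega>) \<omega>"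
      by eventually_elim simp
    then have "sqn M (\<lambda>\<omega>. Z t \<omega> - Z' t \<omega>) = sqn M (rhs t (\<lambda>\<omega>. \<eta> \<omega> - \<zeta> \<omega>) ?D ?v (\<lambda>\<omega>. I \<omega> - J \<omega>))"
      by (rule sqn_cong_AE)
    also have "\<dots> \<le> ennreal K * (sqn M (\<lambda>\<omega>. \<eta> \<omega> - \<zeta> \<omega>) + conv_energy \<gamma> ?D t + conv_energy \<alpha> ?D t + conv_energy \<alpha> ?v t + sqn M (\<lambda>\<omega>. I \<omega> - J \<omega>))"
      by (intro K(2) t process_diff pX pY pbX pbY) measurable
    also have "\<dots> \<le> ennreal K * (ennreal c * sqn M (\<lambda>\<omega>. \<eta> \<omega> - \<zeta> \<omega>) + ennreal c * conv_energy \<gamma> ?D t + ennreal c * conv_energy \<alpha> ?D t + ennreal c * conv_energy (2 * \<alpha> - 1) ?D t)"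
    proof (intro mult_left_mono)
      have e: "x \<le> ennreal c * x" for x :: ennreal
        using mult_right_mono[OF ennreal_leI[OF c(1)] zero_le[of x]] by (simp only: ennreal_1 mult_1)
      have "conv_energy \<alpha> ?v t \<le> ennreal (L\<^sub>b\<^sup>2) * conv_energy \<alpha> ?D t"
      proof (intro conv_energy_mono_scale process_diff pX pY t)
        fix r assume r: "r \<in> {0..T}"
        have "sqn M (?v r) \<le> sqn M (\<lambda>\<omega>. L\<^sub>b *\<^sub>R (X r \<omega> - Y r \<omega>))"
          using L\<^sub>b r by (intro sqn_mono) simp
        also have "\<dots> = ennreal (L\<^sub>b\<^sup>2) * sqn M (\<lambda>\<omega>. X r \<omega> - Y r \<omega>)"
          by (rule sqn_scaleR[OF process_at[OF process_diff[OF pX pY] r]])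
        finally show "sqn M (?v r) \<le> ennreal (L\<^sub>b\<^sup>2) * sqn M (\<lambda>\<omega>. X r \<omega> - Y r \<omega>)" .
      qed
      then have 1: "conv_energy \<alpha> ?D t + conv_energy \<alpha> ?v t \<le> ennreal c * conv_energy \<alpha> ?D t"
      proof -
        assume a: "conv_energy \<alpha> ?v t \<le> ennreal (L\<^sub>b\<^sup>2) * conv_energy \<alpha> ?D t"
        have "conv_energy \<alpha> ?D t + conv_energy \<alpha> ?v t \<le> conv_energy \<alpha> ?D t + ennreal (L\<^sub>b\<^sup>2) * conv_energy \<alpha> ?D t" by (rule add_left_mono[OF a])
        also have "\<dots> = ennreal (1 + L\<^sub>b\<^sup>2) * conv_energy \<alpha> ?D t" by (simp add: ennreal_plus distrib_right)
        also have "\<dots> \<le> ennreal c * conv_energy \<alpha> ?D t" by (intro mult_right_mono ennreal_leI c) simp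
        finally show ?thesis .
      qed
      have 2: "sqn M (\<lambda>\<omega>. I \<omega> - J \<omega>) \<le> ennreal c * conv_energy (2 * \<alpha> - 1) ?D t"
        by (rule order_trans[OF ito_term_diff_le[OF X Y t I(1) J(1)]]) (intro mult_right_mono ennreal_leI c, simp)
      have "sqn M (\<lambda>\<omega>. \<eta> \<omega> - \<zeta> \<omega>) + conv_energy \<gamma> ?D t + (conv_energy \<alpha> ?D t + conv_energy \<alpha> ?v t) + sqn M (\<lambda>\<omega>. I \<omega> - J \<omega>)
        \<le> ennreal c * sqn M (\<lambda>\<omega>. \<eta> \<omega> - \<zeta> \<omega>) + ennreal c * conv_energy \<gamma> ?D t + ennreal c * conv_energy \<alpha> ?D t + ennreal c * conv_energy (2 * \<alpha> - 1) ?D t"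
        by (intro add_mono e 1 2)
      then show "sqn M (\<lambda>\<omega>. \<eta> \<omega> - \<zeta> \<omega>) + conv_energy \<gamma> ?D t + conv_energy \<alpha> ?D t + conv_energy \<alpha> ?v t + sqn M (\<lambda>\<omega>. I \<omega> - J \<omega>)
        \<le> ennreal c * sqn M (\<lambda>\<omega>. \<eta> \<omega> - \<zeta> \<omega>) + ennreal c * conv_energy \<gamma> ?D t + ennreal c * conv_energy \<alpha> ?D t + ennreal c * conv_energy (2 * \<alpha> - 1) ?D t"
        by (simp only: add.assoc)
    qed simp
    also have "\<dots> = ennreal (K * c) * (sqn M (\<lambda>\<omega>. \<eta> \<omega> - \<zeta> \<omega>) + conv_energy \<gamma> ?D t + conv_energy \<alpha> ?D t + conv_energy (2 * \<alpha> - 1) ?D t)"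
      using c(1) K(1) by (simp add: ennreal_mult distrib_left mult.assoc)
    finally show ?thesis .
  qed
  moreover have "0 \<le> K * c" using K(1) c(1) by simp
  ultimately show ?thesis by blast
qed

text \<open>The three kernels in \<open>mild_map_stable\<close> have small exponentially weighted mass (\<open>laplace_kernel\<close>) for large
  \<open>l\<close>; only the term with the initial values is not contracted.\<close>

theorem mild_map_contraction:
  "\<exists>K\<ge>0. \<exists>l\<ge>0. \<forall>X\<in>H2 M F T. \<forall>Y\<in>H2 M F T. \<forall>\<eta> \<zeta> Z Z'. \<eta> \<in> borel_measurable M \<longrightarrow> \<zeta> \<in> borel_measurable M \<longrightarrow>
     mild_map \<eta> X Z \<longrightarrow> mild_map \<zeta> Y Z' \<longrightarrow>
     weighted_sup l (\<lambda>t \<omega>. Z t \<omega> - Z' t \<omega>) \<le> ennreal K * sqn M (\<lambda>\<omega>. \<eta> \<omega> - \<zeta> \<omega>) + ennreal (1 / 4) * weighted_sup l (\<lambda>t \<omega>. X t \<omega> - Y t \<omega>)"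
proof -
  obtain K where K: "0 \<le> K" "\<And>X Y \<eta> \<zeta> Z Z' t. X \<in> H2 M F T \<Longrightarrow> Y \<in> H2 M F T \<Longrightarrow> \<eta> \<in> borel_measurable M \<Longrightarrow> \<zeta> \<in> borel_measurable M \<Longrightarrow>
     mild_map \<eta> X Z \<Longrightarrow> mild_map \<zeta> Y Z' \<Longrightarrow> t \<in> {0..T} \<Longrightarrow> sqn M (\<lambda>\<omega>. Z t \<omega> - Z' t \<omega>) \<le> ennreal K * (sqn M (\<lambda>\<omega>. \<eta> \<omega> - \<zeta> \<omega>) +
       conv_energy \<gamma> (\<lambda>r \<omega>. X r \<omega> - Y r \<omega>) t + conv_energy \<alpha> (\<lambda>r \<omega>. X r \<omega> - Y r \<omega>) t + conv_energy (2 * \<alpha> - 1) (\<lambda>r \<omega>. X r \<omega> - Y r \<omega>) t)"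
    using mild_map_stable by blast
  \<comment> \<open>Three kernels of size \<open>\<theta>\<close> with constant \<open>K\<close> make at most \<open>1 / 4\<close>.\<close>
  define \<theta> where "\<theta> = 1 / (12 * (K + 1))"
  have \<theta>: "0 < \<theta>" using K(1) by (simp add: \<theta>_def)
  have "eventually (\<lambda>n. laplace_kernel T \<gamma> (real n) \<le> ennreal \<theta> \<and> laplace_kernel T \<alpha> (real n) \<le> ennreal \<theta> \<and> laplace_kernel T (2 * \<alpha> - 1) (real n) \<le> ennreal \<theta>) sequentially"
    using exponents T \<theta> by (intro eventually_conj eventually_laplace_kernel_small) auto
  then obtain n where n: "laplace_kernel T \<gamma> (real n) \<le> ennreal \<theta>" "laplace_kernel T \<alpha> (real n) \<le> ennreal \<theta>" "laplace_kernel T (2 * \<alpha> - 1) (real n) \<le> ennreal \<theta>"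
    using eventually_happens'[OF sequentially_bot] by blast
  define l where "l = real n"
  have "weighted_sup l (\<lambda>t \<omega>. Z t \<omega> - Z' t \<omega>) \<le> ennreal K * sqn M (\<lambda>\<omega>. \<eta> \<omega> - \<zeta> \<omega>) + ennreal (1 / 4) * weighted_sup l (\<lambda>t \<omega>. X t \<omega> - Y t \<omega>)"
    if h: "X \<in> H2 M F T" "Y \<in> H2 M F T" "\<eta> \<in> borel_measurable M" "\<zeta> \<in> borel_measurable M" "mild_map \<eta> X Z" "mild_map \<zeta> Y Z'" for X Y \<eta> \<zeta> Z Z'
    unfolding weighted_sup_def[of l "\<lambda>t \<omega>. Z t \<omega> - Z' t \<omega>"]
  proof (rule SUP_least)
    fix t assume t: "t \<in> {0..T}"
    let ?D = "\<lambda>r \<omega>. X r \<omega> - Y r \<omega>" and ?N = "weighted_sup l (\<lambda>t \<omega>. X t \<omega> - Y t \<omega>)" and ?a = "sqn M (\<lambda>\<omega>. \<eta> \<omega> - \<zeta> \<omega>)"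
    have ce: "conv_energy p ?D t \<le> ?N * (ennreal (exp (l * t)) * ennreal \<theta>)" if "laplace_kernel T p (real n) \<le> ennreal \<theta>" for p
      using that by (intro order_trans[OF conv_energy_le_weighted_sup[OF t, of p ?D l]] mult_left_mono) (auto simp: l_def)
    have "sqn M (\<lambda>\<omega>. Z t \<omega> - Z' t \<omega>) \<le> ennreal K * (?a + conv_energy \<gamma> ?D t + conv_energy \<alpha> ?D t + conv_energy (2 * \<alpha> - 1) ?D t)"
      by (rule K(2)[OF h t])
    also have "\<dots> \<le> ennreal K * (?a + ?N * (ennreal (exp (l * t)) * ennreal \<theta>) + ?N * (ennreal (exp (l * t)) * ennreal \<theta>) + ?N * (ennreal (exp (l * t)) * ennreal \<theta>))"
      by (intro mult_left_mono add_mono ce n order_refl) simp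
    finally have "ennreal (exp (- l * t)) * sqn M (\<lambda>\<omega>. Z t \<omega> - Z' t \<omega>) \<le>
      ennreal (exp (- l * t)) * (ennreal K * (?a + ?N * (ennreal (exp (l * t)) * ennreal \<theta>) + ?N * (ennreal (exp (l * t)) * ennreal \<theta>) + ?N * (ennreal (exp (l * t)) * ennreal \<theta>)))"
      by (rule mult_left_mono) simp
    also have "\<dots> = ennreal (exp (- l * t)) * (ennreal K * ?a) + (ennreal (exp (- l * t)) * ennreal (exp (l * t))) * (3 * (ennreal K * ennreal \<theta>)) * ?N"
    proof -
      have "e * (k * (a + N * (f * h) + N * (f * h) + N * (f * h))) = e * (k * a) + (e * f) * (3 * (k * h)) * N" for e k a N f h :: ennreal
      proof -
        have three: "(3::ennreal) = 1 + 1 + 1" by simp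
        have "N * (f * h) + N * (f * h) + N * (f * h) = 3 * (N * (f * h))" by (simp only: three distrib_right mult_1)
        then have "a + N * (f * h) + N * (f * h) + N * (f * h) = a + 3 * (N * (f * h))" by (simp only: add.assoc)
        then show ?thesis by (simp only: distrib_left) (simp only: mult_ac)
      qed
      then show ?thesis .
    qed
    also have "\<dots> \<le> ennreal K * ?a + ennreal (1 / 4) * ?N"
    proof (intro add_mono)
      have "ennreal (exp (- l * t)) * (ennreal K * ?a) \<le> 1 * (ennreal K * ?a)"
        using t by (intro mult_right_mono) (auto simp: l_def)
      then show "ennreal (exp (- l * t)) * (ennreal K * ?a) \<le> ennreal K * ?a" by simp
      have 1: "ennreal (exp (- l * t)) * ennreal (exp (l * t)) = 1" by (simp add: ennreal_mult[symmetric] exp_minus)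
      have "3 * (ennreal K * ennreal \<theta>) = ennreal (3 * (K * \<theta>))" using K(1) \<theta> by (simp add: ennreal_mult)
      also have "\<dots> \<le> ennreal (1 / 4)" using K(1) by (intro ennreal_leI) (simp add: \<theta>_def field_simps)
      finally show "(ennreal (exp (- l * t)) * ennreal (exp (l * t))) * (3 * (ennreal K * ennreal \<theta>)) * ?N \<le> ennreal (1 / 4) * ?N"
        unfolding 1 mult_1 by (rule mult_right_mono) simp
    qed
    finally show "ennreal (exp (- l * t)) * sqn M (\<lambda>\<omega>. Z t \<omega> - Z' t \<omega>) \<le> ennreal K * ?a + ennreal (1 / 4) * ?N" .
  qed
  moreover have "0 \<le> l" by (simp add: l_def)
  ultimately show ?thesis using K(1) by blast
qed

text \<open>At two fixed points the contracted term is a quarter of the left side and can be absorbed, the left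
  side being finite.\<close>

theorem mild_solutions_close:
  "\<exists>C\<ge>0. \<forall>X\<in>H2 M F T. \<forall>Y\<in>H2 M F T. \<forall>\<eta> \<zeta>. \<eta> \<in> borel_measurable M \<longrightarrow> \<zeta> \<in> borel_measurable M \<longrightarrow>
     mild_map \<eta> X X \<longrightarrow> mild_map \<zeta> Y Y \<longrightarrow>
     (\<forall>t\<in>{0..T}. sqn M (\<lambda>\<omega>. X t \<omega> - Y t \<omega>) \<le> ennreal C * sqn M (\<lambda>\<omega>. \<eta> \<omega> - \<zeta> \<omega>))"
proof -
  obtain K l where K: "0 \<le> K" "0 \<le> l" "\<And>X Y \<eta> \<zeta> Z Z'. X \<in> H2 M F T \<Longrightarrow> Y \<in> H2 M F T \<Longrightarrow> \<eta> \<in> borel_measurable M \<Longrightarrow> \<zeta> \<in> borel_measurable M \<Longrightarrow>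
     mild_map \<eta> X Z \<Longrightarrow> mild_map \<zeta> Y Z' \<Longrightarrow>
     weighted_sup l (\<lambda>t \<omega>. Z t \<omega> - Z' t \<omega>) \<le> ennreal K * sqn M (\<lambda>\<omega>. \<eta> \<omega> - \<zeta> \<omega>) + ennreal (1 / 4) * weighted_sup l (\<lambda>t \<omega>. X t \<omega> - Y t \<omega>)"
    using mild_map_contraction by blast
  have absorb: "N \<le> 2 * a" if N: "N \<le> a + ennreal (1 / 4) * N" "N < \<infinity>" for N a :: ennreal
  proof (cases "a = \<infinity>")
    case False
    obtain x where x: "N = ennreal x" "0 \<le> x" using N(2) by (cases N) auto
    obtain y where y: "a = ennreal y" "0 \<le> y" using False by (cases a) auto
    have "ennreal x \<le> ennreal (y + 1 / 4 * x)"
      using N(1) x y by (simp add: ennreal_mult[symmetric] ennreal_plus[symmetric] del: ennreal_plus)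
    then have "x \<le> y + 1 / 4 * x" using x y by (subst (asm) ennreal_le_iff) auto
    then have "ennreal x \<le> ennreal (2 * y)" using x y by (intro ennreal_leI) linarith
    then show ?thesis using x y by (simp add: ennreal_mult)
  qed (simp add: ennreal_mult_top)
  have "sqn M (\<lambda>\<omega>. X t \<omega> - Y t \<omega>) \<le> ennreal (exp (l * T) * (2 * K)) * sqn M (\<lambda>\<omega>. \<eta> \<omega> - \<zeta> \<omega>)"
    if h: "X \<in> H2 M F T" "Y \<in> H2 M F T" "\<eta> \<in> borel_measurable M" "\<zeta> \<in> borel_measurable M" "mild_map \<eta> X X" "mild_map \<zeta> Y Y" and t: "t \<in> {0..T}" for X Y \<eta> \<zeta> t
  proof -
    have "weighted_sup l (\<lambda>t \<omega>. X t \<omega> - Y t \<omega>) \<le> 2 * (ennreal K * sqn M (\<lambda>\<omega>. \<eta> \<omega> - \<zeta> \<omega>))"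
      by (rule absorb[OF K(3)[OF h] weighted_sup_finite[OF h(1,2) K(2)]])
    then have "sqn M (\<lambda>\<omega>. X t \<omega> - Y t \<omega>) \<le> ennreal (exp (l * t)) * (2 * (ennreal K * sqn M (\<lambda>\<omega>. \<eta> \<omega> - \<zeta> \<omega>)))"
      by (intro order_trans[OF sqn_le_weighted_sup[OF t, of _ l]] mult_left_mono) auto
    also have "\<dots> \<le> ennreal (exp (l * T)) * (2 * (ennreal K * sqn M (\<lambda>\<omega>. \<eta> \<omega> - \<zeta> \<omega>)))"
      using t K(2) by (intro mult_right_mono ennreal_leI) (auto intro: mult_left_mono)
    also have "\<dots> = ennreal (exp (l * T) * (2 * K)) * sqn M (\<lambda>\<omega>. \<eta> \<omega> - \<zeta> \<omega>)"
      using K(1) by (simp add: ennreal_mult mult.assoc)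
    finally show ?thesis .
  qed
  moreover have "0 \<le> exp (l * T) * (2 * K)" using K(1) by simp
  ultimately show ?thesis by blast
qed

section \<open>Existence of a continuous solution\<close>

lemma rhs_measurable:
  assumes t: "t \<in> {0..T}" and [measurable]: "\<eta> \<in> borel_measurable M" "I \<in> borel_measurable M" and X: "process X" and v: "process v"
  shows "rhs t \<eta> X v I \<in> borel_measurable M"
proof -
  have [measurable]: "(\<lambda>\<omega>. kernel_conv \<gamma> (\<lambda>r. X r \<omega>) t) \<in> borel_measurable M" "(\<lambda>\<omega>. kernel_conv \<alpha> (\<lambda>r. X r \<omega>) t) \<in> borel_measurable M" "(\<lambda>\<omega>. kernel_conv \<alpha> (\<lambda>r. v r \<omega>) t) \<in> borel_measurable M"
    using process_at[OF process_conv[OF X] t] process_at[OF process_conv[OF v] t] by auto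
  have m: "(\<lambda>\<omega>. D *v f \<omega>) \<in> borel_measurable M" if "f \<in> borel_measurable M" for D :: "real ^ 'n ^ 'n" and f
    using measurable_compose[OF that borel_measurable_continuous_onI[OF linear_continuous_on[OF matrix_vector_mul_bounded_linear[of D]]]] .
  show ?thesis
    unfolding rhs_def[abs_def]
    by (intro borel_measurable_add borel_measurable_diff borel_measurable_scaleR borel_measurable_const m) measurable
qed

lemma mild_map_at:
  assumes "mild_map \<eta> X Z" and t: "t \<in> {0..T}"
    and I: "has_ito_integral M F W t (\<lambda>r \<omega>. (t - r) powr (\<alpha> - 1) *\<^sub>R \<sigma> r (X r \<omega>)) I"
  shows "AE \<omega> in M. Z t \<omega> = rhs t \<eta> X (\<lambda>r \<omega>. b r (X r \<omega>)) I \<omega>"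
proof -
  obtain J where J: "has_ito_integral M F W t (\<lambda>r \<omega>. (t - r) powr (\<alpha> - 1) *\<^sub>R \<sigma> r (X r \<omega>)) J"
    "AE \<omega> in M. Z t \<omega> = rhs t \<eta> X (\<lambda>r \<omega>. b r (X r \<omega>)) J \<omega>" using assms(1) t unfolding mild_map_def by blast
  have "AE \<omega> in M. J \<omega> = I \<omega>"
    by (rule ito_unique[OF has_ito_integral_imp_ito[OF J(1) t] has_ito_integral_imp_ito[OF I t]]) simp
  with J(2) show ?thesis by eventually_elim (simp add: rhs_def)
qed

lemma mild_map_cong:
  assumes "mild_map \<eta> X Z" "\<And>t. t \<in> {0..T} \<Longrightarrow> AE \<omega> in M. Z' t \<omega> = Z t \<omega>"
  shows "mild_map \<eta> X Z'"
  unfolding mild_map_def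
proof
  fix t assume t: "t \<in> {0..T}"
  obtain J where J: "has_ito_integral M F W t (\<lambda>r \<omega>. (t - r) powr (\<alpha> - 1) *\<^sub>R \<sigma> r (X r \<omega>)) J"
    "AE \<omega> in M. Z t \<omega> = rhs t \<eta> X (\<lambda>r \<omega>. b r (X r \<omega>)) J \<omega>" using assms(1) t unfolding mild_map_def by blast
  have "AE \<omega> in M. Z' t \<omega> = rhs t \<eta> X (\<lambda>r \<omega>. b r (X r \<omega>)) J \<omega>"
    using assms(2)[OF t] J(2) by eventually_elim simp
  with J(1) show "\<exists>I. has_ito_integral M F W t (\<lambda>r \<omega>. (t - r) powr (\<alpha> - 1) *\<^sub>R \<sigma> r (X r \<omega>)) I \<and> (AE \<omega> in M. Z' t \<omega> = rhs t \<eta> X (\<lambda>r \<omega>. b r (X r \<omega>)) I \<omega>)"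
    by (intro exI[of _ J] conjI)
qed

text \<open>Two descriptions of the stochastic convolution: \<open>I t\<close> is an Ito integral for each time, \<open>N\<close> has
  continuous paths.\<close>

definition forcing :: "(real \<Rightarrow> 'w \<Rightarrow> real ^ 'n) \<Rightarrow> (real \<Rightarrow> 'w \<Rightarrow> real ^ 'n) \<Rightarrow> (real \<Rightarrow> 'w \<Rightarrow> real ^ 'n) \<Rightarrow> bool" where
  "forcing X I N \<longleftrightarrow> (\<forall>t\<in>{0..T}. has_ito_integral M F W t (\<lambda>r \<omega>. (t - r) powr (\<alpha> - 1) *\<^sub>R \<sigma> r (X r \<omega>)) (I t)) \<and>
     process N \<and> (AE \<omega> in M. continuous_on {0..T} (\<lambda>t. N t \<omega>)) \<and> (\<forall>t\<in>{0..T}. AE \<omega> in M. N t \<omega> = I t \<omega>)"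

lemma forcing_exists:
  assumes X: "X \<in> H2 M F T"
  shows "\<exists>I N. forcing X I N"
proof -
  obtain C where C: "0 \<le> C" "\<And>t x. t \<in> {0..T} \<Longrightarrow> norm (b t x) \<le> C \<and> norm (\<sigma> t x) \<le> C" using coefficient_bounds by blast
  have "\<exists>I Y. (\<forall>t\<in>{0..T}. has_ito_integral M F W t (\<lambda>r \<omega>. (t - r) powr (\<alpha> - 1) *\<^sub>R \<sigma> r (X r \<omega>)) (I t)) \<and>
     (AE \<omega> in M. continuous_on {0..T} (\<lambda>t. Y t \<omega>)) \<and> (\<forall>t\<in>{0..T}. AE \<omega> in M. Y t \<omega> = I t \<omega>)"
  proof (rule stochastic_convolution_continuous[OF T \<alpha>])
    show "(\<lambda>(r, \<omega>). \<sigma> r (X r \<omega>)) \<in> borel_measurable (restrict_space borel {0..T} \<Otimes>\<^sub>M M)"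
      using coefficient_process[OF measurable_\<sigma> H2D(1)[OF X]] unfolding process_def .
    show "(\<lambda>\<omega>. \<sigma> r (X r \<omega>)) \<in> borel_measurable (F r)" if "r \<in> {0..T}" for r
      by (rule coefficient_adapted[where X = X, OF measurable_\<sigma> H2D(2)[OF X that] that])
    show "norm (\<sigma> r (X r \<omega>)) \<le> C" if "r \<in> {0..T}" for r \<omega> using C(2)[OF that] by blast
  qed
  then obtain I Y where I: "\<And>t. t \<in> {0..T} \<Longrightarrow> has_ito_integral M F W t (\<lambda>r \<omega>. (t - r) powr (\<alpha> - 1) *\<^sub>R \<sigma> r (X r \<omega>)) (I t)"
    and Y: "AE \<omega> in M. continuous_on {0..T} (\<lambda>t. Y t \<omega>)" "\<And>t. t \<in> {0..T} \<Longrightarrow> AE \<omega> in M. Y t \<omega> = I t \<omega>" by blast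
  have IF: "I t \<in> borel_measurable (F t)" if "t \<in> {0..T}" for t
    using I[OF that] unfolding has_ito_integral_def Xi_def by blast
  obtain N where N: "(\<lambda>(t, \<omega>). N t \<omega>) \<in> borel_measurable (restrict_space borel {0..T} \<Otimes>\<^sub>M M)" "AE \<omega> in M. \<forall>t\<in>{0..T}. N t \<omega> = Y t \<omega>"
    using adapted_measurable_version[OF T IF Y] by blast
  have "AE \<omega> in M. continuous_on {0..T} (\<lambda>t. N t \<omega>)"
    using N(2) Y(1)
  proof eventually_elim
    case (elim \<omega>)
    then show ?case using continuous_on_cong[of "{0..T}" "{0..T}" "\<lambda>t. N t \<omega>" "\<lambda>t. Y t \<omega>"] by simp
  qed
  moreover have "AE \<omega> in M. N t \<omega> = I t \<omega>" if t: "t \<in> {0..T}" for t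
    using N(2) Y(2)[OF t] by eventually_elim (use t in simp)
  ultimately have "forcing X I N" unfolding forcing_def process_def using I N(1) by blast
  then show ?thesis by blast
qed

lemma mild_map_exists:
  assumes X: "X \<in> H2 M F T"
  shows "\<exists>Z. mild_map \<eta> X Z"
proof -
  obtain I N where "forcing X I N" using forcing_exists[OF X] by blast
  then have "mild_map \<eta> X (\<lambda>t. rhs t \<eta> X (\<lambda>r \<omega>. b r (X r \<omega>)) (I t))"
    unfolding forcing_def mild_map_def by blast
  then show ?thesis by blast
qed

text \<open>At each time the terms of the right side have versions measurable for \<open>F t\<close>. Together with the
  continuous paths of \<open>path\<close> this is what \<open>adapted_measurable_version\<close> needs.\<close>

lemma mild_map_in_H2:
  assumes X: "X \<in> H2 M F T" and \<eta>: "\<eta> \<in> Xi M F 0" and N: "forcing X I N"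
    and path: "AE \<omega> in M. continuous_on {0..T} (\<lambda>t. rhs t \<eta> X (\<lambda>r \<omega>. b r (X r \<omega>)) (N t) \<omega>)"
  shows "\<exists>Z\<in>H2 M F T. (AE \<omega> in M. continuous_on {0..T} (\<lambda>t. Z t \<omega>)) \<and> mild_map \<eta> X Z"
proof -
  let ?v = "\<lambda>r \<omega>. b r (X r \<omega>)"
  note pX = H2D(1)[OF X] and pv = coefficient_process[OF measurable_b H2D(1)[OF X]] and ps = coefficient_process[OF measurable_\<sigma> H2D(1)[OF X]]
  obtain D1 where D1: "\<And>t. t \<in> {0..T} \<Longrightarrow> sqn M (X t) \<le> ennreal D1" using H2D(4)[OF X] by blast
  obtain D2 where D2: "\<And>r. r \<in> {0..T} \<Longrightarrow> sqn M (?v r) \<le> ennreal D2" "\<And>r. r \<in> {0..T} \<Longrightarrow> sqn M (\<lambda>\<omega>. \<sigma> r (X r \<omega>)) \<le> ennreal D2"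
    using bounded_coefficient_process[OF pX] by blast
  have I: "has_ito_integral M F W t (\<lambda>r \<omega>. (t - r) powr (\<alpha> - 1) *\<^sub>R \<sigma> r (X r \<omega>)) (I t)" if "t \<in> {0..T}" for t
    using N that unfolding forcing_def by blast
  have NI: "AE \<omega> in M. N t \<omega> = I t \<omega>" if "t \<in> {0..T}" for t using N that unfolding forcing_def by blast
  have IF: "I t \<in> borel_measurable (F t)" if "t \<in> {0..T}" for t using I[OF that] unfolding has_ito_integral_def Xi_def by blast
  have T0: "0 \<in> {0..T}" using T by simp
  have \<eta>F: "\<eta> \<in> borel_measurable (F t)" if "t \<in> {0..T}" for t
  proof (rule borel_measurable_F_mono)
    show "\<eta> \<in> borel_measurable (F 0)" using \<eta> unfolding Xi_def by simp
  qed (use that in auto)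
  have \<eta>M: "\<eta> \<in> borel_measurable M" by (rule borel_measurable_F_M[OF \<eta>F[OF T0] T0])
  have "\<exists>Z. Z \<in> borel_measurable (F t) \<and> (AE \<omega> in M. Z \<omega> = rhs t \<eta> X ?v (I t) \<omega>)" if t: "t \<in> {0..T}" for t
  proof -
    obtain V1 where V1: "V1 \<in> borel_measurable (F t)" "AE \<omega> in M. V1 \<omega> = kernel_conv \<gamma> (\<lambda>r. X r \<omega>) t"
      using conv_version[OF pX exponents(1) t D1 H2D(2)[OF X]] by blast
    obtain V2 where V2: "V2 \<in> borel_measurable (F t)" "AE \<omega> in M. V2 \<omega> = kernel_conv \<alpha> (\<lambda>r. X r \<omega>) t"
      using conv_version[OF pX exponents(3) t D1 H2D(2)[OF X]] by blast
    obtain V3 where V3: "V3 \<in> borel_measurable (F t)" "AE \<omega> in M. V3 \<omega> = kernel_conv \<alpha> (\<lambda>r. ?v r \<omega>) t"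
      using conv_version[OF pv exponents(3) t D2(1) coefficient_adapted[where X = X, OF measurable_b H2D(2)[OF X]]] by blast
    have m: "(\<lambda>\<omega>. D *v f \<omega>) \<in> borel_measurable (F t)" if "f \<in> borel_measurable (F t)" for D :: "real ^ 'n ^ 'n" and f
      using measurable_compose[OF that borel_measurable_continuous_onI[OF linear_continuous_on[OF matrix_vector_mul_bounded_linear[of D]]]] .
    have "(\<lambda>\<omega>. \<eta> \<omega> - (t powr \<gamma> / Gamma (\<gamma> + 1)) *\<^sub>R (A *v \<eta> \<omega>) + (1 / Gamma \<gamma>) *\<^sub>R (A *v V1 \<omega>) + (1 / Gamma \<alpha>) *\<^sub>R (B *v V2 \<omega>)
       + (1 / Gamma \<alpha>) *\<^sub>R V3 \<omega> + (1 / Gamma \<alpha>) *\<^sub>R I t \<omega>) \<in> borel_measurable (F t)"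
      by (intro borel_measurable_add borel_measurable_diff borel_measurable_scaleR borel_measurable_const m \<eta>F t V1(1) V2(1) V3(1) IF)
    moreover have "AE \<omega> in M. \<eta> \<omega> - (t powr \<gamma> / Gamma (\<gamma> + 1)) *\<^sub>R (A *v \<eta> \<omega>) + (1 / Gamma \<gamma>) *\<^sub>R (A *v V1 \<omega>) + (1 / Gamma \<alpha>) *\<^sub>R (B *v V2 \<omega>)
       + (1 / Gamma \<alpha>) *\<^sub>R V3 \<omega> + (1 / Gamma \<alpha>) *\<^sub>R I t \<omega> = rhs t \<eta> X ?v (I t) \<omega>"
      using V1(2) V2(2) V3(2) by eventually_elim (simp add: rhs_def)
    ultimately show ?thesis by blast
  qed
  then have ex: "\<forall>t. \<exists>Z. t \<in> {0..T} \<longrightarrow> Z \<in> borel_measurable (F t) \<and> (AE \<omega> in M. Z \<omega> = rhs t \<eta> X ?v (I t) \<omega>)" by blast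
  from choice[OF ex] obtain Z0 where Z0: "\<And>t. t \<in> {0..T} \<Longrightarrow> Z0 t \<in> borel_measurable (F t)"
    "\<And>t. t \<in> {0..T} \<Longrightarrow> AE \<omega> in M. Z0 t \<omega> = rhs t \<eta> X ?v (I t) \<omega>" by blast
  have YZ: "AE \<omega> in M. rhs t \<eta> X ?v (N t) \<omega> = Z0 t \<omega>" if t: "t \<in> {0..T}" for t
    using Z0(2)[OF t] NI[OF t] by eventually_elim (simp add: rhs_def)
  obtain Z where Z: "(\<lambda>(t, \<omega>). Z t \<omega>) \<in> borel_measurable (restrict_space borel {0..T} \<Otimes>\<^sub>M M)"
    "\<And>t. t \<in> {0..T} \<Longrightarrow> Z t \<in> borel_measurable (F t)" "AE \<omega> in M. \<forall>t\<in>{0..T}. Z t \<omega> = rhs t \<eta> X ?v (N t) \<omega>"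
    using adapted_measurable_version[OF T Z0(1) path YZ] by blast
  have Z_rhs: "AE \<omega> in M. Z t \<omega> = rhs t \<eta> X ?v (I t) \<omega>" if t: "t \<in> {0..T}" for t
    using Z(3) NI[OF t] by eventually_elim (use t in \<open>simp add: rhs_def\<close>)
  have cont: "AE \<omega> in M. continuous_on {0..T} (\<lambda>t. Z t \<omega>)"
    using Z(3) path
  proof eventually_elim
    case (elim \<omega>)
    then show ?case using continuous_on_cong[of "{0..T}" "{0..T}" "\<lambda>t. Z t \<omega>" "\<lambda>t. rhs t \<eta> X ?v (N t) \<omega>"] by simp
  qed
  have "mild_map \<eta> X Z" unfolding mild_map_def using I Z_rhs by blast
  moreover have "Z \<in> H2 M F T"
  proof -
    obtain K where K: "0 \<le> K" "\<And>t \<eta> X v I. t \<in> {0..T} \<Longrightarrow> \<eta> \<in> borel_measurable M \<Longrightarrow> process X \<Longrightarrow> process v \<Longrightarrow> I \<in> borel_measurable M \<Longrightarrow>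
       sqn M (rhs t \<eta> X v I) \<le> ennreal K * (sqn M \<eta> + conv_energy \<gamma> X t + conv_energy \<alpha> X t + conv_energy \<alpha> v t + sqn M I)"
      using sqn_rhs_le by blast
    have \<eta>_fin: "sqn M \<eta> < \<infinity>" using \<eta> sqn_finite_iff[OF \<eta>M] by (simp add: Xi_def)
    define R where "R = ennreal K * (sqn M \<eta> + ennreal D1 * ennreal (T powr \<gamma> / \<gamma>) + ennreal D1 * ennreal (T powr \<alpha> / \<alpha>) + ennreal D2 * ennreal (T powr \<alpha> / \<alpha>)
      + 4 * (ennreal D2 * ennreal (T powr (2 * \<alpha> - 1) / (2 * \<alpha> - 1))))"
    have R: "R < \<infinity>" using \<eta>_fin by (auto simp: R_def ennreal_mult_less_top)
    have le: "sqn M (Z t) \<le> R" if t: "t \<in> {0..T}" for t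
    proof -
      note iI = has_ito_integral_imp_ito[OF I[OF t] t]
      have "sqn M (I t) \<le> 4 * sqn (lborel \<Otimes>\<^sub>M M) (case_prod (\<lambda>r \<omega>. indicator {0..t} r *\<^sub>R (t - r) powr (\<alpha> - 1) *\<^sub>R \<sigma> r (X r \<omega>)))"
        by (rule ito_bound[OF iI])
      also have "sqn (lborel \<Otimes>\<^sub>M M) (case_prod (\<lambda>r \<omega>. indicator {0..t} r *\<^sub>R (t - r) powr (\<alpha> - 1) *\<^sub>R \<sigma> r (X r \<omega>))) = (\<integral>\<^sup>+r\<in>{0..t}. ennreal (((t - r) powr (\<alpha> - 1))\<^sup>2) * sqn M (\<lambda>\<omega>. \<sigma> r (X r \<omega>)) \<partial>lborel)"
        using t by (intro sqn_weighted_process ps) auto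
      also have "\<dots> = conv_energy (2 * \<alpha> - 1) (\<lambda>r \<omega>. \<sigma> r (X r \<omega>)) t"
        unfolding conv_energy_def by (simp add: power2_eq_square powr_add[symmetric])
      also have "4 * \<dots> \<le> 4 * (ennreal D2 * ennreal (T powr (2 * \<alpha> - 1) / (2 * \<alpha> - 1)))"
        by (intro mult_left_mono conv_energy_le_const exponents t D2) (use exponents in simp_all)
      finally have 1: "sqn M (I t) \<le> 4 * (ennreal D2 * ennreal (T powr (2 * \<alpha> - 1) / (2 * \<alpha> - 1)))" .
      have "sqn M (Z t) = sqn M (rhs t \<eta> X ?v (I t))" by (rule sqn_cong_AE[OF Z_rhs[OF t]])
      also have "\<dots> \<le> ennreal K * (sqn M \<eta> + conv_energy \<gamma> X t + conv_energy \<alpha> X t + conv_energy \<alpha> ?v t + sqn M (I t))"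
        by (intro K(2) t \<eta>M pX pv ito_measurable(2)[OF iI])
      also have "\<dots> \<le> R"
        unfolding R_def by (intro mult_left_mono add_mono order_refl conv_energy_le_const exponents t D1 D2(1) 1) (use exponents in simp_all)
      finally show ?thesis .
    qed
    obtain x where x: "R = ennreal x" using R by (cases R) auto
    show ?thesis by (rule H2I[where D = x]) (use Z le x in \<open>auto simp: process_def\<close>)
  qed
  ultimately show ?thesis using cont by blast
qed

lemma continuous_on_rhs:
  assumes "continuous_on {0..T} (\<lambda>t. kernel_conv \<gamma> (\<lambda>r. X r \<omega>) t)" "continuous_on {0..T} (\<lambda>t. kernel_conv \<alpha> (\<lambda>r. X r \<omega>) t)"
    "continuous_on {0..T} (\<lambda>t. kernel_conv \<alpha> (\<lambda>r. v r \<omega>) t)" "continuous_on {0..T} (\<lambda>t. N t \<omega>)"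
  shows "continuous_on {0..T} (\<lambda>t. rhs t \<eta> X v (N t) \<omega>)"
proof -
  have 1: "continuous_on {0..T} (\<lambda>t. t powr \<gamma>)" using exponents by (intro continuous_on_powr' continuous_intros) auto
  have G: "Gamma (\<gamma> + 1) \<noteq> 0" using Gamma_real_pos[of "\<gamma> + 1"] exponents(1) by linarith
  show ?thesis
    unfolding rhs_def using G
    by (intro continuous_on_add continuous_on_diff continuous_on_scaleR continuous_on_const continuous_on_divide 1 assms
      bounded_linear.continuous_on[OF matrix_vector_mul_bounded_linear]) auto
qed

lemma drift_conv_continuous:
  assumes X: "process X" and \<omega>: "\<omega> \<in> space M"
  shows "continuous_on {0..T} (\<lambda>t. kernel_conv \<alpha> (\<lambda>r. b r (X r \<omega>)) t)"
proof -
  obtain C where C: "0 \<le> C" "\<And>t x. t \<in> {0..T} \<Longrightarrow> norm (b t x) \<le> C \<and> norm (\<sigma> t x) \<le> C" using coefficient_bounds by blast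
  show ?thesis
    unfolding kernel_conv_def
    by (rule continuous_on_kernel_convolution[OF exponents(3) \<alpha>(2) process_path[OF coefficient_process[OF measurable_b X] \<omega>], of C]) (use C in blast)
qed

text \<open>Continuous inputs have continuous convolutions, so \<open>mild_map_in_H2\<close> applies.\<close>

lemma picard_step:
  assumes X: "X \<in> H2 M F T" and \<eta>: "\<eta> \<in> Xi M F 0" and path: "AE \<omega> in M. continuous_on {0..T} (\<lambda>t. X t \<omega>)"
  shows "\<exists>Z\<in>H2 M F T. (AE \<omega> in M. continuous_on {0..T} (\<lambda>t. Z t \<omega>)) \<and> mild_map \<eta> X Z"
proof -
  obtain I N where N: "forcing X I N" using forcing_exists[OF X] by blast
  then have "AE \<omega> in M. continuous_on {0..T} (\<lambda>t. N t \<omega>)" unfolding forcing_def by blast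
  with path have "AE \<omega> in M. continuous_on {0..T} (\<lambda>t. rhs t \<eta> X (\<lambda>r \<omega>. b r (X r \<omega>)) (N t) \<omega>)"
    using AE_space
  proof eventually_elim
    case (elim \<omega>)
    show ?case
      by (intro continuous_on_rhs continuous_on_kernel_conv exponents \<alpha>(2) elim(1,2) drift_conv_continuous[OF H2D(1)[OF X] elim(3)])
  qed
  from mild_map_in_H2[OF X \<eta> N this] show ?thesis .
qed

text \<open>Picard iteration from the zero process through processes with continuous paths. The contraction makes
  the mean-square convergence geometric, so at each time the iterates converge almost surely, and the
  limit is measurable and adapted. Continuity of the paths is lost at this point.\<close>

theorem fixed_point_in_H2:
  assumes \<eta>: "\<eta> \<in> Xi M F 0"
  shows "\<exists>X\<in>H2 M F T. mild_map \<eta> X X"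
proof -
  have T0: "0 \<in> {0..T}" using T by simp
  have \<eta>M: "\<eta> \<in> borel_measurable M" using borel_measurable_F_M[OF _ T0] \<eta> unfolding Xi_def by blast
  obtain K l where K: "0 \<le> K" "0 \<le> l" "\<And>X Y \<eta> \<zeta> Z Z'. X \<in> H2 M F T \<Longrightarrow> Y \<in> H2 M F T \<Longrightarrow> \<eta> \<in> borel_measurable M \<Longrightarrow> \<zeta> \<in> borel_measurable M \<Longrightarrow>
     mild_map \<eta> X Z \<Longrightarrow> mild_map \<zeta> Y Z' \<Longrightarrow>
     weighted_sup l (\<lambda>t \<omega>. Z t \<omega> - Z' t \<omega>) \<le> ennreal K * sqn M (\<lambda>\<omega>. \<eta> \<omega> - \<zeta> \<omega>) + ennreal (1 / 4) * weighted_sup l (\<lambda>t \<omega>. X t \<omega> - Y t \<omega>)"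
    using mild_map_contraction by blast
  have contr: "weighted_sup l (\<lambda>t \<omega>. Z t \<omega> - Z' t \<omega>) \<le> ennreal (1 / 4) * weighted_sup l (\<lambda>t \<omega>. X t \<omega> - Y t \<omega>)"
    if "X \<in> H2 M F T" "Y \<in> H2 M F T" "mild_map \<eta> X Z" "mild_map \<eta> Y Z'" for X Y Z Z'
    using K(3)[OF that(1,2) \<eta>M \<eta>M that(3,4)] by simp
  define good where "good = (\<lambda>X :: real \<Rightarrow> 'w \<Rightarrow> real ^ 'n. X \<in> H2 M F T \<and> (AE \<omega> in M. continuous_on {0..T} (\<lambda>t. X t \<omega>)))"
  define next_step where "next_step = (\<lambda>X :: real \<Rightarrow> 'w \<Rightarrow> real ^ 'n. SOME Z :: real \<Rightarrow> 'w \<Rightarrow> real ^ 'n. good Z \<and> mild_map \<eta> X Z)"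
  have next_step: "good (next_step X)" "mild_map \<eta> X (next_step X)" if "good X" for X
  proof -
    have "\<exists>Z. good Z \<and> mild_map \<eta> X Z" using picard_step[OF _ \<eta>, of X] that unfolding good_def by blast
    from someI_ex[OF this] show "good (next_step X)" "mild_map \<eta> X (next_step X)" unfolding next_step_def by blast+
  qed
  define x where "x = rec_nat (\<lambda>_ _. 0) (\<lambda>_. next_step)"
  have x_0: "x 0 = (\<lambda>_ _. 0)" and x_Suc: "x (Suc k) = next_step (x k)" for k by (simp_all add: x_def)
  have x_good: "good (x k)" for k
  proof (induction k)
    case 0
    then show ?case unfolding x_0 good_def using H2_zero by simp
  next
    case (Suc k)
    then show ?case unfolding x_Suc by (rule next_step)
  qed
  have x_map: "mild_map \<eta> (x k) (x (Suc k))" for k unfolding x_Suc by (rule next_step[OF x_good])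
  have x_H2: "x k \<in> H2 M F T" for k using x_good[of k] unfolding good_def by blast
  obtain c0 where c0: "weighted_sup l (\<lambda>t \<omega>. x (Suc 0) t \<omega> - x 0 t \<omega>) = ennreal c0" "0 \<le> c0"
    using weighted_sup_finite[OF x_H2[of "Suc 0"] x_H2[of 0] K(2)] by (cases "weighted_sup l (\<lambda>t \<omega>. x (Suc 0) t \<omega> - x 0 t \<omega>)") auto
  have d: "weighted_sup l (\<lambda>t \<omega>. x (Suc k) t \<omega> - x k t \<omega>) \<le> ennreal (c0 * (1 / 4) ^ k)" for k
  proof (induction k)
    case 0
    then show ?case using c0 by simp
  next
    case (Suc k)
    have "weighted_sup l (\<lambda>t \<omega>. x (Suc (Suc k)) t \<omega> - x (Suc k) t \<omega>) \<le> ennreal (1 / 4) * weighted_sup l (\<lambda>t \<omega>. x (Suc k) t \<omega> - x k t \<omega>)"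
      by (rule contr[OF x_H2 x_H2 x_map x_map])
    also have "\<dots> \<le> ennreal (1 / 4) * ennreal (c0 * (1 / 4) ^ k)" by (rule mult_left_mono[OF Suc]) simp
    also have "\<dots> = ennreal (c0 * (1 / 4) ^ Suc k)" using c0(2) by (simp add: ennreal_mult[symmetric])
    finally show ?case .
  qed
  have unweight: "sqn M (D t) \<le> ennreal (exp (l * T) * a)" if "weighted_sup l D \<le> ennreal a" "0 \<le> a" "t \<in> {0..T}" for D a t
  proof -
    have "sqn M (D t) \<le> ennreal (exp (l * t)) * weighted_sup l D" by (rule sqn_le_weighted_sup[OF that(3)])
    also have "\<dots> \<le> ennreal (exp (l * T)) * ennreal a"
      using that K(2) by (intro mult_mono ennreal_leI) (auto intro: mult_left_mono)
    finally show ?thesis using that(2) by (simp add: ennreal_mult)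
  qed
  define c where "c = exp (l * T) * c0"
  have c: "0 \<le> c" using c0 by (simp add: c_def)
  have xm: "x k t \<in> borel_measurable M" if "t \<in> {0..T}" for k t using H2D(3)[OF x_H2 that] .
  have step: "sqn M (\<lambda>\<omega>. x (Suc k) t \<omega> - x k t \<omega>) \<le> ennreal (c * (1 / 4) ^ k)" if t: "t \<in> {0..T}" for k t
    using unweight[OF d[of k] _ t] c0(2) by (simp add: c_def mult.assoc)
  have far: "sqn M (\<lambda>\<omega>. x (k + j) t \<omega> - x k t \<omega>) \<le> ennreal (4 * c * (1 / 4) ^ k)" if t: "t \<in> {0..T}" for k j t
  proof (induction j arbitrary: k)
    case 0
    then show ?case using c by simp
  next
    case (Suc j)
    have "sqn M (\<lambda>\<omega>. x (k + Suc j) t \<omega> - x k t \<omega>) \<le> 2 * sqn M (\<lambda>\<omega>. x (Suc k + j) t \<omega> - x (Suc k) t \<omega>) + 2 * sqn M (\<lambda>\<omega>. x (Suc k) t \<omega> - x k t \<omega>)"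
      using sqn_triangle[OF xm[OF t] xm[OF t] xm[OF t], of "Suc k + j" k "Suc k"] by simp
    also have "\<dots> \<le> 2 * ennreal (4 * c * (1 / 4) ^ Suc k) + 2 * ennreal (c * (1 / 4) ^ k)"
      by (intro add_mono mult_left_mono Suc.IH step t) auto
    also have "\<dots> = ennreal (2 * (4 * c * (1 / 4) ^ Suc k) + 2 * (c * (1 / 4) ^ k))"
    proof -
      have *: "2 * ennreal a + 2 * ennreal a' = ennreal (2 * a + 2 * a')" if "0 \<le> a" "0 \<le> a'" for a a'
        using that by (simp add: ennreal_plus ennreal_mult)
      then show ?thesis by (intro *) (use c in simp_all)
    qed
    also have "2 * (4 * c * (1 / 4) ^ Suc k) + 2 * (c * (1 / 4) ^ k) = 4 * c * (1 / 4) ^ k" by simp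
    finally show ?case .
  qed
  define Y where "Y = (\<lambda>t \<omega>. lim (\<lambda>k. x k t \<omega>))"
  have conv: "AE \<omega> in M. (\<lambda>k. x k t \<omega>) \<longlonglongrightarrow> Y t \<omega>" if t: "t \<in> {0..T}" for t
  proof -
    have "AE \<omega> in M. convergent (\<lambda>k. x k t \<omega>)"
      by (rule AE_convergent_if_fast_Cauchy[where c = c and q = "1 / 4"]) (use xm[OF t] step[OF t] c in auto)
    then show ?thesis unfolding Y_def by eventually_elim (rule convergent_LIMSEQ_iff[THEN iffD1])
  qed
  have Y_far: "sqn M (\<lambda>\<omega>. Y t \<omega> - x k t \<omega>) \<le> ennreal (4 * c * (1 / 4) ^ k)" if t: "t \<in> {0..T}" for t k
  proof -
    have "sqn M (\<lambda>\<omega>. Y t \<omega> - x k t \<omega>) \<le> liminf (\<lambda>j. sqn M (\<lambda>\<omega>. x (j + k) t \<omega> - x k t \<omega>))"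
    proof (rule sqn_le_liminf)
      show "AE \<omega> in M. (\<lambda>j. x (j + k) t \<omega> - x k t \<omega>) \<longlonglongrightarrow> Y t \<omega> - x k t \<omega>"
        using conv[OF t] by eventually_elim (intro tendsto_diff tendsto_const LIMSEQ_ignore_initial_segment)
      show "(\<lambda>\<omega>. x (j + k) t \<omega> - x k t \<omega>) \<in> borel_measurable M" for j by (intro borel_measurable_diff xm t)
    qed
    also have "\<dots> \<le> liminf (\<lambda>j. ennreal (4 * c * (1 / 4) ^ k))"
      using far[OF t, of k] by (intro Liminf_mono always_eventually allI) (simp add: add.commute)
    finally show ?thesis by (simp add: Liminf_const)
  qed
  have pY: "process Y"
    unfolding process_def Y_def split_beta'
    by (rule borel_measurable_lim_metric) (use H2D(1)[OF x_H2] in \<open>simp add: process_def split_beta'\<close>)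
  have Y_H2: "Y \<in> H2 M F T"
  proof (rule H2I[OF pY])
    show "Y t \<in> borel_measurable (F t)" if "t \<in> {0..T}" for t
      unfolding Y_def by (rule borel_measurable_lim_metric) (rule H2D(2)[OF x_H2 that])
    show "sqn M (Y t) \<le> ennreal (4 * c * (1 / 4) ^ 0)" if "t \<in> {0..T}" for t
      using Y_far[OF that, of 0] by (simp add: x_0)
  qed
  obtain Z where Z: "mild_map \<eta> Y Z" using mild_map_exists[OF Y_H2] by blast
  have "AE \<omega> in M. Y t \<omega> = Z t \<omega>" if t: "t \<in> {0..T}" for t
  proof -
    obtain I N where N: "forcing Y I N" using forcing_exists[OF Y_H2] by blast
    have I: "has_ito_integral M F W t (\<lambda>r \<omega>. (t - r) powr (\<alpha> - 1) *\<^sub>R \<sigma> r (Y r \<omega>)) (I t)" using N t unfolding forcing_def by blast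
    define R where "R = rhs t \<eta> Y (\<lambda>r \<omega>. b r (Y r \<omega>)) (I t)"
    have ZR: "AE \<omega> in M. Z t \<omega> = R \<omega>" unfolding R_def by (rule mild_map_at[OF Z t I])
    have Rm: "R \<in> borel_measurable M"
      unfolding R_def by (intro rhs_measurable t \<eta>M ito_measurable(2)[OF has_ito_integral_imp_ito[OF I t]] pY coefficient_process[OF measurable_b pY])
    note Ym = process_at[OF pY t]
    have wY: "weighted_sup l (\<lambda>t \<omega>. Y t \<omega> - x k t \<omega>) \<le> ennreal (4 * c * (1 / 4) ^ k)" for k
      unfolding weighted_sup_def
    proof (rule SUP_least)
      fix s assume s: "s \<in> {0..T}"
      have "ennreal (exp (- l * s)) * sqn M (\<lambda>\<omega>. Y s \<omega> - x k s \<omega>) \<le> 1 * sqn M (\<lambda>\<omega>. Y s \<omega> - x k s \<omega>)"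
        using K(2) s by (intro mult_right_mono) auto
      then show "ennreal (exp (- l * s)) * sqn M (\<lambda>\<omega>. Y s \<omega> - x k s \<omega>) \<le> ennreal (4 * c * (1 / 4) ^ k)"
        using Y_far[OF s, of k] by simp
    qed
    have "sqn M (\<lambda>\<omega>. Y t \<omega> - R \<omega>) \<le> ennreal (2 * (exp (l * T) * (4 * c * (1 / 4) ^ k)) + 2 * (4 * c * (1 / 4) ^ Suc k))" for k
    proof -
      have "weighted_sup l (\<lambda>t \<omega>. Z t \<omega> - x (Suc k) t \<omega>) \<le> ennreal (1 / 4) * weighted_sup l (\<lambda>t \<omega>. Y t \<omega> - x k t \<omega>)"
        by (rule contr[OF Y_H2 x_H2 Z x_map])
      also have "\<dots> \<le> 1 * ennreal (4 * c * (1 / 4) ^ k)" by (intro mult_mono wY) auto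
      finally have "weighted_sup l (\<lambda>t \<omega>. Z t \<omega> - x (Suc k) t \<omega>) \<le> ennreal (4 * c * (1 / 4) ^ k)" by simp
      from unweight[OF this _ t] have 1: "sqn M (\<lambda>\<omega>. Z t \<omega> - x (Suc k) t \<omega>) \<le> ennreal (exp (l * T) * (4 * c * (1 / 4) ^ k))"
        using c by simp
      have "AE \<omega> in M. R \<omega> - x (Suc k) t \<omega> = Z t \<omega> - x (Suc k) t \<omega>" using ZR by eventually_elim simp
      from sqn_cong_AE[OF this] 1 have 2: "sqn M (\<lambda>\<omega>. R \<omega> - x (Suc k) t \<omega>) \<le> ennreal (exp (l * T) * (4 * c * (1 / 4) ^ k))" by simp
      have "sqn M (\<lambda>\<omega>. Y t \<omega> - R \<omega>) = sqn M (\<lambda>\<omega>. R \<omega> - Y t \<omega>)" by (rule sqn_minus_commute)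
      also have "\<dots> \<le> 2 * sqn M (\<lambda>\<omega>. R \<omega> - x (Suc k) t \<omega>) + 2 * sqn M (\<lambda>\<omega>. x (Suc k) t \<omega> - Y t \<omega>)"
        by (rule sqn_triangle[OF Rm xm[OF t] Ym])
      also have "\<dots> \<le> 2 * ennreal (exp (l * T) * (4 * c * (1 / 4) ^ k)) + 2 * ennreal (4 * c * (1 / 4) ^ Suc k)"
        using 2 Y_far[OF t, of "Suc k"] sqn_minus_commute[of M "x (Suc k) t" "Y t"] by (intro add_mono mult_left_mono) simp_all
      also have "\<dots> = ennreal (2 * (exp (l * T) * (4 * c * (1 / 4) ^ k)) + 2 * (4 * c * (1 / 4) ^ Suc k))"
      proof -
        have *: "2 * ennreal a + 2 * ennreal a' = ennreal (2 * a + 2 * a')" if "0 \<le> a" "0 \<le> a'" for a a'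
          using that by (simp add: ennreal_plus ennreal_mult)
        then show ?thesis by (intro *) (use c in simp_all)
      qed
      finally show ?thesis .
    qed
    moreover have "(\<lambda>k. ennreal (2 * (exp (l * T) * (4 * c * (1 / 4) ^ k)) + 2 * (4 * c * (1 / 4) ^ Suc k))) \<longlonglongrightarrow> ennreal (2 * (exp (l * T) * (4 * c * 0)) + 2 * (4 * c * 0))"
      by (intro tendsto_ennrealI tendsto_intros LIMSEQ_realpow_zero LIMSEQ_Suc) auto
    ultimately have "sqn M (\<lambda>\<omega>. Y t \<omega> - R \<omega>) \<le> ennreal (2 * (exp (l * T) * (4 * c * 0)) + 2 * (4 * c * 0))"
      by (intro LIMSEQ_le_const) auto
    then have "sqn M (\<lambda>\<omega>. Y t \<omega> - R \<omega>) = 0" by simp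
    moreover have "(\<lambda>\<omega>. Y t \<omega> - R \<omega>) \<in> borel_measurable M" using Ym Rm by (rule borel_measurable_diff)
    ultimately have "AE \<omega> in M. Y t \<omega> - R \<omega> = 0" by (simp only: sqn_eq_0_iff)
    with ZR show ?thesis by eventually_elim simp
  qed
  from mild_map_cong[OF Z this] Y_H2 show ?thesis by blast
qed

text \<open>Fix a path. At almost every time it satisfies the linear Volterra equation
  \<open>x = h + P (k * x) + Q (k' * x)\<close>, where \<open>k\<close> and \<open>k'\<close> are the kernels of exponents \<open>\<gamma>\<close> and \<open>\<alpha>\<close> and \<open>h\<close> collects the initial
  value, the drift and the stochastic convolution. Here \<open>h\<close> is continuous: the drift is bounded, whatever
  the regularity of \<open>X\<close>. So \<open>volterra_continuous_solution\<close> gives a continuous solution, \<open>volterra_unique_AE\<close>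
  shows that it agrees with the path at almost every time, and the convolutions do not see the
  exceptional times.\<close>

theorem fixed_point_path_continuous:
  assumes X: "X \<in> H2 M F T" and \<eta>: "\<eta> \<in> Xi M F 0" and fp: "mild_map \<eta> X X" and N: "forcing X I N"
  shows "AE \<omega> in M. continuous_on {0..T} (\<lambda>t. rhs t \<eta> X (\<lambda>r \<omega>. b r (X r \<omega>)) (N t) \<omega>)"
proof -
  let ?v = "\<lambda>r \<omega>. b r (X r \<omega>)"
  define P where "P = (\<lambda>x. (1 / Gamma \<gamma>) *\<^sub>R (A *v x))"
  define Q where "Q = (\<lambda>x. (1 / Gamma \<alpha>) *\<^sub>R (B *v x))"
  have P: "bounded_linear P" unfolding P_def by (intro bounded_linear_scaleR_right[THEN bounded_linear_compose] matrix_vector_mul_bounded_linear)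
  have Q: "bounded_linear Q" unfolding Q_def by (intro bounded_linear_scaleR_right[THEN bounded_linear_compose] matrix_vector_mul_bounded_linear)
  note pX = H2D(1)[OF X] and pv = coefficient_process[OF measurable_b H2D(1)[OF X]]
  have T0: "0 \<in> {0..T}" using T by simp
  have \<eta>M: "\<eta> \<in> borel_measurable M" using borel_measurable_F_M[OF _ T0] \<eta> unfolding Xi_def by blast
  have pN: "process N" and Nc: "AE \<omega> in M. continuous_on {0..T} (\<lambda>t. N t \<omega>)" using N unfolding forcing_def by blast+
  \<comment> \<open>With the zero process as input, only the terms free of convolutions of \<open>X\<close> remain.\<close>
  define h where "h = (\<lambda>t \<omega>. rhs t \<eta> (\<lambda>_ _. 0) ?v (N t) \<omega>)"
  have zero: "kernel_conv p (\<lambda>_. 0 :: real ^ 'n) t = 0" for p t by (simp add: kernel_conv_def)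
  have rhs_h: "rhs t \<eta> X ?v (N t) \<omega> = h t \<omega> + P (kernel_conv \<gamma> (\<lambda>r. X r \<omega>) t) + Q (kernel_conv \<alpha> (\<lambda>r. X r \<omega>) t)" for t \<omega>
    unfolding h_def rhs_def zero P_def Q_def by (simp add: algebra_simps)
  have pR: "process (\<lambda>t \<omega>. rhs t \<eta> X ?v (N t) \<omega>)"
  proof -
    have m: "(\<lambda>x. D *v f x) \<in> borel_measurable (restrict_space borel {0..T} \<Otimes>\<^sub>M M)" if "f \<in> borel_measurable (restrict_space borel {0..T} \<Otimes>\<^sub>M M)" for D :: "real ^ 'n ^ 'n" and f
      using measurable_compose[OF that borel_measurable_continuous_onI[OF linear_continuous_on[OF matrix_vector_mul_bounded_linear[of D]]]] .
    have fst: "(\<lambda>x. fst x powr \<gamma> / Gamma (\<gamma> + 1)) \<in> borel_measurable (restrict_space borel {0..T} \<Otimes>\<^sub>M M)"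
    proof -
      have "(\<lambda>s::real. s powr \<gamma> / Gamma (\<gamma> + 1)) \<in> borel_measurable (restrict_space borel {0..T})"
        by (intro measurable_restrict_space1) measurable
      from measurable_compose[OF measurable_fst this] show ?thesis .
    qed
    have \<eta>x: "(\<lambda>x. \<eta> (snd x)) \<in> borel_measurable (restrict_space borel {0..T} \<Otimes>\<^sub>M M)" by (rule measurable_compose[OF measurable_snd \<eta>M])
    show ?thesis
      unfolding process_def rhs_def split_beta'
      by (intro borel_measurable_add borel_measurable_diff borel_measurable_scaleR borel_measurable_const m fst \<eta>x
         process_conv[OF pX, unfolded process_def split_beta'] process_conv[OF pv, unfolded process_def split_beta'] pN[unfolded process_def split_beta'])
  qed
  define D where "D = (\<lambda>t \<omega>. X t \<omega> - rhs t \<eta> X ?v (N t) \<omega>)"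
  have pD: "process D" unfolding D_def by (rule process_diff[OF pX pR])
  have D0: "sqn M (D t) = 0" if t: "t \<in> {0..T}" for t
  proof -
    have I: "has_ito_integral M F W t (\<lambda>r \<omega>. (t - r) powr (\<alpha> - 1) *\<^sub>R \<sigma> r (X r \<omega>)) (I t)" "AE \<omega> in M. N t \<omega> = I t \<omega>" using N t unfolding forcing_def by blast+
    have "AE \<omega> in M. D t \<omega> = 0"
      using mild_map_at[OF fp t I(1)] I(2) by eventually_elim (simp add: D_def rhs_def)
    then show ?thesis using process_at[OF pD t] by (simp add: sqn_eq_0_iff)
  qed
  have one: "(\<lambda>_::real. 1::real) \<in> borel_measurable borel" by simp
  note mD = process_weighted[OF pD one order_refl]
  have "sqn (lborel \<Otimes>\<^sub>M M) (\<lambda>(r, \<omega>). indicator {0..T} r *\<^sub>R 1 *\<^sub>R D r \<omega>) = (\<integral>\<^sup>+r\<in>{0..T}. ennreal (1\<^sup>2) * sqn M (D r) \<partial>lborel)"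
    by (rule sqn_weighted_process[OF pD one order_refl])
  also have "\<dots> = (\<integral>\<^sup>+(r::real). 0 \<partial>lborel)" by (intro nn_integral_cong) (auto simp: indicator_def D0)
  finally have z: "sqn (lborel \<Otimes>\<^sub>M M) (\<lambda>(r, \<omega>). indicator {0..T} r *\<^sub>R 1 *\<^sub>R D r \<omega>) = 0" by simp
  \<comment> \<open>Equality holds almost surely at each time; by Fubini it holds at almost every time on almost every path.\<close>
  have AE_D: "AE \<omega> in M. AE r in lborel. r \<in> {0..T} \<longrightarrow> D r \<omega> = 0"
  proof -
    define G where "G = (\<lambda>(r, \<omega>). indicator {0..T} r *\<^sub>R 1 *\<^sub>R D r \<omega>)"
    have [measurable]: "G \<in> borel_measurable (lborel \<Otimes>\<^sub>M M)" unfolding G_def by (rule mD)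
    have "(\<integral>\<^sup>+\<omega>. (\<integral>\<^sup>+r. ennreal ((norm (G (r, \<omega>)))\<^sup>2) \<partial>lborel) \<partial>M) = sqn (lborel \<Otimes>\<^sub>M M) G"
      unfolding sqn_def by (rule lborel_M.nn_integral_snd) measurable
    also have "\<dots> = 0" using z by (simp add: G_def)
    finally have "AE \<omega> in M. (\<integral>\<^sup>+r. ennreal ((norm (G (r, \<omega>)))\<^sup>2) \<partial>lborel) = 0"
      by (subst (asm) nn_integral_0_iff_AE) measurable
    then show ?thesis using AE_space
    proof eventually_elim
      case (elim \<omega>)
      have "(\<lambda>r. G (r, \<omega>)) \<in> borel_measurable lborel" using elim(2) by measurable
      then have "AE r in lborel. ennreal ((norm (G (r, \<omega>)))\<^sup>2) = 0"
        using elim(1) by (subst (asm) nn_integral_0_iff_AE) auto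
      then show ?case by eventually_elim (auto simp: G_def)
    qed
  qed
  obtain D1 where D1: "\<And>t. t \<in> {0..T} \<Longrightarrow> sqn M (X t) \<le> ennreal D1" using H2D(4)[OF X] by blast
  have TT: "T \<in> {0..T}" using T by simp
  have "AE \<omega> in M. set_integrable lborel {0..T} (\<lambda>r. (T - r) powr (1 - 1) *\<^sub>R X r \<omega>)"
    by (rule AE_set_integrable_kernel[OF pX _ TT]) (simp, erule D1)
  with AE_D Nc show ?thesis using AE_space
  proof eventually_elim
    case (elim \<omega>)
    note \<omega> = elim(4)
    have path: "(\<lambda>r. indicator {0..T} r *\<^sub>R X r \<omega>) \<in> borel_measurable borel" by (rule process_path[OF pX \<omega>])
    have fin: "(\<integral>\<^sup>+r\<in>{0..T}. ennreal (norm (X r \<omega>)) \<partial>lborel) < \<infinity>"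
    proof -
      have "(\<integral>\<^sup>+r\<in>{0..T}. ennreal (norm (X r \<omega>)) \<partial>lborel) = (\<integral>\<^sup>+r. ennreal (norm (indicator {0..T} r *\<^sub>R (T - r) powr (1 - 1) *\<^sub>R X r \<omega>)) \<partial>lborel)"
        by (rule nn_integral_cong_AE, use AE_lborel_singleton[of T] in eventually_elim) (auto simp: indicator_def)
      also have "\<dots> < \<infinity>" using elim(3) unfolding set_integrable_def integrable_iff_bounded by simp
      finally show ?thesis .
    qed
    have hc: "continuous_on {0..T} (\<lambda>t. h t \<omega>)"
      unfolding h_def by (intro continuous_on_rhs drift_conv_continuous[OF pX \<omega>] elim(2)) (simp_all add: zero)
    obtain y where y: "continuous_on {0..T} y" "\<And>t. t \<in> {0..T} \<Longrightarrow> y t = h t \<omega> + P (kernel_conv \<gamma> y t) + Q (kernel_conv \<alpha> y t)"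
      using volterra_continuous_solution[OF _ exponents(1,2) exponents(3) \<alpha>(2) P Q hc] T by auto
    note ypath = continuous_on_indicator_measurable[OF y(1)]
    obtain C where C: "\<And>r. r \<in> {0..T} \<Longrightarrow> norm (y r) \<le> C" using continuous_on_Icc_bounded[OF y(1)] by blast
    \<comment> \<open>The path minus the continuous solution solves the homogeneous equation.\<close>
    define w where "w = (\<lambda>r. X r \<omega> - y r)"
    have wpath: "(\<lambda>r. indicator {0..T} r *\<^sub>R w r) \<in> borel_measurable borel"
      using borel_measurable_diff[OF path ypath] by (simp add: w_def scaleR_diff_right)
    have T': "0 \<le> T" using T by simp
    have wfin: "(\<integral>\<^sup>+r\<in>{0..T}. ennreal (norm (w r)) \<partial>lborel) < \<infinity>"
    proof -
      have pm: "(\<lambda>r. ennreal (norm (X r \<omega>)) * indicator {0..T} r) \<in> borel_measurable lborel"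
      proof -
        have "(\<lambda>r. indicator {0..T} r *\<^sub>R X r \<omega>) \<in> borel_measurable lborel" using path by simp
        then have "(\<lambda>r. ennreal (norm (indicator {0..T} r *\<^sub>R X r \<omega>))) \<in> borel_measurable lborel"
          by (rule measurable_compose[where g = "\<lambda>x. ennreal (norm x)"]) measurable
        also have "(\<lambda>r. ennreal (norm (indicator {0..T} r *\<^sub>R X r \<omega>))) = (\<lambda>r. ennreal (norm (X r \<omega>)) * indicator {0..T} r)" by (auto simp: indicator_def fun_eq_iff)
        finally show ?thesis .
      qed
      have "(\<integral>\<^sup>+r\<in>{0..T}. ennreal (norm (w r)) \<partial>lborel) \<le> (\<integral>\<^sup>+r. ennreal (norm (X r \<omega>)) * indicator {0..T} r + ennreal (max 0 C) * indicator {0..T} r \<partial>lborel)"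
      proof (intro nn_integral_mono)
        fix r
        show "ennreal (norm (w r)) * indicator {0..T} r \<le> ennreal (norm (X r \<omega>)) * indicator {0..T} r + ennreal (max 0 C) * indicator {0..T} r"
        proof (cases "r \<in> {0..T}")
          case True
          have "norm (w r) \<le> norm (X r \<omega>) + norm (y r)" unfolding w_def by (rule norm_triangle_ineq4)
          also have "\<dots> \<le> norm (X r \<omega>) + max 0 C" using C[OF True] by simp
          finally have "ennreal (norm (w r)) \<le> ennreal (norm (X r \<omega>) + max 0 C)" by (rule ennreal_leI)
          also have "\<dots> = ennreal (norm (X r \<omega>)) + ennreal (max 0 C)" by (rule ennreal_plus) simp_all
          finally have "ennreal (norm (w r)) \<le> ennreal (norm (X r \<omega>)) + ennreal (max 0 C)" .
          then show ?thesis using True by simp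
        qed simp
      qed
      also have "\<dots> = (\<integral>\<^sup>+r\<in>{0..T}. ennreal (norm (X r \<omega>)) \<partial>lborel) + (\<integral>\<^sup>+r\<in>{0..T}. ennreal (max 0 C) \<partial>lborel)"
        by (rule nn_integral_add[OF pm]) auto
      also have "\<dots> < \<infinity>" using fin T' by (simp add: nn_integral_cmult_indicator ennreal_mult_less_top)
      finally show ?thesis .
    qed
    have eq: "AE t in lborel. t \<in> {0..T} \<longrightarrow> w t = P (kernel_conv \<gamma> w t) + Q (kernel_conv \<alpha> w t)"
      using elim(1) AE_kernel_integrable[OF path exponents(1) T' fin] AE_kernel_integrable[OF path exponents(3) T' fin]
    proof eventually_elim
      case (elim t)
      show ?case
      proof
        assume t: "t \<in> {0..T}"
        have k: "kernel_conv p w t = kernel_conv p (\<lambda>r. X r \<omega>) t - kernel_conv p y t" if "0 < p" "set_integrable lborel {0..t} (\<lambda>r. (t - r) powr (p - 1) *\<^sub>R X r \<omega>)" for p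
          unfolding w_def by (rule kernel_conv_diff[symmetric, OF that(2) set_integrable_kernel_continuous[OF that(1) y(1) t]])
        have "X t \<omega> = rhs t \<eta> X ?v (N t) \<omega>" using elim(1) t by (simp add: D_def)
        then have "w t = P (kernel_conv \<gamma> (\<lambda>r. X r \<omega>) t) - P (kernel_conv \<gamma> y t) + (Q (kernel_conv \<alpha> (\<lambda>r. X r \<omega>) t) - Q (kernel_conv \<alpha> y t))"
          unfolding w_def y(2)[OF t] rhs_h by simp
        then show "w t = P (kernel_conv \<gamma> w t) + Q (kernel_conv \<alpha> w t)"
          by (simp only: k[OF exponents(1) elim(2)[rule_format, OF t]] k[OF exponents(3) elim(3)[rule_format, OF t]] linear_diff[OF bounded_linear.linear[OF P]] linear_diff[OF bounded_linear.linear[OF Q]])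
      qed
    qed
    have w0: "AE t in lborel. t \<in> {0..T} \<longrightarrow> w t = 0"
      by (rule volterra_unique_AE[OF T' exponents(1) exponents(3) P Q wpath wfin eq])
    have conv_eq: "kernel_conv p (\<lambda>r. X r \<omega>) t = kernel_conv p y t" if t: "t \<in> {0..T}" for p t
    proof (rule kernel_conv_cong_AE)
      show "AE r in lborel. r \<in> {0..t} \<longrightarrow> X r \<omega> = y r"
        using w0 by eventually_elim (use t in \<open>auto simp: w_def\<close>)
      show "(\<lambda>r. indicator {0..t} r *\<^sub>R X r \<omega>) \<in> borel_measurable borel" using indicator_scale_subset_measurable[OF path, of t] t by simp
      show "(\<lambda>r. indicator {0..t} r *\<^sub>R y r) \<in> borel_measurable borel" using indicator_scale_subset_measurable[OF ypath, of t] t by simp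
    qed
    have "y t = rhs t \<eta> X ?v (N t) \<omega>" if "t \<in> {0..T}" for t
      unfolding rhs_h conv_eq[OF that] by (rule y(2)[OF that])
    then show ?case using y(1) continuous_on_cong[of "{0..T}" "{0..T}" y "\<lambda>t. rhs t \<eta> X ?v (N t) \<omega>"] by simp
  qed
qed

text \<open>The output \<open>X\<close> of the fixed point \<open>Y\<close>, taken with continuous paths, agrees with \<open>Y\<close> almost surely at each
  time. By \<open>mild_map_stable\<close> an output \<open>Z\<close> of \<open>X\<close> therefore agrees with \<open>X\<close>.\<close>

theorem mild_solution_exists:
  assumes \<eta>: "\<eta> \<in> Xi M F 0"
  shows "\<exists>X. mild_solution M F W T \<alpha> \<beta> A B b \<sigma> \<eta> X"
proof -
  have T0: "0 \<in> {0..T}" using T by simp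
  have \<eta>M: "\<eta> \<in> borel_measurable M" using borel_measurable_F_M[OF _ T0] \<eta> unfolding Xi_def by blast
  obtain Y where Y: "Y \<in> H2 M F T" "mild_map \<eta> Y Y" using fixed_point_in_H2[OF \<eta>] by blast
  obtain I N where N: "forcing Y I N" using forcing_exists[OF Y(1)] by blast
  obtain X where X: "X \<in> H2 M F T" "AE \<omega> in M. continuous_on {0..T} (\<lambda>t. X t \<omega>)" "mild_map \<eta> Y X"
    using mild_map_in_H2[OF Y(1) \<eta> N fixed_point_path_continuous[OF Y(1) \<eta> Y(2) N]] by blast
  obtain Z where Z: "mild_map \<eta> X Z" using mild_map_exists[OF X(1)] by blast
  obtain K where K: "0 \<le> K" "\<And>X Y \<eta> \<zeta> Z Z' t. X \<in> H2 M F T \<Longrightarrow> Y \<in> H2 M F T \<Longrightarrow> \<eta> \<in> borel_measurable M \<Longrightarrow> \<zeta> \<in> borel_measurable M \<Longrightarrow>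
     mild_map \<eta> X Z \<Longrightarrow> mild_map \<zeta> Y Z' \<Longrightarrow> t \<in> {0..T} \<Longrightarrow> sqn M (\<lambda>\<omega>. Z t \<omega> - Z' t \<omega>) \<le> ennreal K * (sqn M (\<lambda>\<omega>. \<eta> \<omega> - \<zeta> \<omega>) +
       conv_energy \<gamma> (\<lambda>r \<omega>. X r \<omega> - Y r \<omega>) t + conv_energy \<alpha> (\<lambda>r \<omega>. X r \<omega> - Y r \<omega>) t + conv_energy (2 * \<alpha> - 1) (\<lambda>r \<omega>. X r \<omega> - Y r \<omega>) t)"
    using mild_map_stable by blast
  have XY: "process (\<lambda>r \<omega>. X r \<omega> - Y r \<omega>)" by (intro process_diff H2D(1) X(1) Y(1))
  have XY0: "sqn M (\<lambda>\<omega>. X r \<omega> - Y r \<omega>) = 0" if "r \<in> {0..T}" for r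
    using K(2)[OF Y(1) Y(1) \<eta>M \<eta>M X(3) Y(2) that] conv_energy_zero[of "\<lambda>_ _. 0 :: real ^ 'n" r] that by (simp add: process_def)
  have "AE \<omega> in M. X t \<omega> = Z t \<omega>" if t: "t \<in> {0..T}" for t
  proof -
    obtain I' N' where N': "forcing X I' N'" using forcing_exists[OF X(1)] by blast
    have I': "has_ito_integral M F W t (\<lambda>r \<omega>. (t - r) powr (\<alpha> - 1) *\<^sub>R \<sigma> r (X r \<omega>)) (I' t)" using N' t unfolding forcing_def by blast
    define R where "R = rhs t \<eta> X (\<lambda>r \<omega>. b r (X r \<omega>)) (I' t)"
    have ZR: "AE \<omega> in M. Z t \<omega> = R \<omega>" unfolding R_def by (rule mild_map_at[OF Z t I'])
    have Rm: "R \<in> borel_measurable M"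
      unfolding R_def by (intro rhs_measurable t \<eta>M ito_measurable(2)[OF has_ito_integral_imp_ito[OF I' t]] H2D(1)[OF X(1)] coefficient_process[OF measurable_b H2D(1)[OF X(1)]])
    have "sqn M (\<lambda>\<omega>. Z t \<omega> - X t \<omega>) = 0"
      using K(2)[OF X(1) Y(1) \<eta>M \<eta>M Z X(3) t] conv_energy_zero[OF XY t XY0] by simp
    moreover have "AE \<omega> in M. R \<omega> - X t \<omega> = Z t \<omega> - X t \<omega>" using ZR by eventually_elim simp
    ultimately have "sqn M (\<lambda>\<omega>. R \<omega> - X t \<omega>) = 0" using sqn_cong_AE by metis
    moreover have "(\<lambda>\<omega>. R \<omega> - X t \<omega>) \<in> borel_measurable M" using Rm H2D(3)[OF X(1) t] by (rule borel_measurable_diff)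
    ultimately have "AE \<omega> in M. R \<omega> - X t \<omega> = 0" by (simp only: sqn_eq_0_iff)
    with ZR show ?thesis by eventually_elim simp
  qed
  from mild_map_cong[OF Z this] have "mild_map \<eta> X X" .
  moreover have "AE \<omega> in M. set_integrable lborel {0..T} (\<lambda>t. (norm (X t \<omega>))\<^sup>2)"
    using X(2) by eventually_elim (intro borel_integrable_atLeastAtMost' continuous_intros)
  ultimately show ?thesis using X(1,2) unfolding mild_solution_def mild_equation_iff by blast
qed

section \<open>Existence, uniqueness and continuous dependence\<close>

theorem mild_solutions_ms_close:
  "\<exists>C\<ge>0. \<forall>\<eta>\<in>Xi M F 0. \<forall>\<zeta>\<in>Xi M F 0. \<forall>X\<in>H2 M F T. \<forall>Y\<in>H2 M F T.
     mild_equation M F W T \<alpha> \<beta> A B b \<sigma> \<eta> X \<longrightarrow> mild_equation M F W T \<alpha> \<beta> A B b \<sigma> \<zeta> Y \<longrightarrow>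
     (\<forall>t\<in>{0..T}. (ms_norm M (\<lambda>\<omega>. X t \<omega> - Y t \<omega>))\<^sup>2 \<le> C * (ms_norm M (\<lambda>\<omega>. \<eta> \<omega> - \<zeta> \<omega>))\<^sup>2)"
proof -
  have ms_diff: "ennreal ((ms_norm M (\<lambda>\<omega>. f \<omega> - g \<omega>))\<^sup>2) = sqn M (\<lambda>\<omega>. f \<omega> - g \<omega>)"
    if f: "f \<in> borel_measurable M" "integrable M (\<lambda>\<omega>. (norm (f \<omega>))\<^sup>2)"
      and g: "g \<in> borel_measurable M" "integrable M (\<lambda>\<omega>. (norm (g \<omega>))\<^sup>2)" for f g :: "'w \<Rightarrow> real ^ 'n"
  proof (rule ms_norm_sq_eq_sqn)
    have "sqn M f < \<infinity>" "sqn M g < \<infinity>" using f g by (simp_all only: sqn_finite_iff)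
    then have "2 * sqn M f + 2 * sqn M g < \<infinity>" by (simp add: ennreal_mult_less_top)
    with sqn_diff[OF f(1) g(1)] have "sqn M (\<lambda>\<omega>. f \<omega> - g \<omega>) < \<infinity>" by (rule le_less_trans)
    then show "integrable M (\<lambda>\<omega>. (norm (f \<omega> - g \<omega>))\<^sup>2)"
      by (simp only: sqn_finite_iff[OF borel_measurable_diff[OF f(1) g(1)]])
  qed
  have Xi_M: "f \<in> borel_measurable M" "integrable M (\<lambda>\<omega>. (norm (f \<omega>))\<^sup>2)" if "f \<in> Xi M F t" "t \<in> {0..T}" for f :: "'w \<Rightarrow> real ^ 'n" and t
    using that borel_measurable_F_M unfolding Xi_def by auto
  have T0: "0 \<in> {0..T}" using T by simp
  obtain C where C: "0 \<le> C" "\<And>X Y \<eta> \<zeta> t. X \<in> H2 M F T \<Longrightarrow> Y \<in> H2 M F T \<Longrightarrow> \<eta> \<in> borel_measurable M \<Longrightarrow> \<zeta> \<in> borel_measurable M \<Longrightarrow>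
     mild_map \<eta> X X \<Longrightarrow> mild_map \<zeta> Y Y \<Longrightarrow> t \<in> {0..T} \<Longrightarrow> sqn M (\<lambda>\<omega>. X t \<omega> - Y t \<omega>) \<le> ennreal C * sqn M (\<lambda>\<omega>. \<eta> \<omega> - \<zeta> \<omega>)"
    using mild_solutions_close by blast
  show ?thesis
  proof (intro exI[of _ C] conjI C(1) ballI impI)
    fix \<eta> \<zeta> :: "'w \<Rightarrow> real ^ 'n" and X Y :: "real \<Rightarrow> 'w \<Rightarrow> real ^ 'n" and t
    assume h: "\<eta> \<in> Xi M F 0" "\<zeta> \<in> Xi M F 0" "X \<in> H2 M F T" "Y \<in> H2 M F T"
      "mild_equation M F W T \<alpha> \<beta> A B b \<sigma> \<eta> X" "mild_equation M F W T \<alpha> \<beta> A B b \<sigma> \<zeta> Y" and t: "t \<in> {0..T}"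
    note \<eta> = Xi_M[OF h(1) T0] and \<zeta> = Xi_M[OF h(2) T0]
    have "X t \<in> Xi M F t" "Y t \<in> Xi M F t" using h(3,4) t unfolding H2_def by blast+
    note Xt = Xi_M[OF this(1) t] and Yt = Xi_M[OF this(2) t]
    have "ennreal ((ms_norm M (\<lambda>\<omega>. X t \<omega> - Y t \<omega>))\<^sup>2) \<le> ennreal C * ennreal ((ms_norm M (\<lambda>\<omega>. \<eta> \<omega> - \<zeta> \<omega>))\<^sup>2)"
      unfolding ms_diff[OF Xt Yt] ms_diff[OF \<eta> \<zeta>] using h(5,6) unfolding mild_equation_iff by (intro C(2) h \<eta> \<zeta> t)
    then show "(ms_norm M (\<lambda>\<omega>. X t \<omega> - Y t \<omega>))\<^sup>2 \<le> C * (ms_norm M (\<lambda>\<omega>. \<eta> \<omega> - \<zeta> \<omega>))\<^sup>2"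
      using C(1) by (simp add: ennreal_mult[symmetric])
  qed
qed

end

theorem theorem4p1:
  fixes M :: "'w measure" and W :: "real \<Rightarrow> 'w \<Rightarrow> real" and F :: "real \<Rightarrow> 'w measure"
    and T \<alpha> \<beta> L\<^sub>b L\<^sub>\<sigma> :: real
    and A B :: "real ^ 'n ^ 'n"
    and b \<sigma> :: "real \<Rightarrow> real ^ 'n \<Rightarrow> real ^ 'n"
  assumes basis: "brownian_basis M W F T"
    and \<alpha>: "1 / 2 < \<alpha>" "\<alpha> < 1"
    and \<beta>: "0 < \<beta>" "\<beta> < 1"
    and \<beta>_less_\<alpha>: "\<beta> < \<alpha>"
    and T: "0 < T"
    and nonpermutable: "A ** B \<noteq> B ** A"
    and measurable_b: "(\<lambda>(t, x). b t x) \<in> borel_measurable (restrict_space borel {0..T} \<Otimes>\<^sub>M borel)"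
    and measurable_\<sigma>: "(\<lambda>(t, x). \<sigma> t x) \<in> borel_measurable (restrict_space borel {0..T} \<Otimes>\<^sub>M borel)"
    and bounded_b: "bounded ((\<lambda>(t, x). b t x) ` ({0..T} \<times> UNIV))"
    and bounded_\<sigma>: "bounded ((\<lambda>(t, x). \<sigma> t x) ` ({0..T} \<times> UNIV))"
    and L\<^sub>b: "0 < L\<^sub>b" "\<And>t x y. t \<in> {0..T} \<Longrightarrow> norm (b t x - b t y) \<le> L\<^sub>b * norm (x - y)"
    and L\<^sub>\<sigma>: "0 < L\<^sub>\<sigma>" "\<And>t x y. t \<in> {0..T} \<Longrightarrow> norm (\<sigma> t x - \<sigma> t y) \<le> L\<^sub>\<sigma> * norm (x - y)"
    and b_0: "set_integrable lborel {0..T} (\<lambda>r. (norm (b r 0))\<^sup>2)"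
    and \<sigma>_0: "esssup (restrict_space lborel {0..T}) (\<lambda>r. ereal (norm (\<sigma> r 0))) < \<infinity>"
  shows "(\<forall>\<eta>\<in>Xi M F 0. \<exists>X. mild_solution M F W T \<alpha> \<beta> A B b \<sigma> \<eta> X \<and>
            (\<forall>Y\<in>H2 M F T. mild_equation M F W T \<alpha> \<beta> A B b \<sigma> \<eta> Y \<longrightarrow>
               H2_norm M T (\<lambda>t \<omega>. X t \<omega> - Y t \<omega>) = 0)) \<and>
         (\<forall>\<phi>. (\<forall>\<eta>\<in>Xi M F 0. mild_solution M F W T \<alpha> \<beta> A B b \<sigma> \<eta> (\<phi> \<eta>)) \<longrightarrow>
            (\<forall>\<gamma>\<in>Xi M F 0. \<forall>\<epsilon>>0. \<exists>\<delta>>0. \<forall>\<eta>\<in>Xi M F 0.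
               ms_norm M (\<lambda>\<omega>. \<eta> \<omega> - \<gamma> \<omega>) < \<delta> \<longrightarrow>
               (SUP t\<in>{0..T}. (ms_norm M (\<lambda>\<omega>. \<phi> \<eta> t \<omega> - \<phi> \<gamma> t \<omega>))\<^sup>2) < \<epsilon>))"
proof -
  interpret basis: brownian_basis M W F T by (rule basis)
  interpret fractional_sde M W F T \<alpha> \<beta> L\<^sub>b L\<^sub>\<sigma> A B b \<sigma>
    by unfold_locales (fact \<alpha> \<beta> \<beta>_less_\<alpha> T measurable_b measurable_\<sigma> bounded_b bounded_\<sigma> L\<^sub>b L\<^sub>\<sigma>)+
  have T0: "{0..T} \<noteq> {}" using T by simp
  obtain C where C: "0 \<le> C" "\<And>\<eta> \<zeta> X Y t. \<eta> \<in> Xi M F 0 \<Longrightarrow> \<zeta> \<in> Xi M F 0 \<Longrightarrow> X \<in> H2 M F T \<Longrightarrow> Y \<in> H2 M F T \<Longrightarrow>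
      mild_equation M F W T \<alpha> \<beta> A B b \<sigma> \<eta> X \<Longrightarrow> mild_equation M F W T \<alpha> \<beta> A B b \<sigma> \<zeta> Y \<Longrightarrow> t \<in> {0..T} \<Longrightarrow>
      (ms_norm M (\<lambda>\<omega>. X t \<omega> - Y t \<omega>))\<^sup>2 \<le> C * (ms_norm M (\<lambda>\<omega>. \<eta> \<omega> - \<zeta> \<omega>))\<^sup>2"
    using mild_solutions_ms_close by blast
  have solution: "X \<in> H2 M F T" "mild_equation M F W T \<alpha> \<beta> A B b \<sigma> \<eta> X"
    if "mild_solution M F W T \<alpha> \<beta> A B b \<sigma> \<eta> X" for \<eta> X
    using that unfolding mild_solution_def by blast+
  show ?thesis
  proof (intro conjI ballI allI impI)
    fix \<eta> :: "'w \<Rightarrow> real ^ 'n" assume \<eta>: "\<eta> \<in> Xi M F 0"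
    obtain X where X: "mild_solution M F W T \<alpha> \<beta> A B b \<sigma> \<eta> X" using mild_solution_exists[OF \<eta>] by blast
    have "H2_norm M T (\<lambda>t \<omega>. X t \<omega> - Y t \<omega>) = 0" if Y: "Y \<in> H2 M F T" "mild_equation M F W T \<alpha> \<beta> A B b \<sigma> \<eta> Y" for Y
    proof -
      have zero: "ms_norm M (\<lambda>\<omega>. \<eta> \<omega> - \<eta> \<omega>) = 0" by (simp add: ms_norm_def)
      have "(ms_norm M (\<lambda>\<omega>. X t \<omega> - Y t \<omega>))\<^sup>2 = 0" if t: "t \<in> {0..T}" for t
        using C(2)[OF \<eta> \<eta> solution(1)[OF X] Y(1) solution(2)[OF X] Y(2) t] zero by simp
      then have "(SUP t\<in>{0..T}. (ms_norm M (\<lambda>\<omega>. X t \<omega> - Y t \<omega>))\<^sup>2) = (SUP t\<in>{0..T}. 0 :: real)"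
        by (intro SUP_cong) auto
      then show ?thesis using T0 by (simp add: H2_norm_def)
    qed
    with X show "\<exists>X. mild_solution M F W T \<alpha> \<beta> A B b \<sigma> \<eta> X \<and>
        (\<forall>Y\<in>H2 M F T. mild_equation M F W T \<alpha> \<beta> A B b \<sigma> \<eta> Y \<longrightarrow> H2_norm M T (\<lambda>t \<omega>. X t \<omega> - Y t \<omega>) = 0)"
      by blast
  next
    fix \<phi> :: "('w \<Rightarrow> real ^ 'n) \<Rightarrow> real \<Rightarrow> 'w \<Rightarrow> real ^ 'n" and \<gamma> :: "'w \<Rightarrow> real ^ 'n" and \<epsilon> :: real
    assume \<phi>: "\<forall>\<eta>\<in>Xi M F 0. mild_solution M F W T \<alpha> \<beta> A B b \<sigma> \<eta> (\<phi> \<eta>)" and \<gamma>: "\<gamma> \<in> Xi M F 0" and \<epsilon>: "0 < \<epsilon>"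
    \<comment> \<open>With this choice \<open>C \<delta>\<^sup>2 \<le> \<epsilon> / 2\<close>; the half keeps the inequality strict under the supremum.\<close>
    define \<delta> where "\<delta> = sqrt (\<epsilon> / (2 * (C + 1)))"
    have \<delta>: "0 < \<delta>" "\<delta>\<^sup>2 = \<epsilon> / (2 * (C + 1))" using \<epsilon> C(1) by (simp_all add: \<delta>_def)
    have "(SUP t\<in>{0..T}. (ms_norm M (\<lambda>\<omega>. \<phi> \<eta> t \<omega> - \<phi> \<gamma> t \<omega>))\<^sup>2) < \<epsilon>"
      if \<eta>: "\<eta> \<in> Xi M F 0" and near: "ms_norm M (\<lambda>\<omega>. \<eta> \<omega> - \<gamma> \<omega>) < \<delta>" for \<eta>
    proof -
      have s: "mild_solution M F W T \<alpha> \<beta> A B b \<sigma> \<eta> (\<phi> \<eta>)" "mild_solution M F W T \<alpha> \<beta> A B b \<sigma> \<gamma> (\<phi> \<gamma>)" using \<phi> \<eta> \<gamma> by blast+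
      have "(ms_norm M (\<lambda>\<omega>. \<eta> \<omega> - \<gamma> \<omega>))\<^sup>2 \<le> \<delta>\<^sup>2"
        using near by (intro power_mono) (simp_all add: ms_norm_def)
      then have "C * (ms_norm M (\<lambda>\<omega>. \<eta> \<omega> - \<gamma> \<omega>))\<^sup>2 \<le> C * (\<epsilon> / (2 * (C + 1)))"
        unfolding \<delta>(2) by (rule mult_left_mono[OF _ C(1)])
      also have "\<dots> \<le> \<epsilon> / 2" using C(1) \<epsilon> by (simp add: field_simps)
      finally have le: "C * (ms_norm M (\<lambda>\<omega>. \<eta> \<omega> - \<gamma> \<omega>))\<^sup>2 \<le> \<epsilon> / 2" .
      have "(SUP t\<in>{0..T}. (ms_norm M (\<lambda>\<omega>. \<phi> \<eta> t \<omega> - \<phi> \<gamma> t \<omega>))\<^sup>2) \<le> \<epsilon> / 2"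
        using C(2)[OF \<eta> \<gamma> solution(1)[OF s(1)] solution(1)[OF s(2)] solution(2)[OF s(1)] solution(2)[OF s(2)]] le
        by (intro cSUP_least[OF T0]) (rule order_trans)
      then show ?thesis using \<epsilon> by linarith
    qed
    with \<delta>(1) show "\<exists>\<delta>>0. \<forall>\<eta>\<in>Xi M F 0. ms_norm M (\<lambda>\<omega>. \<eta> \<omega> - \<gamma> \<omega>) < \<delta> \<longrightarrow>
        (SUP t\<in>{0..T}. (ms_norm M (\<lambda>\<omega>. \<phi> \<eta> t \<omega> - \<phi> \<gamma> t \<omega>))\<^sup>2) < \<epsilon>"
      by blast
  qed
qed

end
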